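(* There exists an absolute constant $C<\infty$ such that the following holds. Let $\Gamma\subset\mathbb{R}^3$ be an oriented closed Lipschitz curve of length $L>0$ with arclength parametrization $\gamma:\mathbb{R}/L\mathbb{Z}\to\mathbb{R}^3$, such that $\|\kappa^*\|_{L^{1,\infty}}<\infty$, where $\kappa^*=\kappa^*_\gamma$. Let $\varepsilon\in(0,\frac L2)$ and let $u^\varepsilon\in L^2(\mathbb{R}^3;\mathbb{R}^3)$ be a divergence-free vector field such that $$\|\nabla\times u^\varepsilon-\mu_\Gamma\|_F\le \varepsilon L .$$ Then $$0\le \mathrm{Exc}_\varepsilon(u^\varepsilon,\Gamma)+C\,\|\kappa^*\|_{L^{1,\infty}}^2\,k_\varepsilon ,$$ and, for all $\phi\in W^{1,\infty}(\mathbb{R}^3;M^{3\times3})$, $$\frac1L\left|k_\varepsilon\int_{\mathbb{R}^3}\phi:u^\varepsilon\otimes u^\varepsilon\,dx-\int_\Gamma\phi:(I-\tau\otimes\tau)\,d\mathcal{H}^1\right|\le C\,\|\phi\|_{L^\infty}\,\mathrm{Exc}_\varepsilon(u^\varepsilon,\Gamma)+C\,k_\varepsilon\,\|\kappa^*\|_{L^{1,\infty}}^2\,\|\phi\|_{W^{1,\infty}_L}.$$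
   Context: Curves: $\Gamma$ is a closed oriented Lipschitz curve of length $L$ with arclength parametrization $\gamma:\mathbb{R}/L\mathbb{Z}\to\mathbb{R}^3$ (so $|\gamma'|=1$ a.e.); $\tau=\gamma'$ is the unit tangent; integrals over $\Gamma$ with respect to $\mathcal{H}^1$ mean integrals in the arclength parameter over $\mathbb{R}/L\mathbb{Z}$. For $h\in\mathbb{R}/L\mathbb{Z}$, $|h|$ is the distance to $0$ modulo $L\mathbb{Z}$. Security radius: for $s$ at which $\gamma$ is differentiable, $$r_\gamma(s)=\sup\Big\{r>0:\ |\gamma(s+h)-\gamma(s)|\ge\tfrac r2\ \text{for all }|h|\ge r,\ \text{and}\ |\gamma'(s+h)-\gamma'(s)|\le\tfrac{|h|}{r}\ \text{for all }|h|\le r\Big\}$$ (the second condition for a.e. such $h$, as $\gamma'$ is only defined a.e.; the supremum of the empty set is $0$), and $r_\gamma(s)=0$ if $\gamma$ is not differentiable at $s$. Set $\kappa^*_\gamma(s)=1/r_\gamma(s)$ and $$\|\kappa^*\|_{L^{1,\infty}}=\sup_{\sigma>0}\sigma\,\big|\{s\in\mathbb{R}/L\mathbb{Z}:\kappa^*(s)\ge\sigma\}\big|.$$ $\mu_\Gamma$ is the vector-valued measure $\int\phi\cdot d\mu_\Gamma=\int_{\mathbb{R}/L\mathbb{Z}}\phi(\gamma(s))\cdot\gamma'(s)\,ds$. Homogeneous flat norm: $\|\omega\|_F=\sup\{\int\xi\cdot d\omega:\ \xi\in C^1_c(\mathbb{R}^3;\mathbb{R}^3),\ \|\nabla\times\xi\|_{L^\infty}\le1\}$;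 for $u\in L^2$, $\nabla\times u$ is understood distributionally, i.e. $\int\xi\cdot d(\nabla\times u)=\int(\nabla\times\xi)\cdot u\,dx$. $k_\varepsilon=\dfrac{4\pi}{|\log(\varepsilon/L)|}$ and $\mathrm{Exc}_\varepsilon(u,\Gamma)=\dfrac{k_\varepsilon}{L}\displaystyle\int_{\mathbb{R}^3}\tfrac12|u|^2\,dx-1$. $M^{3\times3}$ is the space of real $3\times3$ matrices, $A:B=\sum_{i,j}A_{ij}B_{ij}$, $(a\otimes b)_{ij}=a_ib_j$, $I$ the identity matrix, and $\|\phi\|_{W^{1,\infty}_L}=\|\phi\|_{L^\infty}+L\|\nabla\phi\|_{L^\infty}$. *)

theory Defs
  imports "HOL-Analysis.Analysis" "HOL-Probability.Essential_Supremum"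
begin

section \<open>Closed curves and the security radius\<close>

text \<open>Functions on the circle of length \<open>L\<close> are represented by \<open>L\<close>-periodic functions on the
  real line.\<close>

definition circle_abs :: "real \<Rightarrow> real \<Rightarrow> real" where
  "circle_abs L h = infdist h (range (\<lambda>k::int. of_int k * L))"

definition closed_arclength_curve :: "real \<Rightarrow> (real \<Rightarrow> real^3) \<Rightarrow> bool" where
  "closed_arclength_curve L \<gamma> \<longleftrightarrow>
     L > 0 \<and> (\<forall>s. \<gamma> (s + L) = \<gamma> s) \<and> (\<exists>M. M-lipschitz_on UNIV \<gamma>) \<and>
     (AE s in lebesgue. \<exists>v. (\<gamma> has_vector_derivative v) (at s) \<and> norm v = 1)"

abbreviation tangent :: "(real \<Rightarrow> real^3) \<Rightarrow> real \<Rightarrow> real^3" where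
  "tangent \<gamma> s \<equiv> vector_derivative \<gamma> (at s)"

definition admissible_radius :: "real \<Rightarrow> (real \<Rightarrow> real^3) \<Rightarrow> real \<Rightarrow> real \<Rightarrow> bool" where
  "admissible_radius L \<gamma> s r \<longleftrightarrow>
     r > 0 \<and>
     (\<forall>h. circle_abs L h \<ge> r \<longrightarrow> norm (\<gamma> (s + h) - \<gamma> s) \<ge> r / 2) \<and>
     (AE h in lebesgue. circle_abs L h \<le> r \<longrightarrow>
        norm (tangent \<gamma> (s + h) - tangent \<gamma> s) \<le> circle_abs L h / r)"

text \<open>With values in \<open>ennreal\<close> the supremum of the empty set is \<open>0\<close>, and \<open>1 / 0 = \<infinity>\<close>.\<close>

definition security_radius :: "real \<Rightarrow> (real \<Rightarrow> real^3) \<Rightarrow> real \<Rightarrow> ennreal" where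
  "security_radius L \<gamma> s =
     (if \<gamma> differentiable at s then (SUP r\<in>{r. admissible_radius L \<gamma> s r}. ennreal r) else 0)"

definition kappa_star :: "real \<Rightarrow> (real \<Rightarrow> real^3) \<Rightarrow> real \<Rightarrow> ennreal" where
  "kappa_star L \<gamma> s = 1 / security_radius L \<gamma> s"

definition weak_L1_norm :: "real \<Rightarrow> (real \<Rightarrow> ennreal) \<Rightarrow> ennreal" where
  "weak_L1_norm L f =
     (SUP \<sigma>\<in>{0<..}. ennreal \<sigma> * emeasure lebesgue {s\<in>{0..<L}. f s \<ge> ennreal \<sigma>})"

section \<open>Test functions, differential operators, function spaces\<close>

definition C1_compact :: "(real^3 \<Rightarrow> 'b::real_normed_vector) \<Rightarrow> bool" where
  "C1_compact f \<longleftrightarrow>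
     (\<exists>f'::real^3 \<Rightarrow> ((real^3) \<Rightarrow>\<^sub>L 'b).
        (\<forall>x. (f has_derivative blinfun_apply (f' x)) (at x)) \<and> continuous_on UNIV f') \<and>
     compact (closure {x. f x \<noteq> 0})"

definition partial_deriv :: "3 \<Rightarrow> (real^3 \<Rightarrow> 'b::real_normed_vector) \<Rightarrow> real^3 \<Rightarrow> 'b" where
  "partial_deriv i f x = frechet_derivative f (at x) (axis i 1)"

definition gradient :: "(real^3 \<Rightarrow> real) \<Rightarrow> real^3 \<Rightarrow> real^3" where
  "gradient \<eta> x = (\<chi> i. partial_deriv i \<eta> x)"

definition curl :: "(real^3 \<Rightarrow> real^3) \<Rightarrow> real^3 \<Rightarrow> real^3" where
  "curl \<xi> x = vector
     [partial_deriv 2 \<xi> x $ 3 - partial_deriv 3 \<xi> x $ 2,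
      partial_deriv 3 \<xi> x $ 1 - partial_deriv 1 \<xi> x $ 3,
      partial_deriv 1 \<xi> x $ 2 - partial_deriv 2 \<xi> x $ 1]"

definition Linf_norm :: "(real^3 \<Rightarrow> 'b::real_normed_vector) \<Rightarrow> ennreal" where
  "Linf_norm f = esssup lebesgue (\<lambda>x. ennreal (norm (f x)))"

definition L2_field :: "(real^3 \<Rightarrow> real^3) \<Rightarrow> bool" where
  "L2_field u \<longleftrightarrow> u \<in> borel_measurable lebesgue \<and> integrable lebesgue (\<lambda>x. (norm (u x))\<^sup>2)"

definition divergence_free :: "(real^3 \<Rightarrow> real^3) \<Rightarrow> bool" where
  "divergence_free u \<longleftrightarrow>
     (\<forall>\<eta>::real^3 \<Rightarrow> real. C1_compact \<eta> \<longrightarrow> (LINT x|lebesgue. u x \<bullet> gradient \<eta> x) = 0)"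

definition locally_integrable :: "(real^3 \<Rightarrow> 'b::euclidean_space) \<Rightarrow> bool" where
  "locally_integrable f \<longleftrightarrow>
     f \<in> borel_measurable lebesgue \<and> (\<forall>K. compact K \<longrightarrow> set_integrable lebesgue K f)"

definition has_weak_gradient ::
  "(real^3 \<Rightarrow> 'b::euclidean_space) \<Rightarrow> (real^3 \<Rightarrow> 'b^3) \<Rightarrow> bool" where
  "has_weak_gradient f G \<longleftrightarrow>
     locally_integrable f \<and> locally_integrable G \<and>
     (\<forall>\<eta> k. C1_compact \<eta> \<longrightarrow>
        (LINT x|lebesgue. partial_deriv k \<eta> x *\<^sub>R f x) = - (LINT x|lebesgue. \<eta> x *\<^sub>R (G x $ k)))"

text \<open>The choice is immaterial: weak gradients are unique almost everywhere.\<close>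

definition weak_gradient :: "(real^3 \<Rightarrow> 'b::euclidean_space) \<Rightarrow> real^3 \<Rightarrow> 'b^3" where
  "weak_gradient f = (SOME G. has_weak_gradient f G)"

definition W1inf :: "(real^3 \<Rightarrow> 'b::euclidean_space) \<Rightarrow> bool" where
  "W1inf f \<longleftrightarrow>
     has_weak_gradient f (weak_gradient f) \<and>
     Linf_norm f < \<infinity> \<and> Linf_norm (weak_gradient f) < \<infinity>"

definition W1inf_norm :: "real \<Rightarrow> (real^3 \<Rightarrow> 'b::euclidean_space) \<Rightarrow> real" where
  "W1inf_norm L f = enn2real (Linf_norm f) + L * enn2real (Linf_norm (weak_gradient f))"

section \<open>Vorticity, flat norm, excess\<close>

text \<open>Vector-valued distributions are represented by their action on test fields.\<close>

definition distr_curl :: "(real^3 \<Rightarrow> real^3) \<Rightarrow> (real^3 \<Rightarrow> real^3) \<Rightarrow> real" where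
  "distr_curl u \<xi> = (LINT x|lebesgue. curl \<xi> x \<bullet> u x)"

definition curve_measure :: "real \<Rightarrow> (real \<Rightarrow> real^3) \<Rightarrow> (real^3 \<Rightarrow> real^3) \<Rightarrow> real" where
  "curve_measure L \<gamma> \<xi> = (LINT s:{0..<L}|lebesgue. \<xi> (\<gamma> s) \<bullet> tangent \<gamma> s)"

definition flat_norm :: "((real^3 \<Rightarrow> real^3) \<Rightarrow> real) \<Rightarrow> ereal" where
  "flat_norm \<omega> = (SUP \<xi>\<in>{\<xi>. C1_compact \<xi> \<and> Linf_norm (curl \<xi>) \<le> 1}. ereal (\<omega> \<xi>))"

definition k_eps :: "real \<Rightarrow> real \<Rightarrow> real" where
  "k_eps L \<epsilon> = 4 * pi / \<bar>ln (\<epsilon> / L)\<bar>"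

definition excess :: "real \<Rightarrow> real \<Rightarrow> (real^3 \<Rightarrow> real^3) \<Rightarrow> real" where
  "excess L \<epsilon> u = k_eps L \<epsilon> / L * (LINT x|lebesgue. 1 / 2 * (norm (u x))\<^sup>2) - 1"

text \<open>On \<open>real^3^3\<close> the library's inner product \<open>A \<bullet> B\<close> is the sum of \<open>A $ i $ j * B $ i $ j\<close>, and
  the norm is the Frobenius norm.\<close>

definition tensor :: "real^3 \<Rightarrow> real^3 \<Rightarrow> real^3^3" where
  "tensor a b = (\<chi> i j. a $ i * b $ j)"

end

theory Submission
  imports Defs
begin

text \<open>The test fields are built from the curve itself. Weak-type control of \<open>\<kappa>\<^sup>*\<close> makes the curve Ahlfors regular,
  \<open>|{t : |x - \<gamma> t| \<le> q}| \<le> 15 K q\<close>, so that kernels integrate along it as along a line, and controls the pairs of points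
  that are far apart in arclength but close in space. For the lower bound one tests the energy with a Biot--Savart field
  \<open>curl \<xi>\<close>, where \<open>\<xi>\<close> is the convolution of \<open>\<tau> \<H>\<^sup>1\<close> with a truncated Newton kernel: nearby tangents are almost parallel
  and give the leading logarithm. For the stress one compares \<open>u\<close> with the same kind of field \<open>v\<close> at the scales between \<open>\<epsilon>\<close> and
  \<open>L\<close>. The energy of \<open>u - v\<close> is the excess up to an error of order \<open>K\<^sup>2 L\<close>. For symmetric \<open>S\<close> the field \<open>S v\<close> equals, up to an error
  controlled by the Lipschitz constant of \<open>S\<close>, a gradient minus a curl \<open>\<nabla> E - curl Z\<close>, with \<open>E\<close>, \<open>Z\<close> obtained from second
  derivatives of the truncated biharmonic kernel \<open>|x| / 8 \<pi>\<close>. Integration by parts then reduces \<open>\<integral> S u \<bullet> u\<close> to \<open>- \<integral> Z \<bullet> d\<mu>\<close>, whose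
  near-diagonal part is the line integral of \<open>S : (I - \<tau> \<otimes> \<tau>)\<close> times the logarithm.\<close>

section \<open>Layer-cake bounds\<close>

text \<open>The obstacle throughout is that an error with one further logarithm would be as large as
  the main term. The linear bound on the measure of
  \<open>{t. norm (x - \<gamma> t) \<le> q}\<close> and the weak-type bound on \<open>\<rho>\<close>
  are both borderline for exponent one: neither allows \<open>1 / norm (x - \<gamma> t)\<close> or
  \<open>1 / \<rho>\<close> to be integrated. Critical powers are therefore split. Beyond the
  security radius a chord has length at least \<open>\<rho> / 2\<close>, so its inverse is at most a
  product of two inverse square roots, one integrated by each bound; this gives one factor
  \<open>K\<close> each, hence \<open>K^2\<close>. In the same way \<open>ln (l / \<rho>)\<close> is
  replaced by a multiple of \<open>sqrt (l / \<rho>)\<close>. The flat-norm tolerance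
  \<open>\<epsilon> * L\<close> is matched by test fields whose curl is of size
  \<open>K / \<epsilon>\<close>, which leaves an error \<open>K * L\<close>. Since
  \<open>K \<ge> 11/3\<close> always holds, all lower powers of \<open>K\<close> are absorbed into
  \<open>K^2\<close>. Two kernels occur because the demands differ: the lower bound with its small
  constant relies on signs (a superharmonic kernel with nonnegative density), while the stress
  identity relies on more derivatives and only on sizes.\<close>

lemma emeasure_lborel_Ici: "emeasure lborel {a::real..} = \<infinity>"
proof -
  have "of_nat n \<le> emeasure lborel {a..}" for n
    using emeasure_mono[of "{a..a + real n}" "{a..}" lborel] by (auto simp: ennreal_of_nat_eq_real_of_nat)
  then show ?thesis using ennreal_Ex_less_of_nat[of "emeasure lborel {a..}"]
    by (metis infinity_ennreal_def leD less_top)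
qed

text \<open>Superlevel sets of an antitone \<open>f\<close> on the half line are initial intervals,
  so the hypothesis bounds the measure of each preimage under \<open>p\<close> by \<open>A\<close>
  times the length of the interval; integrating over the levels gives the claim. All integrals of
  kernels along the curve reduce to this comparison with the line.\<close>

lemma nn_integral_antitone_le:
  fixes f :: "real \<Rightarrow> ennreal" and p :: "'a \<Rightarrow> real"
  assumes M: "sigma_finite_measure M" and p[measurable]: "p \<in> borel_measurable M"
    and f[measurable]: "f \<in> borel_measurable borel"
    and p0: "\<And>x. x \<in> space M \<Longrightarrow> 0 \<le> p x"
    and anti: "\<And>x y. 0 \<le> x \<Longrightarrow> x \<le> y \<Longrightarrow> f y \<le> f x"
    and A: "A > 0" "\<And>q. q > 0 \<Longrightarrow> emeasure M {x\<in>space M. p x \<le> q} \<le> ennreal (A * q)"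
  shows "(\<integral>\<^sup>+x. f (p x) \<partial>M) \<le> ennreal A * (\<integral>\<^sup>+\<rho>. f \<rho> * indicator {0..} \<rho> \<partial>lborel)"
proof -
  interpret M: sigma_finite_measure M by fact
  interpret P: pair_sigma_finite M lborel by unfold_locales
  let ?I = "\<lambda>c (t::real). if 0 \<le> t \<and> ennreal t < c then 1 else (0::ennreal)"
  have level: "(\<integral>\<^sup>+t. ?I c t \<partial>lborel) = c" for c :: ennreal
  proof (cases c)
    case (real r)
    have "(\<integral>\<^sup>+t. ?I c t \<partial>lborel) = (\<integral>\<^sup>+t. indicator {0..<r} t \<partial>lborel)"
      using real by (intro nn_integral_cong) (auto simp: indicator_def ennreal_less_iff)
    with real show ?thesis by simp
  next
    case top
    have "(\<integral>\<^sup>+t. ?I c t \<partial>lborel) = (\<integral>\<^sup>+t. indicator {0::real..} t \<partial>lborel)"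
      using top by (intro nn_integral_cong) (auto simp: indicator_def)
    then show ?thesis using top by (simp add: emeasure_lborel_Ici)
  qed
  have "(\<integral>\<^sup>+x. f (p x) \<partial>M) = (\<integral>\<^sup>+x. \<integral>\<^sup>+t. ?I (f (p x)) t \<partial>lborel \<partial>M)"
    by (simp add: level)
  also have "\<dots> = (\<integral>\<^sup>+t. \<integral>\<^sup>+x. ?I (f (p x)) t \<partial>M \<partial>lborel)"
    by (rule P.Fubini'[symmetric]) measurable
  also have "\<dots> \<le> (\<integral>\<^sup>+t. ennreal A * (\<integral>\<^sup>+\<rho>. ?I (f \<rho>) t * indicator {0..} \<rho> \<partial>lborel) \<partial>lborel)"
  proof (rule nn_integral_mono)
    fix t :: real
    show "(\<integral>\<^sup>+x. ?I (f (p x)) t \<partial>M) \<le> ennreal A * (\<integral>\<^sup>+\<rho>. ?I (f \<rho>) t * indicator {0..} \<rho> \<partial>lborel)"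
    proof (cases "0 \<le> t")
      case True
      define S where "S = {\<rho>. 0 \<le> \<rho> \<and> ennreal t < f \<rho>}"
      have Sm[measurable]: "S \<in> sets borel" unfolding S_def by measurable
      have down: "x \<in> S" if "y \<in> S" "0 \<le> x" "x \<le> y" for x y
        using that anti[of x y] by (auto simp: S_def intro: less_le_trans)
      have "(\<integral>\<^sup>+x. ?I (f (p x)) t \<partial>M) = (\<integral>\<^sup>+x. indicator {x\<in>space M. p x \<in> S} x \<partial>M)"
        using True p0 by (intro nn_integral_cong) (auto simp: indicator_def S_def)
      also have "\<dots> = emeasure M {x\<in>space M. p x \<in> S}"
        by (intro nn_integral_indicator) measurable
      finally have 1: "(\<integral>\<^sup>+x. ?I (f (p x)) t \<partial>M) = emeasure M {x\<in>space M. p x \<in> S}" .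
      have "(\<integral>\<^sup>+\<rho>. ?I (f \<rho>) t * indicator {0..} \<rho> \<partial>lborel) = (\<integral>\<^sup>+\<rho>. indicator S \<rho> \<partial>lborel)"
        using True by (intro nn_integral_cong) (auto simp: indicator_def S_def)
      then have 2: "(\<integral>\<^sup>+\<rho>. ?I (f \<rho>) t * indicator {0..} \<rho> \<partial>lborel) = emeasure lborel S" by simp
      have "emeasure M {x\<in>space M. p x \<in> S} \<le> ennreal A * emeasure lborel S"
      proof (cases "bdd_above S")
        case False
        have "{0..} \<subseteq> S"
          using False down unfolding bdd_above_def by (auto, meson linear)
        then have "emeasure lborel {0::real..} \<le> emeasure lborel S" by (intro emeasure_mono) auto
        then have "emeasure lborel S = \<infinity>" by (simp add: emeasure_lborel_Ici top_unique)
        then show ?thesis using A by (simp add: ennreal_mult_top)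
      next
        case bdd: True
        show ?thesis
        proof (cases "S = {}")
          case True then show ?thesis by simp
        next
          case False
          define c where "c = Sup S"
          have c0: "0 \<le> c" and up: "\<And>x. x \<in> S \<Longrightarrow> x \<le> c"
            using False bdd by (auto simp: c_def S_def intro: cSup_upper cSup_upper2)
          have "{0..<c} \<subseteq> S"
          proof
            fix x assume "x \<in> {0..<c}"
            then obtain y where "y \<in> S" "x < y" using less_cSupE[of x S] False unfolding c_def by auto
            then show "x \<in> S" using down \<open>x \<in> {0..<c}\<close> by auto
          qed
          then have "emeasure lborel {0..<c} \<le> emeasure lborel S" by (intro emeasure_mono) auto
          then have l: "ennreal c \<le> emeasure lborel S" using c0 by simp
          \<comment> \<open>The growth hypothesis is available for positive \<open>q\<close> only,
            while \<open>c\<close> may be \<open>0\<close>; hence the enlargement by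
            \<open>e / A\<close>.\<close>
          have "emeasure M {x\<in>space M. p x \<in> S} \<le> ennreal (A * c)"
          proof (rule ennreal_le_epsilon)
            fix e :: real assume "0 < e"
            have "emeasure M {x\<in>space M. p x \<in> S} \<le> emeasure M {x\<in>space M. p x \<le> c + e / A}"
              using up \<open>0 < e\<close> A by (intro emeasure_mono) (auto intro: add_increasing2)
            also have "\<dots> \<le> ennreal (A * (c + e/A))" using \<open>0 < e\<close> A c0 by (intro A(2)) (simp add: add_nonneg_pos)
            also have "A * (c + e/A) = A * c + e" using A by (simp add: field_simps)
            finally show "emeasure M {x\<in>space M. p x \<in> S} \<le> ennreal (A * c) + ennreal e"
              using A c0 \<open>0 < e\<close> by simp
          qed
          also have "\<dots> = ennreal A * ennreal c" using A c0 by (simp add: ennreal_mult)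
          also have "\<dots> \<le> ennreal A * emeasure lborel S" by (intro mult_left_mono l) simp
          finally show ?thesis .
        qed
      qed
      then show ?thesis by (simp only: 1 2)
    qed simp
  qed
  also have "\<dots> = ennreal A * (\<integral>\<^sup>+t. \<integral>\<^sup>+\<rho>. ?I (f \<rho>) t * indicator {0..} \<rho> \<partial>lborel \<partial>lborel)"
    by (rule nn_integral_cmult) measurable
  also have "(\<integral>\<^sup>+t. \<integral>\<^sup>+\<rho>. ?I (f \<rho>) t * indicator {0..} \<rho> \<partial>lborel \<partial>lborel)
      = (\<integral>\<^sup>+\<rho>. \<integral>\<^sup>+t. ?I (f \<rho>) t * indicator {0..} \<rho> \<partial>lborel \<partial>lborel)"
    by (rule lborel_pair.Fubini') measurable
  also have "\<dots> = (\<integral>\<^sup>+\<rho>. f \<rho> * indicator {0..} \<rho> \<partial>lborel)"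
    by (subst nn_integral_multc) (simp_all add: level)
  finally show ?thesis .
qed

lemma nn_integral_powr_0:
  assumes "0 \<le> b" "b < 1" "0 \<le> R"
  shows "(\<integral>\<^sup>+\<rho>. ennreal (\<rho> powr -b) * indicator {0..R} \<rho> \<partial>lborel) = ennreal (R powr (1 - b) / (1 - b))"
proof -
  have "((\<lambda>x. x powr -b) has_integral (R powr (-b + 1) / (-b + 1))) {0..R}"
    using assms by (intro has_integral_powr_from_0) auto
  from nn_integral_has_integral_lebesgue[OF _ this]
  show ?thesis by (simp add: add.commute mult.commute ennreal_indicator ennreal_mult'' nn_integral_completion)
qed

lemma nn_integral_powr_le:
  fixes p :: "'a \<Rightarrow> real"
  assumes M: "sigma_finite_measure M" and p[measurable]: "p \<in> borel_measurable M"
    and p0: "\<And>x. x \<in> space M \<Longrightarrow> 0 \<le> p x"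
    and A: "A > 0" "\<And>q. q > 0 \<Longrightarrow> emeasure M {x\<in>space M. p x \<le> q} \<le> ennreal (A * q)"
    and b: "0 \<le> b" "b < 1" "0 \<le> R"
  shows "(\<integral>\<^sup>+x. (if p x \<le> R then ennreal (p x powr -b) else 0) \<partial>M) \<le> ennreal (A * (R powr (1 - b) / (1 - b)))"
proof -
  \<comment> \<open>\<open>0 powr -b\<close> is \<open>0\<close>, so the plain power is not antitone
    at the origin. The value \<open>\<infinity>\<close> there repairs this and changes the
    comparison integral only on a null set.\<close>
  let ?f = "\<lambda>\<rho>. if \<rho> \<le> R then if \<rho> \<le> 0 then \<infinity> else ennreal (\<rho> powr -b) else 0"
  have "(\<integral>\<^sup>+x. (if p x \<le> R then ennreal (p x powr -b) else 0) \<partial>M) \<le> (\<integral>\<^sup>+x. ?f (p x) \<partial>M)"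
    using p0 by (intro nn_integral_mono) (auto simp: top_greatest)
  also have "\<dots> \<le> ennreal A * (\<integral>\<^sup>+\<rho>. ?f \<rho> * indicator {0..} \<rho> \<partial>lborel)"
    using M p _ p0 _ A
    by (rule nn_integral_antitone_le) (use b in \<open>auto intro!: ennreal_leI powr_mono2'\<close>)
  also have "(\<integral>\<^sup>+\<rho>. ?f \<rho> * indicator {0..} \<rho> \<partial>lborel)
     = (\<integral>\<^sup>+\<rho>. ennreal (\<rho> powr -b) * indicator {0..R} \<rho> \<partial>lborel)"
  proof (rule nn_integral_cong_AE)
    have "AE \<rho>::real in lborel. \<rho> \<noteq> 0" by (rule AE_lborel_singleton)
    then show "AE \<rho> in lborel. ?f \<rho> * indicator {0..} \<rho> = ennreal (\<rho> powr -b) * indicator {0..R} \<rho>"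
      by eventually_elim (auto simp: indicator_def)
  qed
  also have "\<dots> = ennreal (R powr (1 - b) / (1 - b))" using b by (rule nn_integral_powr_0)
  also have "ennreal A * ennreal (R powr (1 - b) / (1 - b)) = ennreal (A * (R powr (1 - b) / (1 - b)))"
    using A b by (subst ennreal_mult) auto
  finally show ?thesis .
qed

lemma nn_integral_max_powr_le:
  fixes p :: "'a \<Rightarrow> real"
  assumes M: "sigma_finite_measure M" and p[measurable]: "p \<in> borel_measurable M"
    and p0: "\<And>x. x \<in> space M \<Longrightarrow> 0 \<le> p x"
    and A: "A > 0" "\<And>q. q > 0 \<Longrightarrow> emeasure M {x\<in>space M. p x \<le> q} \<le> ennreal (A * q)"
    and b: "1 < a" "0 < \<eta>"
  shows "(\<integral>\<^sup>+x. ennreal (max \<eta> (p x) powr -a) \<partial>M) \<le> ennreal (A * (\<eta> powr (1 - a) * a / (a - 1)))"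
proof -
  let ?f = "\<lambda>\<rho>. ennreal (max \<eta> \<rho> powr -a)"
  have "(\<integral>\<^sup>+x. ?f (p x) \<partial>M) \<le> ennreal A * (\<integral>\<^sup>+\<rho>. ?f \<rho> * indicator {0..} \<rho> \<partial>lborel)"
    using M p _ p0 _ A
    by (rule nn_integral_antitone_le) (use b in \<open>auto intro!: ennreal_leI powr_mono2'\<close>)
  also have "(\<integral>\<^sup>+\<rho>. ?f \<rho> * indicator {0..} \<rho> \<partial>lborel) = ennreal (\<eta> powr (1 - a) * a / (a - 1))"
  proof -
    have i1: "((\<lambda>x. x powr -a) has_integral -(\<eta> powr (-a + 1) / (-a + 1))) {\<eta>..}"
      using has_integral_powr_to_inf[of "-a" \<eta>] b by simp
    have i2: "((\<lambda>x::real. \<eta> powr -a) has_integral \<eta> * \<eta> powr -a) {0..\<eta>}"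
      using has_integral_const_real[of "\<eta> powr -a" 0 \<eta>] b by simp
    have n1: "(\<integral>\<^sup>+\<rho>. ennreal (\<rho> powr -a) * indicator {\<eta>..} \<rho> \<partial>lborel) = ennreal (-(\<eta> powr (-a + 1) / (-a + 1)))"
      using nn_integral_has_integral_lebesgue[OF _ i1]
      by (simp add: mult.commute ennreal_indicator ennreal_mult'' nn_integral_completion)
    have n2: "(\<integral>\<^sup>+\<rho>. ennreal (\<eta> powr -a) * indicator {0..\<eta>} (\<rho>::real) \<partial>lborel) = ennreal (\<eta> * \<eta> powr -a)"
      using nn_integral_has_integral_lebesgue[OF _ i2]
      by (simp add: mult.commute ennreal_indicator ennreal_mult'' nn_integral_completion)
    have "(\<integral>\<^sup>+\<rho>. ?f \<rho> * indicator {0..} \<rho> \<partial>lborel)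
      = (\<integral>\<^sup>+\<rho>. ennreal (\<eta> powr -a) * indicator {0..\<eta>} \<rho> + ennreal (\<rho> powr -a) * indicator {\<eta>..} \<rho> \<partial>lborel)"
    proof (rule nn_integral_cong_AE)
      have "AE \<rho>::real in lborel. \<rho> \<noteq> \<eta>" by (rule AE_lborel_singleton)
      then show "AE \<rho> in lborel. ?f \<rho> * indicator {0..} \<rho>
         = ennreal (\<eta> powr -a) * indicator {0..\<eta>} \<rho> + ennreal (\<rho> powr -a) * indicator {\<eta>..} \<rho>"
        by eventually_elim (use b in \<open>auto simp: indicator_def max_def\<close>)
    qed
    also have "\<dots> = ennreal (\<eta> * \<eta> powr -a) + ennreal (-(\<eta> powr (-a + 1) / (-a + 1)))"
      by (subst nn_integral_add) (auto simp: n1 n2)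
    also have "\<dots> = ennreal (\<eta> * \<eta> powr -a + -(\<eta> powr (-a + 1) / (-a + 1)))"
      using b by (intro ennreal_plus[symmetric]) (auto simp: divide_nonneg_neg)
    also have "\<eta> * \<eta> powr -a = \<eta> powr (1 - a)"
      using b by (simp add: powr_diff powr_minus field_simps)
    also have "\<eta> powr (1 - a) + -(\<eta> powr (-a + 1) / (-a + 1)) = \<eta> powr (1 - a) * a / (a - 1)"
      using b by (simp add: field_simps)
    finally show ?thesis .
  qed
  also have "ennreal A * ennreal (\<eta> powr (1 - a) * a / (a - 1)) = ennreal (A * (\<eta> powr (1 - a) * a / (a - 1)))"
    using A b by (subst ennreal_mult) auto
  finally show ?thesis .
qed

lemma emeasure_norm_ball3:
  assumes "0 \<le> q"
  shows "emeasure lborel {x::real^3. norm x \<le> q} = ennreal (4/3 * pi * q^3)"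
proof -
  have "{x::real^3. norm x \<le> q} = cball 0 q" by auto
  then show ?thesis using emeasure_cball[of q "0::real^3"] assms
    by (simp add: eval_unit_ball_vol mult.commute)
qed

text \<open>The cube of the norm has a linear distribution function, with constant
  \<open>4/3 * pi\<close>, so the one-dimensional comparison applies to it with exponent
  \<open>a/3\<close>.\<close>

lemma nn_integral_ball3_powr:
  assumes a: "0 \<le> a" "a < 3" "0 \<le> R"
  shows "(\<integral>\<^sup>+x. (if norm (x::real^3) \<le> R then ennreal (norm x powr -a) else 0) \<partial>lborel)
    \<le> ennreal (4 * pi * R powr (3 - a) / (3 - a))"
proof -
  have *: "(norm x)^3 \<le> R^3 \<longleftrightarrow> norm x \<le> R" for x :: "real^3"
    using a by (intro power_mono_iff) auto
  have pw: "((t::real)^3) powr r = t powr (3*r)" if "0 \<le> t" for t r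
  proof (cases "t = 0")
    case False
    with that have "t^3 = t powr 3" by (simp add: powr_numeral)
    then show ?thesis by (simp only: powr_powr)
  qed simp
  have "(\<integral>\<^sup>+x. (if norm (x::real^3) \<le> R then ennreal (norm x powr -a) else 0) \<partial>lborel)
     = (\<integral>\<^sup>+x. (if (norm (x::real^3))^3 \<le> R^3 then ennreal (((norm x)^3) powr -(a/3)) else 0) \<partial>lborel)"
    by (intro nn_integral_cong) (simp add: * pw[OF norm_ge_zero])
  also have "\<dots> \<le> ennreal (4/3*pi * ((R^3) powr (1 - a/3) / (1 - a/3)))"
  proof (rule nn_integral_powr_le)
    fix q :: real assume q: "q > 0"
    have "(norm x)^3 \<le> q \<longleftrightarrow> norm x \<le> root 3 q" for x :: "real^3"
      using power_mono_iff[of "norm x" "root 3 q" 3] q by simp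
    then show "emeasure lborel {x\<in>space lborel. (norm (x::real^3))^3 \<le> q} \<le> ennreal (4/3*pi*q)"
      using q emeasure_norm_ball3[of "root 3 q"] by simp
  qed (use a in \<open>auto simp: lborel.sigma_finite_measure_axioms\<close>)
  also have "4/3*pi * ((R^3) powr (1 - a/3) / (1 - a/3)) = 4 * pi * R powr (3 - a) / (3 - a)"
  proof -
    have "(R^3) powr (1 - a/3) = R powr (3 - a)"
      using pw[OF a(3), of "1 - a/3"] by (simp add: algebra_simps)
    moreover have "4/3*pi * (B / (1 - a/3)) = 4*pi*B/(3-a)" for B :: real
    proof -
      have "1 - a/3 = (3 - a)/3" by (simp add: field_simps)
      then show ?thesis by simp
    qed
    ultimately show ?thesis by simp
  qed
  finally show ?thesis .
qed

section \<open>Compactly supported continuously differentiable fields\<close>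

text \<open>The partial derivatives are carried along as explicit data. Curls, divergences and
  gradients of convolutions are then given by formulas in the derivatives of the kernel, and every
  later field comes with its witness \<open>d\<close>.\<close>

definition C1c :: "(real^3 \<Rightarrow> 'b::real_normed_vector) \<Rightarrow> (3 \<Rightarrow> real^3 \<Rightarrow> 'b) \<Rightarrow> bool" where
  "C1c f d \<longleftrightarrow> (\<forall>x. (f has_derivative (\<lambda>h. \<Sum>i\<in>UNIV. (h$i) *\<^sub>R d i x)) (at x)) \<and>
     (\<forall>i. continuous_on UNIV (d i)) \<and>
     (\<exists>R. \<forall>x. R \<le> norm x \<longrightarrow> f x = 0 \<and> (\<forall>i. d i x = 0))"

lemma C1cI:
  assumes "\<And>x. (f has_derivative (\<lambda>h. \<Sum>i\<in>UNIV. (h$i) *\<^sub>R d i x)) (at x)"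
    "\<And>i. continuous_on UNIV (d i)"
    "\<And>x. R \<le> norm x \<Longrightarrow> f x = 0" "\<And>i x. R \<le> norm x \<Longrightarrow> d i x = 0"
  shows "C1c f d"
  using assms unfolding C1c_def by blast

lemma C1cD:
  assumes "C1c f d"
  shows C1c_deriv: "(f has_derivative (\<lambda>h. \<Sum>i\<in>UNIV. (h$i) *\<^sub>R d i x)) (at x)"
    and C1c_cont_d: "continuous_on UNIV (d i)"
    and C1c_cont: "continuous_on UNIV f"
  using assms unfolding C1c_def
  by (auto simp: continuous_on_eq_continuous_within intro: has_derivative_continuous)

lemma C1c_supp:
  assumes "C1c f d"
  obtains R where "R > 0" "\<And>x. R \<le> norm x \<Longrightarrow> f x = 0" "\<And>i x. R \<le> norm x \<Longrightarrow> d i x = 0"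
proof -
  from assms obtain R where R: "\<forall>x. R \<le> norm x \<longrightarrow> f x = 0 \<and> (\<forall>i. d i x = 0)"
    unfolding C1c_def by blast
  show ?thesis by (rule that[of "max R 1"]) (use R in auto)
qed

lemma C1c_supp':
  assumes "C1c f d"
  obtains R where "\<And>x. R \<le> norm x \<Longrightarrow> f x = 0" "\<And>i x. R \<le> norm x \<Longrightarrow> d i x = 0"
  using C1c_supp[OF assms] by metis

lemma compact_supp_bounded:
  fixes g :: "real^3 \<Rightarrow> 'b::real_normed_vector"
  assumes "continuous_on UNIV g" "\<And>x. R \<le> norm x \<Longrightarrow> g x = 0"
  obtains B where "B > 0" "\<And>x. norm (g x) \<le> B"
proof -
  have "bounded (g ` cball 0 R)"
    by (intro compact_imp_bounded compact_continuous_image) (use assms in \<open>auto intro: continuous_on_subset\<close>)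
  then obtain B where "\<forall>x\<in>cball 0 R. norm (g x) \<le> B"
    by (auto simp: bounded_iff)
  then have B: "\<And>x. norm x \<le> R \<Longrightarrow> norm (g x) \<le> B" by simp
  have "norm (g x) \<le> max B 1" for x
    using B[of x] assms(2)[of x] by (cases "norm x \<le> R") auto
  then show ?thesis by (intro that[of "max B 1"]) auto
qed

lemma C1c_bounded:
  assumes "C1c f d"
  obtains B where "B > 0" "\<And>x. norm (f x) \<le> B" "\<And>i x. norm (d i x) \<le> B"
proof -
  obtain R where R: "\<And>x. R \<le> norm x \<Longrightarrow> f x = 0" "\<And>i x. R \<le> norm x \<Longrightarrow> d i x = 0"
    using C1c_supp'[OF assms] by metis
  obtain B0 where B0: "B0 > 0" "\<And>x. norm (f x) \<le> B0"
    using compact_supp_bounded[OF C1c_cont[OF assms] R(1)] by metis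
  have "\<forall>i. \<exists>B. B > 0 \<and> (\<forall>x. norm (d i x) \<le> B)"
    using compact_supp_bounded[OF C1c_cont_d[OF assms] R(2)] by metis
  then obtain B where B: "\<And>i. B i > 0" "\<And>i x. norm (d i x) \<le> B i" by metis
  have "norm (d i x) \<le> B0 + sum B UNIV" for i x
    using B(2)[of i x] member_le_sum[of i UNIV B] B(1) B0(1) by (force intro: less_imp_le)
  moreover have "norm (f x) \<le> B0 + sum B UNIV" for x
    using B0(2)[of x] sum_nonneg[of UNIV B] B(1) by (force intro: less_imp_le)
  ultimately show ?thesis using that[of "B0 + sum B UNIV"] B0 B(1)
    by (meson add_pos_nonneg less_imp_le sum_nonneg)
qed

lemma compact_supp_integrable:
  fixes g :: "real^3 \<Rightarrow> 'b::euclidean_space"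
  assumes "continuous_on UNIV g" "\<And>x. R \<le> norm x \<Longrightarrow> g x = 0"
  shows "integrable lborel g"
proof -
  have "integrable lborel (\<lambda>x. indicator (cball 0 R) x *\<^sub>R g x)"
    by (rule borel_integrable_compact) (use assms in \<open>auto intro: continuous_on_subset\<close>)
  also have "(\<lambda>x. indicator (cball 0 R) x *\<^sub>R g x) = g"
    using assms by (force simp: indicator_def)
  finally show ?thesis .
qed

lemma
  fixes f :: "real^3 \<Rightarrow> 'b::euclidean_space"
  assumes "C1c f d"
  shows C1c_integrable: "integrable lborel f" and C1c_integrable_d: "integrable lborel (d i)"
    and C1c_measurable: "f \<in> borel_measurable borel" and C1c_measurable_d: "d i \<in> borel_measurable borel"
proof -
  obtain R where R: "\<And>x. R \<le> norm x \<Longrightarrow> f x = 0" "\<And>i x. R \<le> norm x \<Longrightarrow> d i x = 0"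
    using C1c_supp'[OF assms] by metis
  show "integrable lborel f" by (rule compact_supp_integrable[OF C1c_cont[OF assms] R(1)])
  show "integrable lborel (d i)" by (rule compact_supp_integrable[OF C1c_cont_d[OF assms] R(2)])
  show "f \<in> borel_measurable borel" "d i \<in> borel_measurable borel"
    using C1c_cont[OF assms] C1c_cont_d[OF assms] by (auto intro: borel_measurable_continuous_onI)
qed

lemma sum_axis_scaleR:
  fixes g :: "'n::finite \<Rightarrow> 'b::real_vector"
  shows "(\<Sum>j\<in>UNIV. (axis i c $ j) *\<^sub>R g j) = c *\<^sub>R g i"
proof -
  have "(\<Sum>j\<in>UNIV. (axis i c $ j) *\<^sub>R g j) = (\<Sum>j\<in>UNIV. if j = i then c *\<^sub>R g i else 0)"
    by (intro sum.cong) (auto simp: axis_def)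
  then show ?thesis by simp
qed

lemma norm_partials_le:
  fixes g :: "3 \<Rightarrow> 'b::real_normed_vector"
  assumes "\<And>i. norm (g i) \<le> B"
  shows "norm (\<Sum>i\<in>UNIV. (h$i) *\<^sub>R g i) \<le> 3 * B * norm h"
proof -
  have "norm (\<Sum>i\<in>UNIV. (h$i) *\<^sub>R g i) \<le> (\<Sum>i\<in>(UNIV::3 set). norm h * B)"
    by (intro sum_norm_le) (use assms in \<open>auto intro!: mult_mono component_le_norm_cart\<close>)
  then show ?thesis by (simp add: mult_ac)
qed

lemma C1c_lipschitz:
  assumes "C1c f d" "\<And>i x. norm (d i x) \<le> B"
  shows "norm (f x - f y) \<le> 3 * B * norm (x - y)"
proof (rule differentiable_bound[of UNIV f "\<lambda>x h. \<Sum>i\<in>UNIV. (h$i) *\<^sub>R d i x"])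
  show "onorm (\<lambda>h. \<Sum>i\<in>UNIV. (h$i) *\<^sub>R d i x) \<le> 3 * B" for x
    using assms(2) by (intro onorm_le norm_partials_le) auto
qed (use C1c_deriv[OF assms(1)] in auto)

text \<open>Difference quotients in direction \<open>i\<close> integrate to zero by translation
  invariance of Lebesgue measure, and they converge boundedly. The steps are at most
  \<open>1\<close>, so the ball of radius \<open>R+1\<close> contains all their supports. All
  integrations by parts rest on this.\<close>

lemma C1c_integral_d_zero:
  fixes f :: "real^3 \<Rightarrow> real"
  assumes C: "C1c f d"
  shows "(LBINT x. d i x) = 0"
proof -
  obtain R where R: "R > 0" "\<And>x. R \<le> norm x \<Longrightarrow> f x = 0" "\<And>i x. R \<le> norm x \<Longrightarrow> d i x = 0"
    using C1c_supp[OF C] by metis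
  obtain B where B: "B > 0" "\<And>i x. norm (d i x) \<le> B"
    using C1c_bounded[OF C] by metis
  note [measurable] = C1c_measurable[OF C] C1c_measurable_d[OF C]
  define t where "t n = inverse (real (Suc n))" for n
  have t: "t n > 0" "t n \<le> 1" for n by (auto simp: t_def inverse_le_1_iff)
  define g where "g n x = (f (x + t n *\<^sub>R axis i 1) - f x) / t n" for n x
  have "(\<lambda>n. LBINT x. g n x) \<longlonglongrightarrow> (LBINT x. d i x)"
  proof (rule integral_dominated_convergence[where w="\<lambda>x. indicator (cball 0 (R+1)) x *\<^sub>R (3 * B)"])
    show "AE x in lborel. (\<lambda>n. g n x) \<longlonglongrightarrow> d i x"
    proof (rule AE_I2)
      fix x :: "real^3"
      have *: "((\<lambda>s::real. x + s *\<^sub>R axis i 1) has_derivative (\<lambda>s. s *\<^sub>R axis i 1)) (at 0)"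
        by (auto intro!: derivative_eq_intros)
      have "((\<lambda>s::real. f (x + s *\<^sub>R axis i 1)) has_derivative (\<lambda>s. \<Sum>j\<in>UNIV. ((s *\<^sub>R axis i 1 :: real^3)$j) *\<^sub>R d j x)) (at 0)"
        by (rule has_derivative_compose[OF *]) (use C1c_deriv[OF C, of x] in simp)
      moreover have "(\<lambda>s. \<Sum>j\<in>UNIV. ((s *\<^sub>R axis i 1 :: real^3)$j) *\<^sub>R d j x) = (\<lambda>s. d i x * s)"
      proof
        fix s
        have "(\<Sum>j\<in>UNIV. ((s *\<^sub>R axis i 1 :: real^3)$j) *\<^sub>R d j x) = s *\<^sub>R (\<Sum>j\<in>UNIV. ((axis i 1 :: real^3)$j) *\<^sub>R d j x)"
          by (simp add: scaleR_sum_right mult.assoc sum_distrib_left)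
        then show "(\<Sum>j\<in>UNIV. ((s *\<^sub>R axis i 1 :: real^3)$j) *\<^sub>R d j x) = d i x * s"
          by (simp only: sum_axis_scaleR) simp
      qed
      ultimately have "((\<lambda>s::real. f (x + s *\<^sub>R axis i 1)) has_field_derivative d i x) (at 0)"
        by (simp add: has_field_derivative_def)
      then have "(\<lambda>s::real. (f (x + s *\<^sub>R axis i 1) - f x) / s) \<midarrow>0\<rightarrow> d i x"
        by (simp add: DERIV_def)
      moreover have "t \<longlonglongrightarrow> 0" unfolding t_def by (rule LIMSEQ_inverse_real_of_nat)
      moreover have "\<forall>\<^sub>F n in sequentially. t n \<noteq> 0" using t by (auto intro!: always_eventually) (metis less_irrefl)
      ultimately show "(\<lambda>n. g n x) \<longlonglongrightarrow> d i x"
        unfolding g_def by (rule tendsto_compose_eventually)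
    qed
    show "integrable lborel (\<lambda>x. indicator (cball 0 (R+1)) x *\<^sub>R (3 * B))"
      by (intro borel_integrable_compact) auto
    show "AE x in lborel. norm (g n x) \<le> indicator (cball 0 (R+1)) x *\<^sub>R (3*B)" for n
    proof (rule AE_I2)
      fix x :: "real^3"
      show "norm (g n x) \<le> indicator (cball 0 (R+1)) x *\<^sub>R (3*B)"
      proof (cases "norm x \<le> R + 1")
        case True
        have "norm (f (x + t n *\<^sub>R axis i 1) - f x) \<le> 3 * B * t n"
          using C1c_lipschitz[OF C B(2), of "x + t n *\<^sub>R axis i 1" x] t[of n] by simp
        then show ?thesis using True t[of n] by (simp add: g_def field_simps)
      next
        case False
        have "norm x \<le> norm (x + t n *\<^sub>R axis i 1) + norm (t n *\<^sub>R axis i 1 :: real^3)"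
          using norm_triangle_ineq4[of "x + t n *\<^sub>R axis i 1" "t n *\<^sub>R axis i 1"] by simp
        then have "norm (x + t n *\<^sub>R axis i 1) \<ge> R" using False t[of n] by simp
        then show ?thesis using False R t[of n] by (simp add: g_def)
      qed
    qed
  qed (auto simp: g_def)
  moreover have "(LBINT x. g n x) = 0" for n
  proof -
    have i0: "integrable lborel f" by (rule C1c_integrable[OF C])
    have e: "(LBINT x. f (x + t n *\<^sub>R axis i 1)) = (LBINT x. f x)"
      by (subst (2) lborel_distr_plus[of "t n *\<^sub>R axis i 1", symmetric]) (simp add: integral_distr add.commute)
    have i1: "integrable lborel (\<lambda>x. f (x + t n *\<^sub>R axis i 1))"
    proof -
      have "integrable (distr lborel borel ((+) (t n *\<^sub>R axis i 1))) f"
        by (simp add: lborel_distr_plus i0)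
      then show ?thesis by (subst (asm) integrable_distr_eq) (auto simp: add.commute)
    qed
    show ?thesis unfolding g_def using i0 i1 e by simp
  qed
  ultimately show ?thesis by (simp add: LIMSEQ_const_iff)
qed

lemma C1c_mult:
  fixes f g :: "real^3 \<Rightarrow> real"
  assumes "C1c f d" "C1c g e"
  shows "C1c (\<lambda>x. f x * g x) (\<lambda>i x. d i x * g x + f x * e i x)"
proof -
  obtain R where R: "\<And>x. R \<le> norm x \<Longrightarrow> f x = 0" "\<And>i x. R \<le> norm x \<Longrightarrow> d i x = 0"
    using C1c_supp'[OF assms(1)] by metis
  show ?thesis
  proof (rule C1cI[where R=R])
    fix x
    show "((\<lambda>x. f x * g x) has_derivative (\<lambda>h. \<Sum>i\<in>UNIV. (h$i) *\<^sub>R (d i x * g x + f x * e i x))) (at x)"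
      by (rule has_derivative_eq_rhs[OF has_derivative_mult[OF C1c_deriv[OF assms(1)] C1c_deriv[OF assms(2)]]])
         (auto simp: fun_eq_iff sum_distrib_left sum_distrib_right sum.distrib[symmetric] algebra_simps intro!: sum.cong)
  qed (use R C1cD[OF assms(1)] C1cD[OF assms(2)] in \<open>auto intro!: continuous_intros\<close>)
qed

lemma C1c_ibp:
  fixes f g :: "real^3 \<Rightarrow> real"
  assumes "C1c f d" "C1c g e"
  shows "(LBINT x. d i x * g x) = - (LBINT x. f x * e i x)"
proof -
  obtain R where R: "\<And>x. R \<le> norm x \<Longrightarrow> f x = 0" "\<And>i x. R \<le> norm x \<Longrightarrow> d i x = 0"
    using C1c_supp'[OF assms(1)] by metis
  have "integrable lborel (\<lambda>x. d i x * g x)" "integrable lborel (\<lambda>x. f x * e i x)"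
    by (rule compact_supp_integrable[where R=R]; use R C1cD[OF assms(1)] C1cD[OF assms(2)] in \<open>auto intro!: continuous_intros\<close>)+
  then show ?thesis using C1c_integral_d_zero[OF C1c_mult[OF assms], of i] by simp
qed

lemma C1c_zero: "C1c (\<lambda>x. 0) (\<lambda>i x. 0)"
  by (rule C1cI) auto

lemma C1c_add:
  assumes "C1c f d" "C1c g e"
  shows "C1c (\<lambda>x. f x + g x) (\<lambda>i x. d i x + e i x)"
proof -
  obtain R where R: "\<And>x. R \<le> norm x \<Longrightarrow> f x = 0" "\<And>i x. R \<le> norm x \<Longrightarrow> d i x = 0"
    using C1c_supp'[OF assms(1)] by metis
  obtain R' where R': "\<And>x. R' \<le> norm x \<Longrightarrow> g x = 0" "\<And>i x. R' \<le> norm x \<Longrightarrow> e i x = 0"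
    using C1c_supp'[OF assms(2)] by metis
  show ?thesis
    by (rule C1cI[where R="max R R'"], rule has_derivative_eq_rhs[OF has_derivative_add[OF C1c_deriv[OF assms(1)] C1c_deriv[OF assms(2)]]])
      (use R R' C1cD[OF assms(1)] C1cD[OF assms(2)] in \<open>auto simp: fun_eq_iff scaleR_add_right sum.distrib intro!: continuous_intros\<close>)
qed

lemma C1c_sum:
  assumes "\<And>j. j \<in> J \<Longrightarrow> C1c (f j) (d j)"
  shows "C1c (\<lambda>x. \<Sum>j\<in>J. f j x) (\<lambda>i x. \<Sum>j\<in>J. d j i x)"
  using assms by (induction J rule: infinite_finite_induct) (simp_all add: C1c_zero C1c_add)

lemma C1c_linear:
  assumes T: "bounded_linear T" and C: "C1c f d"
  shows "C1c (\<lambda>x. T (f x)) (\<lambda>i x. T (d i x))"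
proof -
  interpret T: bounded_linear T by fact
  obtain R where R: "\<And>x. R \<le> norm x \<Longrightarrow> f x = 0" "\<And>i x. R \<le> norm x \<Longrightarrow> d i x = 0"
    using C1c_supp'[OF C] by metis
  show ?thesis
    by (rule C1cI[where R=R], rule has_derivative_eq_rhs[OF T.has_derivative[OF C1c_deriv[OF C]]])
      (use R in \<open>auto simp: T.sum T.scaleR T.zero intro!: T.continuous_on C1c_cont_d[OF C]\<close>)
qed

lemma C1c_reflect:
  assumes C: "C1c f d"
  shows "C1c (\<lambda>x. f (z - x)) (\<lambda>i x. - d i (z - x))"
proof -
  obtain R where R: "\<And>x. R \<le> norm x \<Longrightarrow> f x = 0" "\<And>i x. R \<le> norm x \<Longrightarrow> d i x = 0"
    using C1c_supp'[OF C] by metis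
  have *: "R \<le> norm (z - x)" if "R + norm z \<le> norm x" for x
    using that norm_triangle_ineq2[of x z] by (simp add: norm_minus_commute)
  show ?thesis
  proof (rule C1cI[where R="R + norm z"])
    fix x
    have "((\<lambda>x. z - x) has_derivative (\<lambda>h. - h)) (at x)" by (auto intro!: derivative_eq_intros)
    from has_derivative_compose[OF this C1c_deriv[OF C]]
    show "((\<lambda>x. f (z - x)) has_derivative (\<lambda>h. \<Sum>i\<in>UNIV. (h$i) *\<^sub>R - d i (z - x))) (at x)"
      by simp
  qed (use R * in \<open>auto intro!: continuous_intros continuous_on_compose2[OF C1c_cont_d[OF C]]\<close>)
qed

lemma C1c_partial_deriv:
  assumes "C1c f d"
  shows "partial_deriv i f x = d i x"
proof -
  have "frechet_derivative f (at x) = (\<lambda>h. \<Sum>i\<in>UNIV. (h$i) *\<^sub>R d i x)"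
    using frechet_derivative_at[OF C1c_deriv[OF assms]] by simp
  then show ?thesis unfolding partial_deriv_def by (simp add: sum_axis_scaleR)
qed

lemma C1c_C1_compact:
  assumes C: "C1c f d"
  shows "C1_compact f"
proof -
  define F where "F x = (\<Sum>i\<in>UNIV. blinfun_scaleR_left (d i x) o\<^sub>L Blinfun (\<lambda>h::real^3. h $ i))" for x
  have bl: "bounded_linear (\<lambda>h::real^3. h $ i)" for i by (rule bounded_linear_vec_nth)
  have F: "blinfun_apply (F x) = (\<lambda>h. \<Sum>i\<in>UNIV. (h$i) *\<^sub>R d i x)" for x
    unfolding F_def by (auto simp: fun_eq_iff blinfun.sum_left bounded_linear_Blinfun_apply[OF bl])
  have cont: "continuous_on UNIV F"
    unfolding F_def using C1c_cont_d[OF C] by (intro continuous_intros) auto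
  obtain R where R: "\<And>x. R \<le> norm x \<Longrightarrow> f x = 0" using C1c_supp'[OF C] by metis
  have "{x. f x \<noteq> 0} \<subseteq> cball 0 R" using R by force
  then have "bounded {x. f x \<noteq> 0}" using bounded_cball bounded_subset by blast
  then have "compact (closure {x. f x \<noteq> 0})" by (simp add: compact_closure)
  then show ?thesis unfolding C1_compact_def
    using cont C1c_deriv[OF C] by (intro conjI exI[of _ F]) (auto simp: F)
qed

section \<open>Convolution along a parametrised measure\<close>

definition conv :: "'s measure \<Rightarrow> ('s \<Rightarrow> real^3) \<Rightarrow> (real^3 \<Rightarrow> real) \<Rightarrow> ('s \<Rightarrow> 'b::euclidean_space) \<Rightarrow> real^3 \<Rightarrow> 'b" where
  "conv M p f m x = (\<integral>s. f (x - p s) *\<^sub>R m s \<partial>M)"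

lemma integral_norm_bound_AE:
  fixes f :: "'a \<Rightarrow> 'b::{banach, second_countable_topology}"
  assumes "integrable M f" "integrable M g" "AE x in M. norm (f x) \<le> g x"
  shows "norm (\<integral>x. f x \<partial>M) \<le> (\<integral>x. g x \<partial>M)"
proof -
  have "norm (\<integral>x. f x \<partial>M) \<le> (\<integral>x. norm (f x) \<partial>M)" by (rule integral_norm_bound)
  also have "\<dots> \<le> (\<integral>x. g x \<partial>M)" using assms by (intro integral_mono_AE) auto
  finally show ?thesis .
qed

lemma compact_supp_uniform:
  fixes g :: "real^3 \<Rightarrow> 'b::real_normed_vector"
  assumes c: "continuous_on UNIV g" and z: "\<And>x. R \<le> norm x \<Longrightarrow> g x = 0" and e: "e > 0"
  shows "\<exists>\<delta>>0. \<forall>x y. norm (x - y) < \<delta> \<longrightarrow> norm (g x - g y) < e"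
proof -
  have "uniformly_continuous_on (cball 0 (R + 1)) g"
    by (rule compact_uniformly_continuous) (use c in \<open>auto intro: continuous_on_subset\<close>)
  then obtain d where d: "d > 0" "\<forall>x\<in>cball 0 (R+1). \<forall>y\<in>cball 0 (R+1). dist y x < d \<longrightarrow> dist (g y) (g x) < e"
    using e unfolding uniformly_continuous_on_def by metis
  have "norm (g x - g y) < e" if h: "norm (x - y) < min d 1" for x y
  proof (cases "norm x \<le> R + 1 \<and> norm y \<le> R + 1")
    case True
    then show ?thesis using d(2) h by (force simp: dist_norm)
  next
    case False
    have "norm x \<le> norm y + norm (x - y)" "norm y \<le> norm x + norm (x - y)"
      by norm+
    then have "R \<le> norm x" "R \<le> norm y" using False h by auto
    then show ?thesis using z e by simp
  qed
  then show ?thesis using d(1) by (intro exI[of _ "min d 1"]) auto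
qed

text \<open>A first-order expansion uniform in the base point is what lets a convolution be
  differentiated under an arbitrary finite measure, in \<open>conv_C1c\<close>.\<close>

lemma C1c_uniform_deriv:
  assumes C: "C1c f d" and e: "e > 0"
  shows "\<exists>\<delta>>0. \<forall>x h. norm h < \<delta> \<longrightarrow> norm (f (x + h) - f x - (\<Sum>i\<in>UNIV. (h$i) *\<^sub>R d i x)) \<le> e * norm h"
proof -
  obtain R where R: "R > 0" "\<And>x. R \<le> norm x \<Longrightarrow> f x = 0" "\<And>i x. R \<le> norm x \<Longrightarrow> d i x = 0"
    using C1c_supp[OF C] by metis
  have "\<exists>\<delta>>0. \<forall>x y. norm (x - y) < \<delta> \<longrightarrow> norm (d i x - d i y) < e/3" for i
  proof -
    have e3: "e / 3 > 0" using e by simp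
    show ?thesis by (rule compact_supp_uniform[OF C1c_cont_d[OF C, of i] R(3) e3])
  qed
  then obtain D where D: "\<And>i. D i > 0" "\<And>i x y. norm (x - y) < D i \<Longrightarrow> norm (d i x - d i y) < e/3"
    by metis
  define \<delta> where "\<delta> = Min (range D)"
  have \<delta>: "\<delta> > 0" "\<And>i. \<delta> \<le> D i" using D(1) by (auto simp: \<delta>_def)
  have "norm (f (x + h) - f x - (\<Sum>i\<in>UNIV. (h$i) *\<^sub>R d i x)) \<le> e * norm h" if h: "norm h < \<delta>" for x h
  proof -
    have "norm ((f (x + h) - (\<Sum>i\<in>UNIV. ((x+h)$i) *\<^sub>R d i x)) - (f x - (\<Sum>i\<in>UNIV. (x$i) *\<^sub>R d i x))) \<le> e * norm (x + h - x)"
    proof (rule differentiable_bound[of "ball x \<delta>" "\<lambda>y. f y - (\<Sum>i\<in>UNIV. (y$i) *\<^sub>R d i x)"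
          "\<lambda>y k. (\<Sum>i\<in>UNIV. (k$i) *\<^sub>R d i y) - (\<Sum>i\<in>UNIV. (k$i) *\<^sub>R d i x)"])
      fix y assume y: "y \<in> ball x \<delta>"
      show "((\<lambda>y. f y - (\<Sum>i\<in>UNIV. (y$i) *\<^sub>R d i x)) has_derivative
         (\<lambda>k. (\<Sum>i\<in>UNIV. (k$i) *\<^sub>R d i y) - (\<Sum>i\<in>UNIV. (k$i) *\<^sub>R d i x))) (at y within ball x \<delta>)"
        by (intro has_derivative_diff has_derivative_sum has_derivative_scaleR_left
            has_derivative_at_withinI[OF C1c_deriv[OF C]] bounded_linear_imp_has_derivative bounded_linear_vec_nth)
      have "norm (d i y - d i x) \<le> e/3" for i
        using D(2)[of y x i] \<delta>(2)[of i] y by (simp add: dist_norm norm_minus_commute less_imp_le)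
      from norm_partials_le[of "\<lambda>i. d i y - d i x", OF this]
      show "onorm (\<lambda>k. (\<Sum>i\<in>UNIV. (k$i) *\<^sub>R d i y) - (\<Sum>i\<in>UNIV. (k$i) *\<^sub>R d i x)) \<le> e"
        using e by (intro onorm_le) (simp_all add: sum_subtractf[symmetric] scaleR_diff_right[symmetric] mult.commute)
    qed (use h \<delta> in \<open>auto simp: dist_norm\<close>)
    moreover have "(\<Sum>i\<in>UNIV. ((x+h)$i) *\<^sub>R d i x) = (\<Sum>i\<in>UNIV. (x$i) *\<^sub>R d i x) + (\<Sum>i\<in>UNIV. (h$i) *\<^sub>R d i x)"
      by (simp add: scaleR_add_left sum.distrib)
    ultimately show ?thesis by (simp add: algebra_simps)
  qed
  with \<delta>(1) show ?thesis by blast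
qed

text \<open>Instantiated twice: with arclength on one period and \<open>p\<close> the curve, and
  with Lebesgue measure on a ball and \<open>p\<close> the identity, where convolution is
  mollification. Boundedness of \<open>p\<close> keeps the supports of the convolutions
  compact.\<close>

locale param_measure = finite_measure M for M :: "'s measure" +
  fixes p :: "'s \<Rightarrow> real^3" and Bp :: real
  assumes p_meas[measurable]: "p \<in> borel_measurable M"
    and p_bdd: "\<And>s. s \<in> space M \<Longrightarrow> norm (p s) \<le> Bp"
begin

lemma conv_integrable:
  fixes m :: "'s \<Rightarrow> 'b::euclidean_space"
  assumes g: "continuous_on UNIV g" "\<And>x. R \<le> norm x \<Longrightarrow> g x = 0" and m: "integrable M m"
  shows "integrable M (\<lambda>s. g (x - p s) *\<^sub>R m s)"
proof -
  obtain B where B: "B > 0" "\<And>x. norm (g x) \<le> B" using compact_supp_bounded[OF g] by metis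
  have [measurable]: "g \<in> borel_measurable borel" using g(1) by (rule borel_measurable_continuous_onI)
  note [measurable] = borel_measurable_integrable[OF m]
  show ?thesis
  proof (rule Bochner_Integration.integrable_bound[where f="\<lambda>s. B * norm (m s)"])
    show "integrable M (\<lambda>s. B * norm (m s))" using m by simp
    show "AE s in M. norm (g (x - p s) *\<^sub>R m s) \<le> norm (B * norm (m s))"
      using B by (auto intro!: mult_right_mono AE_I2 simp: abs_mult)
  qed measurable
qed

lemma conv_continuous:
  fixes m :: "'s \<Rightarrow> 'b::euclidean_space"
  assumes g: "continuous_on UNIV g" "\<And>x. R \<le> norm x \<Longrightarrow> g x = 0" and m: "integrable M m"
  shows "continuous_on UNIV (conv M p g m)"
  unfolding continuous_on_iff
proof (intro ballI allI impI)
  fix x :: "real^3" and e :: real assume e: "e > 0"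
  define I where "I = (\<integral>s. norm (m s) \<partial>M)"
  have I0: "I \<ge> 0" by (simp add: I_def)
  have eI: "e / (I + 1) > 0" using e I0 by simp
  obtain \<delta> where \<delta>: "\<delta> > 0" "\<And>x y. norm (x - y) < \<delta> \<Longrightarrow> norm (g x - g y) < e / (I + 1)"
    using compact_supp_uniform[OF g eI] by blast
  have "dist (conv M p g m y) (conv M p g m x) < e" if y: "dist y x < \<delta>" for y
  proof -
    have "conv M p g m y - conv M p g m x = (\<integral>s. (g (y - p s) - g (x - p s)) *\<^sub>R m s \<partial>M)"
      unfolding conv_def using conv_integrable[OF g m] by (simp add: scaleR_diff_left)
    also have "norm \<dots> \<le> (\<integral>s. (e/(I+1)) * norm (m s) \<partial>M)"
    proof (rule integral_norm_bound_AE)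
      have "norm ((g (y - p s) - g (x - p s)) *\<^sub>R m s) \<le> e/(I+1) * norm (m s)" for s
        unfolding norm_scaleR using \<delta>(2)[of "y - p s" "x - p s"] y
        by (intro mult_right_mono) (auto simp: dist_norm less_imp_le)
      then show "AE s in M. norm ((g (y - p s) - g (x - p s)) *\<^sub>R m s) \<le> e/(I+1) * norm (m s)" by simp
      show "integrable M (\<lambda>s. (g (y - p s) - g (x - p s)) *\<^sub>R m s)"
        using conv_integrable[OF g m] by (simp add: scaleR_diff_left)
    qed (use m in simp)
    also have "\<dots> = e / (I+1) * I" by (simp add: I_def)
    also have "\<dots> < e" using e I0 by (simp add: field_simps)
    finally show ?thesis by (simp add: dist_norm)
  qed
  with \<delta>(1) show "\<exists>d>0. \<forall>x'\<in>UNIV. dist x' x < d \<longrightarrow> dist (conv M p g m x') (conv M p g m x) < e" by blast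
qed

lemma conv_supp:
  assumes "\<And>x. R \<le> norm x \<Longrightarrow> g x = 0" "R + Bp \<le> norm x"
  shows "conv M p g m x = 0"
proof -
  have "g (x - p s) = 0" if "s \<in> space M" for s
    using assms p_bdd[OF that] norm_triangle_ineq2[of x "p s"] by (intro assms(1)) linarith
  then show ?thesis unfolding conv_def by (intro integral_eq_zero_AE AE_I2) auto
qed

lemma conv_C1c:
  fixes m :: "'s \<Rightarrow> 'b::euclidean_space"
  assumes C: "C1c f d" and m: "integrable M m"
  shows "C1c (conv M p f m) (\<lambda>i. conv M p (d i) m)"
proof -
  obtain R where R: "R > 0" "\<And>x. R \<le> norm x \<Longrightarrow> f x = 0" "\<And>i x. R \<le> norm x \<Longrightarrow> d i x = 0"
    using C1c_supp[OF C] by metis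
  note f = C1c_cont[OF C] R(2) and d = C1c_cont_d[OF C] R(3)
  show ?thesis
  proof (rule C1cI[where R="R + Bp"])
    fix x
    define I where "I = (\<integral>s. norm (m s) \<partial>M)"
    have I0: "I \<ge> 0" by (simp add: I_def)
    show "(conv M p f m has_derivative (\<lambda>h. \<Sum>i\<in>UNIV. (h$i) *\<^sub>R conv M p (d i) m x)) (at x)"
      unfolding has_derivative_at_alt
    proof (intro conjI allI impI)
      show "bounded_linear (\<lambda>h. \<Sum>i\<in>UNIV. (h$i) *\<^sub>R conv M p (d i) m x)"
        by (intro bounded_linear_sum bounded_linear_scaleR_const bounded_linear_vec_nth)
      fix e :: real assume e: "e > 0"
      have eI: "e / (I + 1) > 0" using e I0 by simp
      obtain \<delta> where \<delta>: "\<delta> > 0"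
        "\<And>x h. norm h < \<delta> \<Longrightarrow> norm (f (x + h) - f x - (\<Sum>i\<in>UNIV. (h$i) *\<^sub>R d i x)) \<le> e/(I+1) * norm h"
        using C1c_uniform_deriv[OF C eI] by blast
      have "norm (conv M p f m y - conv M p f m x - (\<Sum>i\<in>UNIV. ((y - x)$i) *\<^sub>R conv M p (d i) m x)) \<le> e * norm (y - x)"
        if y: "norm (y - x) < \<delta>" for y
      proof -
        let ?h = "y - x"
        let ?g = "\<lambda>s. f (y - p s) - f (x - p s) - (\<Sum>i\<in>UNIV. (?h$i) *\<^sub>R d i (x - p s))"
        have i1: "integrable M (\<lambda>s. f (y - p s) *\<^sub>R m s)" for y by (rule conv_integrable[OF f m])
        have i2: "integrable M (\<lambda>s. d i (x - p s) *\<^sub>R m s)" for i by (rule conv_integrable[OF d m])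
        have eq: "?g s *\<^sub>R m s = f (y - p s) *\<^sub>R m s - f (x - p s) *\<^sub>R m s - (\<Sum>i\<in>UNIV. (?h$i) *\<^sub>R (d i (x - p s) *\<^sub>R m s))" for s
          by (simp add: scaleR_diff_left scaleR_sum_left)
        have eq1: "(\<integral>s. ?g s *\<^sub>R m s \<partial>M) = conv M p f m y - conv M p f m x - (\<Sum>i\<in>UNIV. (?h$i) *\<^sub>R conv M p (d i) m x)"
        proof -
          have i3: "integrable M (\<lambda>s. \<Sum>i\<in>UNIV. (?h$i) *\<^sub>R (d i (x - p s) *\<^sub>R m s))"
            using i2 by (intro Bochner_Integration.integrable_sum integrable_scaleR_right) auto
          have "(\<integral>s. (\<Sum>i\<in>UNIV. (?h$i) *\<^sub>R (d i (x - p s) *\<^sub>R m s)) \<partial>M) = (\<Sum>i\<in>UNIV. (?h$i) *\<^sub>R conv M p (d i) m x)"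
            unfolding conv_def using i2
            by (subst Bochner_Integration.integral_sum) (auto simp del: scaleR_scaleR intro!: sum.cong)
          then show ?thesis
            unfolding eq using i1 i3 by (simp add: conv_def del: scaleR_scaleR)
        qed
        have "norm (\<integral>s. ?g s *\<^sub>R m s \<partial>M) \<le> (\<integral>s. e/(I+1) * norm ?h * norm (m s) \<partial>M)"
        proof (rule integral_norm_bound_AE)
          show "integrable M (\<lambda>s. ?g s *\<^sub>R m s)" unfolding eq
            by (intro Bochner_Integration.integrable_diff i1 Bochner_Integration.integrable_sum integrable_scaleR_right i2)
          have "norm (?g s *\<^sub>R m s) \<le> e/(I+1) * norm ?h * norm (m s)" for s
            unfolding norm_scaleR using \<delta>(2)[of ?h "x - p s"] y
            by (intro mult_right_mono) (auto simp: algebra_simps)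
          then show "AE s in M. norm (?g s *\<^sub>R m s) \<le> e/(I+1) * norm ?h * norm (m s)" by simp
        qed (use m in simp)
        also have "(\<integral>s. e/(I+1) * norm ?h * norm (m s) \<partial>M) = e/(I+1) * norm ?h * I"
          by (simp add: I_def)
        also have "e/(I+1) * norm ?h * I = e * norm ?h * (I / (I+1))" by simp
        also have "\<dots> \<le> e * norm ?h * 1" using e I0 by (intro mult_left_mono) auto
        finally show ?thesis unfolding eq1 by simp
      qed
      with \<delta>(1) show "\<exists>d'>0. \<forall>y. norm (y - x) < d' \<longrightarrow>
          norm (conv M p f m y - conv M p f m x - (\<Sum>i\<in>UNIV. ((y - x)$i) *\<^sub>R conv M p (d i) m x)) \<le> e * norm (y - x)"
        by blast
    qed
  next
    show "continuous_on UNIV (conv M p (d i) m)" for i by (rule conv_continuous[OF d m])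
    show "conv M p f m x = 0" if "R + Bp \<le> norm x" for x using R(2) that by (rule conv_supp)
    show "conv M p (d i) m x = 0" if "R + Bp \<le> norm x" for i x using R(3) that by (rule conv_supp)
  qed
qed

lemma conv_Fubini:
  fixes m :: "'s \<Rightarrow> 'b::euclidean_space" and g :: "real^3 \<Rightarrow> 'b"
  assumes f: "continuous_on UNIV f" "\<And>x. R \<le> norm x \<Longrightarrow> f x = 0" and m: "integrable M m"
    and g: "continuous_on UNIV g" "\<And>x. R' \<le> norm x \<Longrightarrow> g x = 0"
  shows "(LBINT x. g x \<bullet> conv M p f m x) = (\<integral>s. (LBINT x. f (x - p s) * (g x \<bullet> m s)) \<partial>M)" (is ?R1)
    and "integrable M (\<lambda>s. LBINT x. f (x - p s) * (g x \<bullet> m s))" (is ?R2)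
proof -
  interpret P: pair_sigma_finite lborel M by unfold_locales
  obtain B where B: "B > 0" "\<And>x. norm (f x) \<le> B" using compact_supp_bounded[OF f] by metis
  have [measurable]: "f \<in> borel_measurable borel" "g \<in> borel_measurable borel"
    using f(1) g(1) by (auto intro: borel_measurable_continuous_onI)
  note [measurable] = borel_measurable_integrable[OF m]
  have gi: "integrable lborel g" by (rule compact_supp_integrable[OF g])
  have int: "integrable (lborel \<Otimes>\<^sub>M M) (\<lambda>(x, s). f (x - p s) * (g x \<bullet> m s))"
  proof (rule P.Fubini_integrable)
    show "(\<lambda>(x, s). f (x - p s) * (g x \<bullet> m s)) \<in> borel_measurable (lborel \<Otimes>\<^sub>M M)" by measurable
    have bd: "norm (f (x - p s) * (g x \<bullet> m s)) \<le> B * norm (g x) * norm (m s)" for x s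
    proof -
      have "\<bar>f (x - p s)\<bar> * \<bar>g x \<bullet> m s\<bar> \<le> B * (norm (g x) * norm (m s))"
        using B by (intro mult_mono) (auto simp: Cauchy_Schwarz_ineq2)
      then show ?thesis by (simp add: abs_mult mult.assoc)
    qed
    have i: "integrable M (\<lambda>s. f (x - p s) * (g x \<bullet> m s))" for x
      by (rule Bochner_Integration.integrable_bound[where f="\<lambda>s. B * norm (g x) * norm (m s)"])
        (use m order_trans[OF bd abs_ge_self] in \<open>auto intro!: AE_I2\<close>)
    then show "AE x in lborel. integrable M (\<lambda>y. case (x, y) of (x, s) \<Rightarrow> f (x - p s) * (g x \<bullet> m s))" by simp
    show "integrable lborel (\<lambda>x. \<integral>y. norm (case (x, y) of (x, s) \<Rightarrow> f (x - p s) * (g x \<bullet> m s)) \<partial>M)"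
    proof (rule Bochner_Integration.integrable_bound[where f="\<lambda>x. B * norm (g x) * (\<integral>s. norm (m s) \<partial>M)"])
      show "integrable lborel (\<lambda>x. B * norm (g x) * (\<integral>s. norm (m s) \<partial>M))" using gi by simp
      have "(\<integral>s. norm (f (x - p s) * (g x \<bullet> m s)) \<partial>M) \<le> (\<integral>s. B * norm (g x) * norm (m s) \<partial>M)" for x
        by (rule integral_mono) (use i m bd in auto)
      then show "AE x in lborel. norm (\<integral>y. norm (case (x, y) of (x, s) \<Rightarrow> f (x - p s) * (g x \<bullet> m s)) \<partial>M)
         \<le> norm (B * norm (g x) * (\<integral>s. norm (m s) \<partial>M))"
        using B by (auto intro!: AE_I2 simp: abs_mult)
    qed measurable
  qed
  have "(LBINT x. g x \<bullet> conv M p f m x) = (LBINT x. (\<integral>s. f (x - p s) * (g x \<bullet> m s) \<partial>M))"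
  proof (rule Bochner_Integration.integral_cong)
    fix x :: "real^3"
    have "g x \<bullet> conv M p f m x = (\<integral>s. g x \<bullet> (f (x - p s) *\<^sub>R m s) \<partial>M)"
    proof -
      have "integrable M (\<lambda>s. f (x - p s) *\<^sub>R m s)" by (rule conv_integrable[OF f m])
      then show ?thesis unfolding conv_def by (simp del: inner_scaleR_right)
    qed
    then show "g x \<bullet> conv M p f m x = (\<integral>s. f (x - p s) * (g x \<bullet> m s) \<partial>M)" by simp
  qed simp
  also have "\<dots> = (\<integral>s. (LBINT x. f (x - p s) * (g x \<bullet> m s)) \<partial>M)"
    by (rule P.Fubini_integral[symmetric, OF int])
  finally show ?R1 .
  show ?R2
    using P.integrable_snd[OF int] by simp
qed

end

section \<open>Curves with weakly integrable inverse security radius\<close>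

locale arc =
  fixes L :: real and \<gamma> \<tau> :: "real \<Rightarrow> real^3"
  assumes L: "L > 0" and per: "\<And>s. \<gamma> (s + L) = \<gamma> s" "\<And>s. \<tau> (s + L) = \<tau> s"
    and \<tau>_meas[measurable]: "\<tau> \<in> borel_measurable borel" and \<tau>_norm[simp]: "\<And>s. norm (\<tau> s) = 1"
    and ftc: "\<And>a b. a \<le> b \<Longrightarrow> \<gamma> b - \<gamma> a = (LBINT t. indicator {a..b} t *\<^sub>R \<tau> t)"
    and deriv: "AE s in lborel. (\<gamma> has_vector_derivative \<tau> s) (at s)"
begin

lemma indicator_Icc_integrable: "integrable lborel (indicator {a..b::real} :: real \<Rightarrow> real)"
  using borel_integrable_compact[of "{a..b}" "\<lambda>_. 1::real"] by simp

lemma indicator_\<tau>_integrable: "integrable lborel (\<lambda>t. indicator {a..b} t *\<^sub>R \<tau> t)"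
  by (rule Bochner_Integration.integrable_bound[OF indicator_Icc_integrable[of a b]])
     (auto split: split_indicator)

lemma lip0: "a \<le> b \<Longrightarrow> norm (\<gamma> b - \<gamma> a) \<le> b - a"
proof -
  assume ab: "a \<le> b"
  have "norm (LBINT t. indicator {a..b} t *\<^sub>R \<tau> t) \<le> (LBINT t. indicator {a..b} t)"
    by (rule integral_norm_bound_AE[OF indicator_\<tau>_integrable indicator_Icc_integrable]) (auto split: split_indicator)
  then show ?thesis using ab ftc[OF ab] by simp
qed

lemma lip: "norm (\<gamma> a - \<gamma> b) \<le> \<bar>a - b\<bar>"
  using lip0[of a b] lip0[of b a] by (cases "a \<le> b") (auto simp: norm_minus_commute)

lemma \<gamma>_cont: "continuous_on UNIV \<gamma>"
proof (rule lipschitz_on_continuous_on[of 1], rule lipschitz_onI)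
  show "dist (\<gamma> x) (\<gamma> y) \<le> 1 * dist x y" for x y using lip[of x y] by (simp add: dist_norm)
qed auto

lemma \<gamma>_meas[measurable]: "\<gamma> \<in> borel_measurable borel"
  by (rule borel_measurable_continuous_onI[OF \<gamma>_cont])

lemma \<gamma>_per_int: "\<gamma> (s + of_int k * L) = \<gamma> s"
proof -
  have nat: "\<gamma> (s + real n * L) = \<gamma> s" for s n
    by (induction n) (auto simp: algebra_simps per(1)[of "s + real _ * L", simplified algebra_simps])
  show ?thesis
  proof (cases "k \<ge> 0")
    case True then show ?thesis using nat[of s "nat k"] by simp
  next
    case False then show ?thesis using nat[of "s + of_int k * L" "nat (-k)"] by (simp add: algebra_simps)
  qed
qed

end

text \<open>Here \<open>\<tau>\<close> is an everywhere unit Borel version of the tangent, and \<open>\<rho>\<close> stands for half the security radius, so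
  that it is itself admissible almost everywhere.\<close>

locale curve = arc +
  fixes K :: real and \<rho> :: "real \<Rightarrow> real"
  assumes K: "K \<ge> 11/3"
    and \<rho>_meas[measurable]: "\<rho> \<in> borel_measurable borel" and \<rho>_nonneg: "\<And>s. 0 \<le> \<rho> s"
    and good_AE: "AE s in lborel. 0 < \<rho> s \<and> \<rho> s \<le> L / 4 \<and>
       (\<forall>h. \<rho> s \<le> \<bar>h\<bar> \<and> \<bar>h\<bar> \<le> L / 2 \<longrightarrow> \<rho> s / 2 \<le> norm (\<gamma> (s + h) - \<gamma> s)) \<and>
       (AE t in lborel. \<bar>t - s\<bar> \<le> \<rho> s \<longrightarrow> norm (\<tau> t - \<tau> s) \<le> \<bar>t - s\<bar> / \<rho> s)"
    and weak: "\<And>x. x > 0 \<Longrightarrow> emeasure lborel {s\<in>{0..<L}. \<rho> s \<le> x} \<le> ennreal (2 * K * x)"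
begin

definition good :: "real \<Rightarrow> bool" where
  "good s \<longleftrightarrow> 0 < \<rho> s \<and> \<rho> s \<le> L / 4 \<and>
       (\<forall>h. \<rho> s \<le> \<bar>h\<bar> \<and> \<bar>h\<bar> \<le> L / 2 \<longrightarrow> \<rho> s / 2 \<le> norm (\<gamma> (s + h) - \<gamma> s)) \<and>
       (AE t in lborel. \<bar>t - s\<bar> \<le> \<rho> s \<longrightarrow> norm (\<tau> t - \<tau> s) \<le> \<bar>t - s\<bar> / \<rho> s)"

lemma AE_good: "AE s in lborel. good s"
  using good_AE unfolding good_def .

lemma good_pos: "good s \<Longrightarrow> 0 < \<rho> s" and good_le: "good s \<Longrightarrow> \<rho> s \<le> L / 4"
  by (auto simp: good_def)

lemma good_far: "good s \<Longrightarrow> \<rho> s \<le> \<bar>h\<bar> \<Longrightarrow> \<bar>h\<bar> \<le> L / 2 \<Longrightarrow> \<rho> s / 2 \<le> norm (\<gamma> (s + h) - \<gamma> s)"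
  by (auto simp: good_def)

text \<open>The deviation from the tangent line is the integral of
  \<open>\<tau> t - \<tau> s\<close>, whose norm is at most
  \<open>\<bar>t - s\<bar> / \<rho> s\<close> almost everywhere.\<close>

lemma good_near:
  assumes g: "good s" and h: "\<bar>h\<bar> \<le> \<rho> s"
  shows "norm (\<gamma> (s + h) - \<gamma> s - h *\<^sub>R \<tau> s) \<le> h\<^sup>2 / (2 * \<rho> s)"
proof -
  have r: "\<rho> s > 0" and ae: "AE t in lborel. \<bar>t - s\<bar> \<le> \<rho> s \<longrightarrow> norm (\<tau> t - \<tau> s) \<le> \<bar>t - s\<bar> / \<rho> s"
    using g by (auto simp: good_def)
  \<comment> \<open>The antiderivative \<open>F\<close> of
    \<open>\<bar>t - s\<bar> / \<rho> s\<close> is left open so that both signs of \<open>h\<close>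
    are covered; the absolute value gives opposite quadratics on the two sides of
    \<open>s\<close>.\<close>
  have main: "norm (\<gamma> b - \<gamma> a - (b - a) *\<^sub>R \<tau> s) \<le> h\<^sup>2 / (2 * \<rho> s)"
    if ab: "a \<le> b" "\<And>t. t \<in> {a..b} \<Longrightarrow> \<bar>t - s\<bar> \<le> \<rho> s"
      and F: "\<And>t. a \<le> t \<Longrightarrow> t \<le> b \<Longrightarrow> DERIV F t :> \<bar>t - s\<bar> / \<rho> s" "F b - F a = h\<^sup>2 / (2 * \<rho> s)" for a b F
  proof -
    have i2: "integrable lborel (\<lambda>t. indicator {a..b} t *\<^sub>R \<tau> s)"
      using indicator_Icc_integrable by (rule integrable_scaleR_left)
    have "\<gamma> b - \<gamma> a - (b - a) *\<^sub>R \<tau> s = (LBINT t. indicator {a..b} t *\<^sub>R \<tau> t) - (LBINT t. indicator {a..b} t *\<^sub>R \<tau> s)"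
      using ftc[OF ab(1)] ab(1) by simp
    also have "\<dots> = (LBINT t. indicator {a..b} t *\<^sub>R \<tau> t - indicator {a..b} t *\<^sub>R \<tau> s)"
      by (rule Bochner_Integration.integral_diff[symmetric, OF indicator_\<tau>_integrable i2])
    also have "norm \<dots> \<le> (LBINT t. indicator {a..b} t * (\<bar>t - s\<bar> / \<rho> s))"
    proof (rule integral_norm_bound_AE)
      have "integrable lborel (\<lambda>t. indicator {a..b} t *\<^sub>R (\<bar>t - s\<bar> / \<rho> s))"
        by (rule borel_integrable_compact) (auto intro!: continuous_intros simp: r less_imp_neq[symmetric])
      then show "integrable lborel (\<lambda>t. indicator {a..b} t * (\<bar>t - s\<bar> / \<rho> s))" by simp
      show "AE t in lborel. norm (indicator {a..b} t *\<^sub>R \<tau> t - indicator {a..b} t *\<^sub>R \<tau> s) \<le> indicator {a..b} t * (\<bar>t - s\<bar> / \<rho> s)"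
        using ae by eventually_elim (use ab in \<open>auto simp: indicator_def\<close>)
    qed (use indicator_\<tau>_integrable i2 in auto)
    also have "\<dots> = (LBINT t. (\<bar>t - s\<bar> / \<rho> s) * indicator {a..b} t)" by (simp add: mult.commute)
    also have "\<dots> = F b - F a"
      by (rule integral_FTC_Icc_real) (use ab F r in \<open>auto intro!: continuous_intros\<close>)
    finally show ?thesis using F(2) by simp
  qed
  have D: "((\<lambda>t. c * (t - s)\<^sup>2) has_real_derivative c * (2 * (t - s))) (at t)" for c t
    by (auto intro!: derivative_eq_intros)
  show ?thesis
  proof (cases "h \<ge> 0")
    case True
    have "norm (\<gamma> (s + h) - \<gamma> s - (s + h - s) *\<^sub>R \<tau> s) \<le> h\<^sup>2 / (2 * \<rho> s)"
    proof (rule main[where F="\<lambda>t. 1 / (2 * \<rho> s) * (t - s)\<^sup>2"])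
      show "((\<lambda>t. 1 / (2 * \<rho> s) * (t - s)\<^sup>2) has_real_derivative \<bar>t - s\<bar> / \<rho> s) (at t)" if "s \<le> t" for t
      proof -
        have "1 / (2 * \<rho> s) * (2 * (t - s)) = \<bar>t - s\<bar> / \<rho> s" using that r by (simp add: field_simps)
        with D[of "1 / (2 * \<rho> s)" t] show ?thesis by (simp only:)
      qed
    qed (use True h r in auto)
    then show ?thesis by simp
  next
    case False
    have "norm (\<gamma> s - \<gamma> (s + h) - (s - (s + h)) *\<^sub>R \<tau> s) \<le> h\<^sup>2 / (2 * \<rho> s)"
    proof (rule main[where F="\<lambda>t. - 1 / (2 * \<rho> s) * (t - s)\<^sup>2"])
      show "((\<lambda>t. - 1 / (2 * \<rho> s) * (t - s)\<^sup>2) has_real_derivative \<bar>t - s\<bar> / \<rho> s) (at t)" if "t \<le> s" for t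
      proof -
        have "- 1 / (2 * \<rho> s) * (2 * (t - s)) = \<bar>t - s\<bar> / \<rho> s" using that r by (simp add: field_simps)
        with D[of "- 1 / (2 * \<rho> s)" t] show ?thesis by (simp only:)
      qed
    qed (use False h r in auto)
    moreover have "\<gamma> s - \<gamma> (s + h) - (s - (s + h)) *\<^sub>R \<tau> s = -(\<gamma> (s + h) - \<gamma> s - h *\<^sub>R \<tau> s)"
      by simp
    ultimately show ?thesis by (metis norm_minus_cancel)
  qed
qed

lemma good_chord:
  assumes g: "good s" and h: "\<bar>h\<bar> \<le> \<rho> s"
  shows "\<bar>h\<bar> / 2 \<le> norm (\<gamma> (s + h) - \<gamma> s)"
proof -
  have r: "\<rho> s > 0" using g by (rule good_pos)
  have "\<bar>h\<bar> = norm (h *\<^sub>R \<tau> s)" by simp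
  also have "\<dots> \<le> norm (\<gamma> (s + h) - \<gamma> s) + norm (\<gamma> (s + h) - \<gamma> s - h *\<^sub>R \<tau> s)"
    using norm_triangle_sub[of "h *\<^sub>R \<tau> s" "\<gamma> (s + h) - \<gamma> s"] by (simp add: norm_minus_commute)
  also have "norm (\<gamma> (s + h) - \<gamma> s - h *\<^sub>R \<tau> s) \<le> h\<^sup>2 / (2 * \<rho> s)" by (rule good_near[OF g h])
  also have "h\<^sup>2 / (2 * \<rho> s) \<le> \<bar>h\<bar> / 2"
  proof -
    have "h\<^sup>2 = \<bar>h\<bar> * \<bar>h\<bar>" by (simp add: power2_eq_square)
    also have "\<dots> \<le> \<bar>h\<bar> * \<rho> s" using h by (intro mult_left_mono) auto
    finally show ?thesis using r by (simp add: field_simps)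
  qed
  finally show ?thesis by simp
qed

section \<open>Arclength measure on a period, Ahlfors regularity, and pairs close in space
  only\<close>

lemma \<gamma>_per': "\<gamma> (s - L) = \<gamma> s"
  using per(1)[of "s - L"] by simp

abbreviation "CM \<equiv> restrict_space lborel {0..<L}"

lemma space_CM[simp]: "space CM = {0..<L}" by (simp add: space_restrict_space)

lemma emeasure_CM: "emeasure CM (space CM) = ennreal L"
  using L by (simp add: emeasure_restrict_space)

lemma finite_CM: "finite_measure CM"
  by (rule finite_measureI) (simp only: emeasure_CM infinity_ennreal_def ennreal_neq_top not_False_eq_True)

lemma \<gamma>_bdd: "\<exists>B. \<forall>s. norm (\<gamma> s) \<le> B"
proof -
  have "norm (\<gamma> s) \<le> norm (\<gamma> 0) + L" for s
  proof -
    define k where "k = \<lfloor>s / L\<rfloor>"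
    have "of_int k * L \<le> s" "s < (of_int k + 1) * L"
      using L unfolding k_def by (simp_all add: floor_divide_lower floor_divide_upper)
    moreover have "\<gamma> s = \<gamma> (s - of_int k * L)" using \<gamma>_per_int[of s "-k"] by simp
    ultimately have "norm (\<gamma> s - \<gamma> 0) \<le> L" using lip[of "s - of_int k * L" 0] by (simp add: algebra_simps)
    then show ?thesis using norm_triangle_sub[of "\<gamma> s" "\<gamma> 0"] by simp
  qed
  then show ?thesis by blast
qed

definition "\<gamma>B = (SOME B. \<forall>s. norm (\<gamma> s) \<le> B)"

lemma \<gamma>B: "norm (\<gamma> s) \<le> \<gamma>B"
  unfolding \<gamma>B_def using someI_ex[OF \<gamma>_bdd] by blast

sublocale PM: param_measure CM \<gamma> \<gamma>B
proof -
  interpret finite_measure CM by (rule finite_CM)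
  show "param_measure CM \<gamma> \<gamma>B"
    by unfold_locales (auto intro: measurable_restrict_space1 \<gamma>B)
qed

lemma borel_CM: "f \<in> borel_measurable borel \<Longrightarrow> f \<in> borel_measurable CM"
  by (rule measurable_restrict_space1) simp

lemma nn_CM: "f \<in> borel_measurable borel \<Longrightarrow> (\<integral>\<^sup>+s. f s \<partial>CM) = (\<integral>\<^sup>+s. f s * indicator {0..<L} s \<partial>lborel)"
  by (simp add: nn_integral_restrict_space)

lemma AE_CM: "AE s in lborel. P s \<Longrightarrow> AE s in CM. P s"
  by (subst AE_restrict_space_iff) auto

lemma AE_CM_good: "AE s in CM. good s"
  by (rule AE_CM[OF AE_good])

text \<open>Parameters with \<open>\<rho> t \<le> 4 * q\<close> have measure at most
  \<open>8 * K * q\<close> by the weak-type bound. If one good \<open>t0\<close> with larger radius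
  remains, any other \<open>t\<close> in the set has a chord to \<open>t0\<close> of length at most
  \<open>2 * q\<close>. That is shorter than \<open>\<rho> t0 / 2\<close>, so \<open>t\<close> lies
  within the security radius of \<open>t0\<close>, where the chord is at least half the arc. Hence
  \<open>t\<close> is within \<open>4 * q\<close> of \<open>t0\<close> modulo
  \<open>L\<close>.\<close>

lemma ahlfors:
  assumes q: "q > 0"
  shows "emeasure CM {t\<in>space CM. norm (x - \<gamma> t) \<le> q} \<le> ennreal (15 * K * q)"
proof -
  define S where "S = {t\<in>{0..<L}. norm (x - \<gamma> t) \<le> q}"
  define Bd where "Bd = {t\<in>{0..<L}. \<rho> t \<le> 4 * q}"
  define N where "N = {t. \<not> good t}"
  \<comment> \<open>The exceptional set \<open>N\<close> is replaced by a measurable null superset,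
    since only that can enter the subadditivity estimate below.\<close>
  obtain N0 where N0: "N \<subseteq> N0" "N0 \<in> sets lborel" "emeasure lborel N0 = 0"
    using AE_good unfolding N_def by (auto elim!: AE_E)
  have "\<exists>t0. S - Bd - N0 \<subseteq> {t0 - 4*q..t0 + 4*q} \<union> {t0 - L - 4*q..t0 - L + 4*q} \<union> {t0 + L - 4*q..t0 + L + 4*q}"
  proof (cases "S - Bd - N0 = {}")
    case False
    then obtain t0 where "t0 \<in> S" "t0 \<notin> Bd" "t0 \<notin> N0" by blast
    then have t0: "t0 \<in> S" "\<rho> t0 > 4*q" "good t0" "0 \<le> t0" "t0 < L"
      using N0(1) by (auto simp: S_def Bd_def N_def)
    have *: "\<bar>h\<bar> \<le> 4 * q" if h: "\<bar>h\<bar> \<le> L / 2" "\<gamma> (t0 + h) = \<gamma> t" "t \<in> S" for h t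
    proof -
      have "norm (\<gamma> (t0 + h) - \<gamma> t0) \<le> norm (x - \<gamma> t) + norm (x - \<gamma> t0)"
        unfolding h(2) by norm
      also have "\<dots> \<le> 2 * q" using h t0 by (auto simp: S_def)
      finally have d: "norm (\<gamma> (t0 + h) - \<gamma> t0) \<le> 2 * q" .
      have "\<bar>h\<bar> \<le> \<rho> t0"
      proof (rule ccontr)
        assume "\<not> \<bar>h\<bar> \<le> \<rho> t0"
        then have "\<rho> t0 / 2 \<le> norm (\<gamma> (t0 + h) - \<gamma> t0)" using good_far[OF t0(3), of h] h by simp
        with d t0(2) show False by simp
      qed
      from good_chord[OF t0(3) this] d show ?thesis by simp
    qed
    have "t \<in> {t0 - 4*q..t0 + 4*q} \<union> {t0 - L - 4*q..t0 - L + 4*q} \<union> {t0 + L - 4*q..t0 + L + 4*q}" if t: "t \<in> S" for t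
    proof -
      have tL: "0 \<le> t" "t < L" using t by (auto simp: S_def)
      consider "\<bar>t - t0\<bar> \<le> L/2" | "t - t0 > L/2" | "t - t0 < - L/2" by linarith
      then show ?thesis
      proof cases
        case 1
        then show ?thesis using *[of "t - t0" t] t by (auto simp: abs_le_iff)
      next
        case 2
        then show ?thesis using *[of "t - t0 - L" t] t tL t0 \<gamma>_per'[of t] by (auto simp: abs_le_iff)
      next
        case 3
        then show ?thesis using *[of "t - t0 + L" t] t tL t0 per(1)[of t] by (auto simp: abs_le_iff)
      qed
    qed
    then show ?thesis by blast
  qed auto
  then obtain t0 where t0: "S - Bd - N0 \<subseteq> {t0 - 4*q..t0 + 4*q} \<union> {t0 - L - 4*q..t0 - L + 4*q} \<union> {t0 + L - 4*q..t0 + L + 4*q}" (is "_ \<subseteq> ?I1 \<union> ?I2 \<union> ?I3")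
    by blast
  have "emeasure lborel S \<le> emeasure lborel (Bd \<union> (N0 \<union> (?I1 \<union> ?I2 \<union> ?I3)))"
    using t0 N0(2) by (intro emeasure_mono) (auto simp: Bd_def)
  also have "\<dots> \<le> emeasure lborel Bd + emeasure lborel (N0 \<union> (?I1 \<union> ?I2 \<union> ?I3))"
    using N0(2) by (intro emeasure_subadditive) (auto simp: Bd_def)
  also have "emeasure lborel (N0 \<union> (?I1 \<union> ?I2 \<union> ?I3)) \<le> emeasure lborel N0 + emeasure lborel (?I1 \<union> ?I2 \<union> ?I3)"
    using N0(2) by (intro emeasure_subadditive) auto
  also have "emeasure lborel (?I1 \<union> ?I2 \<union> ?I3) \<le> emeasure lborel (?I1 \<union> ?I2) + emeasure lborel ?I3"
    by (intro emeasure_subadditive) auto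
  also have "emeasure lborel (?I1 \<union> ?I2) \<le> emeasure lborel ?I1 + emeasure lborel ?I2"
    by (intro emeasure_subadditive) auto
  also have "emeasure lborel Bd \<le> ennreal (2 * K * (4 * q))" unfolding Bd_def using q by (intro weak) simp
  finally have "emeasure lborel S \<le> ennreal (2 * K * (4 * q)) + (0 + (ennreal (8*q) + ennreal (8*q) + ennreal (8*q)))"
    using q N0(3) by (simp add: add_mono add_left_mono)
  also have "\<dots> = ennreal (8 * K * q + 24 * q)"
    using q K by (simp flip: ennreal_plus)
  \<comment> \<open>The three translates of the interval contribute \<open>24 * q\<close>, and
    \<open>24 \<le> 7 * K\<close> because \<open>K \<ge> 11/3\<close>.\<close>
  also have "\<dots> \<le> ennreal (15 * K * q)"
    using q K by (intro ennreal_leI) (simp add: field_simps)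
  finally have "emeasure lborel S \<le> ennreal (15 * K * q)" .
  then show ?thesis by (subst emeasure_restrict_space) (auto simp: S_def)
qed

lemma CM_powr_le:
  assumes "0 \<le> b" "b < 1" "0 \<le> R"
  shows "(\<integral>\<^sup>+t. (if norm (x - \<gamma> t) \<le> R then ennreal (norm (x - \<gamma> t) powr -b) else 0) \<partial>CM)
    \<le> ennreal (15 * K * (R powr (1 - b) / (1 - b)))"
  using K assms ahlfors by (intro nn_integral_powr_le[OF PM.sigma_finite_measure_axioms]) (auto intro!: borel_CM)

lemma CM_max_powr_le:
  assumes "1 < a" "0 < \<eta>"
  shows "(\<integral>\<^sup>+t. ennreal (max \<eta> (norm (x - \<gamma> t)) powr -a) \<partial>CM) \<le> ennreal (15 * K * (\<eta> powr (1 - a) * a / (a - 1)))"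
  using K assms ahlfors by (intro nn_integral_max_powr_le[OF PM.sigma_finite_measure_axioms]) (auto intro!: borel_CM)

lemma CM_\<rho>_le:
  assumes "0 \<le> R"
  shows "(\<integral>\<^sup>+s. (if \<rho> s \<le> R then ennreal (\<rho> s powr -(1/2)) else 0) \<partial>CM) \<le> ennreal (4 * K * sqrt R)"
proof -
  have "(\<integral>\<^sup>+s. (if \<rho> s \<le> R then ennreal (\<rho> s powr -(1/2)) else 0) \<partial>CM) \<le> ennreal (2 * K * (R powr (1 - 1/2) / (1 - 1/2)))"
  proof (rule nn_integral_powr_le[OF PM.sigma_finite_measure_axioms])
    fix q :: real assume "0 < q"
    then show "emeasure CM {x \<in> space CM. \<rho> x \<le> q} \<le> ennreal (2 * K * q)"
      using weak[of q] by (subst emeasure_restrict_space) auto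
  qed (use K assms \<rho>_nonneg in \<open>auto intro!: borel_CM\<close>)
  then show ?thesis using assms by (simp add: powr_half_sqrt mult.assoc)
qed

lemma nn_shift0:
  fixes F :: "real \<Rightarrow> ennreal"
  assumes F[measurable]: "F \<in> borel_measurable borel" and P: "\<And>t. F (t + L) = F t" and d: "0 \<le> d" "d \<le> L"
  shows "(\<integral>\<^sup>+t. F t * indicator {a+d..<a+d+L} t \<partial>lborel) = (\<integral>\<^sup>+t. F t * indicator {a..<a+L} t \<partial>lborel)"
proof -
  have sh: "(\<integral>\<^sup>+t. F t * indicator {a+L..<a+d+L} t \<partial>lborel) = (\<integral>\<^sup>+t. F t * indicator {a..<a+d} t \<partial>lborel)"
    by (subst nn_integral_real_affine[where c=1 and t=L])
       (auto intro!: nn_integral_cong simp: indicator_def P add.commute)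
  have "(\<integral>\<^sup>+t. F t * indicator {a+d..<a+d+L} t \<partial>lborel)
      = (\<integral>\<^sup>+t. F t * indicator {a+d..<a+L} t + F t * indicator {a+L..<a+d+L} t \<partial>lborel)"
    using d by (intro nn_integral_cong) (auto simp: indicator_def)
  also have "\<dots> = (\<integral>\<^sup>+t. F t * indicator {a+d..<a+L} t \<partial>lborel) + (\<integral>\<^sup>+t. F t * indicator {a..<a+d} t \<partial>lborel)"
    by (subst nn_integral_add) (auto simp: sh)
  also have "\<dots> = (\<integral>\<^sup>+t. F t * indicator {a+d..<a+L} t + F t * indicator {a..<a+d} t \<partial>lborel)"
    by (subst nn_integral_add) auto
  also have "\<dots> = (\<integral>\<^sup>+t. F t * indicator {a..<a+L} t \<partial>lborel)"
    using d by (intro nn_integral_cong) (auto simp: indicator_def)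
  finally show ?thesis .
qed

text \<open>The period centred at the base point: for \<open>h\<close> in this window the ordinary
  \<open>\<bar>h\<bar>\<close> is the circle distance, so the conditions in \<open>good\<close>
  apply directly after the shift \<open>t = s + h\<close>.\<close>

abbreviation "HM \<equiv> restrict_space lborel {-(L/2)..<L/2}"

lemma space_HM[simp]: "space HM = {-(L/2)..<L/2}" by (simp add: space_restrict_space)

lemma borel_HM: "f \<in> borel_measurable borel \<Longrightarrow> f \<in> borel_measurable HM"
  by (rule measurable_restrict_space1) simp

lemma finite_HM: "finite_measure HM"
proof (rule finite_measureI)
  have "emeasure HM (space HM) = ennreal L" using L by (simp add: emeasure_restrict_space)
  then show "emeasure HM (space HM) \<noteq> \<infinity>" by simp
qed

lemma nn_HM: "f \<in> borel_measurable borel \<Longrightarrow> (\<integral>\<^sup>+s. f s \<partial>HM) = (\<integral>\<^sup>+s. f s * indicator {-(L/2)..<L/2} s \<partial>lborel)"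
  by (simp add: nn_integral_restrict_space)

lemma nn_shift:
  fixes F :: "real \<Rightarrow> ennreal"
  assumes F[measurable]: "F \<in> borel_measurable borel" and P: "\<And>t. F (t + L) = F t" and s: "0 \<le> s" "s < L"
  shows "(\<integral>\<^sup>+t. F t \<partial>CM) = (\<integral>\<^sup>+h. F (s + h) \<partial>HM)"
proof -
  have "(\<integral>\<^sup>+t. F t \<partial>CM) = (\<integral>\<^sup>+t. F t * indicator {0..<L} t \<partial>lborel)" by (simp add: nn_CM)
  also have "\<dots> = (\<integral>\<^sup>+t. F t * indicator {s-L/2..<s+L/2} t \<partial>lborel)"
  proof (cases "s \<ge> L/2")
    case True
    have e: "s - L/2 + L = s + L/2" by simp
    show ?thesis using nn_shift0[OF F P, of "s - L/2" 0] True s unfolding add_0 e by simp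
  next
    case False
    have e: "s - L/2 + (L/2 - s) = 0" "s - L/2 + L = s + L/2" by simp_all
    show ?thesis using nn_shift0[OF F P, of "L/2 - s" "s - L/2"] False s unfolding e by simp
  qed
  also have "\<dots> = (\<integral>\<^sup>+h. F (s + h) * indicator {-(L/2)..<L/2} h \<partial>lborel)"
    by (subst nn_integral_real_affine[where c=1 and t=s])
       (auto intro!: nn_integral_cong simp: indicator_def)
  also have "\<dots> = (\<integral>\<^sup>+h. F (s + h) \<partial>HM)" by (rule nn_HM[symmetric]) measurable
  finally show ?thesis .
qed

lemma integral_shift:
  fixes F :: "real \<Rightarrow> real"
  assumes F[measurable]: "F \<in> borel_measurable borel" and P: "\<And>t. F (t + L) = F t" and s: "0 \<le> s" "s < L"
    and bd: "\<And>t. \<bar>F t\<bar> \<le> B"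
  shows "(\<integral>t. F t \<partial>CM) = (\<integral>h. F (s + h) \<partial>HM)"
proof -
  have [measurable]: "F \<in> borel_measurable CM" "(\<lambda>h. F (s + h)) \<in> borel_measurable HM"
    subgoal by (rule borel_CM) measurable
    subgoal by (rule borel_HM) measurable
    done
  have i1: "integrable CM F"
    by (rule PM.integrable_const_bound[where B=B]) (use bd in auto)
  have i2: "integrable HM (\<lambda>h. F (s + h))"
    by (rule finite_measure.integrable_const_bound[OF finite_HM, where B=B]) (use bd in auto)
  show ?thesis
    unfolding real_lebesgue_integral_def[OF i1] real_lebesgue_integral_def[OF i2]
    using nn_shift[of "\<lambda>t. ennreal (F t)" s] nn_shift[of "\<lambda>t. ennreal (- F t)" s] P s by simp
qed

text \<open>This is the only place where pairs beyond the security radius are integrated, and the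
  source of \<open>K^2\<close>. Such chords have length at least \<open>\<rho> s / 2\<close>, so
  \<open>1 / z \<le> sqrt 2 * \<rho> powr -(1/2) * z powr -(1/2)\<close>. The inner integral of the
  half power is of order \<open>K * sqrt R\<close> by \<open>ahlfors\<close>, the outer one by the
  weak-type bound for \<open>\<rho>\<close>. The restriction to \<open>\<rho> s \<le> 2 * R\<close>
  comes for free from \<open>\<rho> s / 2 \<le> z \<le> R\<close>.\<close>

lemma far_lemma:
  assumes R: "R > 0"
  shows "(\<integral>\<^sup>+s. (\<integral>\<^sup>+h. (if \<rho> s < \<bar>h\<bar> \<and> norm (\<gamma> (s + h) - \<gamma> s) \<le> R
      then ennreal (1 / norm (\<gamma> (s + h) - \<gamma> s)) else 0) \<partial>HM) \<partial>CM) \<le> ennreal (240 * K\<^sup>2 * R)"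
proof -
  let ?z = "\<lambda>s h. norm (\<gamma> (s + h) - \<gamma> s)"
  let ?J = "\<lambda>s. (\<integral>\<^sup>+h. (if \<rho> s < \<bar>h\<bar> \<and> ?z s h \<le> R then ennreal (1 / ?z s h) else 0) \<partial>HM)"
  have J: "?J s \<le> ennreal (sqrt 2 * (15 * K * (2 * sqrt R))) * (if \<rho> s \<le> 2 * R then ennreal (\<rho> s powr -(1/2)) else 0)"
    if g: "good s" and s: "s \<in> {0..<L}" for s
  proof -
    have r: "\<rho> s > 0" using g by (rule good_pos)
    have pt: "(if \<rho> s < \<bar>h\<bar> \<and> ?z s h \<le> R then ennreal (1 / ?z s h) else 0) \<le>
        ennreal (sqrt 2) * (if \<rho> s \<le> 2 * R then ennreal (\<rho> s powr -(1/2)) else 0) *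
        (if norm (\<gamma> s - \<gamma> (s + h)) \<le> R then ennreal (norm (\<gamma> s - \<gamma> (s + h)) powr -(1/2)) else 0)"
      if h: "h \<in> {-(L/2)..<L/2}" for h
    proof (cases "\<rho> s < \<bar>h\<bar> \<and> ?z s h \<le> R")
      case True
      then have z: "\<rho> s / 2 \<le> ?z s h" using good_far[OF g, of h] h by auto
      let ?w = "?z s h"
      have w: "?w > 0" using z r by linarith
      \<comment> \<open>Exponent one is split evenly: one half is paid by \<open>\<rho>\<close>, the
        other stays with the chord, and each is below the integrability threshold.\<close>
      have "?w powr -1 = ?w powr -(1/2) * ?w powr -(1/2)" by (simp flip: powr_add)
      also have "\<dots> \<le> (\<rho> s / 2) powr -(1/2) * ?w powr -(1/2)"
        using z r by (intro mult_right_mono powr_mono2') auto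
      also have "(\<rho> s / 2) powr -(1/2) = sqrt 2 * \<rho> s powr -(1/2)"
        using r by (simp add: powr_divide powr_minus powr_half_sqrt field_simps)
      finally have "1 / ?w \<le> sqrt 2 * \<rho> s powr -(1/2) * ?w powr -(1/2)"
        using w by (simp add: powr_minus_divide)
      then have "ennreal (1 / ?w) \<le> ennreal (sqrt 2 * \<rho> s powr -(1/2) * ?w powr -(1/2))" by (rule ennreal_leI)
      moreover have "\<rho> s \<le> 2 * R" using z True by linarith
      ultimately show ?thesis using True by (simp add: norm_minus_commute ennreal_mult)
    next
      case False
      then show ?thesis by (simp only: if_False zero_le)
    qed
    have "?J s \<le> (\<integral>\<^sup>+h. ennreal (sqrt 2) * (if \<rho> s \<le> 2 * R then ennreal (\<rho> s powr -(1/2)) else 0) *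
        (if norm (\<gamma> s - \<gamma> (s + h)) \<le> R then ennreal (norm (\<gamma> s - \<gamma> (s + h)) powr -(1/2)) else 0) \<partial>HM)"
      using pt by (intro nn_integral_mono) auto
    also have "\<dots> = ennreal (sqrt 2) * (if \<rho> s \<le> 2 * R then ennreal (\<rho> s powr -(1/2)) else 0) *
        (\<integral>\<^sup>+h. (if norm (\<gamma> s - \<gamma> (s + h)) \<le> R then ennreal (norm (\<gamma> s - \<gamma> (s + h)) powr -(1/2)) else 0) \<partial>HM)"
      by (rule nn_integral_cmult) (rule borel_HM, measurable)
    also have "(\<integral>\<^sup>+h. (if norm (\<gamma> s - \<gamma> (s + h)) \<le> R then ennreal (norm (\<gamma> s - \<gamma> (s + h)) powr -(1/2)) else 0) \<partial>HM)
       = (\<integral>\<^sup>+t. (if norm (\<gamma> s - \<gamma> t) \<le> R then ennreal (norm (\<gamma> s - \<gamma> t) powr -(1/2)) else 0) \<partial>CM)"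
      using s by (intro nn_shift[symmetric]) (auto simp: per)
    also have "\<dots> \<le> ennreal (15 * K * (R powr (1 - 1/2) / (1 - 1/2)))"
      using R by (intro CM_powr_le) auto
    also have "R powr (1 - 1/2) / (1 - 1/2) = 2 * sqrt R" using R by (simp add: powr_half_sqrt)
    finally have "?J s \<le> ennreal (sqrt 2) * (if \<rho> s \<le> 2 * R then ennreal (\<rho> s powr -(1/2)) else 0) * ennreal (15 * K * (2 * sqrt R))"
      by (simp add: mult_left_mono)
    also have "\<dots> = ennreal (sqrt 2 * (15 * K * (2 * sqrt R))) * (if \<rho> s \<le> 2 * R then ennreal (\<rho> s powr -(1/2)) else 0)"
      using K R by (subst ennreal_mult) (auto simp: mult_ac)
    finally show ?thesis .
  qed
  have "(\<integral>\<^sup>+s. ?J s \<partial>CM) \<le> (\<integral>\<^sup>+s. ennreal (sqrt 2 * (15 * K * (2 * sqrt R))) * (if \<rho> s \<le> 2 * R then ennreal (\<rho> s powr -(1/2)) else 0) \<partial>CM)"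
  proof (rule nn_integral_mono_AE)
    have "AE s in CM. s \<in> space CM" by (rule AE_space)
    then show "AE s in CM. ?J s \<le> ennreal (sqrt 2 * (15 * K * (2 * sqrt R))) * (if \<rho> s \<le> 2 * R then ennreal (\<rho> s powr -(1/2)) else 0)"
      using AE_CM_good by eventually_elim (use J in auto)
  qed
  also have "\<dots> = ennreal (sqrt 2 * (15 * K * (2 * sqrt R))) * (\<integral>\<^sup>+s. (if \<rho> s \<le> 2 * R then ennreal (\<rho> s powr -(1/2)) else 0) \<partial>CM)"
    by (rule nn_integral_cmult) (auto intro!: borel_CM)
  also have "\<dots> \<le> ennreal (sqrt 2 * (15 * K * (2 * sqrt R))) * ennreal (4 * K * sqrt (2 * R))"
    using R by (intro mult_left_mono CM_\<rho>_le) auto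
  also have "\<dots> = ennreal (sqrt 2 * (15 * K * (2 * sqrt R)) * (4 * K * sqrt (2 * R)))"
    using K R by (subst ennreal_mult) auto
  also have "sqrt 2 * (15 * K * (2 * sqrt R)) * (4 * K * sqrt (2 * R)) = 240 * K\<^sup>2 * R"
  proof -
    have "sqrt 2 * (15 * K * (2 * sqrt R)) * (4 * K * sqrt (2 * R)) = 120 * K\<^sup>2 * (sqrt 2 * sqrt 2) * (sqrt R * sqrt R)"
      by (simp add: real_sqrt_mult power2_eq_square)
    then show ?thesis using R by simp
  qed
  finally show ?thesis .
qed

end

section \<open>Radial kernels and curls\<close>

text \<open>First, second and third partial derivatives of a radial function \<open>f (x \<bullet> x)\<close>; \<open>f1\<close>, \<open>f2\<close>, \<open>f3\<close> are the derivatives of \<open>f\<close>.\<close>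

definition K1 :: "(real \<Rightarrow> real) \<Rightarrow> 3 \<Rightarrow> real^3 \<Rightarrow> real" where
  "K1 f1 k x = 2 * x$k * f1 (x \<bullet> x)"

definition K2 :: "(real \<Rightarrow> real) \<Rightarrow> (real \<Rightarrow> real) \<Rightarrow> 3 \<Rightarrow> 3 \<Rightarrow> real^3 \<Rightarrow> real" where
  "K2 f1 f2 i k x = 2 * of_bool (i = k) * f1 (x \<bullet> x) + 4 * x$i * x$k * f2 (x \<bullet> x)"

definition K3 :: "(real \<Rightarrow> real) \<Rightarrow> (real \<Rightarrow> real) \<Rightarrow> 3 \<Rightarrow> 3 \<Rightarrow> 3 \<Rightarrow> real^3 \<Rightarrow> real" where
  "K3 f2 f3 i j k x = 4 * (of_bool (i = j) * x$k + of_bool (i = k) * x$j + of_bool (j = k) * x$i) * f2 (x \<bullet> x)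
     + 8 * x$i * x$j * x$k * f3 (x \<bullet> x)"

lemma has_derivative_radial:
  assumes "\<And>y. DERIV f y :> f' y"
  shows "((\<lambda>x::real^3. f (x \<bullet> x)) has_derivative (\<lambda>h. f' (x \<bullet> x) * (2 * (x \<bullet> h)))) (at x)"
proof -
  have 1: "((\<lambda>x::real^3. x \<bullet> x) has_derivative (\<lambda>h. 2 * (x \<bullet> h))) (at x)"
    by (rule derivative_eq_intros | simp add: inner_commute)+
  show ?thesis
    using has_derivative_compose[OF 1 assms[unfolded has_field_derivative_def]] by simp
qed

lemma norm_ge_sq: "0 \<le> R \<Longrightarrow> R \<le> norm x \<Longrightarrow> R\<^sup>2 \<le> x \<bullet> x"
  by (simp add: power2_norm_eq_inner[symmetric] power_mono)

lemma radial_continuous: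
  assumes "continuous_on UNIV f"
  shows "continuous_on UNIV (\<lambda>x::real^3. f (x \<bullet> x))"
  by (rule continuous_on_compose2[OF assms]) (auto intro!: continuous_intros)

lemma DERIV_cont: "(\<And>y. DERIV f y :> f' y) \<Longrightarrow> continuous_on UNIV (f :: real \<Rightarrow> real)"
  by (meson DERIV_continuous continuous_at_imp_continuous_on)

lemma C1c_radial:
  assumes d: "\<And>y. DERIV f0 y :> f1 y" and c: "continuous_on UNIV f1"
    and R: "0 \<le> R" and z: "\<And>y. R\<^sup>2 \<le> y \<Longrightarrow> f0 y = 0" "\<And>y. R\<^sup>2 \<le> y \<Longrightarrow> f1 y = 0"
  shows "C1c (\<lambda>x. f0 (x \<bullet> x)) (\<lambda>i. K1 f1 i)"
proof (rule C1cI[where R=R])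
  show "((\<lambda>x. f0 (x \<bullet> x)) has_derivative (\<lambda>h. \<Sum>i\<in>UNIV. (h$i) *\<^sub>R K1 f1 i x)) (at x)" for x
    by (rule has_derivative_eq_rhs[OF has_derivative_radial[OF d]])
       (simp add: fun_eq_iff K1_def inner_vec_def sum_distrib_left mult_ac)
  show "continuous_on UNIV (K1 f1 i)" for i
    unfolding K1_def[abs_def] by (intro continuous_intros radial_continuous c)
qed (auto simp: K1_def z norm_ge_sq R)

lemma C1c_K1:
  assumes d: "\<And>y. DERIV f1 y :> f2 y" and c: "continuous_on UNIV f2"
    and R: "0 \<le> R" and z: "\<And>y. R\<^sup>2 \<le> y \<Longrightarrow> f1 y = 0" "\<And>y. R\<^sup>2 \<le> y \<Longrightarrow> f2 y = 0"
  shows "C1c (K1 f1 k) (\<lambda>i. K2 f1 f2 i k)"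
proof (rule C1cI[where R=R])
  show "(K1 f1 k has_derivative (\<lambda>h. \<Sum>i\<in>UNIV. (h$i) *\<^sub>R K2 f1 f2 i k x)) (at x)" for x
    unfolding K1_def[abs_def]
  proof (rule has_derivative_eq_rhs[OF has_derivative_mult[OF _ has_derivative_radial[OF d]]])
    show "((\<lambda>x. 2 * x $ k) has_derivative (\<lambda>h. 2 * h $ k)) (at x)"
      by (intro derivative_intros bounded_linear_imp_has_derivative bounded_linear_vec_nth)
    show "(\<lambda>h. 2 * x $ k * (f2 (x \<bullet> x) * (2 * (x \<bullet> h))) + 2 * h $ k * f1 (x \<bullet> x)) = (\<lambda>h. \<Sum>i\<in>UNIV. (h$i) *\<^sub>R K2 f1 f2 i k x)"
      using exhaust_3[of k] by (auto simp: fun_eq_iff K2_def inner_vec_def sum_3 algebra_simps)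
  qed
  show "continuous_on UNIV (K2 f1 f2 i k)" for i
    unfolding K2_def[abs_def] by (intro continuous_intros radial_continuous c DERIV_cont[OF d])
qed (auto simp: K1_def K2_def z norm_ge_sq R)

lemma C1c_K2:
  assumes d: "\<And>y. DERIV f1 y :> f2 y" "\<And>y. DERIV f2 y :> f3 y" and c: "continuous_on UNIV f3"
    and R: "0 \<le> R" and z: "\<And>y. R\<^sup>2 \<le> y \<Longrightarrow> f1 y = 0" "\<And>y. R\<^sup>2 \<le> y \<Longrightarrow> f2 y = 0" "\<And>y. R\<^sup>2 \<le> y \<Longrightarrow> f3 y = 0"
  shows "C1c (K2 f1 f2 j k) (\<lambda>i. K3 f2 f3 i j k)"
proof (rule C1cI[where R=R])
  show "(K2 f1 f2 j k has_derivative (\<lambda>h. \<Sum>i\<in>UNIV. (h$i) *\<^sub>R K3 f2 f3 i j k x)) (at x)" for x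
    unfolding K2_def[abs_def]
  proof (rule has_derivative_eq_rhs[OF has_derivative_add[OF has_derivative_mult[OF _ has_derivative_radial[OF d(1)]] has_derivative_mult[OF _ has_derivative_radial[OF d(2)]]]])
    show "((\<lambda>x::real^3. 2 * of_bool (j = k)::real) has_derivative (\<lambda>h. 0)) (at x)" by simp
    show "((\<lambda>x. 4 * x $ j * x $ k) has_derivative (\<lambda>h. 4 * (x $ j * h $ k + h $ j * x $ k))) (at x)"
    proof -
      have n: "((\<lambda>x::real^3. x $ m) has_derivative (\<lambda>h. h $ m)) (at x)" for m
        by (intro bounded_linear_imp_has_derivative bounded_linear_vec_nth)
      have "((\<lambda>x. 4 * (x $ j * x $ k)) has_derivative (\<lambda>h. 4 * (x $ j * h $ k + h $ j * x $ k))) (at x)"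
        by (rule has_derivative_mult_right[OF has_derivative_mult[OF n n]])
      then show ?thesis by (simp add: mult.assoc)
    qed
    show "(\<lambda>h. 2 * of_bool (j = k) * (f2 (x \<bullet> x) * (2 * (x \<bullet> h))) + 0 * f1 (x \<bullet> x) +
       (4 * x $ j * x $ k * (f3 (x \<bullet> x) * (2 * (x \<bullet> h))) + 4 * (x $ j * h $ k + h $ j * x $ k) * f2 (x \<bullet> x)))
      = (\<lambda>h. \<Sum>i\<in>UNIV. (h$i) *\<^sub>R K3 f2 f3 i j k x)"
    proof
      fix h :: "real^3"
      have e: "(\<Sum>i\<in>UNIV. h$i * of_bool (i = m)) = h$m" for m :: 3
        using exhaust_3[of m] by (auto simp: sum_3)
      have "(\<Sum>i\<in>UNIV. (h$i) *\<^sub>R K3 f2 f3 i j k x) =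
        4 * ((\<Sum>i\<in>UNIV. h$i * of_bool (i = j)) * x$k + (\<Sum>i\<in>UNIV. h$i * of_bool (i = k)) * x$j + of_bool (j = k) * (\<Sum>i\<in>UNIV. x$i * h$i)) * f2 (x \<bullet> x)
        + 8 * (\<Sum>i\<in>UNIV. x$i * h$i) * x$j * x$k * f3 (x \<bullet> x)"
        by (simp add: K3_def sum_3 algebra_simps)
      then show "2 * of_bool (j = k) * (f2 (x \<bullet> x) * (2 * (x \<bullet> h))) + 0 * f1 (x \<bullet> x) +
       (4 * x $ j * x $ k * (f3 (x \<bullet> x) * (2 * (x \<bullet> h))) + 4 * (x $ j * h $ k + h $ j * x $ k) * f2 (x \<bullet> x))
      = (\<Sum>i\<in>UNIV. (h$i) *\<^sub>R K3 f2 f3 i j k x)"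
        unfolding e by (simp add: inner_vec_def algebra_simps)
    qed
  qed
  show "continuous_on UNIV (K3 f2 f3 i j k)" for i
    unfolding K3_def[abs_def] by (intro continuous_intros radial_continuous c DERIV_cont[OF d(2)])
qed (auto simp: K2_def K3_def z norm_ge_sq R)

lemma K3_sym: "K3 f2 f3 i j k = K3 f2 f3 j i k"
  by (auto simp: K3_def fun_eq_iff)

section \<open>Curls, integration by parts, and the flat norm as a bound on test fields\<close>

definition curlv :: "(3 \<Rightarrow> real^3 \<Rightarrow> real^3) \<Rightarrow> real^3 \<Rightarrow> real^3" where
  "curlv d x = vector [d 2 x $ 3 - d 3 x $ 2, d 3 x $ 1 - d 1 x $ 3, d 1 x $ 2 - d 2 x $ 1]"

lemma curlv_nth[simp]:
  "curlv d x $ 1 = d 2 x $ 3 - d 3 x $ 2" "curlv d x $ 2 = d 3 x $ 1 - d 1 x $ 3" "curlv d x $ 3 = d 1 x $ 2 - d 2 x $ 1"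
  by (simp_all add: curlv_def)

lemma curlv_alt: "curlv d x = (\<Sum>i\<in>UNIV. cross3 (axis i 1) (d i x))"
  by (simp add: vec_eq_iff forall_3 sum_3 cross3_def axis_def)

lemma curlv_cont: "(\<And>i. continuous_on UNIV (d i)) \<Longrightarrow> continuous_on UNIV (curlv d)"
  unfolding curlv_alt[abs_def] by (intro continuous_on_sum continuous_on_cross continuous_on_const) auto

lemma curl_C1c: "C1c f d \<Longrightarrow> curl f x = curlv d x"
  by (simp add: curl_def curlv_def C1c_partial_deriv)

lemma C1c_nth: "C1c f d \<Longrightarrow> C1c (\<lambda>x. f x $ k) (\<lambda>i x. d i x $ k)"
  by (rule C1c_linear[OF bounded_linear_vec_nth])

lemma C1c_prod_integrable:
  fixes f g :: "real^3 \<Rightarrow> real"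
  assumes "C1c f d" "C1c g e"
  shows "integrable lborel (\<lambda>x. d i x * g x)" "integrable lborel (\<lambda>x. f x * e i x)" "integrable lborel (\<lambda>x. f x * g x)"
proof -
  obtain R where R: "\<And>x. R \<le> norm x \<Longrightarrow> f x = 0" "\<And>i x. R \<le> norm x \<Longrightarrow> d i x = 0"
    using C1c_supp'[OF assms(1)] by metis
  show "integrable lborel (\<lambda>x. d i x * g x)" "integrable lborel (\<lambda>x. f x * e i x)" "integrable lborel (\<lambda>x. f x * g x)"
    by (rule compact_supp_integrable[where R=R]; use R C1cD[OF assms(1)] C1cD[OF assms(2)] in \<open>auto intro!: continuous_intros\<close>)+
qed

lemma curl_ibp:
  assumes Z: "C1c Z dZ" and v: "C1c v dv"
  shows "(LBINT x. curlv dZ x \<bullet> v x) = (LBINT x. Z x \<bullet> curlv dv x)"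
proof -
  have i: "integrable lborel (\<lambda>x. dZ i x $ a * v x $ b)" "integrable lborel (\<lambda>x. Z x $ a * dv i x $ b)" for i a b
    using C1c_prod_integrable[OF C1c_nth[OF Z, of a] C1c_nth[OF v, of b]] by auto
  have ibp: "(LBINT x. dZ i x $ a * v x $ b) = - (LBINT x. Z x $ a * dv i x $ b)" for i a b
    by (rule C1c_ibp[OF C1c_nth[OF Z] C1c_nth[OF v]])
  have "(LBINT x. curlv dZ x \<bullet> v x) =
     (LBINT x. dZ 2 x $ 3 * v x $ 1 - dZ 3 x $ 2 * v x $ 1 + (dZ 3 x $ 1 * v x $ 2 - dZ 1 x $ 3 * v x $ 2) + (dZ 1 x $ 2 * v x $ 3 - dZ 2 x $ 1 * v x $ 3))"
    by (simp add: inner_vec_def sum_3 algebra_simps)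
  also have "\<dots> = (LBINT x. dZ 2 x $ 3 * v x $ 1) - (LBINT x. dZ 3 x $ 2 * v x $ 1)
    + ((LBINT x. dZ 3 x $ 1 * v x $ 2) - (LBINT x. dZ 1 x $ 3 * v x $ 2))
    + ((LBINT x. dZ 1 x $ 2 * v x $ 3) - (LBINT x. dZ 2 x $ 1 * v x $ 3))"
    using i by simp
  also have "\<dots> = (LBINT x. Z x $ 1 * dv 2 x $ 3) - (LBINT x. Z x $ 1 * dv 3 x $ 2)
    + ((LBINT x. Z x $ 2 * dv 3 x $ 1) - (LBINT x. Z x $ 2 * dv 1 x $ 3))
    + ((LBINT x. Z x $ 3 * dv 1 x $ 2) - (LBINT x. Z x $ 3 * dv 2 x $ 1))"
    unfolding ibp by simp
  also have "\<dots> = (LBINT x. Z x $ 1 * dv 2 x $ 3 - Z x $ 1 * dv 3 x $ 2 + (Z x $ 2 * dv 3 x $ 1 - Z x $ 2 * dv 1 x $ 3) + (Z x $ 3 * dv 1 x $ 2 - Z x $ 3 * dv 2 x $ 1))"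
    using i by simp
  also have "\<dots> = (LBINT x. Z x \<bullet> curlv dv x)"
    by (simp add: inner_vec_def sum_3 algebra_simps)
  finally show ?thesis .
qed

lemma grad_ibp:
  fixes E :: "real^3 \<Rightarrow> real"
  assumes E: "C1c E dE" and v: "C1c v dv" and div: "\<And>x. (\<Sum>i\<in>UNIV. dv i x $ i) = 0"
  shows "(LBINT x. (\<chi> i. dE i x) \<bullet> v x) = 0"
proof -
  have i: "integrable lborel (\<lambda>x. dE i x * v x $ b)" "integrable lborel (\<lambda>x. E x * dv i x $ b)" for i b
    using C1c_prod_integrable[OF E C1c_nth[OF v, of b]] by auto
  have ibp: "(LBINT x. dE i x * v x $ b) = - (LBINT x. E x * dv i x $ b)" for i b
    by (rule C1c_ibp[OF E C1c_nth[OF v]])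
  have "(LBINT x. (\<chi> i. dE i x) \<bullet> v x) = (LBINT x. (\<Sum>i\<in>UNIV. dE i x * v x $ i))"
    by (simp add: inner_vec_def)
  also have "\<dots> = (\<Sum>i\<in>UNIV. LBINT x. dE i x * v x $ i)"
    using i by (intro Bochner_Integration.integral_sum) auto
  also have "\<dots> = - (\<Sum>i\<in>UNIV. LBINT x. E x * dv i x $ i)"
    unfolding ibp by (simp add: sum_negf)
  also have "(\<Sum>i\<in>UNIV. LBINT x. E x * dv i x $ i) = (LBINT x. (\<Sum>i\<in>UNIV. E x * dv i x $ i))"
    using i by (intro Bochner_Integration.integral_sum[symmetric]) auto
  also have "\<dots> = (LBINT x. E x * (\<Sum>i\<in>UNIV. dv i x $ i))" by (simp add: sum_distrib_left)
  also have "\<dots> = 0" unfolding div by simp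
  finally show ?thesis by simp
qed

text \<open>Both \<open>(1/A) * Z\<close> and \<open>(-1/A) * Z\<close> compete in the supremum, and
  homogeneity turns this into a two-sided bound. Homogeneity is assumed on continuously
  differentiable compactly supported fields only, where the distributions at hand are given by
  honest integrals.\<close>

lemma flat_norm_test:
  assumes lin: "\<And>c \<xi> d. C1c \<xi> d \<Longrightarrow> \<omega> (\<lambda>x. c *\<^sub>R \<xi> x) = c * \<omega> \<xi>"
    and F: "flat_norm \<omega> \<le> ereal B" and Z: "C1c Z dZ" and A: "A > 0" "\<And>x. norm (curlv dZ x) \<le> A"
  shows "\<bar>\<omega> Z\<bar> \<le> B * A"
proof -
  have 1: "c * \<omega> Z \<le> B" if c: "\<bar>c\<bar> * A \<le> 1" for c
  proof -
    have C: "C1c (\<lambda>x. c *\<^sub>R Z x) (\<lambda>i x. c *\<^sub>R dZ i x)"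
      by (rule C1c_linear[OF bounded_linear_scaleR_right Z])
    have "curl (\<lambda>x. c *\<^sub>R Z x) x = c *\<^sub>R curlv dZ x" for x
      unfolding curl_C1c[OF C] by (simp add: vec_eq_iff forall_3 algebra_simps)
    moreover have "norm (c *\<^sub>R curlv dZ x) \<le> 1" for x
      using mult_left_mono[OF A(2), of "\<bar>c\<bar>" x] c by simp
    ultimately have le: "ennreal (norm (curl (\<lambda>x. c *\<^sub>R Z x) x)) \<le> 1" for x by simp
    have m: "(\<lambda>x. ennreal (norm (curl (\<lambda>x. c *\<^sub>R Z x) x))) \<in> borel_measurable lebesgue"
    proof -
      have "continuous_on UNIV (curlv (\<lambda>i x. c *\<^sub>R dZ i x))"
        by (intro curlv_cont continuous_intros C1c_cont_d[OF Z])
      then have "curlv (\<lambda>i x. c *\<^sub>R dZ i x) \<in> borel_measurable borel" by (rule borel_measurable_continuous_onI)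
      then have "(\<lambda>x. ennreal (norm (curlv (\<lambda>i x. c *\<^sub>R dZ i x) x))) \<in> borel_measurable borel" by measurable
      then have "(\<lambda>x. ennreal (norm (curlv (\<lambda>i x. c *\<^sub>R dZ i x) x))) \<in> borel_measurable lborel" by simp
      then show ?thesis unfolding curl_C1c[OF C] by (rule measurable_completion)
    qed
    have "Linf_norm (curl (\<lambda>x. c *\<^sub>R Z x)) \<le> 1"
      unfolding Linf_norm_def by (rule esssup_I[OF m]) (use le in simp)
    then have "ereal (\<omega> (\<lambda>x. c *\<^sub>R Z x)) \<le> flat_norm \<omega>"
      unfolding flat_norm_def using C1c_C1_compact[OF C] by (intro SUP_upper) simp
    then have "ereal (\<omega> (\<lambda>x. c *\<^sub>R Z x)) \<le> ereal B" using F by (rule order_trans)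
    then show ?thesis using lin[OF Z] by simp
  qed
  have "(1/A) * \<omega> Z \<le> B" "(-1/A) * \<omega> Z \<le> B" using A(1) 1[of "1/A"] 1[of "-1/A"] by simp_all
  then show ?thesis using A(1) by (simp add: field_simps abs_le_iff)
qed

lemma conv_nth:
  fixes m :: "'s \<Rightarrow> real^3"
  assumes "integrable M (\<lambda>s. f (x - p s) *\<^sub>R m s)"
  shows "conv M p f m x $ k = conv M p f (\<lambda>s. m s $ k) x"
  unfolding conv_def using integral_bounded_linear[OF bounded_linear_vec_nth assms, of k] by simp

lemma norm_cross_le: "norm (cross3 a b) \<le> norm a * norm b"
proof (rule power2_le_imp_le)
  show "(norm (cross3 a b))\<^sup>2 \<le> (norm a * norm b)\<^sup>2"
    using norm_cross_dot[of a b] zero_le_power2[of "a \<bullet> b"] by linarith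
qed simp

lemma borel_measurable_cross3[measurable (raw)]:
  assumes "f \<in> borel_measurable M" "g \<in> borel_measurable M"
  shows "(\<lambda>x. cross3 (f x) (g x)) \<in> borel_measurable M"
  using assms by (rule borel_measurable_continuous_Pair)
    (auto intro!: continuous_on_cross continuous_intros)

lemma borel_measurable_vec_nth'[measurable (raw)]:
  fixes f :: "'a \<Rightarrow> ('b::euclidean_space)^'n"
  assumes "f \<in> borel_measurable M"
  shows "(\<lambda>x. f x $ i) \<in> borel_measurable M"
proof -
  have "(\<lambda>x::('b^'n). x $ i) \<in> borel_measurable borel"
    by (intro borel_measurable_continuous_onI continuous_intros)
  from measurable_compose[OF assms this] show ?thesis .
qed

lemma conv_minus_w: "conv M p f (\<lambda>s. - m s) x = - conv M p f m x"
  by (simp add: conv_def)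

lemma conv_zero_w[simp]: "conv M p f (\<lambda>s. 0) x = 0"
  by (simp add: conv_def)

section \<open>Biot-Savart fields of the curve\<close>

context curve
begin

lemma CM_integrable:
  fixes m :: "real \<Rightarrow> 'b::euclidean_space"
  assumes "m \<in> borel_measurable borel" "\<And>s. norm (m s) \<le> B"
  shows "integrable CM m"
  using assms by (intro PM.integrable_const_bound[where B=B] borel_CM) auto

lemma measure_CM: "measure CM (space CM) = L"
  using emeasure_CM L by (simp add: measure_def)

lemma integral_translate:
  fixes F :: "real \<Rightarrow> real"
  assumes F[measurable]: "F \<in> borel_measurable borel" and P: "\<And>t. F (t + L) = F t" and d: "0 \<le> d" "d \<le> L"
    and bd: "\<And>t. \<bar>F t\<bar> \<le> B"
  shows "(\<integral>s. F (s + d) \<partial>CM) = (\<integral>s. F s \<partial>CM)"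
proof -
  have nn: "(\<integral>\<^sup>+s. f (s + d) \<partial>CM) = (\<integral>\<^sup>+s. f s \<partial>CM)"
    if [measurable]: "f \<in> borel_measurable borel" and Pf: "\<And>t. f (t + L) = f t" for f :: "real \<Rightarrow> ennreal"
  proof -
    have "(\<integral>\<^sup>+s. f (s + d) \<partial>CM) = (\<integral>\<^sup>+s. f (s + d) * indicator {0..<L} s \<partial>lborel)" by (rule nn_CM) measurable
    also have "\<dots> = (\<integral>\<^sup>+s. f s * indicator {0+d..<0+d+L} s \<partial>lborel)"
      by (subst (2) nn_integral_real_affine[where c=1 and t=d])
        (auto intro!: nn_integral_cong simp: indicator_def add.commute)
    also have "\<dots> = (\<integral>\<^sup>+s. f s * indicator {0..<0+L} s \<partial>lborel)"
      using Pf d by (intro nn_shift0) auto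
    also have "\<dots> = (\<integral>\<^sup>+s. f s \<partial>CM)" by (simp add: nn_CM)
    finally show ?thesis .
  qed
  have i1: "integrable CM F" by (rule CM_integrable[where B=B]) (use bd in auto)
  have i2: "integrable CM (\<lambda>s. F (s + d))" by (rule CM_integrable[where B=B]) (use bd in auto)
  show ?thesis
    unfolding real_lebesgue_integral_def[OF i1] real_lebesgue_integral_def[OF i2]
    using nn[of "\<lambda>t. ennreal (F t)"] nn[of "\<lambda>t. ennreal (- F t)"] P by simp
qed

lemma conv_int:
  fixes m :: "real \<Rightarrow> 'b::euclidean_space"
  assumes "C1c f d" "m \<in> borel_measurable borel" "\<And>s. norm (m s) \<le> B"
  shows "integrable CM (\<lambda>s. f (x - \<gamma> s) *\<^sub>R m s)" (is ?R1) "integrable CM (\<lambda>s. d i (x - \<gamma> s) *\<^sub>R m s)" (is ?R2)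
proof -
  obtain R where R: "\<And>x. R \<le> norm x \<Longrightarrow> f x = 0" "\<And>i x. R \<le> norm x \<Longrightarrow> d i x = 0"
    using C1c_supp'[OF assms(1)] by metis
  have m: "integrable CM m" by (rule CM_integrable[OF assms(2,3)])
  show ?R1 by (rule PM.conv_integrable[OF C1c_cont[OF assms(1)] R(1) m])
  show ?R2 by (rule PM.conv_integrable[OF C1c_cont_d[OF assms(1)] R(2) m])
qed

text \<open>The curve has no boundary: the line integral of the gradient of \<open>g (x - y)\<close>
  vanishes. The composition \<open>F\<close> of \<open>g\<close> with the curve is only
  differentiable almost everywhere, so the argument goes through difference quotients. They are
  bounded by the Lipschitz constant, and their integrals over a period vanish by
  translation.\<close>

lemma conv_closed:
  fixes g :: "real^3 \<Rightarrow> real"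
  assumes C: "C1c g dg"
  shows "(\<Sum>i\<in>UNIV. conv CM \<gamma> (dg i) (\<lambda>s. \<tau> s $ i) x) = 0"
proof -
  obtain B where B: "B > 0" "\<And>x. norm (g x) \<le> B" "\<And>i x. norm (dg i x) \<le> B" using C1c_bounded[OF C] by metis
  note [measurable] = C1c_measurable[OF C] C1c_measurable_d[OF C]
  define t where "t n = L * inverse (real (Suc n))" for n
  have t: "t n > 0" "t n \<le> L" for n
    using L by (auto simp: t_def inverse_le_1_iff mult_le_cancel_left1)
  define F where "F s = g (x - \<gamma> s)" for s
  have [measurable]: "F \<in> borel_measurable borel" unfolding F_def by measurable
  define D where "D s = - (\<Sum>i\<in>UNIV. dg i (x - \<gamma> s) * \<tau> s $ i)" for s
  have [measurable]: "D \<in> borel_measurable borel" unfolding D_def by measurable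
  have "(\<lambda>n. \<integral>s. (F (s + t n) - F s) / t n \<partial>CM) \<longlonglongrightarrow> (\<integral>s. D s \<partial>CM)"
  proof (rule integral_dominated_convergence[where w="\<lambda>_. 3 * B"])
    show "AE s in CM. (\<lambda>n. (F (s + t n) - F s) / t n) \<longlonglongrightarrow> D s"
    proof (rule AE_CM, use deriv in eventually_elim)
      fix s assume ds: "(\<gamma> has_vector_derivative \<tau> s) (at s)"
      have "((\<lambda>s. x - \<gamma> s) has_derivative (\<lambda>h. - (h *\<^sub>R \<tau> s))) (at s)"
        using ds unfolding has_vector_derivative_def by (auto intro!: derivative_eq_intros)
      from has_derivative_compose[OF this C1c_deriv[OF C]]
      have "(F has_derivative (\<lambda>h. \<Sum>i\<in>UNIV. (- (h *\<^sub>R \<tau> s)) $ i *\<^sub>R dg i (x - \<gamma> s))) (at s)"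
        unfolding F_def .
      also have "(\<lambda>h. \<Sum>i\<in>UNIV. (- (h *\<^sub>R \<tau> s)) $ i *\<^sub>R dg i (x - \<gamma> s)) = (\<lambda>h. D s * h)"
        by (auto simp: D_def fun_eq_iff sum_distrib_left sum_distrib_right sum_negf mult_ac)
      finally have "(F has_field_derivative D s) (at s)" by (simp add: has_field_derivative_def)
      then have "(\<lambda>h. (F (s + h) - F s) / h) \<midarrow>0\<rightarrow> D s" by (simp add: DERIV_def)
      moreover have "t \<longlonglongrightarrow> 0" unfolding t_def
        using tendsto_mult_left[OF LIMSEQ_inverse_real_of_nat, of L] by simp
      moreover have "\<forall>\<^sub>F n in sequentially. t n \<noteq> 0" using t by (auto intro!: always_eventually) (metis less_irrefl)
      ultimately show "(\<lambda>n. (F (s + t n) - F s) / t n) \<longlonglongrightarrow> D s"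
        by (rule tendsto_compose_eventually)
    qed
    have "norm ((F (s + t n) - F s) / t n) \<le> 3 * B" for s n
    proof -
      have "norm (F (s + t n) - F s) \<le> 3 * B * norm ((x - \<gamma> (s + t n)) - (x - \<gamma> s))"
        unfolding F_def by (rule C1c_lipschitz[OF C B(3)])
      also have "\<dots> \<le> 3 * B * t n"
        using lip[of s "s + t n"] t[of n] B(1) by (intro mult_left_mono) auto
      finally show ?thesis using t[of n] by (simp add: field_simps)
    qed
    then show "AE s in CM. norm ((F (s + t n) - F s) / t n) \<le> 3 * B" for n by simp
  qed (auto intro!: borel_CM)
  moreover have "(\<integral>s. (F (s + t n) - F s) / t n \<partial>CM) = 0" for n
  proof -
    have bd: "\<bar>F s\<bar> \<le> B" for s using B(2) by (simp add: F_def)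
    have "integrable CM F" "integrable CM (\<lambda>s. F (s + t n))"
      using bd by (auto intro!: CM_integrable[where B=B])
    moreover have "(\<integral>s. F (s + t n) \<partial>CM) = (\<integral>s. F s \<partial>CM)"
      using t[of n] bd by (intro integral_translate) (auto simp: F_def per)
    ultimately show ?thesis by simp
  qed
  ultimately have "(\<integral>s. D s \<partial>CM) = 0" by (simp only: LIMSEQ_const_iff)
  moreover have "(\<integral>s. D s \<partial>CM) = - (\<Sum>i\<in>UNIV. conv CM \<gamma> (dg i) (\<lambda>s. \<tau> s $ i) x)"
  proof -
    have "integrable CM (\<lambda>s. dg i (x - \<gamma> s) *\<^sub>R (\<tau> s $ i))" for i
      using component_le_norm_cart[of "\<tau> _" i] by (intro conv_int(2)[OF C, where B=1]) auto
    then show ?thesis unfolding D_def conv_def by simp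
  qed
  ultimately show ?thesis by simp
qed

text \<open>The Biot-Savart field of a radial potential \<open>f (x \<bullet> x)\<close> with
  derivative \<open>f1\<close>: the curl of the convolution of the potential with
  \<open>\<tau>\<close> along the curve. The curl is written out under the integral, so that the
  definition depends on \<open>f1\<close> alone and makes sense for kernels given only through their
  derivative.\<close>

definition vfield :: "(real \<Rightarrow> real) \<Rightarrow> real^3 \<Rightarrow> real^3" where
  "vfield f1 x = (\<Sum>k\<in>UNIV. conv CM \<gamma> (K1 f1 k) (\<lambda>s. cross3 (axis k 1) (\<tau> s)) x)"

definition dvfield :: "(real \<Rightarrow> real) \<Rightarrow> (real \<Rightarrow> real) \<Rightarrow> 3 \<Rightarrow> real^3 \<Rightarrow> real^3" where
  "dvfield f1 f2 i x = (\<Sum>k\<in>UNIV. conv CM \<gamma> (K2 f1 f2 i k) (\<lambda>s. cross3 (axis k 1) (\<tau> s)) x)"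

lemma cross_axis_\<tau>: "(\<lambda>s. cross3 (axis k 1) (\<tau> s)) \<in> borel_measurable borel" "norm (cross3 (axis k 1) (\<tau> s)) \<le> 1"
  using norm_cross_le[of "axis k 1" "\<tau> s"] by simp_all

lemma vfield_C1c:
  assumes "\<And>k. C1c (K1 f1 k) (\<lambda>i. K2 f1 f2 i k)"
  shows "C1c (vfield f1) (dvfield f1 f2)"
  unfolding vfield_def[abs_def] dvfield_def[abs_def]
  by (intro C1c_sum PM.conv_C1c assms CM_integrable[OF cross_axis_\<tau>])

lemma K2_sym: "K2 f1 f2 i k = K2 f1 f2 k i"
  by (auto simp: K2_def fun_eq_iff)

lemma dvfield_nth:
  assumes "\<And>k. C1c (K1 f1 k) (\<lambda>i. K2 f1 f2 i k)"
  shows "dvfield f1 f2 i x $ 1 = conv CM \<gamma> (K2 f1 f2 i 3) (\<lambda>s. - \<tau> s $ 2) x + conv CM \<gamma> (K2 f1 f2 i 2) (\<lambda>s. \<tau> s $ 3) x" (is ?R1)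
    "dvfield f1 f2 i x $ 2 = conv CM \<gamma> (K2 f1 f2 i 1) (\<lambda>s. - \<tau> s $ 3) x + conv CM \<gamma> (K2 f1 f2 i 3) (\<lambda>s. \<tau> s $ 1) x" (is ?R2)
    "dvfield f1 f2 i x $ 3 = conv CM \<gamma> (K2 f1 f2 i 2) (\<lambda>s. - \<tau> s $ 1) x + conv CM \<gamma> (K2 f1 f2 i 1) (\<lambda>s. \<tau> s $ 2) x" (is ?R3)
proof -
  have "dvfield f1 f2 i x $ j = (\<Sum>k\<in>UNIV. conv CM \<gamma> (K2 f1 f2 i k) (\<lambda>s. cross3 (axis k 1) (\<tau> s) $ j) x)" for j
    unfolding dvfield_def sum_component
    by (intro sum.cong refl conv_nth conv_int(2)[OF assms cross_axis_\<tau>])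
  then show ?R1
    ?R2
    ?R3
    by (simp_all add: sum_3 cross_components axis_def)
qed

lemma dvfield_div:
  assumes "\<And>k. C1c (K1 f1 k) (\<lambda>i. K2 f1 f2 i k)"
  shows "(\<Sum>i\<in>UNIV. dvfield f1 f2 i x $ i) = 0"
  by (simp add: sum_3 dvfield_nth[OF assms] conv_minus_w K2_sym[of f1 f2 2 1] K2_sym[of f1 f2 3 1] K2_sym[of f1 f2 3 2])

text \<open>This is \<open>curl curl = grad div - Laplacian\<close>. The term
  \<open>grad div\<close> vanishes by \<open>conv_closed\<close>, applied to each first partial
  derivative of the potential, and the trace of \<open>K2\<close> is its Laplacian.\<close>

lemma dvfield_curl:
  assumes A: "\<And>k. C1c (K1 f1 k) (\<lambda>i. K2 f1 f2 i k)"
  shows "curlv (dvfield f1 f2) x = - conv CM \<gamma> (\<lambda>x. \<Sum>i\<in>UNIV. K2 f1 f2 i i x) \<tau> x"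
proof -
  have 0: "(\<Sum>i\<in>UNIV. conv CM \<gamma> (K2 f1 f2 i k) (\<lambda>s. \<tau> s $ i) x) = 0" for k
    by (rule conv_closed[OF A])
  have i: "integrable CM (\<lambda>s. K2 f1 f2 i k (x - \<gamma> s) *\<^sub>R (\<tau> s))" for i k
    by (rule conv_int(2)[OF A, where B=1]) auto
  have ij: "integrable CM (\<lambda>s. K2 f1 f2 i k (x - \<gamma> s) *\<^sub>R (\<tau> s $ j))" for i k j
    using component_le_norm_cart[of "\<tau> _" j] by (intro conv_int(2)[OF A, where B=1]) auto
  have "integrable CM (\<lambda>s. (\<Sum>i\<in>UNIV. K2 f1 f2 i i (x - \<gamma> s)) *\<^sub>R \<tau> s)"
    unfolding scaleR_sum_left by (intro Bochner_Integration.integrable_sum i)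
  then have "conv CM \<gamma> (\<lambda>x. \<Sum>i\<in>UNIV. K2 f1 f2 i i x) \<tau> x $ j = conv CM \<gamma> (\<lambda>x. \<Sum>i\<in>UNIV. K2 f1 f2 i i x) (\<lambda>s. \<tau> s $ j) x" for j
    by (rule conv_nth)
  moreover have "conv CM \<gamma> (\<lambda>x. \<Sum>i\<in>UNIV. K2 f1 f2 i i x) (\<lambda>s. \<tau> s $ j) x
     = (\<Sum>i\<in>UNIV. conv CM \<gamma> (K2 f1 f2 i i) (\<lambda>s. \<tau> s $ j) x)" for j
    unfolding conv_def scaleR_sum_left using ij by (intro Bochner_Integration.integral_sum) auto
  ultimately have tr: "conv CM \<gamma> (\<lambda>x. \<Sum>i\<in>UNIV. K2 f1 f2 i i x) \<tau> x $ j = (\<Sum>i\<in>UNIV. conv CM \<gamma> (K2 f1 f2 i i) (\<lambda>s. \<tau> s $ j) x)" for j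
    by simp
  show ?thesis
    using 0[of 1] 0[of 2] 0[of 3]
    unfolding vec_eq_iff forall_3
    by (intro conjI; simp add: tr[unfolded sum_3] dvfield_nth[OF A] conv_minus_w sum_3 K2_sym[of f1 f2 2 1] K2_sym[of f1 f2 3 1] K2_sym[of f1 f2 3 2])
qed

lemma vfield_eq_curl:
  assumes A: "C1c (\<lambda>x. f0 (x \<bullet> x)) (\<lambda>i. K1 f1 i)"
  shows "curlv (\<lambda>i. conv CM \<gamma> (K1 f1 i) \<tau>) x = vfield f1 x"
proof -
  have i: "integrable CM (\<lambda>s. K1 f1 k (x - \<gamma> s) *\<^sub>R (\<tau> s))" for k
    by (rule conv_int(2)[OF A, where B=1]) auto
  have "cross3 a (conv CM \<gamma> (K1 f1 k) \<tau> x) = conv CM \<gamma> (K1 f1 k) (\<lambda>s. cross3 a (\<tau> s)) x" for a k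
  proof -
    have "bounded_linear (cross3 a)"
      using bilinear_cross unfolding bilinear_def by (auto simp: linear_conv_bounded_linear)
    from integral_bounded_linear[OF this i]
    show ?thesis unfolding conv_def by (simp add: cross_mult_right)
  qed
  then show ?thesis unfolding curlv_alt vfield_def by simp
qed

text \<open>By Ahlfors regularity the integral of
  \<open>max \<eta> (norm (x - \<gamma> s)) powr -2\<close> along the curve is at most
  \<open>30 * K / \<eta>\<close>, at every point of space. This yields the sup bounds on curls that
  the flat norm calls for.\<close>

lemma conv_bound:
  fixes m :: "real \<Rightarrow> 'b::euclidean_space"
  assumes f: "f \<in> borel_measurable borel" "\<And>z. \<bar>f z\<bar> \<le> c * max \<eta> (norm z) powr -2" and e: "0 < \<eta>" "0 \<le> c" "0 \<le> B"
    and m: "m \<in> borel_measurable borel" "\<And>s. norm (m s) \<le> B"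
  shows "norm (conv CM \<gamma> f m x) \<le> B * c * (30 * K / \<eta>)"
proof -
  note [measurable] = f(1) m(1)
  have "ennreal (norm (conv CM \<gamma> f m x)) \<le> (\<integral>\<^sup>+s. norm (f (x - \<gamma> s) *\<^sub>R m s) \<partial>CM)"
  proof (cases "integrable CM (\<lambda>s. f (x - \<gamma> s) *\<^sub>R m s)")
    case True
    then show ?thesis unfolding conv_def by (rule integral_norm_bound_ennreal)
  next
    case False
    then show ?thesis unfolding conv_def by (simp add: not_integrable_integral_eq)
  qed
  also have "\<dots> \<le> (\<integral>\<^sup>+s. ennreal (B * c) * ennreal (max \<eta> (norm (x - \<gamma> s)) powr -2) \<partial>CM)"
  proof (rule nn_integral_mono)
    fix s
    have "norm (f (x - \<gamma> s) *\<^sub>R m s) \<le> (c * max \<eta> (norm (x - \<gamma> s)) powr -2) * B"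
      unfolding norm_scaleR using f(2) m(2) e by (intro mult_mono) auto
    then show "ennreal (norm (f (x - \<gamma> s) *\<^sub>R m s)) \<le> ennreal (B * c) * ennreal (max \<eta> (norm (x - \<gamma> s)) powr -2)"
      using e by (subst ennreal_mult[symmetric]) (auto simp: mult_ac intro!: ennreal_leI)
  qed
  also have "\<dots> = ennreal (B * c) * (\<integral>\<^sup>+s. ennreal (max \<eta> (norm (x - \<gamma> s)) powr -2) \<partial>CM)"
    by (rule nn_integral_cmult) (rule borel_CM, measurable)
  also have "\<dots> \<le> ennreal (B * c) * ennreal (15 * K * (\<eta> powr (1 - 2) * 2 / (2 - 1)))"
    using e by (intro mult_left_mono CM_max_powr_le) auto
  also have "\<dots> = ennreal (B * c * (30 * K / \<eta>))"
    using e K by (subst ennreal_mult[symmetric]) (auto simp: powr_minus_divide mult_ac)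
  finally show ?thesis using e K by (simp add: ennreal_le_iff)
qed

end

lemma DERIV_glue:
  fixes p q :: "real \<Rightarrow> real"
  assumes p: "\<And>y. y \<le> c \<Longrightarrow> DERIV p y :> p' y" and q: "\<And>y. c \<le> y \<Longrightarrow> DERIV q y :> q' y"
    and e: "p c = q c" "p' c = q' c"
  shows "DERIV (\<lambda>y. if y \<le> c then p y else q y) y :> (if y \<le> c then p' y else q' y)"
proof -
  let ?f = "\<lambda>y. if y \<le> c then p y else q y"
  consider "y < c" | "y > c" | "y = c" by linarith
  then show ?thesis
  proof cases
    case 1
    have "eventually (\<lambda>t. p t = ?f t) (nhds y)"
      using order_tendstoD(2)[OF tendsto_ident_at 1] eventually_nhds_in_open[of "{..<c}" y] 1
      by (auto elim!: eventually_mono)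
    then show ?thesis using p[of y] 1 DERIV_cong_ev[of y y p ?f "p' y" "p' y"] by simp
  next
    case 2
    have "eventually (\<lambda>t. q t = ?f t) (nhds y)"
      using eventually_nhds_in_open[of "{c<..}" y] 2 by (auto elim!: eventually_mono)
    then show ?thesis using q[of y] 2 DERIV_cong_ev[of y y q ?f "q' y" "q' y"] by simp
  next
    case 3
    have "((\<lambda>h. (?f (c + h) - ?f c) / h) \<longlongrightarrow> p' c) (at_left 0)"
    proof (rule Lim_transform_eventually)
      show "((\<lambda>h. (p (c + h) - p c) / h) \<longlongrightarrow> p' c) (at_left 0)"
        using p[of c] by (auto simp: DERIV_def filterlim_at_split)
      show "\<forall>\<^sub>F h in at_left 0. (p (c + h) - p c) / h = (?f (c + h) - ?f c) / h"
        by (auto simp: eventually_at_filter)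
    qed
    moreover have "((\<lambda>h. (?f (c + h) - ?f c) / h) \<longlongrightarrow> p' c) (at_right 0)"
    proof (rule Lim_transform_eventually)
      show "((\<lambda>h. (q (c + h) - q c) / h) \<longlongrightarrow> p' c) (at_right 0)"
        using q[of c] e(2) by (auto simp: DERIV_def filterlim_at_split)
      show "\<forall>\<^sub>F h in at_right 0. (q (c + h) - q c) / h = (?f (c + h) - ?f c) / h"
        by (auto simp: eventually_at_filter e)
    qed
    ultimately show ?thesis using 3 by (simp add: DERIV_def filterlim_at_split)
  qed
qed

section \<open>The truncated Newton kernel\<close>

text \<open>The function \<open>y powr -(1/2)\<close>, continued below \<open>y = 1\<close> by its Taylor polynomial of degree two; thus \<open>Gam R (x \<bullet> x)\<close> is a
  superharmonic function that agrees with the Newton kernel outside the ball of radius \<open>R\<close>, and \<open>del R\<close> is minus its Laplacian.\<close>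

definition gam0 :: "real \<Rightarrow> real" where
  "gam0 y = (if y \<le> 1 then 1 + (1 - y) / 2 + 3/8 * (1 - y)\<^sup>2 else y powr -(1/2))"
definition gam1 :: "real \<Rightarrow> real" where
  "gam1 y = (if y \<le> 1 then - 1/2 - 3/4 * (1 - y) else - (1/2) * y powr -(3/2))"
definition gam2 :: "real \<Rightarrow> real" where
  "gam2 y = (if y \<le> 1 then 3/4 else 3/4 * y powr -(5/2))"

lemma DERIV_powr':
  fixes y c r :: real
  shows "0 < y \<Longrightarrow> DERIV (\<lambda>y. c * y powr r) y :> c * r * y powr (r - 1)"
  using DERIV_cmult[OF has_real_derivative_powr[of y r], of c] by (simp add: mult.assoc)

lemma gam_deriv: "DERIV gam0 y :> gam1 y" "DERIV gam1 y :> gam2 y"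
proof -
  have "DERIV (\<lambda>y. if y \<le> 1 then 1 + (1 - y) / 2 + 3/8 * (1 - y)\<^sup>2 else y powr -(1/2)) y :>
     (if y \<le> 1 then - 1/2 - 3/4 * (1 - y) else - (1/2) * y powr -(3/2))"
  proof (rule DERIV_glue)
    fix y :: real
    show "DERIV (\<lambda>y. 1 + (1 - y) / 2 + 3/8 * (1 - y)\<^sup>2) y :> - 1/2 - 3/4 * (1 - y)"
      by (auto intro!: derivative_eq_intros simp: field_simps)
    show "DERIV (\<lambda>y. y powr -(1/2)) y :> - (1/2) * y powr -(3/2)" if "1 \<le> y"
      using DERIV_powr'[of y 1 "-(1/2)"] that by simp
  qed auto
  then show "DERIV gam0 y :> gam1 y" unfolding gam0_def[abs_def] gam1_def .
  have "DERIV (\<lambda>y. if y \<le> 1 then - 1/2 - 3/4 * (1 - y) else - (1/2) * y powr -(3/2)) y :>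
     (if y \<le> 1 then 3/4 else 3/4 * y powr -(5/2))"
  proof (rule DERIV_glue)
    fix y :: real
    show "DERIV (\<lambda>y. - 1/2 - 3/4 * (1 - y)) y :> 3/4"
      by (auto intro!: derivative_eq_intros)
    show "DERIV (\<lambda>y. - (1/2) * y powr -(3/2)) y :> 3/4 * y powr -(5/2)" if "1 \<le> y"
      using DERIV_powr'[of y "-(1/2)" "-(3/2)"] that by simp
  qed auto
  then show "DERIV gam1 y :> gam2 y" unfolding gam1_def[abs_def] gam2_def .
qed

lemma gam2_max: "gam2 y = 3/4 * max 1 y powr -(5/2)"
  by (simp add: gam2_def max_def)

lemma gam2_cont: "continuous_on UNIV gam2"
  unfolding gam2_max[abs_def] by (intro continuous_intros) auto

definition Gam :: "real \<Rightarrow> real \<Rightarrow> real" where "Gam R y = 1 / (4*pi*R) * gam0 (y / R\<^sup>2)"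
definition Gam' :: "real \<Rightarrow> real \<Rightarrow> real" where "Gam' R y = 1 / (4*pi*R^3) * gam1 (y / R\<^sup>2)"
definition Gam'' :: "real \<Rightarrow> real \<Rightarrow> real" where "Gam'' R y = 1 / (4*pi*R^5) * gam2 (y / R\<^sup>2)"

definition del :: "real \<Rightarrow> real \<Rightarrow> real" where
  "del R y = 15 / (8 * pi * R^3) * max 0 (1 - y / R\<^sup>2)"

lemma Gam_deriv:
  assumes "R > 0"
  shows "DERIV (Gam R) y :> Gam' R y" "DERIV (Gam' R) y :> Gam'' R y"
proof -
  have s: "DERIV (\<lambda>y. y / R\<^sup>2) y :> 1 / R\<^sup>2" by (rule DERIV_cdivide) simp
  show "DERIV (Gam R) y :> Gam' R y"
    unfolding Gam_def[abs_def] Gam'_def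
    using DERIV_cmult[OF DERIV_chain2[OF gam_deriv(1) s], of "1 / (4*pi*R)"]
    by (simp add: power2_eq_square power3_eq_cube mult_ac)
  show "DERIV (Gam' R) y :> Gam'' R y"
    unfolding Gam'_def[abs_def] Gam''_def
    using DERIV_cmult[OF DERIV_chain2[OF gam_deriv(2) s], of "1 / (4*pi*R^3)"]
    by (simp add: power_numeral_reduce mult_ac)
qed

lemma Gam''_cont: "R > 0 \<Longrightarrow> continuous_on UNIV (Gam'' R)"
  unfolding Gam''_def[abs_def] by (intro continuous_intros continuous_on_compose2[OF gam2_cont]) auto

lemma powr_sq:
  fixes R r :: real
  assumes "R > 0"
  shows "(R\<^sup>2) powr r = R powr (2 * r)"
proof -
  have "R\<^sup>2 = R powr 2" using assms by (simp add: powr_numeral)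
  then show ?thesis by (simp only: powr_powr)
qed

lemma powr_sq_div:
  fixes R r y :: real
  assumes "R > 0" "y > 0"
  shows "(y / R\<^sup>2) powr r = y powr r * R powr (-2 * r)"
proof -
  show ?thesis using assms powr_sq[OF assms(1), of r] by (simp add: powr_divide powr_minus_divide)
qed

lemma Gam_outer:
  assumes "R > 0" "R\<^sup>2 \<le> y"
  shows "Gam R y = 1 / (4*pi) * y powr -(1/2)" "Gam' R y = - 1 / (8*pi) * y powr -(3/2)"
    "Gam'' R y = 3 / (16*pi) * y powr -(5/2)"
proof -
  have y: "y > 0" using assms by (meson less_le_trans zero_less_power)
  have u: "1 \<le> y / R\<^sup>2" using assms by simp
  have p: "R powr 1 = R" "R powr 3 = R^3" "R powr 5 = R^5" using assms by (simp_all add: powr_numeral)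
  have g: "gam0 u = u powr -(1/2)" "gam1 u = -(1/2) * u powr -(3/2)" "gam2 u = 3/4 * u powr -(5/2)" if "1 \<le> u" for u
    using that by (cases "u = 1"; simp add: gam0_def gam1_def gam2_def)+
  show "Gam R y = 1 / (4*pi) * y powr -(1/2)"
    unfolding Gam_def g(1)[OF u] powr_sq_div[OF assms(1) y] using assms p by simp
  show "Gam' R y = - 1 / (8*pi) * y powr -(3/2)"
    unfolding Gam'_def g(2)[OF u] powr_sq_div[OF assms(1) y] using assms p by simp
  show "Gam'' R y = 3 / (16*pi) * y powr -(5/2)"
    unfolding Gam''_def g(3)[OF u] powr_sq_div[OF assms(1) y] using assms p by simp
qed

text \<open>In closed form \<open>Gam'' R y\<close> is
  \<open>3 / (16 * pi) * max (R\<^sup>2) y powr -(5/2)\<close>, which decreases in \<open>R\<close>.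
  Hence \<open>GG' a b\<close> increases up to its zero at \<open>b\<^sup>2\<close>, so it is
  nonpositive before, and \<open>GG a b\<close> is decreasing and nonnegative.\<close>

lemma Gam''_mono:
  assumes "0 < a" "a \<le> b" "0 \<le> y"
  shows "Gam'' b y \<le> Gam'' a y"
proof -
  have *: "Gam'' R y = 3 / (16*pi) * max (R\<^sup>2) y powr -(5/2)" if R: "R > 0" for R
  proof (cases "R\<^sup>2 \<le> y")
    case True then show ?thesis using Gam_outer(3)[OF R True] by (simp add: max_def)
  next
    case False
    then have "y / R\<^sup>2 \<le> 1" using R by simp
    moreover have "(R\<^sup>2) powr -(5/2) = 1 / R^5"
      using powr_sq[OF R, of "-(5/2)"] R by (simp add: powr_minus_divide powr_numeral)
    ultimately show ?thesis using False R by (simp add: Gam''_def gam2_def max_def)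
  qed
  have "max (b\<^sup>2) y powr -(5/2) \<le> max (a\<^sup>2) y powr -(5/2)"
    using assms by (intro powr_mono2' max.mono power_mono) (auto simp: less_max_iff_disj)
  then have "3 / (16*pi) * max (b\<^sup>2) y powr -(5/2) \<le> 3 / (16*pi) * max (a\<^sup>2) y powr -(5/2)"
    by (intro mult_left_mono) auto
  moreover have "b > 0" using assms by simp
  ultimately show ?thesis using assms(1) by (simp only: *)
qed

text \<open>The Newton kernel restricted to the scales between \<open>a\<close> and
  \<open>b\<close>: smoothed below \<open>a\<close>, and zero beyond \<open>b\<close> because both
  truncations agree there. This gives a compactly supported potential for the test field.\<close>

definition GG :: "real \<Rightarrow> real \<Rightarrow> real \<Rightarrow> real" where "GG a b y = Gam a y - Gam b y"
definition GG' :: "real \<Rightarrow> real \<Rightarrow> real \<Rightarrow> real" where "GG' a b y = Gam' a y - Gam' b y"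
definition GG'' :: "real \<Rightarrow> real \<Rightarrow> real \<Rightarrow> real" where "GG'' a b y = Gam'' a y - Gam'' b y"

lemma GG_deriv:
  assumes "0 < a" "a \<le> b"
  shows "DERIV (GG a b) y :> GG' a b y" "DERIV (GG' a b) y :> GG'' a b y" "continuous_on UNIV (GG'' a b)"
  unfolding GG_def[abs_def] GG'_def[abs_def] GG''_def[abs_def]
  using assms by (auto intro!: DERIV_diff Gam_deriv continuous_on_diff Gam''_cont)

lemma GG_zero:
  assumes "0 < a" "a \<le> b" "b\<^sup>2 \<le> y"
  shows "GG a b y = 0" "GG' a b y = 0" "GG'' a b y = 0"
proof -
  have "a\<^sup>2 \<le> y" using assms power_mono[of a b 2] by linarith
  then show "GG a b y = 0" "GG' a b y = 0" "GG'' a b y = 0"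
    using assms by (simp_all add: GG_def GG'_def GG''_def Gam_outer)
qed

lemma GG'_nonpos:
  assumes "0 < a" "a \<le> b" "0 \<le> y"
  shows "GG' a b y \<le> 0"
proof (cases "b\<^sup>2 \<le> y")
  case True then show ?thesis using GG_zero[OF assms(1,2)] by simp
next
  case False
  have "GG' a b y \<le> GG' a b (b\<^sup>2)"
  proof (rule DERIV_nonneg_imp_nondecreasing[where f="GG' a b"])
    fix x assume "y \<le> x" "x \<le> b\<^sup>2"
    then have "0 \<le> GG'' a b x" using Gam''_mono[OF assms(1,2), of x] assms by (simp add: GG''_def)
    then show "\<exists>y. DERIV (GG' a b) x :> y \<and> 0 \<le> y" using GG_deriv(2)[OF assms(1,2)] by blast
  qed (use False in simp)
  then show ?thesis using GG_zero(2)[OF assms(1,2), of "b\<^sup>2"] by simp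
qed

lemma GG_antimono:
  assumes "0 < a" "a \<le> b" "0 \<le> x" "x \<le> y"
  shows "GG a b y \<le> GG a b x"
proof (rule DERIV_nonpos_imp_nonincreasing[where f="GG a b"])
  fix z assume "x \<le> z" "z \<le> y"
  then have "GG' a b z \<le> 0" using assms by (intro GG'_nonpos) auto
  then show "\<exists>y. DERIV (GG a b) z :> y \<and> y \<le> 0" using GG_deriv(1)[OF assms(1,2)] by blast
qed (use assms in simp)

lemma GG_nonneg:
  assumes "0 < a" "a \<le> b" "0 \<le> y"
  shows "0 \<le> GG a b y"
proof (cases "b\<^sup>2 \<le> y")
  case True then show ?thesis using GG_zero[OF assms(1,2)] by simp
next
  case False
  then show ?thesis using GG_antimono[OF assms(1,2,3), of "b\<^sup>2"] GG_zero(1)[OF assms(1,2), of "b\<^sup>2"] by simp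
qed

lemma gam0_bounds: "0 \<le> y \<Longrightarrow> 0 \<le> gam0 y" "0 \<le> y \<Longrightarrow> gam0 y \<le> 15/8" "0 < y \<Longrightarrow> gam0 y \<le> y powr -(1/2)"
proof -
  show "0 \<le> y \<Longrightarrow> 0 \<le> gam0 y" by (auto simp: gam0_def)
  show "gam0 y \<le> 15/8" if "0 \<le> y"
  proof (cases "y \<le> 1")
    case True
    have "(1 - y)\<^sup>2 \<le> 1\<^sup>2" using that True by (intro power_mono) auto
    moreover have "w \<le> 1 \<Longrightarrow> 1 + (1 - y) / 2 + 3/8 * w \<le> 15/8" for w :: real using that by (simp add: field_simps)
    ultimately show ?thesis using True by (simp add: gam0_def)
  next
    case False
    have "y powr -(1/2) \<le> 1 powr -(1/2)" using False by (intro powr_mono2') auto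
    then show ?thesis using False by (simp add: gam0_def)
  qed
  show "gam0 y \<le> y powr -(1/2)" if "0 < y"
  proof (cases "y \<le> 1")
    case True
    define r where "r = sqrt y"
    have r: "0 < r" "r \<le> 1" "y = r\<^sup>2" using that True by (auto simp: r_def)
    \<comment> \<open>With \<open>y = r\<^sup>2\<close> the claim reads
      \<open>r * (15 - 10 * r\<^sup>2 + 3 * r^4) \<le> 8\<close>. The triple root at
      \<open>r = 1\<close> of the difference reflects that the Taylor polynomial matches
      \<open>y powr -(1/2)\<close> to second order there.\<close>
    have "0 \<le> (1 - r)^3 * (8 + 9 * r + 3 * r\<^sup>2)" using r by (intro mult_nonneg_nonneg) auto
    also have "\<dots> = 8 - 15 * r + 10 * r^3 - 3 * r^5"
      by (simp add: power_numeral_reduce algebra_simps)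
    finally have "r * (15 - 10 * r\<^sup>2 + 3 * (r\<^sup>2)\<^sup>2) \<le> 8"
      by (simp add: power_numeral_reduce algebra_simps)
    moreover have "8 * gam0 y = 15 - 10 * y + 3 * y\<^sup>2"
      using True by (simp add: gam0_def power2_diff diff_divide_distrib add_divide_distrib algebra_simps)
    ultimately have "r * (8 * gam0 y) \<le> 8" by (simp add: r(3))
    then have "gam0 y \<le> 1 / r" using r by (simp add: field_simps)
    also have "1 / r = y powr -(1/2)" using that by (simp add: r_def powr_minus_divide powr_half_sqrt)
    finally show ?thesis .
  qed (simp add: gam0_def)
qed

lemma Gam_nonneg: "0 < R \<Longrightarrow> 0 \<le> y \<Longrightarrow> 0 \<le> Gam R y"
  by (simp add: Gam_def gam0_bounds)

lemma Gam_le: "0 < R \<Longrightarrow> 0 \<le> y \<Longrightarrow> Gam R y \<le> 15 / (32 * pi * R)"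
  using gam0_bounds(2)[of "y / R\<^sup>2"] by (simp add: Gam_def field_simps)

lemma sqrt_inner: "sqrt (x \<bullet> x) = norm x"
  by (simp add: norm_eq_sqrt_inner)

lemma Gam_le_newton:
  assumes "0 < R" "x \<noteq> 0"
  shows "Gam R (x \<bullet> x) \<le> 1 / (4 * pi * norm x)"
proof -
  have x: "0 < x \<bullet> x" using assms by simp
  have "gam0 (x \<bullet> x / R\<^sup>2) \<le> (x \<bullet> x / R\<^sup>2) powr -(1/2)" using assms x by (intro gam0_bounds) auto
  also have "\<dots> = R / norm x"
    using powr_sq_div[OF assms(1) x, of "-(1/2)"] assms x by (simp add: powr_minus_divide powr_half_sqrt sqrt_inner)
  finally show ?thesis using assms unfolding Gam_def by (simp add: field_simps)
qed

lemma GG_le_newton: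
  assumes "0 < a" "a \<le> b" "x \<noteq> 0"
  shows "GG a b (x \<bullet> x) \<le> 1 / (4 * pi * norm x)"
  using Gam_le_newton[OF assms(1,3)] Gam_nonneg[of b "x \<bullet> x"] assms by (simp add: GG_def)

lemma GG_ge:
  assumes "0 < a" "a \<le> b" "a \<le> h"
  shows "1 / (4 * pi * h) - 15 / (32 * pi * b) \<le> GG a b (h\<^sup>2)"
proof -
  have h: "h > 0" using assms by simp
  have "Gam a (h\<^sup>2) = 1 / (4*pi) * (h\<^sup>2) powr -(1/2)"
    using assms by (intro Gam_outer power_mono) auto
  also have "(h\<^sup>2) powr -(1/2) = 1 / h" using h by (simp add: powr_minus_divide powr_half_sqrt)
  finally show ?thesis using Gam_le[of b "h\<^sup>2"] assms by (simp add: GG_def)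
qed

text \<open>The left side is the Laplacian of \<open>Gam R (x \<bullet> x)\<close>: in three
  dimensions a radial function of \<open>y = x \<bullet> x\<close> has Laplacian
  \<open>6 f' + 4 y f''\<close>. Outside the ball it vanishes since the Newton kernel is harmonic;
  inside, the quadratic continuation leaves a nonpositive multiple of
  \<open>1 - y / R\<^sup>2\<close>.\<close>

lemma del_eq:
  assumes "R > 0"
  shows "6 * Gam' R y + 4 * y * Gam'' R y = - del R y"
proof (cases "y \<le> R\<^sup>2")
  case True
  define u where "u = y / R\<^sup>2"
  have u: "u \<le> 1" "y = u * R\<^sup>2" using True assms by (auto simp: u_def)
  have "6 * Gam' R y + 4 * y * Gam'' R y = 1 / (4*pi*R^3) * (6 * gam1 u + 4 * u * gam2 u)"
    using assms unfolding Gam'_def Gam''_def u_def[symmetric]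
    by (simp add: u(2) field_simps power_numeral_reduce)
  also have "6 * gam1 u + 4 * u * gam2 u = - (15/2) * (1 - u)" using u by (simp add: gam1_def gam2_def field_simps)
  finally show ?thesis using u assms by (simp add: del_def max_def u_def[symmetric])
next
  case False
  then have o: "R\<^sup>2 \<le> y" and y: "y > 0" using assms order_le_less_trans[OF zero_le_power2, of R y] by auto
  have "y * y powr -(5/2) = y powr -(3/2)" using y by (simp add: powr_mult_base)
  moreover have "del R y = 0" using False assms by (simp add: del_def max_def field_simps)
  ultimately show ?thesis unfolding Gam_outer(2,3)[OF assms o] by (simp add: algebra_simps)
qed

lemma K2_trace: "(\<Sum>i\<in>UNIV. K2 f1 f2 i i x) = 6 * f1 (x \<bullet> x) + 4 * (x \<bullet> x) * f2 (x \<bullet> x)"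
  by (simp add: sum_3 K2_def inner_vec_def algebra_simps)

lemma K2_trace_GG:
  assumes "0 < a" "a \<le> b"
  shows "(\<Sum>i\<in>UNIV. K2 (GG' a b) (GG'' a b) i i x) = del b (x \<bullet> x) - del a (x \<bullet> x)"
  using del_eq[of a "x \<bullet> x"] del_eq[of b "x \<bullet> x"] assms unfolding K2_trace
  by (simp add: GG'_def GG''_def algebra_simps)

lemma C1c_GG:
  assumes "0 < a" "a \<le> b"
  shows "C1c (\<lambda>x. GG a b (x \<bullet> x)) (\<lambda>i. K1 (GG' a b) i)" (is ?R1) "C1c (K1 (GG' a b) k) (\<lambda>i. K2 (GG' a b) (GG'' a b) i k)" (is ?R2)
proof -
  show ?R1
    by (rule C1c_radial[where R=b]) (use assms in \<open>auto intro!: GG_deriv GG_zero DERIV_cont[OF GG_deriv(2)]\<close>)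
  show ?R2
    by (rule C1c_K1[where R=b]) (use assms in \<open>auto intro!: GG_deriv GG_zero\<close>)
qed

lemma del_nonneg: "0 < R \<Longrightarrow> 0 \<le> del R y"
  by (simp add: del_def)

lemma del_le: "0 < R \<Longrightarrow> 0 \<le> y \<Longrightarrow> del R y \<le> 15 / (8 * pi * R^3)"
proof -
  assume R: "0 < R" and y: "0 \<le> y"
  have "15 / (8 * pi * R^3) * max 0 (1 - y / R\<^sup>2) \<le> 15 / (8 * pi * R^3) * 1"
    using R y by (intro mult_left_mono) auto
  then show "del R y \<le> 15 / (8 * pi * R^3)" by (simp add: del_def)
qed

lemma del_zero: "0 < R \<Longrightarrow> R\<^sup>2 \<le> y \<Longrightarrow> del R y = 0"
  by (simp add: del_def max_def)

lemma del_cont: "0 < R \<Longrightarrow> continuous_on UNIV (\<lambda>x::real^3. del R (x \<bullet> x))"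
  unfolding del_def by (intro continuous_intros) auto

lemma del_integrable: "0 < R \<Longrightarrow> integrable lborel (\<lambda>x::real^3. del R (x \<bullet> x))"
  by (rule compact_supp_integrable[where R=R, OF del_cont]) (auto simp add: del_zero norm_ge_sq)

text \<open>The superlevel set of \<open>1 - x \<bullet> x / R\<^sup>2\<close> at level
  \<open>t\<close> is a ball of radius \<open>R * sqrt (1 - t)\<close>, so the mass reduces to
  integrating \<open>(1 - t) powr (3/2)\<close>, which gives \<open>2/5\<close>. This is the origin
  of the factor \<open>15/8\<close> in \<open>del\<close>.\<close>

lemma del_mass:
  assumes R: "0 < R"
  shows "(LBINT x. del R ((x::real^3) \<bullet> x)) = 1"
proof -
  let ?f = "\<lambda>x::real^3. max 0 (1 - x \<bullet> x / R\<^sup>2)"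
  have cut: "(\<integral>\<^sup>+t. indicator {0..<?f x} t \<partial>lborel) = ennreal (?f x)" for x
    by simp
  have m: "Measurable.pred (lborel \<Otimes>\<^sub>M lborel) (\<lambda>(x::real^3, t). 0 \<le> t \<and> t < ?f x)" by measurable
  have "(\<integral>\<^sup>+x. ennreal (?f x) \<partial>lborel) = (\<integral>\<^sup>+x. \<integral>\<^sup>+t. (if 0 \<le> t \<and> t < ?f x then 1 else 0) \<partial>lborel \<partial>lborel)"
    unfolding cut[symmetric] by (intro nn_integral_cong) (auto simp: indicator_def)
  also have "\<dots> = (\<integral>\<^sup>+t. \<integral>\<^sup>+x. (if 0 \<le> t \<and> t < ?f x then 1 else 0) \<partial>lborel \<partial>lborel)"
    by (rule lborel_pair.Fubini'[symmetric]) measurable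
  also have "\<dots> = (\<integral>\<^sup>+t. ennreal (4/3 * pi * R^3 * (1 - t) powr (3/2)) * indicator {0..1} t \<partial>lborel)"
  proof (rule nn_integral_cong_AE)
    have "AE t::real in lborel. t \<noteq> 1" by (rule AE_lborel_singleton)
    then show "AE t in lborel. (\<integral>\<^sup>+x. (if 0 \<le> t \<and> t < ?f x then 1 else 0) \<partial>lborel) = ennreal (4/3 * pi * R^3 * (1 - t) powr (3/2)) * indicator {0..1} t"
    proof eventually_elim
      fix t :: real assume t1: "t \<noteq> 1"
      show "(\<integral>\<^sup>+x. (if 0 \<le> t \<and> t < ?f x then 1 else 0) \<partial>lborel) = ennreal (4/3 * pi * R^3 * (1 - t) powr (3/2)) * indicator {0..1} t"
      proof (cases "0 \<le> t \<and> t < 1")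
        case True
        define r where "r = R * sqrt (1 - t)"
        have r: "r > 0" "r\<^sup>2 = R\<^sup>2 * (1 - t)" using True R by (auto simp: r_def power_mult_distrib)
        have "t < ?f x \<longleftrightarrow> x \<in> ball 0 r" for x
        proof -
          have "t < ?f x \<longleftrightarrow> x \<bullet> x / R\<^sup>2 < 1 - t" using True by auto
          also have "\<dots> \<longleftrightarrow> x \<bullet> x < r\<^sup>2" using R unfolding r(2) by (subst pos_divide_less_eq) (auto simp: mult.commute)
          also have "\<dots> \<longleftrightarrow> norm x < r" using r(1) by (metis norm_ge_zero power2_norm_eq_inner power_less_imp_less_base power_strict_mono less_imp_le zero_less_numeral)
          finally show ?thesis by simp
        qed
        then have "(\<integral>\<^sup>+x. (if 0 \<le> t \<and> t < ?f x then 1 else 0) \<partial>lborel) = (\<integral>\<^sup>+x. indicator (ball (0::real^3) r) x \<partial>lborel)"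
          using True by (intro nn_integral_cong) (auto simp: indicator_def)
        also have "\<dots> = emeasure lborel (ball (0::real^3) r)" by simp
        also have "\<dots> = ennreal (4/3 * pi * r^3)" using emeasure_ball[of r "0::real^3"] r by (simp add: eval_unit_ball_vol mult.commute)
        also have "r^3 = R^3 * (1 - t) powr (3/2)"
        proof -
          have "sqrt (1 - t) ^ 3 = ((1 - t) powr (1/2)) powr 3" using True by (simp add: powr_half_sqrt powr_numeral)
          also have "\<dots> = (1 - t) powr (3/2)" by (simp add: powr_powr)
          finally show ?thesis by (simp add: r_def power_mult_distrib)
        qed
        finally show ?thesis using True by (simp add: mult.assoc)
      next
        case False
        then have z: "(if 0 \<le> t \<and> t < ?f x then 1 else 0) = (0::ennreal)" for x
          by (auto simp: max_def not_less intro: order_trans[of _ 1])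
        show ?thesis unfolding z using False t1 by (auto simp: indicator_def)
      qed
    qed
  qed
  also have "\<dots> = ennreal (4/3 * pi * R^3 * (2/5))"
  proof -
    have "((\<lambda>t. 4/3 * pi * R^3 * (1 - t) powr (3/2)) has_integral (4/3 * pi * R^3 * (2/5))) {0..1}"
    proof -
      have "((\<lambda>t::real. (1 - t) powr (3/2)) has_integral ((- (2/5) * (1 - 1) powr (5/2)) - (- (2/5) * (1 - 0) powr (5/2)))) {0..1}"
      proof (rule fundamental_theorem_of_calculus_interior)
        show "continuous_on {0..1} (\<lambda>t::real. - (2/5) * (1 - t) powr (5/2))"
          by (intro continuous_on_mult continuous_on_const continuous_on_powr' continuous_on_diff continuous_on_id) auto
        fix t :: real assume t: "t \<in> {0<..<1}"
        have "DERIV (\<lambda>t. - (2/5) * (1 - t) powr (5/2)) t :> (1 - t) powr (3/2)"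
          using t by (auto intro!: derivative_eq_intros)
        then show "((\<lambda>t. - (2/5) * (1 - t) powr (5/2)) has_vector_derivative (1 - t) powr (3/2)) (at t)"
          by (simp add: has_real_derivative_iff_has_vector_derivative)
      qed simp
      from has_integral_mult_right[OF this, of "4/3 * pi * R^3"] show ?thesis by simp
    qed
    from nn_integral_has_integral_lebesgue[OF _ this] R
    have "(\<integral>\<^sup>+t. ennreal (indicator {0..1} t * (4/3 * pi * R^3 * (1 - t) powr (3/2))) \<partial>lborel) = ennreal (4/3 * pi * R^3 * (2/5))"
      by (simp add: nn_integral_completion)
    moreover have "(\<integral>\<^sup>+t. ennreal (4/3 * pi * R^3 * (1 - t) powr (3/2)) * indicator {0..1} t \<partial>lborel)
       = (\<integral>\<^sup>+t. ennreal (indicator {0..1} t * (4/3 * pi * R^3 * (1 - t) powr (3/2))) \<partial>lborel)"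
      by (intro nn_integral_cong) (auto split: split_indicator)
    ultimately show ?thesis by simp
  qed
  finally have nn: "(\<integral>\<^sup>+x. ennreal (?f x) \<partial>lborel) = ennreal (8 * pi * R^3 / 15)" by (simp add: mult.assoc)
  have "(LBINT x. ?f x) = 8 * pi * R^3 / 15"
    by (subst integral_eq_nn_integral) (use R in \<open>auto simp: nn\<close>)
  then show ?thesis unfolding del_def using R by simp
qed

section \<open>Averages of the truncated kernel and the quadratic form of the energy\<close>

lemma lborel_integral_reflect:
  fixes f :: "real^3 \<Rightarrow> real"
  assumes [measurable]: "f \<in> borel_measurable borel"
  shows "(LBINT y. f (c - y)) = (LBINT x. f x)"
proof -
  have "lborel = distr lborel borel (\<lambda>x::real^3. c + (-1) *\<^sub>R x)"
    using lborel_affine[of "-1" c] by (simp add: density_1)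
  then have "(LBINT x. f x) = (\<integral>x. f x \<partial>distr lborel borel (\<lambda>x. c + (-1) *\<^sub>R x))" by simp
  also have "\<dots> = (LBINT x. f (c - x))" by (subst integral_distr) auto
  finally show ?thesis ..
qed

definition avg :: "real \<Rightarrow> real \<Rightarrow> real \<Rightarrow> real^3 \<Rightarrow> real" where
  "avg a l c z = (LBINT y. del c (y \<bullet> y) * GG a l ((z - y) \<bullet> (z - y)))"

lemma cont_int_prod:
  fixes f g :: "real^3 \<Rightarrow> real"
  assumes "continuous_on UNIV f" "\<And>x. R \<le> norm x \<Longrightarrow> f x = 0" "continuous_on UNIV g"
  shows "integrable lborel (\<lambda>x. f x * g x)" "integrable lborel (\<lambda>x. f x * g (z - x))"
  by (rule compact_supp_integrable[where R=R]; use assms in \<open>auto intro!: continuous_intros continuous_on_compose2[OF assms(3)]\<close>)+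

lemma del_GG_integrable:
  assumes "0 < a" "a \<le> l" "0 < c"
  shows "integrable lborel (\<lambda>y::real^3. del c (y \<bullet> y) * GG a l ((z - y) \<bullet> (z - y)))"
  using cont_int_prod(2)[OF del_cont _ C1c_cont[OF C1c_GG(1)], of c c a l z] assms
  by (simp add: del_zero norm_ge_sq)

text \<open>Green's identity: \<open>del a - del a'\<close> is the Laplacian of
  \<open>GG a' a\<close>, and two integrations by parts move that Laplacian to
  \<open>GG a l\<close>, where it equals \<open>del l - del a\<close>.\<close>

lemma avg_green:
  assumes a: "0 < a'" "a' \<le> a" "a \<le> l"
  shows "avg a l a z - avg a l a' z
    = (LBINT y. GG a' a (y \<bullet> y) * (del l ((z - y) \<bullet> (z - y)) - del a ((z - y) \<bullet> (z - y))))"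
proof -
  have al: "0 < a" "a \<le> l" using a by auto
  let ?W = "\<lambda>y::real^3. GG a' a (y \<bullet> y)" and ?G = "\<lambda>y::real^3. GG a l (y \<bullet> y)"
  let ?W1 = "K1 (GG' a' a)" and ?G1 = "K1 (GG' a l)" and ?W2 = "K2 (GG' a' a) (GG'' a' a)" and ?G2 = "K2 (GG' a l) (GG'' a l)"
  note W = C1c_GG[OF a(1,2)] and G = C1c_GG[OF al]
  have 1: "(LBINT y. ?W2 i i y * ?G (z - y)) = (LBINT y. ?W y * ?G2 i i (z - y))" for i
  proof -
    have "(LBINT y. ?W2 i i y * ?G (z - y)) = (LBINT y. ?W1 i y * ?G1 i (z - y))"
      using C1c_ibp[OF W(2) C1c_reflect[OF G(1)], of i i z] by simp
    also have "\<dots> = (LBINT y. ?W y * ?G2 i i (z - y))"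
      using C1c_ibp[OF W(1) C1c_reflect[OF G(2)], of i i z] by simp
    finally show ?thesis .
  qed
  have i1: "integrable lborel (\<lambda>y. ?W2 i i y * ?G (z - y))" and i2: "integrable lborel (\<lambda>y. ?W y * ?G2 i i (z - y))" for i
    using C1c_prod_integrable(1)[OF W(2) C1c_reflect[OF G(1)]]
      C1c_prod_integrable(2)[OF W(1) C1c_reflect[OF G(2)]] by simp_all
  have "avg a l a z - avg a l a' z = (LBINT y. (del a (y \<bullet> y) - del a' (y \<bullet> y)) * ?G (z - y))"
    unfolding avg_def using del_GG_integrable[OF al] a by (simp add: left_diff_distrib)
  also have "\<dots> = (LBINT y. (\<Sum>i\<in>UNIV. ?W2 i i y * ?G (z - y)))"
    unfolding sum_distrib_right[symmetric] K2_trace_GG[OF a(1,2)] ..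
  also have "\<dots> = (LBINT y. (\<Sum>i\<in>UNIV. ?W y * ?G2 i i (z - y)))"
    using i1 i2 1 by (simp add: Bochner_Integration.integral_sum)
  also have "\<dots> = (LBINT y. ?W y * (del l ((z - y) \<bullet> (z - y)) - del a ((z - y) \<bullet> (z - y))))"
    unfolding sum_distrib_left[symmetric] K2_trace_GG[OF al] ..
  finally show ?thesis .
qed

lemma GG_integrable: "0 < a \<Longrightarrow> a \<le> l \<Longrightarrow> integrable lborel (\<lambda>y::real^3. GG a l (y \<bullet> y))"
  by (rule C1c_integrable[OF C1c_GG(1)])

lemma GG_integral_le:
  assumes "0 < a" "a \<le> l"
  shows "(LBINT y. GG a l ((y::real^3) \<bullet> y)) \<le> l\<^sup>2 / 2"
proof -
  have "ennreal (LBINT y. GG a l ((y::real^3) \<bullet> y)) = (\<integral>\<^sup>+y. ennreal (GG a l ((y::real^3) \<bullet> y)) \<partial>lborel)"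
    using assms by (intro nn_integral_eq_integral[symmetric] GG_integrable AE_I2 GG_nonneg) auto
  also have "\<dots> \<le> (\<integral>\<^sup>+y. ennreal (1 / (4 * pi)) * (if norm (y::real^3) \<le> l then ennreal (norm y powr -1) else 0) \<partial>lborel)"
  proof (rule nn_integral_mono_AE)
    have "AE y::real^3 in lborel. y \<noteq> 0" by (rule AE_lborel_singleton)
    then show "AE y::real^3 in lborel. ennreal (GG a l (y \<bullet> y)) \<le> ennreal (1 / (4 * pi)) * (if norm y \<le> l then ennreal (norm y powr -1) else 0)"
    proof eventually_elim
      fix y :: "real^3" assume y: "y \<noteq> 0"
      show "ennreal (GG a l (y \<bullet> y)) \<le> ennreal (1 / (4 * pi)) * (if norm y \<le> l then ennreal (norm y powr -1) else 0)"
      proof (cases "norm y \<le> l")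
        case True
        have "GG a l (y \<bullet> y) \<le> 1 / (4 * pi) * norm y powr -1"
          using GG_le_newton[OF assms y] y by (simp add: powr_minus_divide)
        then show ?thesis using True by (simp add: ennreal_mult'[symmetric] ennreal_leI)
      next
        case False
        then have "l\<^sup>2 \<le> y \<bullet> y" using assms by (intro norm_ge_sq) auto
        then show ?thesis using GG_zero(1)[OF assms] by simp
      qed
    qed
  qed
  also have "\<dots> = ennreal (1 / (4 * pi)) * (\<integral>\<^sup>+y. (if norm (y::real^3) \<le> l then ennreal (norm y powr -1) else 0) \<partial>lborel)"
    by (rule nn_integral_cmult) measurable
  also have "\<dots> \<le> ennreal (1 / (4 * pi)) * ennreal (4 * pi * l powr (3 - 1) / (3 - 1))"
    using assms by (intro mult_left_mono nn_integral_ball3_powr) auto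
  also have "\<dots> = ennreal (1 / (4*pi) * (4 * pi * l powr (3 - 1) / (3 - 1)))" by (rule ennreal_mult'[symmetric]) simp
  also have "1 / (4*pi) * (4 * pi * l powr (3 - 1) / (3 - 1)) = l\<^sup>2 / 2" using assms by (simp add: powr_numeral)
  finally show ?thesis by (simp add: ennreal_le_iff)
qed

text \<open>A quantitative mean value inequality for an almost superharmonic function. In
  \<open>avg_green\<close> the weight \<open>GG a' a\<close> is nonnegative with integral at most
  \<open>a\<^sup>2 / 2\<close>, and the positive part of the Laplacian of \<open>GG a l\<close> is
  at most \<open>15 / (8 * pi * l^3)\<close>. As \<open>a'\<close> tends to \<open>0\<close>, the
  average over \<open>del a'\<close> tends to the value at \<open>z\<close>.\<close>

lemma avg_le:
  assumes a: "0 < a" "a \<le> l"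
  shows "avg a l a z \<le> GG a l (z \<bullet> z) + 15 * a\<^sup>2 / (16 * pi * l^3)"
proof -
  obtain B where B: "B > 0" "\<And>i x. norm (K1 (GG' a l) i x) \<le> B" using C1c_bounded[OF C1c_GG(1)[OF a]] by metis
  \<comment> \<open>The last term pays for replacing the average at scale \<open>a'\<close> by the
    point value: \<open>3 * B\<close> is a Lipschitz constant of the kernel and \<open>a'\<close>
    the radius of the averaging ball.\<close>
  have *: "avg a l a z \<le> GG a l (z \<bullet> z) + 15 * a\<^sup>2 / (16 * pi * l^3) + 3 * B * a'" if a': "0 < a'" "a' \<le> a" for a'
  proof -
    have "avg a l a z - avg a l a' z \<le> (\<integral>y. GG a' a (y \<bullet> y) * (15 / (8 * pi * l^3)) \<partial>(lborel::(real^3) measure))"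
      unfolding avg_green[OF a' a(2)]
    proof (rule Bochner_Integration.integral_mono)
      show "integrable lborel (\<lambda>y::real^3. GG a' a (y \<bullet> y) * (15 / (8 * pi * l^3)))"
        using GG_integrable[OF a'] by simp
      show "integrable lborel (\<lambda>y. GG a' a (y \<bullet> y) * (del l ((z - y) \<bullet> (z - y)) - del a ((z - y) \<bullet> (z - y))))"
        using cont_int_prod(2)[OF C1c_cont[OF C1c_GG(1)[OF a']], of a "\<lambda>x. del l (x \<bullet> x) - del a (x \<bullet> x)" z] a a'
        by (simp add: GG_zero norm_ge_sq continuous_on_diff del_cont)
      fix y :: "real^3"
      have "del l ((z - y) \<bullet> (z - y)) - del a ((z - y) \<bullet> (z - y)) \<le> 15 / (8 * pi * l^3)"
        using del_le[of l "(z - y) \<bullet> (z - y)"] del_nonneg[of a "(z - y) \<bullet> (z - y)"] a by simp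
      then show "GG a' a (y \<bullet> y) * (del l ((z - y) \<bullet> (z - y)) - del a ((z - y) \<bullet> (z - y))) \<le> GG a' a (y \<bullet> y) * (15 / (8 * pi * l^3))"
        using GG_nonneg[OF a'] by (intro mult_left_mono) auto
    qed
    also have "\<dots> = (LBINT y. GG a' a ((y::real^3) \<bullet> y)) * (15 / (8 * pi * l^3))" by simp
    also have "\<dots> \<le> a\<^sup>2 / 2 * (15 / (8 * pi * l^3))"
      using GG_integral_le[OF a'] a by (intro mult_right_mono) auto
    finally have 1: "avg a l a z - avg a l a' z \<le> 15 * a\<^sup>2 / (16 * pi * l^3)" by (simp add: field_simps)
    have "avg a l a' z \<le> (LBINT y. del a' ((y::real^3) \<bullet> y) * (GG a l (z \<bullet> z) + 3 * B * a'))"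
      unfolding avg_def
    proof (rule Bochner_Integration.integral_mono[OF del_GG_integrable])
      show "integrable lborel (\<lambda>y::real^3. del a' (y \<bullet> y) * (GG a l (z \<bullet> z) + 3 * B * a'))"
        using del_integrable[OF a'(1)] by simp
      fix y :: "real^3"
      show "del a' (y \<bullet> y) * GG a l ((z - y) \<bullet> (z - y)) \<le> del a' (y \<bullet> y) * (GG a l (z \<bullet> z) + 3 * B * a')"
      proof (cases "norm y \<le> a'")
        case True
        have "norm (GG a l ((z - y) \<bullet> (z - y)) - GG a l (z \<bullet> z)) \<le> 3 * B * norm ((z - y) - z)"
          by (rule C1c_lipschitz[OF C1c_GG(1)[OF a] B(2)])
        also have "\<dots> \<le> 3 * B * a'" using True B by (intro mult_left_mono) auto
        finally show ?thesis using del_nonneg[OF a'(1)] by (intro mult_left_mono) (auto simp: abs_le_iff)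
      next
        case False
        then show ?thesis using del_zero[of a' "y \<bullet> y"] norm_ge_sq[of a' y] a' by simp
      qed
    qed (use a a' in auto)
    also have "\<dots> = GG a l (z \<bullet> z) + 3 * B * a'" using del_mass[OF a'(1)] by simp
    finally show ?thesis using 1 by simp
  qed
  show ?thesis
  proof (rule field_le_epsilon)
    fix e :: real assume e: "e > 0"
    define a' where "a' = min a (e / (3 * B))"
    have "0 < a'" "a' \<le> a" using a e B by (auto simp: a'_def)
    from *[OF this] have "avg a l a z \<le> GG a l (z \<bullet> z) + 15 * a\<^sup>2 / (16 * pi * l^3) + 3 * B * a'" .
    moreover have "3 * B * a' \<le> 3 * B * (e / (3 * B))" using B by (intro mult_left_mono) (auto simp: a'_def)
    ultimately show "avg a l a z \<le> GG a l (z \<bullet> z) + 15 * a\<^sup>2 / (16 * pi * l^3) + e" using B by simp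
  qed
qed

lemma avg_nonneg: "0 < a \<Longrightarrow> a \<le> l \<Longrightarrow> 0 < c \<Longrightarrow> 0 \<le> avg a l c z"
  unfolding avg_def by (intro integral_nonneg_AE AE_I2 mult_nonneg_nonneg del_nonneg GG_nonneg) auto

lemma avg_outer_le:
  assumes a: "0 < a" "a \<le> l"
  shows "avg a l l z \<le> 15 / (16 * pi * l)"
proof -
  have l: "l > 0" using a by simp
  have m: "(\<lambda>y::real^3. GG a l (y \<bullet> y)) \<in> borel_measurable borel" by (rule C1c_measurable[OF C1c_GG(1)[OF a]])
  have i: "integrable lborel (\<lambda>y::real^3. GG a l ((z - y) \<bullet> (z - y)))"
    using C1c_integrable[OF C1c_reflect[OF C1c_GG(1)[OF a]]] by simp
  have "avg a l l z \<le> (LBINT y. 15 / (8 * pi * l^3) * GG a l ((z - y) \<bullet> (z - y)))"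
    unfolding avg_def
    by (rule Bochner_Integration.integral_mono[OF del_GG_integrable]) (use a l i in \<open>auto intro!: mult_right_mono del_le[of l, unfolded times_divide_eq_left] GG_nonneg simp del: times_divide_eq_left\<close>)
  also have "\<dots> = 15 / (8 * pi * l^3) * (\<integral>y. GG a l (y \<bullet> y) \<partial>(lborel::(real^3) measure))"
    using lborel_integral_reflect[OF m, of z] by simp
  also have "\<dots> \<le> 15 / (8 * pi * l^3) * (l\<^sup>2 / 2)"
    using GG_integral_le[OF a] l by (intro mult_left_mono) auto
  also have "\<dots> = 15 / (16 * pi * l)" using l by (simp add: power2_eq_square power3_eq_cube)
  finally show ?thesis .
qed

lemma avg_zero:
  assumes "0 < a" "a \<le> l" "0 < c" "c \<le> l" "2 * l \<le> norm z"
  shows "avg a l c z = 0"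
proof -
  have "del c (y \<bullet> y) * GG a l ((z - y) \<bullet> (z - y)) = 0" for y
  proof (cases "norm y \<ge> c")
    case True
    then show ?thesis using del_zero[of c "y \<bullet> y"] norm_ge_sq[of c y] assms by simp
  next
    case False
    then have "l \<le> norm (z - y)" using norm_triangle_ineq2[of z y] assms by linarith
    then show ?thesis using GG_zero(1)[OF assms(1,2)] norm_ge_sq[of l "z - y"] assms by simp
  qed
  then show ?thesis unfolding avg_def by (simp only: Bochner_Integration.integral_zero)
qed

text \<open>The kernel of \<open>\<mu>(\<xi>) - (\<integral> |curl \<xi>|\<^sup>2) / 2\<close> as a quadratic form in \<open>\<mu>\<close>.\<close>

definition PP :: "real \<Rightarrow> real \<Rightarrow> real^3 \<Rightarrow> real" where
  "PP a l z = GG a l (z \<bullet> z) - (avg a l a z - avg a l l z) / 2"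

text \<open>By \<open>avg_le\<close>, half the average at scale \<open>a\<close> uses up at most
  half of \<open>GG\<close> and a term of order \<open>1 / l\<close>, while the average at scale
  \<open>l\<close> enters with a favourable sign. Nonnegativity of \<open>del\<close> is what makes
  both steps work.\<close>

lemma PP_ge:
  assumes a: "0 < a" "a \<le> l"
  shows "GG a l (z \<bullet> z) / 2 - 1 / (6 * l) \<le> PP a l z"
proof -
  have l: "l > 0" using a by simp
  have "15 * a\<^sup>2 / (16 * pi * l^3) \<le> 15 * l\<^sup>2 / (16 * pi * l^3)"
    using a by (intro divide_right_mono mult_left_mono power_mono) auto
  also have "\<dots> = (15 / (16 * pi)) / l" using l by (simp add: power2_eq_square power3_eq_cube)
  also have "\<dots> \<le> (1 / 3) / l" using l pi_gt3 by (intro divide_right_mono) (auto simp: field_simps)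
  finally have "15 * a\<^sup>2 / (16 * pi * l^3) \<le> 1 / (3 * l)" by simp
  moreover have "1 / (3 * l) = 2 * (1 / (6 * l))" by simp
  ultimately show ?thesis
    using avg_le[OF a, of z] avg_nonneg[OF a l, of z] l unfolding PP_def diff_divide_distrib by linarith
qed

lemma PP_zero: "0 < a \<Longrightarrow> a \<le> l \<Longrightarrow> 2 * l \<le> norm z \<Longrightarrow> PP a l z = 0"
  unfolding PP_def using avg_zero[of a l a z] avg_zero[of a l l z] GG_zero(1)[of a l "z \<bullet> z"] norm_ge_sq[of l z] by simp

lemma PP_abs_le:
  assumes a: "0 < a" "a \<le> l" and z: "z \<noteq> 0"
  shows "\<bar>PP a l z\<bar> \<le> (if norm z \<le> 2 * l then 1 / norm z else 0)"
proof (cases "2 * l \<le> norm z")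
  case True then show ?thesis using PP_zero[OF a True] a by simp
next
  case False
  have l: "l > 0" and nz: "norm z > 0" using a z by auto
  have "2 / (2 * l) \<le> 2 / norm z" using False l z by (intro divide_left_mono) auto
  then have lz: "1 / l \<le> 2 / norm z" by simp
  have 1: "GG a l (z \<bullet> z) \<le> 1 / (4 * pi * norm z)" by (rule GG_le_newton[OF a z])
  have "1 / (4 * pi * norm z) \<le> 1 / (12 * norm z)" using nz pi_gt3 by (intro divide_left_mono) auto
  moreover have "15 / (16 * pi * l) = 15 / (16 * pi) * (1 / l)" by simp
  moreover have "15 / (16 * pi) * (1 / l) \<le> 1 / 3 * (2 / norm z)"
    using lz l nz pi_gt3 by (intro mult_mono) (auto simp: field_simps)
  ultimately have "avg a l l z \<le> 1 / 3 * (2 / norm z)" "GG a l (z \<bullet> z) \<le> 1 / (12 * norm z)"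
    using 1 avg_outer_le[OF a, of z] by simp_all
  moreover have "g - (B - A) / 2 \<le> n + e / 2" if "A \<le> e" "g \<le> n" "0 \<le> B" for g A B n e :: real
    using that by (simp add: field_simps)
  ultimately have "PP a l z \<le> 1 / (12 * norm z) + 1 / 3 * (2 / norm z) / 2"
    using avg_nonneg[OF a a(1), of z] unfolding PP_def by blast
  also have "\<dots> \<le> 1 / norm z" using nz by (simp add: field_simps)
  finally have up: "PP a l z \<le> 1 / norm z" .
  have "- (1 / norm z) \<le> - (1 / (6 * l))" using lz l nz by (simp add: field_simps)
  also have "\<dots> \<le> PP a l z" using PP_ge[OF a, of z] GG_nonneg[OF a, of "z \<bullet> z"] by simp
  finally show ?thesis using up False by simp
qed

lemma integral_le_nn:
  assumes f: "integrable M f" and le: "AE x in M. ennreal (f x) \<le> g x" and g: "(\<integral>\<^sup>+x. g x \<partial>M) \<le> ennreal B" and B: "0 \<le> B"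
  shows "(\<integral>x. f x \<partial>M) \<le> B"
proof -
  have i: "integrable M (\<lambda>x. max 0 (f x))" using f by simp
  have "(\<integral>x. f x \<partial>M) \<le> (\<integral>x. max 0 (f x) \<partial>M)"
    by (rule Bochner_Integration.integral_mono[OF f i]) simp
  also have "ennreal \<dots> = (\<integral>\<^sup>+x. ennreal (max 0 (f x)) \<partial>M)"
    by (rule nn_integral_eq_integral[symmetric, OF i]) simp
  then have "ennreal (\<integral>x. max 0 (f x) \<partial>M) \<le> (\<integral>\<^sup>+x. g x \<partial>M)"
    using le by (auto intro!: nn_integral_mono_AE elim!: eventually_mono simp: max_def)
  then have "(\<integral>x. max 0 (f x) \<partial>M) \<le> B" using g B by (meson ennreal_le_iff order_trans)
  finally show ?thesis .
qed

lemma integral_inverse_window: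
  fixes a m :: real
  assumes "0 < a" "a \<le> m"
  shows "(LBINT h. indicator {a..m} h * (1 / h)) = ln m - ln a" (is ?R1)
    and "integrable lborel (\<lambda>h. indicator {a..m} h * (1 / h))" (is ?R2)
proof -
  have "has_bochner_integral lborel (\<lambda>x. (1 / x) * indicator {a..m} x) (ln m - ln a)"
  proof (rule has_bochner_integral_FTC_Icc_real[where F=ln and f="\<lambda>x. 1 / x" and a=a and b=m])
    show "DERIV ln x :> 1 / x" if "a \<le> x" for x using that assms by (intro DERIV_ln_divide) simp
    show "isCont (\<lambda>x. 1 / x) x" if "a \<le> x" for x using that assms by (intro continuous_intros) simp
  qed (rule assms)
  then show ?R1
    ?R2
    by (auto simp: has_bochner_integral_iff mult.commute)
qed

lemma integral_sym_window:
  fixes f :: "real \<Rightarrow> real"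
  assumes i: "integrable lborel (\<lambda>h. indicator {a..m} h * f h)" and ev: "\<And>h. f (- h) = f h" and a: "0 < a"
  shows "(LBINT h. indicator {h. a \<le> \<bar>h\<bar> \<and> \<bar>h\<bar> \<le> m} h * f h) = 2 * (LBINT h. indicator {a..m} h * f h)" (is ?R1)
    and "integrable lborel (\<lambda>h. indicator {h. a \<le> \<bar>h\<bar> \<and> \<bar>h\<bar> \<le> m} h * f h)" (is ?R2)
proof -
  have i2: "integrable lborel (\<lambda>h. indicator {a..m} (- h) * f (- h))"
    using lborel_integrable_real_affine[OF i, of "-1" 0] by simp
  have e2: "(LBINT h. indicator {a..m} (- h) * f (- h)) = (LBINT h. indicator {a..m} h * f h)"
    using lborel_integral_real_affine[of "-1" "\<lambda>h. indicator {a..m} h * f h" 0] by simp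
  have eq: "indicator {h. a \<le> \<bar>h\<bar> \<and> \<bar>h\<bar> \<le> m} h * f h = indicator {a..m} h * f h + indicator {a..m} (- h) * f (- h)" for h
    using a by (auto simp: indicator_def ev)
  show ?R1
    ?R2
    unfolding eq using i i2 e2 by simp_all
qed

section \<open>The Biot-Savart energy as a double integral along the curve\<close>

context curve
begin

definition pairing :: "(real^3 \<Rightarrow> real^3) \<Rightarrow> real" where
  "pairing Z = (\<integral>t. Z (\<gamma> t) \<bullet> \<tau> t \<partial>CM)"

definition xi :: "real \<Rightarrow> real \<Rightarrow> real^3 \<Rightarrow> real^3" where
  "xi a l = conv CM \<gamma> (\<lambda>x. GG a l (x \<bullet> x)) \<tau>"

definition dxi :: "real \<Rightarrow> real \<Rightarrow> 3 \<Rightarrow> real^3 \<Rightarrow> real^3" where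
  "dxi a l i = conv CM \<gamma> (K1 (GG' a l) i) \<tau>"

lemma \<tau>_CM_integrable: "integrable CM \<tau>"
  by (rule CM_integrable[where B=1]) auto

lemma xi_C1c:
  assumes "0 < a" "a \<le> l"
  shows "C1c (xi a l) (dxi a l)"
  unfolding xi_def dxi_def[abs_def] by (rule PM.conv_C1c[OF C1c_GG(1)[OF assms] \<tau>_CM_integrable])

lemma curlv_dxi:
  assumes "0 < a" "a \<le> l"
  shows "curlv (dxi a l) = vfield (GG' a l)"
  unfolding dxi_def[abs_def] using vfield_eq_curl[OF C1c_GG(1)[OF assms]] by auto

lemma xi_inner:
  assumes "0 < a" "a \<le> l"
  shows "xi a l x \<bullet> e = (\<integral>s. GG a l ((x - \<gamma> s) \<bullet> (x - \<gamma> s)) * (\<tau> s \<bullet> e) \<partial>CM)"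
proof -
  have i: "integrable CM (\<lambda>s. GG a l ((x - \<gamma> s) \<bullet> (x - \<gamma> s)) *\<^sub>R \<tau> s)"
    using conv_int(1)[OF C1c_GG(1)[OF assms] \<tau>_meas, where B=1 and x=x] by simp
  have "(\<integral>s. (GG a l ((x - \<gamma> s) \<bullet> (x - \<gamma> s)) *\<^sub>R \<tau> s) \<bullet> e \<partial>CM) = xi a l x \<bullet> e"
    unfolding xi_def conv_def by (rule integral_inner_left[OF i])
  then show ?thesis by simp
qed

text \<open>With \<open>v = curl \<xi>\<close> the energy is the integral of
  \<open>\<xi> \<bullet> curl v\<close>, and \<open>curl v\<close> is the convolution of the curve
  with \<open>del a - del l\<close>. One application of Fubini brings out the outer line integral, a
  second one, at fixed \<open>t\<close>, the inner; the remaining space integral of two kernels is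
  an \<open>avg\<close>, after the reflection \<open>x = \<gamma> t - y\<close>.\<close>

lemma energy_vv:
  assumes a: "0 < a" "a \<le> l"
  defines "v \<equiv> vfield (GG' a l)"
  shows "(LBINT x. v x \<bullet> v x) = (\<integral>t. (\<integral>s. (avg a l a (\<gamma> t - \<gamma> s) - avg a l l (\<gamma> t - \<gamma> s)) * (\<tau> s \<bullet> \<tau> t) \<partial>CM) \<partial>CM)" (is ?R1)
    and "integrable CM (\<lambda>t. \<integral>s. (avg a l a (\<gamma> t - \<gamma> s) - avg a l l (\<gamma> t - \<gamma> s)) * (\<tau> s \<bullet> \<tau> t) \<partial>CM)" (is ?R2)
proof -
  have l: "l > 0" using a by simp
  let ?D = "\<lambda>y::real^3. del a (y \<bullet> y) - del l (y \<bullet> y)" and ?G = "\<lambda>y::real^3. GG a l (y \<bullet> y)"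
  note A = C1c_GG(2)[OF a] and xi = xi_C1c[OF a]
  have vC: "C1c v (dvfield (GG' a l) (GG'' a l))" unfolding v_def by (rule vfield_C1c[OF A])
  have vx: "v x = curlv (dxi a l) x" for x unfolding v_def curlv_dxi[OF a] ..
  have Dc: "continuous_on UNIV ?D" by (intro continuous_on_diff del_cont a l)
  have Dz: "?D x = 0" if "l \<le> norm x" for x
    using del_zero[of a "x \<bullet> x"] del_zero[of l "x \<bullet> x"] norm_ge_sq[of l x] norm_ge_sq[of a x] a that by simp
  obtain R where R: "\<And>x. R \<le> norm x \<Longrightarrow> xi a l x = 0" using C1c_supp'[OF xi] by metis
  have cv: "curlv (dvfield (GG' a l) (GG'' a l)) x = conv CM \<gamma> ?D \<tau> x" for x
    unfolding dvfield_curl[OF A] K2_trace_GG[OF a] conv_def integral_minus[symmetric] scaleR_minus_left[symmetric] minus_diff_eq ..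
  have "(LBINT x. v x \<bullet> v x) = (LBINT x. curlv (dxi a l) x \<bullet> v x)" by (simp add: vx)
  also have "\<dots> = (LBINT x. xi a l x \<bullet> conv CM \<gamma> ?D \<tau> x)"
    using curl_ibp[OF xi vC] unfolding cv .
  also have "\<dots> = (\<integral>t. (LBINT x. ?D (x - \<gamma> t) * (xi a l x \<bullet> \<tau> t)) \<partial>CM)"
    by (rule PM.conv_Fubini(1)[OF Dc Dz \<tau>_CM_integrable C1c_cont[OF xi] R])
  finally have 1: "(LBINT x. v x \<bullet> v x) = (\<integral>t. (LBINT x. ?D (x - \<gamma> t) * (xi a l x \<bullet> \<tau> t)) \<partial>CM)" .
  have 2: "integrable CM (\<lambda>t. LBINT x. ?D (x - \<gamma> t) * (xi a l x \<bullet> \<tau> t))"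
    by (rule PM.conv_Fubini(2)[OF Dc Dz \<tau>_CM_integrable C1c_cont[OF xi] R])
  have 3: "(LBINT x. ?D (x - \<gamma> t) * (xi a l x \<bullet> \<tau> t)) = (\<integral>s. (avg a l a (\<gamma> t - \<gamma> s) - avg a l l (\<gamma> t - \<gamma> s)) * (\<tau> s \<bullet> \<tau> t) \<partial>CM)" for t
  proof -
    have c': "continuous_on UNIV (\<lambda>x. ?D (x - \<gamma> t) *\<^sub>R \<tau> t)"
      by (intro continuous_intros continuous_on_compose2[OF Dc]) auto
    have z': "?D (x - \<gamma> t) *\<^sub>R \<tau> t = 0" if "l + \<gamma>B \<le> norm x" for x
      using Dz[of "x - \<gamma> t"] that \<gamma>B[of t] norm_triangle_ineq2[of x "\<gamma> t"] by simp
    have z: "?G x = 0" if "l \<le> norm x" for x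
      using GG_zero(1)[OF a] norm_ge_sq[of l x] l that by simp
    have "(LBINT x. ?D (x - \<gamma> t) * (xi a l x \<bullet> \<tau> t)) = (LBINT x. (?D (x - \<gamma> t) *\<^sub>R \<tau> t) \<bullet> conv CM \<gamma> ?G \<tau> x)"
      by (simp add: xi_def inner_commute)
    also have "\<dots> = (\<integral>s. (LBINT x. ?G (x - \<gamma> s) * ((?D (x - \<gamma> t) *\<^sub>R \<tau> t) \<bullet> \<tau> s)) \<partial>CM)"
      by (rule PM.conv_Fubini(1)[OF C1c_cont[OF C1c_GG(1)[OF a]] z \<tau>_CM_integrable c' z'])
    also have "\<dots> = (\<integral>s. (avg a l a (\<gamma> t - \<gamma> s) - avg a l l (\<gamma> t - \<gamma> s)) * (\<tau> s \<bullet> \<tau> t) \<partial>CM)"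
    proof (rule Bochner_Integration.integral_cong[OF refl])
      fix s
      have [measurable]: "?D \<in> borel_measurable borel" "?G \<in> borel_measurable borel"
        using Dc C1c_cont[OF C1c_GG(1)[OF a]] by (auto intro: borel_measurable_continuous_onI)
      have "(LBINT x. ?G (x - \<gamma> s) * ((?D (x - \<gamma> t) *\<^sub>R \<tau> t) \<bullet> \<tau> s)) = (LBINT x. ?G (x - \<gamma> s) * ?D (x - \<gamma> t) * (\<tau> s \<bullet> \<tau> t))"
        by (simp add: inner_commute mult_ac)
      also have "\<dots> = (LBINT x. ?G (x - \<gamma> s) * ?D (x - \<gamma> t)) * (\<tau> s \<bullet> \<tau> t)" by simp
      also have "(LBINT x. ?G (x - \<gamma> s) * ?D (x - \<gamma> t)) = (LBINT y. ?G (\<gamma> t - y - \<gamma> s) * ?D (\<gamma> t - y - \<gamma> t))"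
        by (rule lborel_integral_reflect[symmetric]) measurable
      also have "\<dots> = (LBINT y. del a (y \<bullet> y) * ?G (\<gamma> t - \<gamma> s - y) - del l (y \<bullet> y) * ?G (\<gamma> t - \<gamma> s - y))"
        by (simp add: algebra_simps)
      also have "\<dots> = avg a l a (\<gamma> t - \<gamma> s) - avg a l l (\<gamma> t - \<gamma> s)"
        unfolding avg_def by (rule Bochner_Integration.integral_diff; rule del_GG_integrable; use a l in simp)
      finally show "(LBINT x. ?G (x - \<gamma> s) * ((?D (x - \<gamma> t) *\<^sub>R \<tau> t) \<bullet> \<tau> s))
        = (avg a l a (\<gamma> t - \<gamma> s) - avg a l l (\<gamma> t - \<gamma> s)) * (\<tau> s \<bullet> \<tau> t)" .
    qed
    finally show ?thesis .
  qed
  show ?R1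
    using 1 unfolding 3 .
  show ?R2
    using 2 unfolding 3 .
qed

end

lemma integral_le_nn':
  assumes f: "integrable M f" and le: "AE x in M. ennreal (f x) \<le> g x"
  shows "ennreal (\<integral>x. f x \<partial>M) \<le> (\<integral>\<^sup>+x. g x \<partial>M)"
proof -
  have i: "integrable M (\<lambda>x. max 0 (f x))" using f by simp
  have "ennreal (\<integral>x. f x \<partial>M) \<le> ennreal (\<integral>x. max 0 (f x) \<partial>M)"
    by (intro ennreal_leI Bochner_Integration.integral_mono[OF f i]) simp
  also have "\<dots> = (\<integral>\<^sup>+x. ennreal (max 0 (f x)) \<partial>M)"
    by (rule nn_integral_eq_integral[symmetric, OF i]) simp
  also have "\<dots> \<le> (\<integral>\<^sup>+x. g x \<partial>M)"
    using le by (auto intro!: nn_integral_mono_AE elim!: eventually_mono simp: max_def)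
  finally show ?thesis .
qed

lemma ennreal_add_le: "0 \<le> y \<Longrightarrow> ennreal (x + y) \<le> ennreal x + ennreal y"
  by (cases "0 \<le> x") (auto simp: ennreal_neg intro: ennreal_leI)

lemma K1_GG_bound:
  assumes a: "0 < a" "a \<le> l"
  shows "\<bar>K1 (GG' a l) k z\<bar> \<le> (1/4) * max a (norm z) powr -2"
proof -
  have l: "l > 0" using a by simp
  have n1: "Gam' l y \<le> 0" if "0 \<le> y" for y
  proof -
    have "gam1 u \<le> 0" if "0 \<le> u" for u using that by (auto simp: gam1_def)
    then have "gam1 (y / l\<^sup>2) \<le> 0" using that by simp
    then show ?thesis unfolding Gam'_def using l by (intro mult_nonneg_nonpos) auto
  qed
  have b: "\<bar>GG' a l (z \<bullet> z)\<bar> \<le> - Gam' a (z \<bullet> z)"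
    using GG'_nonpos[OF a, of "z \<bullet> z"] n1[of "z \<bullet> z"] by (simp add: GG'_def)
  have "\<bar>K1 (GG' a l) k z\<bar> = 2 * \<bar>z $ k\<bar> * \<bar>GG' a l (z \<bullet> z)\<bar>" by (simp add: K1_def abs_mult)
  also have "\<dots> \<le> 2 * norm z * (- Gam' a (z \<bullet> z))"
    using b component_le_norm_cart[of z k] by (intro mult_mono) auto
  also have "\<dots> \<le> (1/4) * max a (norm z) powr -2"
  proof (cases "a \<le> norm z")
    case True
    then have nz: "norm z > 0" using a by linarith
    have "Gam' a (z \<bullet> z) = - 1 / (8*pi) * (z \<bullet> z) powr -(3/2)"
      using True a by (intro Gam_outer norm_ge_sq) auto
    also have "(z \<bullet> z) powr -(3/2) = norm z powr -3"
      using powr_sq[OF nz, of "-(3/2)"] by (simp add: power2_norm_eq_inner)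
    finally have "2 * norm z * (- Gam' a (z \<bullet> z)) = 1 / (4 * pi) * (norm z * norm z powr -3)" by simp
    also have "norm z * norm z powr -3 = norm z powr -2" using nz by (simp add: powr_mult_base)
    also have "1 / (4 * pi) * norm z powr -2 \<le> (1/4) * norm z powr -2"
      using pi_gt3 by (intro mult_right_mono) (auto simp: field_simps)
    finally show ?thesis using True by (simp add: max_def)
  next
    case False
    then have "z \<bullet> z / a\<^sup>2 \<le> 1" using a
      by (simp add: power2_norm_eq_inner[symmetric] power_mono)
    then have "- gam1 (z \<bullet> z / a\<^sup>2) \<le> 5/4" using a by (simp add: gam1_def)
    then have "- Gam' a (z \<bullet> z) \<le> 1 / (4*pi*a^3) * (5/4)" unfolding Gam'_def
      using a mult_left_mono[of "- gam1 (z \<bullet> z / a\<^sup>2)" "5/4" "1 / (4*pi*a^3)"] by simp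
    then have "2 * norm z * (- Gam' a (z \<bullet> z)) \<le> 2 * a * (1 / (4*pi*a^3) * (5/4))"
      using False a n1 b by (intro mult_mono) auto
    also have "\<dots> = (5 / (8 * pi)) * (1 / a\<^sup>2)" using a by (simp add: power2_eq_square power3_eq_cube)
    also have "\<dots> \<le> (1/4) * (1 / a\<^sup>2)" using pi_gt3 by (intro mult_right_mono) (auto simp: field_simps)
    also have "1 / a\<^sup>2 = a powr -2" using a by (simp add: powr_minus_divide powr_numeral)
    finally show ?thesis using False by (simp add: max_def)
  qed
  finally show ?thesis .
qed

lemma avg_measurable[measurable]:
  assumes "0 < a" "a \<le> l" "0 < c"
  shows "avg a l c \<in> borel_measurable borel"
proof -
  have [measurable]: "(\<lambda>x::real^3. GG a l (x \<bullet> x)) \<in> borel_measurable borel" "(\<lambda>x::real^3. del c (x \<bullet> x)) \<in> borel_measurable borel"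
    using C1c_cont[OF C1c_GG(1)[OF assms(1,2)]] del_cont[OF assms(3)] by (auto intro: borel_measurable_continuous_onI)
  have "(\<lambda>(z::real^3, y::real^3). GG a l ((z - y) \<bullet> (z - y))) \<in> borel_measurable (borel \<Otimes>\<^sub>M borel)"
    using measurable_compose[of "\<lambda>(z::real^3, y::real^3). z - y" "borel \<Otimes>\<^sub>M borel" borel "\<lambda>x. GG a l (x \<bullet> x)" borel]
    by (simp add: split_beta')
  then have [measurable]: "(\<lambda>(z::real^3, y::real^3). del c (y \<bullet> y) * GG a l ((z - y) \<bullet> (z - y))) \<in> borel_measurable (borel \<Otimes>\<^sub>M lborel)"
    by measurable
  show ?thesis unfolding avg_def[abs_def] by measurable
qed

lemma PP_measurable[measurable]:
  assumes a: "0 < a" "a \<le> l"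
  shows "PP a l \<in> borel_measurable borel"
proof -
  have [measurable]: "(\<lambda>x::real^3. GG a l (x \<bullet> x)) \<in> borel_measurable borel"
    using C1c_cont[OF C1c_GG(1)[OF a]] by (auto intro: borel_measurable_continuous_onI)
  have [measurable]: "avg a l a \<in> borel_measurable borel" "avg a l l \<in> borel_measurable borel"
    using a by (auto intro!: avg_measurable)
  show ?thesis unfolding PP_def[abs_def] by measurable
qed

lemma avg_bdd:
  assumes a: "0 < a" "a \<le> l"
  obtains B where "\<And>z::real^3. \<bar>GG a l (z \<bullet> z)\<bar> \<le> B" "\<And>z. \<bar>avg a l a z\<bar> \<le> B" "\<And>z. \<bar>avg a l l z\<bar> \<le> B"
proof -
  obtain B where B: "B > 0" "\<And>z::real^3. norm (GG a l (z \<bullet> z)) \<le> B" using C1c_bounded[OF C1c_GG(1)[OF a]] by metis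
  let ?B = "B + 15 * a\<^sup>2 / (16 * pi * l^3) + 15 / (16 * pi * l)"
  have l: "l > 0" using a by simp
  have p: "0 \<le> 15 * a\<^sup>2 / (16 * pi * l^3)" "0 \<le> 15 / (16 * pi * l)" using l by auto
  show ?thesis
  proof (rule that[of ?B])
    show "\<bar>GG a l (z \<bullet> z)\<bar> \<le> ?B" for z :: "real^3" using B(2)[of z] p unfolding real_norm_def by linarith
    show "\<bar>avg a l a z\<bar> \<le> ?B" for z using avg_le[OF a, of z] avg_nonneg[OF a a(1), of z] B(2)[of z] p unfolding real_norm_def by linarith
    show "\<bar>avg a l l z\<bar> \<le> ?B" for z using avg_outer_le[OF a, of z] avg_nonneg[OF a l, of z] B(1) p by linarith
  qed
qed

section \<open>The lower bound for the energy\<close>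

context curve
begin

text \<open>This is the curl of the test field for the lower bound. The flat-norm hypothesis
  therefore costs \<open>\<epsilon> * L * (23 * K / a)\<close>, which is small relative to
  \<open>K * L\<close> when \<open>a\<close> is a large multiple of
  \<open>\<epsilon>\<close>.\<close>

lemma vfield_GG_bound:
  assumes a: "0 < a" "a \<le> l"
  shows "norm (vfield (GG' a l) x) \<le> 23 * K / a"
proof -
  have "norm (vfield (GG' a l) x) \<le> (\<Sum>k\<in>(UNIV::3 set). 1 * (1/4) * (30 * K / a))"
    unfolding vfield_def
  proof (intro sum_norm_le conv_bound)
    fix k :: 3
    show "K1 (GG' a l) k \<in> borel_measurable borel" by (rule C1c_measurable[OF C1c_GG(2)[OF a]])
  qed (use a K1_GG_bound[OF a] cross_axis_\<tau> in auto)
  also have "\<dots> = 22.5 * (K / a)" by simp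
  also have "\<dots> \<le> 23 * (K / a)" using K a by (intro mult_right_mono) auto
  finally show ?thesis by simp
qed

definition far :: "real \<Rightarrow> real \<Rightarrow> real \<Rightarrow> ennreal" where
  "far R s h = (if \<rho> s < \<bar>h\<bar> \<and> norm (\<gamma> (s + h) - \<gamma> s) \<le> R then ennreal (1 / norm (\<gamma> (s + h) - \<gamma> s)) else 0)"

lemma good_AE_h:
  assumes "good t"
  shows "AE h in lborel. \<bar>h\<bar> \<le> \<rho> t \<longrightarrow> norm (\<tau> (t + h) - \<tau> t) \<le> \<bar>h\<bar> / \<rho> t"
proof -
  have "AE s in lborel. \<bar>s - t\<bar> \<le> \<rho> t \<longrightarrow> norm (\<tau> s - \<tau> t) \<le> \<bar>s - t\<bar> / \<rho> t"
    using assms by (auto simp: good_def)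
  then have "AE h in lborel. \<bar>t + 1 * h - t\<bar> \<le> \<rho> t \<longrightarrow> norm (\<tau> (t + 1 * h) - \<tau> t) \<le> \<bar>t + 1 * h - t\<bar> / \<rho> t"
    by (intro AE_borel_affine) auto
  then show ?thesis by simp
qed

lemma near_inner:
  assumes "norm (\<tau> s - \<tau> t) \<le> d"
  shows "1 - d\<^sup>2 / 2 \<le> \<tau> s \<bullet> \<tau> t" "\<tau> s \<bullet> \<tau> t \<le> 1" "- 1 \<le> \<tau> s \<bullet> \<tau> t"
proof -
  have "(norm (\<tau> s - \<tau> t))\<^sup>2 = 2 - 2 * (\<tau> s \<bullet> \<tau> t)"
    by (simp add: power2_norm_eq_inner inner_diff inner_commute flip: norm_eq_1)
       (simp add: power2_norm_eq_inner[symmetric])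
  moreover have "(norm (\<tau> s - \<tau> t))\<^sup>2 \<le> d\<^sup>2" using assms by (intro power_mono) auto
  ultimately show "1 - d\<^sup>2 / 2 \<le> \<tau> s \<bullet> \<tau> t" by (simp add: field_simps)
  show "\<tau> s \<bullet> \<tau> t \<le> 1" "- 1 \<le> \<tau> s \<bullet> \<tau> t"
    using Cauchy_Schwarz_ineq2[of "\<tau> s" "\<tau> t"] by (auto simp: abs_le_iff)
qed

text \<open>An explicit minorant, in the arclength difference \<open>h\<close>, of \<open>PP\<close>
  times the inner product of the tangents. The term \<open>1 / (8 * pi * \<bar>h\<bar>)\<close> is
  half the Newton kernel and yields the logarithm. The terms with \<open>l\<close> in the window
  come from the outer truncation, \<open>1 / (16 * pi * r)\<close> from the turning of the tangent,
  and the plateau from the additive error in \<open>PP_ge\<close>.\<close>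

definition wlow :: "real \<Rightarrow> real \<Rightarrow> real \<Rightarrow> real \<Rightarrow> real" where
  "wlow a l r h = indicator {h. a \<le> \<bar>h\<bar> \<and> \<bar>h\<bar> \<le> min r l} h * (1 / (8 * pi * \<bar>h\<bar>) - 15 / (64 * pi * l) - 1 / (16 * pi * r))
     - 1 / (6 * l) * indicator {-4*l..4*l} h"

text \<open>Within the security radius the tangents have nonnegative inner product, so the lower
  bound for \<open>PP\<close> may be multiplied by it and the difference is nonpositive. Beyond it
  the crude bound \<open>1 / norm z\<close> holds, and the pair is charged to
  \<open>far\<close>.\<close>

lemma wlow_le:
  assumes a: "0 < a" "a \<le> l" and g: "good t" and h: "\<bar>h\<bar> \<le> L / 2"
    and ae: "\<bar>h\<bar> \<le> \<rho> t \<longrightarrow> norm (\<tau> (t + h) - \<tau> t) \<le> \<bar>h\<bar> / \<rho> t"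
  shows "ennreal (wlow a l (\<rho> t) h - PP a l (\<gamma> t - \<gamma> (t + h)) * (\<tau> (t + h) \<bullet> \<tau> t)) \<le> far (2 * l) t h"
proof -
  have l: "l > 0" and r: "\<rho> t > 0" using a good_pos[OF g] by auto
  define z where "z = \<gamma> t - \<gamma> (t + h)"
  define c where "c = \<tau> (t + h) \<bullet> \<tau> t"
  have nz: "norm (\<gamma> (t + h) - \<gamma> t) = norm z" by (simp add: z_def norm_minus_commute)
  have zh: "norm z \<le> \<bar>h\<bar>" using lip[of t "t + h"] by (simp add: z_def)
  show ?thesis
  proof (cases "\<bar>h\<bar> \<le> \<rho> t")
    case True
    define d where "d = \<bar>h\<bar> / \<rho> t"
    have d: "0 \<le> d" "d \<le> 1" using True r by (auto simp: d_def)
    have c: "1 - d\<^sup>2 / 2 \<le> c" "c \<le> 1" using near_inner[of "t + h" t d] ae True unfolding c_def d_def by auto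
    have "d\<^sup>2 \<le> 1" using d by (simp add: power_le_one)
    then have c0: "0 \<le> c" using c by linarith
    have "wlow a l (\<rho> t) h \<le> PP a l z * c"
    proof (cases "2 * l \<le> norm z")
      case True
      then have "wlow a l (\<rho> t) h \<le> 0" using zh l by (auto simp: wlow_def indicator_def)
      then show ?thesis using PP_zero[OF a True] by simp
    next
      case False
      \<comment> \<open>\<open>PP\<close> vanishes for chords of length at least
        \<open>2 * l\<close>, and near chords are at least half the arc; this fixes the width
        \<open>4 * l\<close> of the plateau in \<open>wlow\<close>.\<close>
      have h4: "\<bar>h\<bar> \<le> 4 * l" using good_chord[OF g True] nz False by simp
      have "(GG a l (z \<bullet> z) / 2 - 1 / (6 * l)) * c \<le> PP a l z * c"
        by (intro mult_right_mono PP_ge a c0)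
      moreover have "1 / (6 * l) * c \<le> 1 / (6 * l) * 1" using l c by (intro mult_left_mono) auto
      ultimately have 1: "GG a l (z \<bullet> z) / 2 * c - 1 / (6 * l) \<le> PP a l z * c"
        by (simp add: left_diff_distrib algebra_simps)
      have G0: "0 \<le> GG a l (z \<bullet> z)" by (rule GG_nonneg[OF a]) simp
      have "indicator {h. a \<le> \<bar>h\<bar> \<and> \<bar>h\<bar> \<le> min (\<rho> t) l} h * (1 / (8 * pi * \<bar>h\<bar>) - 15 / (64 * pi * l) - 1 / (16 * pi * \<rho> t)) \<le> GG a l (z \<bullet> z) / 2 * c"
      proof (cases "a \<le> \<bar>h\<bar> \<and> \<bar>h\<bar> \<le> min (\<rho> t) l")
        case True
        then have hp: "\<bar>h\<bar> > 0" using a by linarith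
        define g where "g = GG a l (\<bar>h\<bar>\<^sup>2)"
        have g1: "1 / (4 * pi * \<bar>h\<bar>) - 15 / (32 * pi * l) \<le> g" unfolding g_def using GG_ge[OF a] True by blast
        have g0: "0 \<le> g" unfolding g_def by (rule GG_nonneg[OF a]) simp
        have "norm (\<bar>h\<bar> *\<^sub>R \<tau> t) = \<bar>h\<bar>" by simp
        have "(\<bar>h\<bar> *\<^sub>R \<tau> t) \<bullet> (\<bar>h\<bar> *\<^sub>R \<tau> t) = \<bar>h\<bar>\<^sup>2" by (simp add: power2_eq_square flip: power2_norm_eq_inner)
        then have g2: "g \<le> 1 / (4 * pi * \<bar>h\<bar>)"
          using GG_le_newton[OF a, of "\<bar>h\<bar> *\<^sub>R \<tau> t"] hp unfolding g_def by (metis \<open>norm (\<bar>h\<bar> *\<^sub>R \<tau> t) = \<bar>h\<bar>\<close> norm_zero less_irrefl)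
        have "g \<le> GG a l (z \<bullet> z)"
          unfolding g_def using power_mono[OF zh norm_ge_zero, of 2] by (intro GG_antimono a) (auto simp: power2_norm_eq_inner)
        then have "g / 2 * (1 - d\<^sup>2 / 2) \<le> GG a l (z \<bullet> z) / 2 * c"
          using c g0 \<open>d\<^sup>2 \<le> 1\<close> by (intro mult_mono) auto
        \<comment> \<open>One factor \<open>d\<close> cancels the singularity
          \<open>1 / \<bar>h\<bar>\<close> and the other is bounded by \<open>1\<close>, so the
          curvature error is constant over the window and its integral is bounded independently of
          \<open>\<rho> t\<close>.\<close>
        moreover have "g * d\<^sup>2 \<le> 1 / (4 * pi * \<rho> t)"
        proof -
          have "g * d\<^sup>2 \<le> 1 / (4 * pi * \<bar>h\<bar>) * (d * 1)"
            using g2 d g0 by (intro mult_mono) (auto simp: power2_eq_square mult_left_le)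
          also have "\<dots> = 1 / (4 * pi * \<rho> t)" using hp r by (simp add: d_def field_simps)
          finally show ?thesis .
        qed
        moreover have "g / 2 * (1 - d\<^sup>2 / 2) = g / 2 - (g * d\<^sup>2) / 4" by (simp add: algebra_simps)
        moreover have "1 / (8 * pi * \<bar>h\<bar>) - 15 / (64 * pi * l) = (1 / (4 * pi * \<bar>h\<bar>) - 15 / (32 * pi * l)) / 2" by (simp add: diff_divide_distrib)
        moreover have "1 / (16 * pi * \<rho> t) = (1 / (4 * pi * \<rho> t)) / 4" by simp
        moreover have "x / 2 - y / 4 \<le> w" if "x \<le> g" "w' \<le> y" "g / 2 - w' / 4 \<le> w" for x y w w' :: real
          using that by (simp add: field_simps)
        ultimately show ?thesis using True g1 by (auto simp: indicator_def)
      next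
        case False
        then show ?thesis using G0 c0 by (auto simp: indicator_def)
      qed
      then show ?thesis using 1 h4 unfolding wlow_def by (auto simp: indicator_def abs_le_iff)
    qed
    then have "wlow a l (\<rho> t) h - PP a l z * c \<le> 0" by simp
    then have "ennreal (wlow a l (\<rho> t) h - PP a l z * c) = 0" by (rule ennreal_neg)
    then show ?thesis unfolding z_def c_def by simp
  next
    case False
    then have zr: "\<rho> t / 2 \<le> norm z" using good_far[OF g, of h] h nz by simp
    then have z0: "z \<noteq> 0" using r by auto
    have w0: "wlow a l (\<rho> t) h \<le> 0" using False l by (auto simp: wlow_def indicator_def)
    have "\<bar>c\<bar> \<le> 1" unfolding c_def using Cauchy_Schwarz_ineq2[of "\<tau> (t + h)" "\<tau> t"] by simp
    then have "\<bar>PP a l z * c\<bar> \<le> \<bar>PP a l z\<bar> * 1" unfolding abs_mult by (intro mult_left_mono) auto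
    also have "\<dots> \<le> (if norm z \<le> 2 * l then 1 / norm z else 0)" using PP_abs_le[OF a z0] by simp
    finally have "wlow a l (\<rho> t) h - PP a l z * c \<le> (if norm z \<le> 2 * l then 1 / norm z else 0)" using w0 by (simp add: abs_le_iff)
    then have "ennreal (wlow a l (\<rho> t) h - PP a l z * c) \<le> ennreal (if norm z \<le> 2 * l then 1 / norm z else 0)" by (rule ennreal_leI)
    also have "\<dots> = far (2 * l) t h" using False by (auto simp: far_def nz)
    finally show ?thesis unfolding z_def c_def .
  qed
qed

lemma HM_lborel:
  fixes f :: "real \<Rightarrow> real"
  assumes "\<And>h. h \<notin> {-(L/2)..<L/2} \<Longrightarrow> f h = 0" "f \<in> borel_measurable borel"
  shows "(\<integral>h. f h \<partial>HM) = (LBINT h. f h)" (is ?R1) "integrable HM f \<longleftrightarrow> integrable lborel f"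
proof -
  have e: "indicator {-(L/2)..<L/2} h * f h = f h" for h using assms(1)[of h] by (auto simp: indicator_def)
  show ?R1
    by (subst integral_restrict_space) (simp_all only: real_scaleR_def e, auto)
  show "integrable HM f \<longleftrightarrow> integrable lborel f"
    by (subst integrable_restrict_space) (simp_all only: real_scaleR_def e set_integrable_def, auto)
qed

text \<open>The logarithm stops at \<open>min (\<rho> t) l\<close>. The constant errors of the
  window integrate to at most \<open>1/5\<close> and the plateau to \<open>4/3\<close>, together
  below \<open>8/5\<close>; the missing part of the logarithm appears as the half power of
  \<open>\<rho> t\<close>.\<close>

lemma wlow_integral:
  assumes a: "0 < a" "a \<le> l" and g: "good t"
  shows "integrable HM (wlow a l (\<rho> t))"
    and "(ln l - ln a) / (4 * pi) - 8/5 - 1 / (2 * pi) * sqrt l * (if \<rho> t \<le> l then \<rho> t powr -(1/2) else 0)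
      \<le> (\<integral>h. wlow a l (\<rho> t) h \<partial>HM)" (is ?R1)
proof -
  have l: "l > 0" and r: "\<rho> t > 0" "\<rho> t \<le> L / 4" using a good_pos[OF g] good_le[OF g] by auto
  define m where "m = min (\<rho> t) l"
  have m: "0 < m" "m \<le> \<rho> t" "m \<le> l" using l r by (auto simp: m_def)
  define c where "c = 15 / (64 * pi * l) + 1 / (16 * pi * \<rho> t)"
  define f where "f h = 1 / (8 * pi * \<bar>h\<bar>) - c" for h :: real
  define w1 where "w1 h = indicator {h. a \<le> \<bar>h\<bar> \<and> \<bar>h\<bar> \<le> m} h * f h" for h :: real
  define w2 where "w2 h = 1 / (6 * l) * indicator {-4*l..4*l} h" for h :: real
  have w: "wlow a l (\<rho> t) h = w1 h - w2 h" for h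
    unfolding wlow_def w1_def w2_def f_def c_def m_def by (simp add: diff_diff_eq)
  have [measurable]: "w1 \<in> borel_measurable borel" unfolding w1_def f_def by measurable
  have w1z: "w1 h = 0" if "h \<notin> {-(L/2)..<L/2}" for h
    using that m r L by (auto simp: w1_def indicator_def)
  have cm: "2 * m * c \<le> 1/5"
  proof -
    have "2 * m * c = 15 / (32 * pi) * (m / l) + 1 / (8 * pi) * (m / \<rho> t)"
      by (simp add: c_def algebra_simps)
    also have "\<dots> \<le> 15 / (32 * pi) * 1 + 1 / (8 * pi) * 1"
      using m l r by (intro add_mono mult_left_mono) auto
    also have "\<dots> = 19 / (32 * pi)" by (simp add: field_simps)
    also have "\<dots> \<le> 19 / (32 * 3)" using pi_gt3 by (intro divide_left_mono) auto
    finally show ?thesis by simp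
  qed
  have w1: "integrable lborel w1 \<and> (ln m - ln a) / (4 * pi) - 1/5 \<le> (LBINT h. w1 h)"
  proof (cases "a \<le> m")
    case True
    have i0: "integrable lborel (\<lambda>h. indicator {a..m} h * (1 / h))" and e0: "(LBINT h. indicator {a..m} h * (1 / h)) = ln m - ln a"
      using integral_inverse_window[OF a(1) True] by auto
    have ic: "integrable lborel (\<lambda>h. indicator {a..m} h * c)" using indicator_Icc_integrable by simp
    have fe: "indicator {a..m} h * f h = 1 / (8 * pi) * (indicator {a..m} h * (1 / h)) - indicator {a..m} h * c" for h
      using a by (auto simp: indicator_def f_def)
    have i1: "integrable lborel (\<lambda>h. indicator {a..m} h * f h)" unfolding fe
      by (intro Bochner_Integration.integrable_diff integrable_mult_right i0 ic)
    have ev: "f (- h) = f h" for h by (simp add: f_def)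
    have "(LBINT h. indicator {a..m} h * f h) = 1 / (8 * pi) * (ln m - ln a) - (m - a) * c"
    proof -
      have "(LBINT h. indicator {a..m} h * f h) = (LBINT h. 1 / (8 * pi) * (indicator {a..m} h * (1 / h))) - (LBINT h. indicator {a..m} h * c)"
        unfolding fe by (rule Bochner_Integration.integral_diff[OF integrable_mult_right[OF i0] ic])
      also have "(LBINT h. 1 / (8 * pi) * (indicator {a..m} h * (1 / h))) = 1 / (8 * pi) * (ln m - ln a)"
        by (simp only: integral_mult_right_zero e0)
      also have "(LBINT h. indicator {a..m} h * c) = (m - a) * c" using True by simp
      finally show ?thesis .
    qed
    then have "(LBINT h. w1 h) = 2 * (1 / (8 * pi) * (ln m - ln a) - (m - a) * c)"
      unfolding w1_def using integral_sym_window(1)[OF i1 ev a(1)] by simp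
    also have "\<dots> = (ln m - ln a) / (4 * pi) - 2 * (m - a) * c" by (simp add: field_simps)
    finally have e: "(LBINT h. w1 h) = (ln m - ln a) / (4 * pi) - 2 * (m - a) * c" .
    have "2 * (m - a) * c \<le> 2 * m * c" using a l r by (intro mult_right_mono) (auto simp: c_def)
    then have "(ln m - ln a) / (4 * pi) - 1/5 \<le> (LBINT h. w1 h)" using cm e by linarith
    moreover have "integrable lborel w1" unfolding w1_def[abs_def] by (rule integral_sym_window(2)[OF i1 ev a(1)])
    ultimately show ?thesis by simp
  next
    case False
    then have w10: "w1 = (\<lambda>h. 0)" by (auto simp: w1_def indicator_def)
    have "ln m \<le> ln a" using False m by simp
    then have "(ln m - ln a) / (4 * pi) \<le> 0" by (intro divide_nonpos_pos) auto
    then have "(ln m - ln a) / (4 * pi) - 1/5 \<le> 0" by linarith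
    moreover have "(LBINT h. w1 h) = 0" "integrable lborel w1" by (simp_all add: w10)
    ultimately show ?thesis by (simp only: conj_absorb)
  qed
  have w2i: "integrable HM w2"
    unfolding w2_def by (rule finite_measure.integrable_const_bound[OF finite_HM, where B="1 / (6 * l)"])
      (use l in \<open>auto simp: indicator_def intro!: borel_HM\<close>)
  have w2: "(\<integral>h. w2 h \<partial>HM) \<le> 4/3"
  proof -
    have "ennreal (\<integral>h. w2 h \<partial>HM) = (\<integral>\<^sup>+h. ennreal (w2 h) \<partial>HM)"
      by (rule nn_integral_eq_integral[symmetric, OF w2i]) (use l in \<open>auto simp: w2_def\<close>)
    also have "\<dots> = (\<integral>\<^sup>+h. ennreal (w2 h) * indicator {-(L/2)..<L/2} h \<partial>lborel)"
      by (rule nn_HM) (simp add: w2_def)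
    also have "\<dots> \<le> (\<integral>\<^sup>+h. ennreal (1 / (6 * l)) * indicator {-4*l..4*l} h \<partial>lborel)"
      by (intro nn_integral_mono) (auto simp: w2_def indicator_def)
    also have "\<dots> = ennreal (1 / (6 * l)) * ennreal (8 * l)"
      using l by (simp add: nn_integral_cmult_indicator)
    also have "\<dots> = ennreal (4/3)" using l by (subst ennreal_mult[symmetric]) auto
    finally show ?thesis by (simp add: ennreal_le_iff)
  qed
  have w1i: "integrable HM w1" and w1e: "(\<integral>h. w1 h \<partial>HM) = (LBINT h. w1 h)"
    using HM_lborel[of w1] w1z w1 by auto
  have wd: "wlow a l (\<rho> t) = (\<lambda>h. w1 h - w2 h)" using w by auto
  show "integrable HM (wlow a l (\<rho> t))" unfolding wd using w1i w2i by simp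
  \<comment> \<open>From \<open>ln x = 2 * ln (sqrt x) \<le> 2 * sqrt x\<close> at
    \<open>x = l / \<rho> t\<close>. A logarithm of \<open>\<rho>\<close> becomes a half power,
    which the weak-type bound can integrate.\<close>
  have "ln l - 2 * (sqrt l * (if \<rho> t \<le> l then \<rho> t powr -(1/2) else 0)) \<le> ln m"
  proof (cases "\<rho> t \<le> l")
    case True
    have "ln (l / \<rho> t) = 2 * ln (sqrt (l / \<rho> t))" using l r by (simp add: ln_sqrt)
    also have "\<dots> \<le> 2 * sqrt (l / \<rho> t)" using ln_le_minus_one[of "sqrt (l / \<rho> t)"] l r by simp
    also have "sqrt (l / \<rho> t) = sqrt l * \<rho> t powr -(1/2)"
      using r l by (simp add: real_sqrt_divide powr_minus_divide powr_half_sqrt)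
    finally show ?thesis using True l r by (simp add: m_def ln_div)
  qed (simp add: m_def min_def)
  then have "(ln l - 2 * (sqrt l * (if \<rho> t \<le> l then \<rho> t powr -(1/2) else 0)) - ln a) / (4 * pi) \<le> (ln m - ln a) / (4 * pi)"
    by (intro divide_right_mono) auto
  also have "(ln l - 2 * (sqrt l * (if \<rho> t \<le> l then \<rho> t powr -(1/2) else 0)) - ln a) / (4 * pi)
    = (ln l - ln a) / (4 * pi) - 1 / (2 * pi) * sqrt l * (if \<rho> t \<le> l then \<rho> t powr -(1/2) else 0)"
    by (simp add: field_simps)
  finally show ?R1
    unfolding wd using w1i w2i w1 w2 w1e by simp
qed

definition JJ :: "real \<Rightarrow> real \<Rightarrow> real \<Rightarrow> real" where
  "JJ a l t = (\<integral>s. PP a l (\<gamma> t - \<gamma> s) * (\<tau> s \<bullet> \<tau> t) \<partial>CM)"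

lemma abs_\<tau>_inner: "\<bar>\<tau> s \<bullet> \<tau> t\<bar> \<le> 1"
  using Cauchy_Schwarz_ineq2[of "\<tau> s" "\<tau> t"] by simp

text \<open>Stated in \<open>ennreal\<close> because the integral of \<open>far\<close> need not be
  finite for each individual \<open>t\<close>; only its integral over \<open>t\<close> is
  controlled, by \<open>far_lemma\<close>.\<close>

lemma JJ_lower:
  assumes a: "0 < a" "a \<le> l" and g: "good t" and t: "0 \<le> t" "t < L"
  shows "ennreal ((ln l - ln a) / (4 * pi) - 8/5 - JJ a l t)
    \<le> ennreal (1 / (2 * pi) * sqrt l * (if \<rho> t \<le> l then \<rho> t powr -(1/2) else 0)) + (\<integral>\<^sup>+h. far (2 * l) t h \<partial>HM)"
proof -
  obtain B where B: "\<And>z::real^3. \<bar>GG a l (z \<bullet> z)\<bar> \<le> B" "\<And>z. \<bar>avg a l a z\<bar> \<le> B" "\<And>z. \<bar>avg a l l z\<bar> \<le> B"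
    using avg_bdd[OF a] by metis
  have PB: "\<bar>PP a l z\<bar> \<le> 2 * B" for z
    using B(1)[of z] B(2)[of z] B(3)[of z] unfolding PP_def by (simp add: abs_le_iff field_simps)
  define F where "F s = PP a l (\<gamma> t - \<gamma> s) * (\<tau> s \<bullet> \<tau> t)" for s
  note [measurable] = PP_measurable[OF a]
  have [measurable]: "F \<in> borel_measurable borel" unfolding F_def by measurable
  have FB: "\<bar>F s\<bar> \<le> 2 * B" for s
    unfolding F_def abs_mult using mult_mono[OF PB abs_\<tau>_inner] order_trans[OF abs_ge_zero PB] by simp
  have J: "JJ a l t = (\<integral>h. F (t + h) \<partial>HM)"
    unfolding JJ_def F_def[symmetric] by (rule integral_shift) (use FB t in \<open>auto simp: F_def per\<close>)
  have Fi: "integrable HM (\<lambda>h. F (t + h))"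
    by (rule finite_measure.integrable_const_bound[OF finite_HM, where B="2 * B"]) (use FB in \<open>auto intro!: borel_HM\<close>)
  have ae: "AE h in HM. \<bar>h\<bar> \<le> \<rho> t \<longrightarrow> norm (\<tau> (t + h) - \<tau> t) \<le> \<bar>h\<bar> / \<rho> t"
    using good_AE_h[OF g] by (subst AE_restrict_space_iff) auto
  have "ennreal ((\<integral>h. wlow a l (\<rho> t) h \<partial>HM) - JJ a l t) = ennreal (\<integral>h. wlow a l (\<rho> t) h - F (t + h) \<partial>HM)"
    using wlow_integral(1)[OF a g] Fi by (simp add: J)
  also have "\<dots> \<le> (\<integral>\<^sup>+h. far (2 * l) t h \<partial>HM)"
  proof (rule integral_le_nn')
    show "integrable HM (\<lambda>h. wlow a l (\<rho> t) h - F (t + h))" using wlow_integral(1)[OF a g] Fi by simp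
    have "AE h in HM. h \<in> space HM" by (rule AE_space)
    then show "AE h in HM. ennreal (wlow a l (\<rho> t) h - F (t + h)) \<le> far (2 * l) t h"
      using ae
    proof eventually_elim
      fix h assume h: "h \<in> space HM" and *: "\<bar>h\<bar> \<le> \<rho> t \<longrightarrow> norm (\<tau> (t + h) - \<tau> t) \<le> \<bar>h\<bar> / \<rho> t"
      show "ennreal (wlow a l (\<rho> t) h - F (t + h)) \<le> far (2 * l) t h"
        unfolding F_def using wlow_le[OF a g _ *] h by (auto simp: abs_le_iff)
    qed
  qed
  finally have 1: "ennreal ((\<integral>h. wlow a l (\<rho> t) h \<partial>HM) - JJ a l t) \<le> (\<integral>\<^sup>+h. far (2 * l) t h \<partial>HM)" .
  let ?X = "1 / (2 * pi) * sqrt l * (if \<rho> t \<le> l then \<rho> t powr -(1/2) else 0)"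
  have "ennreal ((ln l - ln a) / (4 * pi) - 8/5 - JJ a l t) \<le> ennreal (((\<integral>h. wlow a l (\<rho> t) h \<partial>HM) - JJ a l t) + ?X)"
    using wlow_integral(2)[OF a g] by (intro ennreal_leI) linarith
  also have "\<dots> \<le> ennreal ((\<integral>h. wlow a l (\<rho> t) h \<partial>HM) - JJ a l t) + ennreal ?X"
    using a by (intro ennreal_add_le) auto
  also have "\<dots> \<le> (\<integral>\<^sup>+h. far (2 * l) t h \<partial>HM) + ennreal ?X" by (intro add_right_mono 1)
  finally show ?thesis by (simp add: add.commute)
qed

lemma far_measurable: "(\<lambda>t. \<integral>\<^sup>+h. far R t h \<partial>HM) \<in> borel_measurable CM"
proof -
  interpret H: finite_measure HM by (rule finite_HM)
  have [measurable]: "(\<lambda>h. h) \<in> borel_measurable HM" by (rule borel_HM) simp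
  have [measurable]: "(\<lambda>h. h) \<in> borel_measurable CM" by (rule borel_CM) simp
  have "(\<lambda>(t, h). far R t h) \<in> borel_measurable (CM \<Otimes>\<^sub>M HM)"
    unfolding far_def by measurable
  then show ?thesis by measurable
qed

lemma JJ_integral:
  assumes a: "0 < a" "a \<le> l" and Ji: "integrable CM (JJ a l)"
  shows "L * ((ln l - ln a) / (4 * pi) - 8/5) - (2 * K * l / pi + 480 * K\<^sup>2 * l) \<le> (\<integral>t. JJ a l t \<partial>CM)"
proof -
  have l: "l > 0" using a by simp
  let ?c = "(ln l - ln a) / (4 * pi) - 8/5"
  have ic: "integrable CM (\<lambda>t. ?c - JJ a l t)" using Ji by simp
  let ?X = "\<lambda>t. ennreal (1 / (2 * pi) * sqrt l * (if \<rho> t \<le> l then \<rho> t powr -(1/2) else 0))"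
  have m: "?X \<in> borel_measurable CM" by (rule borel_CM) measurable
  have "(\<integral>t. ?c - JJ a l t \<partial>CM) \<le> 2 * K * l / pi + 480 * K\<^sup>2 * l"
  proof (rule integral_le_nn[OF ic])
    have eq: "ennreal (2 * K * l / pi) + ennreal (240 * K\<^sup>2 * (2 * l)) = ennreal (2 * K * l / pi + 480 * K\<^sup>2 * l)"
      using l K by (subst ennreal_plus[symmetric]) (auto simp: algebra_simps)
    have "AE t in CM. t \<in> space CM" by (rule AE_space)
    then show "AE t in CM. ennreal (?c - JJ a l t) \<le> ?X t + (\<integral>\<^sup>+h. far (2 * l) t h \<partial>HM)"
      using AE_CM_good by eventually_elim (use JJ_lower[OF a] in auto)
    have "(\<integral>\<^sup>+t. ?X t + (\<integral>\<^sup>+h. far (2 * l) t h \<partial>HM) \<partial>CM) = (\<integral>\<^sup>+t. ?X t \<partial>CM) + (\<integral>\<^sup>+t. (\<integral>\<^sup>+h. far (2 * l) t h \<partial>HM) \<partial>CM)"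
      by (rule nn_integral_add[OF m far_measurable])
    also have "(\<integral>\<^sup>+t. ?X t \<partial>CM) = (\<integral>\<^sup>+t. ennreal (1 / (2 * pi) * sqrt l) * (if \<rho> t \<le> l then ennreal (\<rho> t powr -(1/2)) else 0) \<partial>CM)"
      using l by (intro nn_integral_cong) (auto simp: ennreal_mult'[symmetric])
    also have "\<dots> = ennreal (1 / (2 * pi) * sqrt l) * (\<integral>\<^sup>+t. (if \<rho> t \<le> l then ennreal (\<rho> t powr -(1/2)) else 0) \<partial>CM)"
      by (rule nn_integral_cmult) (rule borel_CM, measurable)
    also have "\<dots> \<le> ennreal (1 / (2 * pi) * sqrt l) * ennreal (4 * K * sqrt l)"
      using l by (intro mult_left_mono CM_\<rho>_le) auto
    also have "\<dots> = ennreal (1 / (2 * pi) * sqrt l * (4 * K * sqrt l))"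
      using l by (intro ennreal_mult'[symmetric]) auto
    also have "1 / (2 * pi) * sqrt l * (4 * K * sqrt l) = 2 * K * l / pi"
      using l by (simp add: field_simps)
    also have "(\<integral>\<^sup>+t. (\<integral>\<^sup>+h. far (2 * l) t h \<partial>HM) \<partial>CM) \<le> ennreal (240 * K\<^sup>2 * (2 * l))"
      unfolding far_def using l by (intro far_lemma) simp
    finally show "(\<integral>\<^sup>+t. ?X t + (\<integral>\<^sup>+h. far (2 * l) t h \<partial>HM) \<partial>CM) \<le> ennreal (2 * K * l / pi + 480 * K\<^sup>2 * l)"
      unfolding eq[symmetric] by (simp add: add_mono)
  qed (use l K in auto)
  moreover have "(\<integral>t. ?c - JJ a l t \<partial>CM) = L * ?c - (\<integral>t. JJ a l t \<partial>CM)"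
    using Ji measure_CM by simp
  ultimately show ?thesis by linarith
qed

definition curl_pair :: "(real^3 \<Rightarrow> real^3) \<Rightarrow> (3 \<Rightarrow> real^3 \<Rightarrow> real^3) \<Rightarrow> real" where
  "curl_pair u dZ = (LBINT x. curlv dZ x \<bullet> u x)"

text \<open>The flat-norm hypothesis in dual form, with explicit derivatives and a Borel field
  \<open>u\<close>. This is the only form in which it is used below.\<close>

definition flat_close :: "real \<Rightarrow> (real^3 \<Rightarrow> real^3) \<Rightarrow> bool" where
  "flat_close \<epsilon> u \<longleftrightarrow> (\<forall>Z dZ A. C1c Z dZ \<longrightarrow> A > 0 \<longrightarrow> (\<forall>x. norm (curlv dZ x) \<le> A) \<longrightarrow>
     \<bar>curl_pair u dZ - pairing Z\<bar> \<le> \<epsilon> * L * A)"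

lemma L2_inner_integrable:
  fixes u v :: "real^3 \<Rightarrow> real^3"
  assumes [measurable]: "u \<in> borel_measurable borel" "v \<in> borel_measurable borel"
    and "integrable lborel (\<lambda>x. (norm (u x))\<^sup>2)" "integrable lborel (\<lambda>x. (norm (v x))\<^sup>2)"
  shows "integrable lborel (\<lambda>x. v x \<bullet> u x)"
proof (rule Bochner_Integration.integrable_bound[where f="\<lambda>x. (norm (v x))\<^sup>2 + (norm (u x))\<^sup>2"])
  have "\<bar>v x \<bullet> u x\<bar> \<le> (norm (v x))\<^sup>2 + (norm (u x))\<^sup>2" for x
  proof -
    have "\<bar>v x \<bullet> u x\<bar> \<le> norm (v x) * norm (u x)" by (rule Cauchy_Schwarz_ineq2)
    also have "\<dots> \<le> (norm (v x))\<^sup>2 + (norm (u x))\<^sup>2"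
      using sum_squares_bound[of "norm (v x)" "norm (u x)"] mult_nonneg_nonneg[OF norm_ge_zero[of "v x"] norm_ge_zero[of "u x"]]
      by linarith
    finally show ?thesis .
  qed
  then show "AE x in lborel. norm (v x \<bullet> u x) \<le> norm ((norm (v x))\<^sup>2 + (norm (u x))\<^sup>2)" by (auto intro!: AE_I2)
qed (use assms in auto)

lemma C1c_sq_integrable:
  fixes v :: "real^3 \<Rightarrow> real^3"
  assumes "C1c v dv"
  shows "integrable lborel (\<lambda>x. (norm (v x))\<^sup>2)"
proof -
  obtain R where R: "\<And>x. R \<le> norm x \<Longrightarrow> v x = 0" using C1c_supp'[OF assms] by metis
  show ?thesis
    by (rule compact_supp_integrable[where R=R]) (use R C1c_cont[OF assms] in \<open>auto intro!: continuous_intros\<close>)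
qed

text \<open>Expanding the nonnegative integral of \<open>(norm (u x - v x))\<^sup>2\<close> shows
  that half the energy of \<open>u\<close> is at least the integral of \<open>v \<bullet> u\<close>
  minus half the energy of \<open>v\<close>. For \<open>v = curl \<xi>\<close> the first term is the
  pairing of \<open>\<xi>\<close> with the curve up to the flat-norm error, and the resulting
  difference is the integral of \<open>JJ\<close>.\<close>

lemma lower_bound:
  assumes a: "0 < a" "a \<le> l" and u[measurable]: "u \<in> borel_measurable borel" "integrable lborel (\<lambda>x. (norm (u x))\<^sup>2)"
    and F: "flat_close \<epsilon> u" and e: "0 \<le> \<epsilon>"
  shows "L * ((ln l - ln a) / (4 * pi) - 8/5) - (2 * K * l / pi + 480 * K\<^sup>2 * l) - \<epsilon> * L * (23 * K / a)
    \<le> (LBINT x. (norm (u x))\<^sup>2) / 2"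
proof -
  define v where "v = vfield (GG' a l)"
  have l: "l > 0" using a by simp
  note vC = vfield_C1c[OF C1c_GG(2)[OF a], folded v_def] and xi = xi_C1c[OF a]
  note [measurable] = C1c_measurable[OF vC] C1c_measurable[OF xi]
  note vi = C1c_sq_integrable[OF vC]
  have vu: "integrable lborel (\<lambda>x. v x \<bullet> u x)" by (rule L2_inner_integrable[OF u(1) C1c_measurable[OF vC] u(2) vi])
  obtain B where B: "\<And>z::real^3. \<bar>GG a l (z \<bullet> z)\<bar> \<le> B" "\<And>z. \<bar>avg a l a z\<bar> \<le> B" "\<And>z. \<bar>avg a l l z\<bar> \<le> B"
    using avg_bdd[OF a] by metis
  have B0: "0 \<le> B" using B(1)[of 0] by linarith
  let ?A = "\<lambda>t s. (avg a l a (\<gamma> t - \<gamma> s) - avg a l l (\<gamma> t - \<gamma> s)) * (\<tau> s \<bullet> \<tau> t)"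
  let ?G = "\<lambda>t s. GG a l ((\<gamma> t - \<gamma> s) \<bullet> (\<gamma> t - \<gamma> s)) * (\<tau> s \<bullet> \<tau> t)"
  have [measurable]: "avg a l a \<in> borel_measurable borel" "avg a l l \<in> borel_measurable borel"
    using a by (auto intro!: avg_measurable)
  have Gm: "(\<lambda>x::real^3. GG a l (x \<bullet> x)) \<in> borel_measurable borel"
    using C1c_cont[OF C1c_GG(1)[OF a]] by (auto intro: borel_measurable_continuous_onI)
  have GG_m[measurable]: "(\<lambda>s. GG a l ((\<gamma> t - \<gamma> s) \<bullet> (\<gamma> t - \<gamma> s))) \<in> borel_measurable borel" for t
    using measurable_compose[OF _ Gm, of "\<lambda>s. \<gamma> t - \<gamma> s" borel] by simp
  have iA: "integrable CM (?A t)" for t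
  proof (rule CM_integrable[where B="2 * B"])
    show "norm (?A t s) \<le> 2 * B" for s
      using mult_mono[OF _ abs_\<tau>_inner, of "\<bar>avg a l a (\<gamma> t - \<gamma> s) - avg a l l (\<gamma> t - \<gamma> s)\<bar>" "2 * B" s t]
        B(2)[of "\<gamma> t - \<gamma> s"] B(3)[of "\<gamma> t - \<gamma> s"] B0 by (simp add: abs_mult)
  qed measurable
  have iG: "integrable CM (?G t)" for t
  proof (rule CM_integrable[where B=B])
    show "norm (?G t s) \<le> B" for s
      using mult_mono[OF B(1)[of "\<gamma> t - \<gamma> s"] abs_\<tau>_inner[of s t]] B0 by (simp add: abs_mult)
  qed measurable
  have J: "JJ a l t = xi a l (\<gamma> t) \<bullet> \<tau> t - (\<integral>s. ?A t s \<partial>CM) / 2" for t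
  proof -
    have "JJ a l t = (\<integral>s. ?G t s - ?A t s / 2 \<partial>CM)"
      unfolding JJ_def PP_def by (intro Bochner_Integration.integral_cong) (auto simp: algebra_simps)
    also have "\<dots> = (\<integral>s. ?G t s \<partial>CM) - (\<integral>s. ?A t s \<partial>CM) / 2"
      using iA iG by simp
    finally show ?thesis by (simp add: xi_inner[OF a])
  qed
  obtain Bx where Bx: "\<And>x. norm (xi a l x) \<le> Bx" using C1c_bounded[OF xi] by metis
  have ix: "integrable CM (\<lambda>t. xi a l (\<gamma> t) \<bullet> \<tau> t)"
  proof (rule CM_integrable[where B=Bx])
    show "norm (xi a l (\<gamma> t) \<bullet> \<tau> t) \<le> Bx" for t
      using Cauchy_Schwarz_ineq2[of "xi a l (\<gamma> t)" "\<tau> t"] Bx[of "\<gamma> t"] by simp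
  qed measurable
  note vv = energy_vv[OF a, folded v_def]
  have Ji: "integrable CM (JJ a l)" unfolding J[abs_def] using ix vv(2) by simp
  have "(\<integral>t. JJ a l t \<partial>CM) = pairing (xi a l) - (LBINT x. v x \<bullet> v x) / 2"
    unfolding J pairing_def using ix vv by simp
  then have 1: "L * ((ln l - ln a) / (4 * pi) - 8/5) - (2 * K * l / pi + 480 * K\<^sup>2 * l) \<le> pairing (xi a l) - (LBINT x. v x \<bullet> v x) / 2"
    using JJ_integral[OF a Ji] by simp
  have "\<bar>curl_pair u (dxi a l) - pairing (xi a l)\<bar> \<le> \<epsilon> * L * (23 * K / a)"
  proof -
    have p: "23 * K / a > 0" using K a by simp
    show ?thesis
      by (rule F[unfolded flat_close_def, rule_format, OF xi p]) (simp only: curlv_dxi[OF a] vfield_GG_bound[OF a])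
  qed
  then have 2: "pairing (xi a l) - \<epsilon> * L * (23 * K / a) \<le> (LBINT x. v x \<bullet> u x)"
    unfolding curl_pair_def curlv_dxi[OF a] v_def by linarith
  have "0 \<le> (LBINT x. (norm (u x - v x))\<^sup>2)" by simp
  also have "\<dots> = (LBINT x. (norm (u x))\<^sup>2 - 2 * (v x \<bullet> u x) + (norm (v x))\<^sup>2)"
    by (intro Bochner_Integration.integral_cong) (auto simp: power2_norm_eq_inner inner_diff inner_commute algebra_simps)
  also have "\<dots> = (LBINT x. (norm (u x))\<^sup>2) - 2 * (LBINT x. v x \<bullet> u x) + (LBINT x. (norm (v x))\<^sup>2)"
    using u(2) vu vi by simp
  also have "(LBINT x. (norm (v x))\<^sup>2) = (LBINT x. v x \<bullet> v x)" by (simp add: power2_norm_eq_inner)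
  finally show ?thesis using 1 2 by linarith
qed

end

section \<open>The truncated biharmonic kernel\<close>

text \<open>The first four derivatives of \<open>sqrt\<close>, continued below \<open>y = 1\<close> by the Taylor polynomial of degree four of \<open>sqrt\<close> at \<open>1\<close>.\<close>

definition n1 :: "real \<Rightarrow> real" where
  "n1 y = (if y \<le> 1 then 1/2 + 1/4 * (1 - y) + 3/16 * (1 - y)^2 + 5/32 * (1 - y)^3 else 1/2 * y powr -(1/2))"
definition n2 :: "real \<Rightarrow> real" where
  "n2 y = (if y \<le> 1 then - 1/4 - 3/8 * (1 - y) - 15/32 * (1 - y)^2 else - (1/4) * y powr -(3/2))"
definition n3 :: "real \<Rightarrow> real" where
  "n3 y = (if y \<le> 1 then 3/8 + 15/16 * (1 - y) else 3/8 * y powr -(5/2))"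
definition n4 :: "real \<Rightarrow> real" where
  "n4 y = - (15/16) * max 1 y powr -(7/2)"

lemma n_deriv: "DERIV n1 y :> n2 y" "DERIV n2 y :> n3 y" "DERIV n3 y :> n4 y"
proof -
  have "DERIV (\<lambda>y. if y \<le> 1 then 1/2 + 1/4 * (1 - y) + 3/16 * (1 - y)^2 + 5/32 * (1 - y)^3 else 1/2 * y powr -(1/2)) y :>
     (if y \<le> 1 then - 1/4 - 3/8 * (1 - y) - 15/32 * (1 - y)^2 else - (1/4) * y powr -(3/2))"
  proof (rule DERIV_glue)
    fix y :: real
    show "DERIV (\<lambda>y. 1/2 + 1/4 * (1 - y) + 3/16 * (1 - y)^2 + 5/32 * (1 - y)^3) y :> - 1/4 - 3/8 * (1 - y) - 15/32 * (1 - y)^2"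
      by (rule derivative_eq_intros refl)+ (simp add: field_simps power2_eq_square)
    show "DERIV (\<lambda>y. 1/2 * y powr -(1/2)) y :> - (1/4) * y powr -(3/2)" if "1 \<le> y"
      using DERIV_powr'[of y "1/2" "-(1/2)"] that by simp
  qed auto
  then show "DERIV n1 y :> n2 y" unfolding n1_def[abs_def] n2_def .
  have "DERIV (\<lambda>y. if y \<le> 1 then - 1/4 - 3/8 * (1 - y) - 15/32 * (1 - y)^2 else - (1/4) * y powr -(3/2)) y :>
     (if y \<le> 1 then 3/8 + 15/16 * (1 - y) else 3/8 * y powr -(5/2))"
  proof (rule DERIV_glue)
    fix y :: real
    show "DERIV (\<lambda>y. - 1/4 - 3/8 * (1 - y) - 15/32 * (1 - y)^2) y :> 3/8 + 15/16 * (1 - y)"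
      by (rule derivative_eq_intros refl)+ (simp add: field_simps power2_eq_square)
    show "DERIV (\<lambda>y. - (1/4) * y powr -(3/2)) y :> 3/8 * y powr -(5/2)" if "1 \<le> y"
      using DERIV_powr'[of y "-(1/4)" "-(3/2)"] that by simp
  qed auto
  then show "DERIV n2 y :> n3 y" unfolding n2_def[abs_def] n3_def .
  have *: "DERIV (\<lambda>y. if y \<le> 1 then 3/8 + 15/16 * (1 - y) else 3/8 * y powr -(5/2)) y :>
     (if y \<le> 1 then - (15/16) else - (15/16) * y powr -(7/2))"
  proof (rule DERIV_glue)
    fix y :: real
    show "DERIV (\<lambda>y. 3/8 + 15/16 * (1 - y)) y :> - (15/16)"
      by (rule derivative_eq_intros refl)+ simp
    show "DERIV (\<lambda>y. 3/8 * y powr -(5/2)) y :> - (15/16) * y powr -(7/2)" if "1 \<le> y"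
      using DERIV_powr'[of y "3/8" "-(5/2)"] that by simp
  qed auto
  show "DERIV n3 y :> n4 y"
  proof -
    have "n4 y = (if y \<le> 1 then - (15/16) else - (15/16) * y powr -(7/2))" by (simp add: n4_def)
    with * show ?thesis unfolding n3_def[abs_def] by simp
  qed
qed

lemma n_outer:
  assumes "1 \<le> y"
  shows "n1 y = 1/2 * y powr -(1/2)" "n2 y = - (1/4) * y powr -(3/2)" "n3 y = 3/8 * y powr -(5/2)" "n4 y = - (15/16) * y powr -(7/2)"
  using assms by (cases "y = 1"; simp add: n1_def n2_def n3_def n4_def max_def)+

lemma n_bounds:
  assumes "0 \<le> y"
  shows "\<bar>n1 y\<bar> \<le> 2 * max 1 y powr -(1/2)" "\<bar>n2 y\<bar> \<le> 2 * max 1 y powr -(3/2)"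
    "\<bar>n3 y\<bar> \<le> 2 * max 1 y powr -(5/2)" "\<bar>n4 y\<bar> \<le> 2 * max 1 y powr -(7/2)"
proof -
  have "\<bar>n1 y\<bar> \<le> 2 \<and> \<bar>n2 y\<bar> \<le> 2 \<and> \<bar>n3 y\<bar> \<le> 2" if y: "y \<le> 1"
  proof -
    have p: "0 \<le> (1 - y)^2" "(1 - y)^2 \<le> 1" "0 \<le> (1 - y)^3" "(1 - y)^3 \<le> 1"
      using assms y by (auto simp: power_le_one)
    have e: "1/2 + 1/4 * w + 3/16 * w2 + 5/32 * w3 \<le> 2" "- 1/4 - 3/8 * w - 15/32 * w2 \<le> 2" "- 2 \<le> - 1/4 - 3/8 * w - 15/32 * w2"
        "0 \<le> 1/2 + 1/4 * w + 3/16 * w2 + 5/32 * w3" "3/8 + 15/16 * w \<le> 2" "0 \<le> 3/8 + 15/16 * w"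
      if "0 \<le> w" "w \<le> 1" "0 \<le> w2" "w2 \<le> 1" "0 \<le> w3" "w3 \<le> 1" for w w2 w3 :: real
      using that by linarith+
    have w: "0 \<le> 1 - y" "1 - y \<le> 1" using assms y by auto
    show ?thesis
      unfolding n1_def n2_def n3_def if_P[OF y]
      using e[OF w p] by (intro conjI abs_leI; linarith)
  qed
  note small = this
  have b4: "\<bar>n4 y\<bar> \<le> 2 * max 1 y powr -(7/2)"
    unfolding n4_def abs_mult by (intro mult_mono) auto
  have "\<bar>n1 y\<bar> \<le> 2 * max 1 y powr -(1/2) \<and> \<bar>n2 y\<bar> \<le> 2 * max 1 y powr -(3/2) \<and> \<bar>n3 y\<bar> \<le> 2 * max 1 y powr -(5/2)"
  proof (cases "y \<le> 1")
    case True
    then have "max 1 y = 1" by simp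
    then show ?thesis using small[OF True] by simp
  next
    case False
    then have m: "max 1 y = y" and y1: "1 \<le> y" by simp_all
    show ?thesis unfolding m n_outer[OF y1] abs_mult by (intro conjI mult_mono) auto
  qed
  then show "\<bar>n1 y\<bar> \<le> 2 * max 1 y powr -(1/2)" "\<bar>n2 y\<bar> \<le> 2 * max 1 y powr -(3/2)"
    "\<bar>n3 y\<bar> \<le> 2 * max 1 y powr -(5/2)" "\<bar>n4 y\<bar> \<le> 2 * max 1 y powr -(7/2)"
    using b4 by auto
qed

text \<open>Derivatives, in \<open>y = x \<bullet> x\<close>, of the truncated biharmonic kernel
  \<open>norm x / (8 * pi)\<close>. The family starts with the first derivative, since the second
  spatial partials are built from \<open>ps1\<close> and \<open>ps2\<close>; four orders are reached
  because the Laplacian is applied twice.\<close>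

definition ps1 :: "real \<Rightarrow> real \<Rightarrow> real" where "ps1 R y = 1 / (8*pi*R) * n1 (y / R\<^sup>2)"
definition ps2 :: "real \<Rightarrow> real \<Rightarrow> real" where "ps2 R y = 1 / (8*pi*R^3) * n2 (y / R\<^sup>2)"
definition ps3 :: "real \<Rightarrow> real \<Rightarrow> real" where "ps3 R y = 1 / (8*pi*R^5) * n3 (y / R\<^sup>2)"
definition ps4 :: "real \<Rightarrow> real \<Rightarrow> real" where "ps4 R y = 1 / (8*pi*R^7) * n4 (y / R\<^sup>2)"

lemma ps_deriv:
  assumes "R > 0"
  shows "DERIV (ps1 R) y :> ps2 R y" "DERIV (ps2 R) y :> ps3 R y" "DERIV (ps3 R) y :> ps4 R y"
proof -
  have s: "DERIV (\<lambda>y. y / R\<^sup>2) y :> 1 / R\<^sup>2" by (rule DERIV_cdivide) simp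
  show "DERIV (ps1 R) y :> ps2 R y"
    unfolding ps1_def[abs_def] ps2_def using DERIV_cmult[OF DERIV_chain2[OF n_deriv(1) s], of "1 / (8*pi*R)"]
    by (simp add: power_numeral_reduce mult_ac)
  show "DERIV (ps2 R) y :> ps3 R y"
    unfolding ps2_def[abs_def] ps3_def using DERIV_cmult[OF DERIV_chain2[OF n_deriv(2) s], of "1 / (8*pi*R^3)"]
    by (simp add: power_numeral_reduce mult_ac)
  show "DERIV (ps3 R) y :> ps4 R y"
    unfolding ps3_def[abs_def] ps4_def using DERIV_cmult[OF DERIV_chain2[OF n_deriv(3) s], of "1 / (8*pi*R^5)"]
    by (simp add: power_numeral_reduce mult_ac)
qed

lemma ps4_cont: "R > 0 \<Longrightarrow> continuous_on UNIV (ps4 R)"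
  unfolding ps4_def[abs_def] n4_def by (intro continuous_intros) auto

lemma ps_outer:
  assumes "R > 0" "R\<^sup>2 \<le> y"
  shows "ps1 R y = 1 / (16*pi) * y powr -(1/2)" "ps2 R y = - 1 / (32*pi) * y powr -(3/2)"
    "ps3 R y = 3 / (64*pi) * y powr -(5/2)" "ps4 R y = - 15 / (128*pi) * y powr -(7/2)"
proof -
  have y: "y > 0" using assms by (meson less_le_trans zero_less_power)
  have u: "1 \<le> y / R\<^sup>2" using assms by simp
  have p: "R powr 1 = R" "R powr 3 = R^3" "R powr 5 = R^5" "R powr 7 = R^7" using assms by (simp_all add: powr_numeral)
  show "ps1 R y = 1 / (16*pi) * y powr -(1/2)" "ps2 R y = - 1 / (32*pi) * y powr -(3/2)"
    "ps3 R y = 3 / (64*pi) * y powr -(5/2)" "ps4 R y = - 15 / (128*pi) * y powr -(7/2)"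
    unfolding ps1_def ps2_def ps3_def ps4_def n_outer[OF u] powr_sq_div[OF assms(1) y] using assms p by simp_all
qed

lemma max_sq_powr:
  assumes "R > 0"
  shows "max 1 ((x \<bullet> x) / R\<^sup>2) powr r = max R (norm x) powr (2 * r) * R powr (-2 * r)"
proof -
  have "max 1 ((x \<bullet> x) / R\<^sup>2) = (max R (norm x))\<^sup>2 / R\<^sup>2"
  proof (cases "norm x \<le> R")
    case True
    then have "(norm x)\<^sup>2 \<le> R\<^sup>2" by (intro power_mono) auto
    then show ?thesis using True assms by (simp add: power2_norm_eq_inner max_def)
  next
    case False
    then have "R\<^sup>2 \<le> (norm x)\<^sup>2" using assms by (intro power_mono) auto
    then show ?thesis using False assms by (simp add: power2_norm_eq_inner max_def)
  qed
  moreover have m: "max R (norm x) > 0" using assms by simp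
  ultimately show ?thesis using powr_sq_div[OF assms, of "(max R (norm x))\<^sup>2" r] powr_sq[OF m, of r] by simp
qed

lemma ps_bounds:
  assumes R: "R > 0"
  shows "\<bar>ps1 R (x \<bullet> x)\<bar> \<le> 1 / (4*pi) * max R (norm x) powr -1" (is ?R1)
    "\<bar>ps2 R (x \<bullet> x)\<bar> \<le> 1 / (4*pi) * max R (norm x) powr -3" (is ?R2)
    "\<bar>ps3 R (x \<bullet> x)\<bar> \<le> 1 / (4*pi) * max R (norm x) powr -5" (is ?R3)
proof -
  have p: "R powr 1 = R" "R powr 3 = R^3" "R powr 5 = R^5" using R by (simp_all add: powr_numeral)
  have y: "0 \<le> x \<bullet> x / R\<^sup>2" by simp
  have s: "\<bar>1 / (8 * pi * P) * n\<bar> \<le> 1 / (4*pi) * M" if "\<bar>n\<bar> \<le> 2 * (M * P)" "P > 0" for n P M :: real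
  proof -
    have "\<bar>1 / (8 * pi * P) * n\<bar> = 1 / (8 * pi * P) * \<bar>n\<bar>" using that by (simp add: abs_mult)
    also have "\<dots> \<le> 1 / (8 * pi * P) * (2 * (M * P))" using that by (intro mult_left_mono) auto
    also have "\<dots> = 1 / (4*pi) * M" using that by simp
    finally show ?thesis .
  qed
  show ?R1
    unfolding ps1_def using n_bounds(1)[OF y] R p max_sq_powr[OF R, of x "-(1/2)"] by (intro s) auto
  show ?R2
    unfolding ps2_def using n_bounds(2)[OF y] R p max_sq_powr[OF R, of x "-(3/2)"] by (intro s) auto
  show ?R3
    unfolding ps3_def using n_bounds(3)[OF y] R p max_sq_powr[OF R, of x "-(5/2)"] by (intro s) auto
qed

text \<open>\<open>gn1\<close>, \<open>gn2\<close> are the first two derivatives of the Laplacian \<open>6 ps1 + 4 y ps2\<close>, a truncated Newton kernel, and \<open>dl\<close> is minus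
  the Laplacian of that kernel.\<close>

definition gn1 :: "real \<Rightarrow> real \<Rightarrow> real" where "gn1 R y = 10 * ps2 R y + 4 * y * ps3 R y"
definition gn2 :: "real \<Rightarrow> real \<Rightarrow> real" where "gn2 R y = 14 * ps3 R y + 4 * y * ps4 R y"
definition dl :: "real \<Rightarrow> real \<Rightarrow> real" where "dl R y = - (6 * gn1 R y + 4 * y * gn2 R y)"

lemma gn_deriv: "R > 0 \<Longrightarrow> DERIV (gn1 R) y :> gn2 R y"
  unfolding gn1_def[abs_def] gn2_def
  by (rule derivative_eq_intros ps_deriv refl | assumption)+ (simp add: algebra_simps)

lemma gn2_cont: "R > 0 \<Longrightarrow> continuous_on UNIV (gn2 R)"
  unfolding gn2_def[abs_def] by (intro continuous_intros ps4_cont DERIV_cont[OF ps_deriv(3)]) auto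

lemma gn_outer:
  assumes "R > 0" "R\<^sup>2 \<le> y"
  shows "6 * ps1 R y + 4 * y * ps2 R y = 1 / (4*pi) * y powr -(1/2)" (is ?R1) "gn1 R y = - 1 / (8*pi) * y powr -(3/2)"
    "gn2 R y = 3 / (16*pi) * y powr -(5/2)"
proof -
  have y: "y > 0" using assms by (meson less_le_trans zero_less_power)
  have e: "y * y powr -(3/2) = y powr -(1/2)" "y * y powr -(5/2) = y powr -(3/2)" "y * y powr -(7/2) = y powr -(5/2)"
    using y by (simp_all add: powr_mult_base)
  have "6 * ps1 R y + 4 * y * ps2 R y = 6 * (1 / (16*pi)) * y powr -(1/2) - 4 / (32*pi) * (y * y powr -(3/2))"
    unfolding ps_outer[OF assms] by simp
  then show ?R1 unfolding e by (simp add: field_simps)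
  have "gn1 R y = - 10 / (32*pi) * y powr -(3/2) + 12 / (64*pi) * (y * y powr -(5/2))"
    unfolding gn1_def ps_outer[OF assms] by simp
  then show "gn1 R y = - 1 / (8*pi) * y powr -(3/2)" unfolding e by (simp add: field_simps)
  have "gn2 R y = 42 / (64*pi) * y powr -(5/2) - 60 / (128*pi) * (y * y powr -(7/2))"
    unfolding gn2_def ps_outer[OF assms] by simp
  then show "gn2 R y = 3 / (16*pi) * y powr -(5/2)" unfolding e by (simp add: field_simps)
qed

lemma dl_zero:
  assumes "R > 0" "R\<^sup>2 \<le> y"
  shows "dl R y = 0"
proof -
  have y: "y > 0" using assms by (meson less_le_trans zero_less_power)
  have e: "y * y powr -(5/2) = y powr -(3/2)" using y by (simp add: powr_mult_base)
  have "dl R y = 6 / (8*pi) * y powr -(3/2) - 12 / (16*pi) * (y * y powr -(5/2))"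
    unfolding dl_def gn_outer(2,3)[OF assms] by simp
  then show ?thesis unfolding e by simp
qed

lemma dl_cont: "R > 0 \<Longrightarrow> continuous_on UNIV (\<lambda>x::real^3. dl R (x \<bullet> x))"
  unfolding dl_def by (intro continuous_intros radial_continuous gn2_cont DERIV_cont[OF gn_deriv]) auto

lemma dl_bound:
  assumes R: "R > 0" and y: "0 \<le> y"
  shows "\<bar>dl R y\<bar> \<le> 16 / R^3"
proof (cases "R\<^sup>2 \<le> y")
  case True then show ?thesis using dl_zero[OF R True] R by simp
next
  case False
  define u where "u = y / R\<^sup>2"
  have u: "0 \<le> u" "u \<le> 1" "y = u * R\<^sup>2" using False R y by (auto simp: u_def)
  have "dl R y = - (60 * ps2 R y + 80 * y * ps3 R y + 16 * y * y * ps4 R y)"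
    unfolding dl_def gn1_def gn2_def by (simp add: algebra_simps)
  also have "\<dots> = - 1 / (8*pi*R^3) * (60 * n2 u + 80 * u * n3 u + 16 * u * u * n4 u)"
    using R unfolding ps2_def ps3_def ps4_def u_def[symmetric] by (simp add: u(3) field_simps power_numeral_reduce)
  finally have e: "dl R y = - 1 / (8*pi*R^3) * (60 * n2 u + 80 * u * n3 u + 16 * u * u * n4 u)" .
  have m: "\<bar>n2 u\<bar> \<le> 2" "\<bar>n3 u\<bar> \<le> 2" "\<bar>n4 u\<bar> \<le> 2"
  proof -
    have "max 1 u = 1" using u(2) by simp
    then show "\<bar>n2 u\<bar> \<le> 2" "\<bar>n3 u\<bar> \<le> 2" "\<bar>n4 u\<bar> \<le> 2" using n_bounds[OF u(1)] by simp_all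
  qed
  have "\<bar>u * n3 u\<bar> \<le> 1 * 2" unfolding abs_mult using u m by (intro mult_mono) auto
  moreover have "\<bar>u * u * n4 u\<bar> \<le> 1 * 2" unfolding abs_mult using u m by (intro mult_mono mult_le_one) auto
  ultimately have "\<bar>60 * n2 u + 80 * (u * n3 u) + 16 * (u * u * n4 u)\<bar> \<le> 312" using m by linarith
  then have "1 / (8*pi*R^3) * \<bar>60 * n2 u + 80 * (u * n3 u) + 16 * (u * u * n4 u)\<bar> \<le> 1 / (8*pi*R^3) * 312"
    using R by (intro mult_left_mono) auto
  moreover have "\<bar>dl R y\<bar> = 1 / (8*pi*R^3) * \<bar>60 * n2 u + 80 * (u * n3 u) + 16 * (u * u * n4 u)\<bar>"
    unfolding e using R by (simp add: abs_mult mult.assoc)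
  ultimately have "\<bar>dl R y\<bar> \<le> 1 / (8*pi*R^3) * 312" by simp
  also have "\<dots> = (39 / pi) * (1 / R^3)" by simp
  also have "\<dots> \<le> 16 * (1 / R^3)" using R pi_gt3 by (intro mult_right_mono) (auto simp: field_simps)
  finally show ?thesis by simp
qed

text \<open>\<open>dl R\<close> and \<open>del R\<close> are minus the Laplacians of two truncated
  Newton kernels that agree outside the ball of radius \<open>R\<close>. Their difference is the
  divergence of a compactly supported gradient and integrates to zero, so the mass of
  \<open>del R\<close> carries over.\<close>

lemma dl_mass:
  assumes R: "R > 0"
  shows "(LBINT x. dl R ((x::real^3) \<bullet> x)) = 1"
proof -
  let ?w1 = "\<lambda>y. gn1 R y - Gam' R y" and ?w2 = "\<lambda>y. gn2 R y - Gam'' R y"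
  have C: "C1c (K1 ?w1 k) (\<lambda>i. K2 ?w1 ?w2 i k)" for k
    by (rule C1c_K1[where R=R])
      (use R in \<open>auto intro!: DERIV_diff gn_deriv Gam_deriv continuous_on_diff gn2_cont Gam''_cont simp: gn_outer Gam_outer\<close>)
  have "(LBINT x. (\<Sum>k\<in>UNIV. K2 ?w1 ?w2 k k x)) = (\<Sum>k\<in>UNIV. LBINT x. K2 ?w1 ?w2 k k x)"
    using C1c_integrable_d[OF C] by (intro Bochner_Integration.integral_sum) auto
  also have "\<dots> = 0" using C1c_integral_d_zero[OF C] by simp
  finally have 0: "(LBINT x. (\<Sum>k\<in>UNIV. K2 ?w1 ?w2 k k x)) = 0" .
  have "(\<Sum>k\<in>UNIV. K2 ?w1 ?w2 k k x) = del R (x \<bullet> x) - dl R (x \<bullet> x)" for x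
    using del_eq[OF R, of "x \<bullet> x"] unfolding K2_trace dl_def by (simp add: algebra_simps)
  then have "(LBINT x. del R ((x::real^3) \<bullet> x) - dl R (x \<bullet> x)) = 0" using 0 by simp
  moreover have "integrable lborel (\<lambda>x::real^3. dl R (x \<bullet> x))"
    by (rule compact_supp_integrable[where R=R]) (use R in \<open>auto intro!: dl_cont dl_zero norm_ge_sq\<close>)
  ultimately show ?thesis using del_integrable[OF R] del_mass[OF R] by simp
qed

section \<open>The biharmonic kernel between two scales\<close>

definition pp1 :: "real \<Rightarrow> real \<Rightarrow> real \<Rightarrow> real" where "pp1 e l y = ps1 e y - ps1 l y"
definition pp2 :: "real \<Rightarrow> real \<Rightarrow> real \<Rightarrow> real" where "pp2 e l y = ps2 e y - ps2 l y"
definition pp3 :: "real \<Rightarrow> real \<Rightarrow> real \<Rightarrow> real" where "pp3 e l y = ps3 e y - ps3 l y"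
definition hg1 :: "real \<Rightarrow> real \<Rightarrow> real \<Rightarrow> real" where "hg1 e l y = gn1 e y - gn1 l y"
definition hg2 :: "real \<Rightarrow> real \<Rightarrow> real \<Rightarrow> real" where "hg2 e l y = gn2 e y - gn2 l y"

lemma pp_zero:
  assumes "0 < e" "e \<le> l" "l\<^sup>2 \<le> y"
  shows "pp1 e l y = 0" "pp2 e l y = 0" "pp3 e l y = 0" "hg1 e l y = 0" "hg2 e l y = 0"
proof -
  have "e\<^sup>2 \<le> y" using assms power_mono[of e l 2] by linarith
  then show "pp1 e l y = 0" "pp2 e l y = 0" "pp3 e l y = 0" "hg1 e l y = 0" "hg2 e l y = 0"
    using assms by (simp_all add: pp1_def pp2_def pp3_def hg1_def hg2_def ps_outer gn_outer)
qed

lemma pp_deriv: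
  assumes "0 < e" "e \<le> l"
  shows "DERIV (pp1 e l) y :> pp2 e l y" "DERIV (pp2 e l) y :> pp3 e l y" "DERIV (hg1 e l) y :> hg2 e l y"
    "continuous_on UNIV (pp3 e l)" "continuous_on UNIV (hg2 e l)"
  unfolding pp1_def[abs_def] pp2_def[abs_def] pp3_def[abs_def] hg1_def[abs_def] hg2_def[abs_def]
  using assms by (auto intro!: DERIV_diff ps_deriv gn_deriv continuous_on_diff gn2_cont DERIV_cont[OF ps_deriv(3)])

abbreviation "D2 e l \<equiv> K2 (pp1 e l) (pp2 e l)"
abbreviation "D3 e l \<equiv> K3 (pp2 e l) (pp3 e l)"

lemma C1c_D2:
  assumes "0 < e" "e \<le> l"
  shows "C1c (D2 e l j k) (\<lambda>i. D3 e l i j k)"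
  by (rule C1c_K2[where R=l]) (use assms in \<open>auto intro!: pp_deriv pp_zero\<close>)

lemma C1c_hg:
  assumes "0 < e" "e \<le> l"
  shows "C1c (K1 (hg1 e l) k) (\<lambda>i. K2 (hg1 e l) (hg2 e l) i k)"
  by (rule C1c_K1[where R=l]) (use assms in \<open>auto intro!: pp_deriv pp_zero\<close>)

text \<open>Contracting two indices gives the gradient of the Laplacian of the biharmonic kernel,
  and that Laplacian is a Newton kernel. So the contraction is exactly the Biot-Savart kernel of the
  comparison field.\<close>

lemma D3_trace: "(\<Sum>i\<in>UNIV. D3 e l i i k x) = K1 (hg1 e l) k x"
proof -
  have "(\<Sum>i\<in>UNIV. D3 e l i i k x) = 4 * (3 * x$k + 2 * x$k) * pp2 e l (x \<bullet> x) + 8 * (x \<bullet> x) * x$k * pp3 e l (x \<bullet> x)"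
    using exhaust_3[of k] by (auto simp: sum_3 K3_def inner_vec_def algebra_simps)
  then show ?thesis by (simp add: K1_def hg1_def gn1_def pp2_def pp3_def algebra_simps)
qed

lemma hg_trace: "(\<Sum>i\<in>UNIV. K2 (hg1 e l) (hg2 e l) i i x) = dl l (x \<bullet> x) - dl e (x \<bullet> x)"
  unfolding K2_trace dl_def hg1_def hg2_def by (simp add: algebra_simps)

lemma pp_bounds:
  assumes e: "0 < e" "e \<le> l"
  shows "\<bar>pp1 e l (x \<bullet> x)\<bar> \<le> 1/6 * max e (norm x) powr -1" (is ?R1)
    "\<bar>pp2 e l (x \<bullet> x)\<bar> \<le> 1/6 * max e (norm x) powr -3" (is ?R2)
    "\<bar>pp3 e l (x \<bullet> x)\<bar> \<le> 1/6 * max e (norm x) powr -5" (is ?R3)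
proof -
  have l: "l > 0" using e by simp
  have mono: "max l (norm x) powr -r \<le> max e (norm x) powr -r" if "r \<ge> 0" for r
    using e that by (intro powr_mono2') (auto simp: less_max_iff_disj)
  have s: "\<bar>A - B\<bar> \<le> 1/6 * M" if "\<bar>A\<bar> \<le> 1 / (4*pi) * M" "\<bar>B\<bar> \<le> 1 / (4*pi) * M'" "M' \<le> M" "0 \<le> M" for A B M M' :: real
  proof -
    have "\<bar>A - B\<bar> \<le> 1 / (4*pi) * M + 1 / (4*pi) * M"
      using that mult_left_mono[OF that(3), of "1 / (4*pi)"] by (simp add: abs_le_iff)
    also have "\<dots> = 1 / (2 * pi) * M" by simp
    also have "\<dots> \<le> 1/6 * M" using that pi_gt3 by (intro mult_right_mono) (auto simp: field_simps)
    finally show ?thesis .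
  qed
  show ?R1
    unfolding pp1_def by (rule s[OF ps_bounds(1)[OF e(1)] ps_bounds(1)[OF l] mono]) auto
  show ?R2
    unfolding pp2_def by (rule s[OF ps_bounds(2)[OF e(1)] ps_bounds(2)[OF l] mono]) auto
  show ?R3
    unfolding pp3_def by (rule s[OF ps_bounds(3)[OF e(1)] ps_bounds(3)[OF l] mono]) auto
qed

lemma comp_prod_le:
  fixes x :: "real^3"
  assumes "norm x \<le> M"
  shows "\<bar>x$i\<bar> \<le> M" "\<bar>x$i * x$j\<bar> \<le> M\<^sup>2" "\<bar>x$i * x$j * x$k\<bar> \<le> M^3"
proof -
  have c: "\<bar>x$i\<bar> \<le> M" for i using component_le_norm_cart[of x i] assms by linarith
  then have M: "0 \<le> M" using abs_ge_zero order_trans by blast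
  show "\<bar>x$i\<bar> \<le> M" by (rule c)
  have 2: "\<bar>x$i * x$j\<bar> \<le> M * M" unfolding abs_mult using M by (intro mult_mono c) auto
  then show "\<bar>x$i * x$j\<bar> \<le> M\<^sup>2" by (simp add: power2_eq_square)
  have "\<bar>x$i * x$j\<bar> * \<bar>x$k\<bar> \<le> M * M * M" using M by (intro mult_mono c 2) auto
  then show "\<bar>x$i * x$j * x$k\<bar> \<le> M^3" by (simp add: abs_mult power3_eq_cube)
qed

lemma D2_bound:
  assumes e: "0 < e" "e \<le> l"
  shows "\<bar>D2 e l i k x\<bar> \<le> (if norm x \<le> l then max e (norm x) powr -1 else 0)"
proof (cases "norm x \<le> l")
  case True
  define M where "M = max e (norm x)"
  have M: "M > 0" "norm x \<le> M" using e by (auto simp: M_def)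
  have "\<bar>2 * of_bool (i = k) * pp1 e l (x \<bullet> x)\<bar> \<le> 2 * (1/6 * M powr -1)"
    using pp_bounds(1)[OF e, of x] unfolding M_def by (auto simp: abs_mult of_bool_def)
  moreover have "\<bar>4 * (x$i * x$k * pp2 e l (x \<bullet> x))\<bar> \<le> 4 * (M\<^sup>2 * (1/6 * M powr -3))"
    using mult_mono[OF comp_prod_le(2)[OF M(2), of i k] pp_bounds(2)[OF e, of x]] unfolding M_def[symmetric]
    by (simp add: abs_mult)
  moreover have "M\<^sup>2 * (1/6 * M powr -3) = 1/6 * M powr -1"
  proof -
    have "M powr 2 * M powr -3 = M powr -1" by (simp flip: powr_add)
    then show ?thesis using M by (simp add: powr_numeral)
  qed
  moreover have "D2 e l i k x = 2 * of_bool (i = k) * pp1 e l (x \<bullet> x) + 4 * (x$i * x$k * pp2 e l (x \<bullet> x))"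
    by (simp add: K2_def)
  ultimately have "\<bar>D2 e l i k x\<bar> \<le> 2 * (1/6 * M powr -1) + 4 * (1/6 * M powr -1)"
    by linarith
  also have "\<dots> = M powr -1" by simp
  finally show ?thesis using True by (simp add: M_def)
next
  case False
  then have "l\<^sup>2 \<le> x \<bullet> x" using e by (intro norm_ge_sq) auto
  then show ?thesis using False e by (simp add: K2_def pp_zero)
qed

lemma D3_bound:
  assumes e: "0 < e" "e \<le> l"
  shows "\<bar>D3 e l i j k x\<bar> \<le> 4 * max e (norm x) powr -2"
proof -
  define M where "M = max e (norm x)"
  have M: "M > 0" "norm x \<le> M" using e by (auto simp: M_def)
  have c: "\<bar>of_bool b * x$k\<bar> \<le> M" for b k using comp_prod_le(1)[OF M(2), of k] M by (cases b) auto
  have "\<bar>of_bool (i = j) * x$k + of_bool (i = k) * x$j + of_bool (j = k) * x$i\<bar> \<le> 3 * M"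
    using c[of "i = j" k] c[of "i = k" j] c[of "j = k" i] by linarith
  moreover have "\<bar>4 * (A * B)\<bar> \<le> 4 * (3 * M * y)" if "\<bar>A\<bar> \<le> 3 * M" "\<bar>B\<bar> \<le> y" for A B y
    using mult_mono[OF that] M that by (simp add: abs_mult)
  ultimately have 1: "\<bar>4 * ((of_bool (i = j) * x$k + of_bool (i = k) * x$j + of_bool (j = k) * x$i) * pp2 e l (x \<bullet> x))\<bar> \<le> 4 * (3 * M * (1/6 * M powr -3))"
    using pp_bounds(2)[OF e, of x] unfolding M_def[symmetric] by blast
  have 2: "\<bar>8 * (x$i * x$j * x$k * pp3 e l (x \<bullet> x))\<bar> \<le> 8 * (M^3 * (1/6 * M powr -5))"
    using mult_mono[OF comp_prod_le(3)[OF M(2), of i j k] pp_bounds(3)[OF e, of x]] M unfolding M_def[symmetric]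
    by (simp add: abs_mult)
  have p1: "3 * M * (1/6 * M powr -3) = 1/2 * M powr -2"
    using M powr_mult_base[of M "-3"] by simp
  have p2: "M^3 * (1/6 * M powr -5) = 1/6 * M powr -2"
  proof -
    have "M powr 3 * M powr -5 = M powr -2" by (simp flip: powr_add)
    then show ?thesis using M by (simp add: powr_numeral)
  qed
  have "\<bar>D3 e l i j k x\<bar> \<le> 4 * (1/2 * M powr -2) + 8 * (1/6 * M powr -2)"
  proof -
    have "D3 e l i j k x = 4 * ((of_bool (i = j) * x$k + of_bool (i = k) * x$j + of_bool (j = k) * x$i) * pp2 e l (x \<bullet> x))
       + 8 * (x$i * x$j * x$k * pp3 e l (x \<bullet> x))"
      by (simp add: K3_def)
    then show ?thesis using 1 2 unfolding p1 p2 by linarith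
  qed
  also have "\<dots> \<le> 4 * M powr -2" by simp
  finally show ?thesis by (simp add: M_def)
qed

lemma norm_matrix_vector_le: "norm ((A::real^3^3) *v x) \<le> norm A * norm x"
proof -
  have "norm (A *v x) = L2_set (\<lambda>i. norm ((A *v x) $ i)) UNIV" by (simp add: norm_vec_def)
  also have "\<dots> \<le> L2_set (\<lambda>i. norm (A $ i) * norm x) UNIV"
    by (rule L2_set_mono) (auto simp: matrix_vector_mul_component Cauchy_Schwarz_ineq2)
  also have "\<dots> = L2_set (\<lambda>i. norm (A $ i)) UNIV * norm x" by (rule L2_set_left_distrib[symmetric]) simp
  finally show ?thesis by (simp add: norm_vec_def)
qed

lemma borel_measurable_matrix_vector[measurable (raw)]:
  fixes A :: "'a \<Rightarrow> real^3^3" and f :: "'a \<Rightarrow> real^3"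
  assumes "A \<in> borel_measurable M" "f \<in> borel_measurable M"
  shows "(\<lambda>x. A x *v f x) \<in> borel_measurable M"
proof (rule borel_measurable_continuous_Pair[OF assms])
  show "continuous_on UNIV (\<lambda>x. fst x *v snd x :: real^3)"
    unfolding matrix_vector_mult_def by (intro continuous_intros)
qed

section \<open>Tensor fields concentrated on the curve\<close>

text \<open>The tensor is frozen at the source point of the curve, as a bounded Borel weight
  \<open>b\<close> inside the convolution. Derivatives then fall on the kernel only, and regularity
  of the tensor enters only when the weight is moved outside again.\<close>

locale tensor_curve = curve +
  fixes e :: real and b :: "real \<Rightarrow> real^3^3" and m :: real
  assumes e: "0 < e" "e \<le> L" and b_meas[measurable]: "b \<in> borel_measurable borel"
    and b_bound: "\<And>s. norm (b s) \<le> m"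
begin

lemma m_nonneg: "0 \<le> m" using b_bound[of 0] norm_ge_zero order_trans by blast

definition cw :: "3 \<Rightarrow> real \<Rightarrow> real^3" where
  "cw k s = b s *v cross3 (axis k 1) (\<tau> s)"

lemma cw_meas[measurable]: "cw k \<in> borel_measurable borel"
  unfolding cw_def[abs_def] by measurable

lemma cw_bound: "norm (cw k s) \<le> m"
proof -
  have "norm (cw k s) \<le> norm (b s) * norm (cross3 (axis k 1) (\<tau> s))" unfolding cw_def by (rule norm_matrix_vector_le)
  also have "\<dots> \<le> m * 1" using b_bound cross_axis_\<tau>(2) m_nonneg by (intro mult_mono) auto
  finally show ?thesis by simp
qed

lemma cw_integrable: "integrable CM (cw k)"
  by (rule CM_integrable[OF cw_meas cw_bound])

text \<open>\<open>XX j\<close> is the convolution of the curve with \<open>\<partial>\<^sub>j \<nabla> H\<close> (\<open>H\<close> the truncated biharmonic kernel, crossed with the tangent and weighted by \<open>b\<close>), \<open>YY i j\<close> its partial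
  derivatives. The point of \<open>VV\<close> is that it is both close to \<open>b v\<close> and a gradient minus a curl (\<open>VV_decomp\<close>).\<close>

definition XX :: "3 \<Rightarrow> real^3 \<Rightarrow> real^3" where
  "XX j x = (\<Sum>k\<in>UNIV. conv CM \<gamma> (D2 e L j k) (cw k) x)"
definition YY :: "3 \<Rightarrow> 3 \<Rightarrow> real^3 \<Rightarrow> real^3" where
  "YY i j x = (\<Sum>k\<in>UNIV. conv CM \<gamma> (D3 e L i j k) (cw k) x)"
definition ZZ :: "real^3 \<Rightarrow> real^3" where "ZZ = curlv XX"
definition dZZ :: "3 \<Rightarrow> real^3 \<Rightarrow> real^3" where "dZZ i = curlv (YY i)"
definition EE :: "real^3 \<Rightarrow> real" where "EE x = (\<Sum>j\<in>UNIV. XX j x $ j)"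
definition dEE :: "3 \<Rightarrow> real^3 \<Rightarrow> real" where "dEE i x = (\<Sum>j\<in>UNIV. YY i j x $ j)"
definition VV :: "real^3 \<Rightarrow> real^3" where "VV x = (\<Sum>i\<in>UNIV. YY i i x)"

lemma XX_C1c: "C1c (XX j) (\<lambda>i. YY i j)"
  unfolding XX_def[abs_def] YY_def[abs_def]
  by (intro C1c_sum PM.conv_C1c C1c_D2 e cw_integrable)

lemma ZZ_C1c: "C1c ZZ dZZ"
proof -
  have bl: "bounded_linear (cross3 a)" for a
    using bilinear_cross unfolding bilinear_def by (auto simp: linear_conv_bounded_linear)
  have "C1c (\<lambda>x. \<Sum>j\<in>UNIV. cross3 (axis j 1) (XX j x)) (\<lambda>i x. \<Sum>j\<in>UNIV. cross3 (axis j 1) (YY i j x))"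
    by (rule C1c_sum, rule C1c_linear[OF bl XX_C1c])
  moreover have "ZZ = (\<lambda>x. \<Sum>j\<in>UNIV. cross3 (axis j 1) (XX j x))"
    by (rule ext) (simp only: ZZ_def curlv_alt)
  moreover have "dZZ = (\<lambda>i x. \<Sum>j\<in>UNIV. cross3 (axis j 1) (YY i j x))"
    by (intro ext) (simp only: dZZ_def curlv_alt)
  ultimately show ?thesis by (simp only:)
qed

lemma EE_C1c: "C1c EE dEE"
  unfolding EE_def[abs_def] dEE_def[abs_def] by (rule C1c_sum, rule C1c_nth[OF XX_C1c])

lemma YY_sym: "YY i j = YY j i"
  by (simp add: YY_def[abs_def] K3_sym[of _ _ i j])

text \<open>Let \<open>N\<close> be the sum over \<open>k\<close> of the convolutions of the partial
  derivative in direction \<open>k\<close> of the biharmonic kernel with the weight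
  \<open>cw k\<close>. Then \<open>XX j\<close> is the derivative of \<open>N\<close> in direction
  \<open>j\<close>, and \<open>VV\<close>, \<open>EE\<close>, \<open>ZZ\<close> are the Laplacian,
  divergence and curl of \<open>N\<close>. The claim is the vector identity
  \<open>Laplacian N = grad div N - curl curl N\<close>, which needs the symmetry of second
  derivatives, \<open>YY_sym\<close>.\<close>

lemma VV_decomp: "VV x = (\<chi> i. dEE i x) - curlv dZZ x"
  unfolding vec_eq_iff forall_3
  by (simp add: VV_def dEE_def dZZ_def sum_3 YY_sym[of 2 1] YY_sym[of 3 1] YY_sym[of 3 2] del: mult_cancel_left)

text \<open>The form in which \<open>VV\<close> is seen to be close to the Biot-Savart field
  multiplied by the tensor: the same kernel, but with the tensor evaluated at the source point
  instead of at \<open>x\<close>.\<close>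

lemma VV_conv: "VV x = (\<Sum>k\<in>UNIV. conv CM \<gamma> (K1 (hg1 e L) k) (cw k) x)"
proof -
  have i: "integrable CM (\<lambda>s. D3 e L i j k (x - \<gamma> s) *\<^sub>R cw k s)" for i j k
    by (rule conv_int(2)[OF C1c_D2[OF e] cw_meas cw_bound])
  have "conv CM \<gamma> (K1 (hg1 e L) k) (cw k) x = (\<Sum>i\<in>UNIV. conv CM \<gamma> (D3 e L i i k) (cw k) x)" for k
    unfolding conv_def D3_trace[symmetric] scaleR_sum_left using i by (intro Bochner_Integration.integral_sum) auto
  then show ?thesis unfolding VV_def YY_def by (subst sum.swap) simp
qed

lemma YY_bound: "norm (YY i j x) \<le> 360 * m * K / e"
proof -
  have "norm (YY i j x) \<le> (\<Sum>k\<in>(UNIV::3 set). m * 4 * (30 * K / e))"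
    unfolding YY_def
  proof (intro sum_norm_le conv_bound)
    show "D3 e L i j k \<in> borel_measurable borel" for k by (rule C1c_measurable_d[OF C1c_D2[OF e]])
  qed (use e D3_bound[OF e] cw_bound m_nonneg in auto)
  then show ?thesis by simp
qed

lemma norm_curlv_le:
  assumes "\<And>i. norm (d i x) \<le> B"
  shows "norm (curlv d x) \<le> 3 * B"
proof -
  have "norm (curlv d x) \<le> (\<Sum>i\<in>(UNIV::3 set). B)"
    unfolding curlv_alt
    by (intro sum_norm_le) (use norm_cross_le[of "axis _ 1" "d _ x"] assms in \<open>auto intro: order_trans\<close>)
  then show ?thesis by simp
qed

lemma dZZ_bound: "norm (dZZ i x) \<le> 1080 * m * K / e"
  unfolding dZZ_def using norm_curlv_le[of "YY i" x, OF YY_bound] by simp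

lemma curlv_dZZ_bound: "norm (curlv dZZ x) \<le> 3240 * m * K / e"
  using norm_curlv_le[of dZZ x, OF dZZ_bound] by simp

lemma ZZ_norm_le: "ennreal (norm (ZZ x)) \<le> ennreal (9 * m) * (\<integral>\<^sup>+s. (if norm (x - \<gamma> s) \<le> L then ennreal (max e (norm (x - \<gamma> s)) powr -1) else 0) \<partial>CM)"
proof -
  let ?I = "\<integral>\<^sup>+s. (if norm (x - \<gamma> s) \<le> L then ennreal (max e (norm (x - \<gamma> s)) powr -1) else 0) \<partial>CM"
  have c: "ennreal (norm (conv CM \<gamma> (D2 e L j k) (cw k) x)) \<le> ennreal m * ?I" for j k
  proof -
    have "ennreal (norm (conv CM \<gamma> (D2 e L j k) (cw k) x)) \<le> (\<integral>\<^sup>+s. norm (D2 e L j k (x - \<gamma> s) *\<^sub>R cw k s) \<partial>CM)"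
      unfolding conv_def by (rule integral_norm_bound_ennreal[OF conv_int(1)[OF C1c_D2[OF e] cw_meas cw_bound]])
    also have "\<dots> \<le> (\<integral>\<^sup>+s. ennreal m * (if norm (x - \<gamma> s) \<le> L then ennreal (max e (norm (x - \<gamma> s)) powr -1) else 0) \<partial>CM)"
    proof (rule nn_integral_mono)
      fix s
      have "norm (D2 e L j k (x - \<gamma> s) *\<^sub>R cw k s) \<le> (if norm (x - \<gamma> s) \<le> L then max e (norm (x - \<gamma> s)) powr -1 else 0) * m"
        unfolding norm_scaleR real_norm_def using D2_bound[OF e] cw_bound m_nonneg by (intro mult_mono) auto
      then have "ennreal (norm (D2 e L j k (x - \<gamma> s) *\<^sub>R cw k s)) \<le> ennreal (m * (if norm (x - \<gamma> s) \<le> L then max e (norm (x - \<gamma> s)) powr -1 else 0))"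
        by (intro ennreal_leI) (simp add: mult.commute)
      then show "ennreal (norm (D2 e L j k (x - \<gamma> s) *\<^sub>R cw k s)) \<le> ennreal m * (if norm (x - \<gamma> s) \<le> L then ennreal (max e (norm (x - \<gamma> s)) powr -1) else 0)"
        using m_nonneg by (auto simp: ennreal_mult split: if_splits)
    qed
    also have "\<dots> = ennreal m * ?I" by (rule nn_integral_cmult) (rule borel_CM, measurable)
    finally show ?thesis .
  qed
  have X: "ennreal (norm (XX j x)) \<le> ennreal (3 * m) * ?I" for j
  proof -
    have "ennreal (norm (XX j x)) \<le> ennreal (\<Sum>k\<in>UNIV. norm (conv CM \<gamma> (D2 e L j k) (cw k) x))"
      unfolding XX_def by (intro ennreal_leI norm_sum)
    also have "\<dots> = (\<Sum>k\<in>UNIV. ennreal (norm (conv CM \<gamma> (D2 e L j k) (cw k) x)))" by (rule sum_ennreal[symmetric]) simp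
    also have "\<dots> \<le> (\<Sum>k\<in>(UNIV::3 set). ennreal m * ?I)" by (intro sum_mono c)
    also have "\<dots> = ennreal (3 * m) * ?I" using m_nonneg by (simp add: ennreal_mult mult.assoc)
    finally show ?thesis .
  qed
  have "ennreal (norm (ZZ x)) \<le> ennreal (\<Sum>j\<in>UNIV. norm (XX j x))"
  proof (rule ennreal_leI)
    have "norm (ZZ x) \<le> (\<Sum>j\<in>UNIV. norm (cross3 (axis j 1) (XX j x)))" unfolding ZZ_def curlv_alt by (rule norm_sum)
    also have "\<dots> \<le> (\<Sum>j\<in>UNIV. norm (XX j x))"
      by (intro sum_mono) (use norm_cross_le[of "axis _ 1" "XX _ x"] in simp)
    finally show "norm (ZZ x) \<le> (\<Sum>j\<in>UNIV. norm (XX j x))" .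
  qed
  also have "\<dots> = (\<Sum>j\<in>UNIV. ennreal (norm (XX j x)))" by (rule sum_ennreal[symmetric]) simp
  also have "\<dots> \<le> (\<Sum>j\<in>(UNIV::3 set). ennreal (3 * m) * ?I)" by (intro sum_mono X)
  also have "\<dots> = ennreal (3 * (3 * m)) * ?I" using m_nonneg by (simp add: ennreal_mult mult.assoc)
  also have "3 * (3 * m) = 9 * m" by simp
  finally show ?thesis .
qed

end

lemma nn_integral_shift3:
  fixes f :: "real^3 \<Rightarrow> ennreal"
  assumes [measurable]: "f \<in> borel_measurable borel"
  shows "(\<integral>\<^sup>+x. f (x - c) \<partial>lborel) = (\<integral>\<^sup>+x. f x \<partial>lborel)"
proof -
  have "(\<integral>\<^sup>+x. f x \<partial>lborel) = (\<integral>\<^sup>+x. f x \<partial>distr lborel borel ((+) (- c)))" by (simp add: lborel_distr_plus)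
  also have "\<dots> = (\<integral>\<^sup>+x. f (x - c) \<partial>lborel)" by (subst nn_integral_distr) auto
  finally show ?thesis ..
qed

lemma lborel_integral_shift3:
  fixes f :: "real^3 \<Rightarrow> real"
  assumes [measurable]: "f \<in> borel_measurable borel"
  shows "(LBINT x. f (x - c)) = (LBINT x. f x)"
proof -
  have "(LBINT x. f x) = (\<integral>x. f x \<partial>distr lborel borel ((+) (- c)))" by (simp add: lborel_distr_plus)
  also have "\<dots> = (LBINT x. f (x - c))" by (subst integral_distr) auto
  finally show ?thesis ..
qed

context curve
begin

lemma \<gamma>_CM[measurable]: "\<gamma> \<in> borel_measurable CM"
  by (rule borel_CM) measurable

text \<open>Integrating over space first makes the inner integral independent of \<open>t\<close> by
  translation, so only the length of the curve and integrability of the power in three dimensions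
  enter.\<close>

lemma nn_tube:
  fixes c :: real
  assumes c: "0 \<le> c" and a: "0 \<le> a" "a < 3" and e: "0 < e"
  shows "(\<integral>\<^sup>+x. (\<integral>\<^sup>+t. (if norm (x - \<gamma> t) \<le> L then ennreal (c * max e (norm (x - \<gamma> t)) powr -a) else 0) \<partial>CM) \<partial>lborel)
    \<le> ennreal (c * (4 * pi * L powr (3 - a) / (3 - a)) * L)"
proof -
  define H :: "real^3 \<Rightarrow> ennreal" where "H z = (if norm z \<le> L then ennreal (c * max e (norm z) powr -a) else 0)" for z
  have H[measurable]: "H \<in> borel_measurable borel" unfolding H_def[abs_def] by measurable
  interpret P: pair_sigma_finite CM "lborel :: (real^3) measure"
    by (intro pair_sigma_finite.intro PM.sigma_finite_measure_axioms sigma_finite_lborel)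
  have b: "(\<integral>\<^sup>+x. H (x - \<gamma> t) \<partial>lborel) \<le> ennreal (c * (4 * pi * L powr (3 - a) / (3 - a)))" for t
  proof -
    have "(\<integral>\<^sup>+x. H (x - \<gamma> t) \<partial>lborel) = (\<integral>\<^sup>+x. H x \<partial>lborel)" by (rule nn_integral_shift3[OF H])
    also have "\<dots> \<le> (\<integral>\<^sup>+x. ennreal c * (if norm (x::real^3) \<le> L then ennreal (norm x powr -a) else 0) \<partial>lborel)"
    proof (rule nn_integral_mono_AE)
      have "AE x in lborel. x \<noteq> (0::real^3)" by (rule AE_lborel_singleton)
      then show "AE x in lborel. H x \<le> ennreal c * (if norm x \<le> L then ennreal (norm x powr -a) else 0)"
      proof eventually_elim
        fix x :: "real^3" assume x: "x \<noteq> 0"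
        have "max e (norm x) powr -a \<le> norm x powr -a" using x a by (intro powr_mono2') auto
        then have "ennreal (c * max e (norm x) powr -a) \<le> ennreal c * ennreal (norm x powr -a)"
          using c by (simp add: ennreal_mult[symmetric] ennreal_leI mult_left_mono)
        then show "H x \<le> ennreal c * (if norm x \<le> L then ennreal (norm x powr -a) else 0)" by (simp add: H_def)
      qed
    qed
    also have "\<dots> = ennreal c * (\<integral>\<^sup>+x. (if norm (x::real^3) \<le> L then ennreal (norm x powr -a) else 0) \<partial>lborel)"
      by (rule nn_integral_cmult) measurable
    also have "\<dots> \<le> ennreal c * ennreal (4 * pi * L powr (3 - a) / (3 - a))"
      using a L by (intro mult_left_mono nn_integral_ball3_powr) auto
    also have "\<dots> = ennreal (c * (4 * pi * L powr (3 - a) / (3 - a)))" using c a by (intro ennreal_mult[symmetric]) auto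
    finally show ?thesis .
  qed
  have "(\<integral>\<^sup>+x. (\<integral>\<^sup>+t. H (x - \<gamma> t) \<partial>CM) \<partial>lborel) = (\<integral>\<^sup>+t. (\<integral>\<^sup>+x. H (x - \<gamma> t) \<partial>lborel) \<partial>CM)"
    by (rule P.Fubini') measurable
  also have "\<dots> \<le> (\<integral>\<^sup>+t. ennreal (c * (4 * pi * L powr (3 - a) / (3 - a))) \<partial>CM)" by (intro nn_integral_mono b)
  also have "\<dots> = ennreal (c * (4 * pi * L powr (3 - a) / (3 - a)) * L)"
    using c a L by (simp add: emeasure_CM[unfolded space_CM] ennreal_mult[symmetric])
  finally show ?thesis by (simp add: H_def)
qed

end

section \<open>Testing the decomposed field with \<open>u\<close> and with the comparison
  field\<close>

definition weak_div_free :: "(real^3 \<Rightarrow> real^3) \<Rightarrow> bool" where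
  "weak_div_free u \<longleftrightarrow> (\<forall>E dE. C1c (E :: real^3 \<Rightarrow> real) dE \<longrightarrow> (LBINT x. u x \<bullet> (\<chi> i. dE i x)) = 0)"

lemma cont_comp_L2:
  fixes g :: "real^3 \<Rightarrow> real^3"
  assumes "continuous_on UNIV g" "\<And>x. R \<le> norm x \<Longrightarrow> g x = 0"
  shows "g \<in> borel_measurable borel" "integrable lborel (\<lambda>x. (norm (g x))\<^sup>2)"
proof -
  show "g \<in> borel_measurable borel" using assms(1) by (rule borel_measurable_continuous_onI)
  show "integrable lborel (\<lambda>x. (norm (g x))\<^sup>2)"
    by (rule compact_supp_integrable[where R=R]) (use assms in \<open>auto intro!: continuous_intros\<close>)
qed

context tensor_curve
begin

lemma VV_C1c: "C1c VV (\<lambda>i x. \<Sum>k\<in>UNIV. conv CM \<gamma> (K2 (hg1 e L) (hg2 e L) i k) (cw k) x)"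
  unfolding VV_conv[abs_def] by (rule C1c_sum, rule PM.conv_C1c[OF C1c_hg[OF e] cw_integrable])

lemma dEE_vec_cont: "continuous_on UNIV (\<lambda>x. \<chi> i. dEE i x)"
  by (rule continuous_on_vec_lambda) (rule C1c_cont_d[OF EE_C1c])

lemma VV_u:
  assumes u: "u \<in> borel_measurable borel" "integrable lborel (\<lambda>x. (norm (u x))\<^sup>2)" and d: "weak_div_free u"
  shows "(LBINT x. VV x \<bullet> u x) = - curl_pair u dZZ"
proof -
  obtain R where R: "\<And>x. R \<le> norm x \<Longrightarrow> ZZ x = 0" "\<And>i x. R \<le> norm x \<Longrightarrow> dZZ i x = 0"
    using C1c_supp'[OF ZZ_C1c] by metis
  obtain R' where R': "\<And>x. R' \<le> norm x \<Longrightarrow> EE x = 0" "\<And>i x. R' \<le> norm x \<Longrightarrow> dEE i x = 0"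
    using C1c_supp'[OF EE_C1c] by metis
  have c1: "continuous_on UNIV (curlv dZZ)" by (rule curlv_cont) (rule C1c_cont_d[OF ZZ_C1c])
  have z1: "curlv dZZ x = 0" if "R \<le> norm x" for x using R(2)[OF that] by (simp add: vec_eq_iff forall_3)
  have z2: "(\<chi> i. dEE i x) = 0" if "R' \<le> norm x" for x using R'(2)[OF that] by (simp add: vec_eq_iff)
  have i1: "integrable lborel (\<lambda>x. curlv dZZ x \<bullet> u x)"
    by (rule L2_inner_integrable[OF u(1) cont_comp_L2(1)[OF c1 z1] u(2) cont_comp_L2(2)[OF c1 z1]])
  have i2: "integrable lborel (\<lambda>x. (\<chi> i. dEE i x) \<bullet> u x)"
    by (rule L2_inner_integrable[OF u(1) cont_comp_L2(1)[OF dEE_vec_cont z2] u(2) cont_comp_L2(2)[OF dEE_vec_cont z2]])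
  have "(LBINT x. VV x \<bullet> u x) = (LBINT x. (\<chi> i. dEE i x) \<bullet> u x) - (LBINT x. curlv dZZ x \<bullet> u x)"
    unfolding VV_decomp inner_diff_left by (rule Bochner_Integration.integral_diff[OF i2 i1])
  also have "(LBINT x. (\<chi> i. dEE i x) \<bullet> u x) = 0"
    using d EE_C1c unfolding weak_div_free_def by (subst inner_commute) blast
  finally show ?thesis by (simp add: curl_pair_def)
qed

text \<open>The gradient part of \<open>VV\<close> is invisible to a divergence-free field, which
  leaves minus the curl of \<open>ZZ\<close>. That curl is bounded by a multiple of
  \<open>m * K / e\<close>, and the tolerance \<open>e * L\<close> of the flat norm cancels the
  factor \<open>1 / e\<close>.\<close>

lemma VV_u_est:
  assumes u: "u \<in> borel_measurable borel" "integrable lborel (\<lambda>x. (norm (u x))\<^sup>2)" and d: "weak_div_free u"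
    and F: "flat_close e u" and m0: "m > 0"
  shows "\<bar>(LBINT x. VV x \<bullet> u x) + pairing ZZ\<bar> \<le> 3240 * m * K * L"
proof -
  have p: "3240 * m * K / e > 0" using m0 K e by simp
  have "\<bar>curl_pair u dZZ - pairing ZZ\<bar> \<le> e * L * (3240 * m * K / e)"
    by (rule F[unfolded flat_close_def, rule_format, OF ZZ_C1c p curlv_dZZ_bound])
  also have "\<dots> = 3240 * m * K * L" using e by simp
  finally show ?thesis unfolding VV_u[OF u d] by (simp add: abs_minus_commute)
qed

definition vref :: "real^3 \<Rightarrow> real^3" where "vref = vfield (hg1 e L)"
definition dvref :: "3 \<Rightarrow> real^3 \<Rightarrow> real^3" where "dvref = dvfield (hg1 e L) (hg2 e L)"

lemma vref_C1c: "C1c vref dvref"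
  unfolding vref_def dvref_def by (rule vfield_C1c[OF C1c_hg[OF e]])

definition dlD :: "real^3 \<Rightarrow> real" where "dlD y = dl e (y \<bullet> y) - dl L (y \<bullet> y)"

lemma dlD_cont: "continuous_on UNIV dlD"
  unfolding dlD_def using dl_cont[OF e(1)] dl_cont[OF L] by (intro continuous_on_diff)

lemma dlD_zero: "L \<le> norm x \<Longrightarrow> dlD x = 0"
  unfolding dlD_def using dl_zero[OF e(1), of "x \<bullet> x"] dl_zero[OF L, of "x \<bullet> x"] norm_ge_sq[of L x] norm_ge_sq[of e x] e L by simp

text \<open>The same computation with the comparison field in place of \<open>u\<close>. Its curl is
  the curve mollified by \<open>dlD\<close>, so the pairing of \<open>ZZ\<close> with the curve
  appears in averaged form.\<close>

lemma VV_vref: "(LBINT x. VV x \<bullet> vref x) = - (\<integral>t. (LBINT x. dlD (x - \<gamma> t) * (ZZ x \<bullet> \<tau> t)) \<partial>CM)"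
  and VV_vref_int: "integrable CM (\<lambda>t. LBINT x. dlD (x - \<gamma> t) * (ZZ x \<bullet> \<tau> t))"
proof -
  have cv: "curlv dvref x = conv CM \<gamma> dlD \<tau> x" for x
    unfolding dvref_def dvfield_curl[OF C1c_hg[OF e]] hg_trace conv_def dlD_def integral_minus[symmetric]
      scaleR_minus_left[symmetric] minus_diff_eq ..
  obtain R where R: "\<And>x. R \<le> norm x \<Longrightarrow> ZZ x = 0" "\<And>i x. R \<le> norm x \<Longrightarrow> dZZ i x = 0"
    using C1c_supp'[OF ZZ_C1c] by metis
  have c1: "continuous_on UNIV (curlv dZZ)" by (rule curlv_cont) (rule C1c_cont_d[OF ZZ_C1c])
  have z1: "curlv dZZ x = 0" if "R \<le> norm x" for x using R(2)[OF that] by (simp add: vec_eq_iff forall_3)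
  obtain R' where R': "\<And>x. R' \<le> norm x \<Longrightarrow> EE x = 0" "\<And>i x. R' \<le> norm x \<Longrightarrow> dEE i x = 0"
    using C1c_supp'[OF EE_C1c] by metis
  have z2: "(\<chi> i. dEE i x) = 0" if "R' \<le> norm x" for x using R'(2)[OF that] by (simp add: vec_eq_iff)
  note vL2 = C1c_measurable[OF vref_C1c] C1c_sq_integrable[OF vref_C1c]
  have i1: "integrable lborel (\<lambda>x. curlv dZZ x \<bullet> vref x)"
    by (rule L2_inner_integrable[OF vL2(1) cont_comp_L2(1)[OF c1 z1] vL2(2) cont_comp_L2(2)[OF c1 z1]])
  have i2: "integrable lborel (\<lambda>x. (\<chi> i. dEE i x) \<bullet> vref x)"
    by (rule L2_inner_integrable[OF vL2(1) cont_comp_L2(1)[OF dEE_vec_cont z2] vL2(2) cont_comp_L2(2)[OF dEE_vec_cont z2]])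
  have dv: "(\<Sum>i\<in>UNIV. dvref i x $ i) = 0" for x
    unfolding dvref_def by (rule dvfield_div[OF C1c_hg[OF e]])
  have "(LBINT x. VV x \<bullet> vref x) = (LBINT x. (\<chi> i. dEE i x) \<bullet> vref x) - (LBINT x. curlv dZZ x \<bullet> vref x)"
    unfolding VV_decomp inner_diff_left by (rule Bochner_Integration.integral_diff[OF i2 i1])
  also have "(LBINT x. (\<chi> i. dEE i x) \<bullet> vref x) = 0" by (rule grad_ibp[OF EE_C1c vref_C1c dv])
  also have "(LBINT x. curlv dZZ x \<bullet> vref x) = (LBINT x. ZZ x \<bullet> conv CM \<gamma> dlD \<tau> x)"
    using curl_ibp[OF ZZ_C1c vref_C1c] unfolding cv .
  also have "\<dots> = (\<integral>t. (LBINT x. dlD (x - \<gamma> t) * (ZZ x \<bullet> \<tau> t)) \<partial>CM)"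
    by (rule PM.conv_Fubini(1)[OF dlD_cont dlD_zero \<tau>_CM_integrable C1c_cont[OF ZZ_C1c] R(1)])
  finally show "(LBINT x. VV x \<bullet> vref x) = - (\<integral>t. (LBINT x. dlD (x - \<gamma> t) * (ZZ x \<bullet> \<tau> t)) \<partial>CM)" by simp
  show "integrable CM (\<lambda>t. LBINT x. dlD (x - \<gamma> t) * (ZZ x \<bullet> \<tau> t))"
    by (rule PM.conv_Fubini(2)[OF dlD_cont dlD_zero \<tau>_CM_integrable C1c_cont[OF ZZ_C1c] R(1)])
qed

lemma ZZ_L1: "(LBINT x. norm (ZZ x)) \<le> 18 * pi * m * L^3"
proof (rule integral_le_nn)
  let ?f = "\<lambda>x s. if norm (x - \<gamma> s) \<le> L then ennreal (max e (norm (x - \<gamma> s)) powr -1) else 0"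
  show "integrable lborel (\<lambda>x. norm (ZZ x))" using C1c_integrable[OF ZZ_C1c] by simp
  show "AE x in lborel. ennreal (norm (ZZ x)) \<le> ennreal (9 * m) * (\<integral>\<^sup>+s. ?f x s \<partial>CM)" by (intro AE_I2 ZZ_norm_le)
  have "(\<integral>\<^sup>+x. ennreal (9 * m) * (\<integral>\<^sup>+s. ?f x s \<partial>CM) \<partial>lborel) = ennreal (9 * m) * (\<integral>\<^sup>+x. (\<integral>\<^sup>+s. ?f x s \<partial>CM) \<partial>lborel)"
    by (rule nn_integral_cmult) measurable
  also have "\<dots> \<le> ennreal (9 * m) * ennreal (1 * (4 * pi * L powr (3 - 1) / (3 - 1)) * L)"
    using nn_tube[of 1 1 e, unfolded mult_1] e by (intro mult_left_mono) auto
  also have "\<dots> = ennreal (9 * m * (1 * (4 * pi * L powr (3 - 1) / (3 - 1)) * L))"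
    using m_nonneg L by (intro ennreal_mult[symmetric]) auto
  also have "9 * m * (1 * (4 * pi * L powr (3 - 1) / (3 - 1)) * L) = 18 * pi * m * L^3"
    using L by (simp add: powr_numeral power2_eq_square power3_eq_cube)
  finally show "(\<integral>\<^sup>+x. ennreal (9 * m) * (\<integral>\<^sup>+s. ?f x s \<partial>CM) \<partial>lborel) \<le> ennreal (18 * pi * m * L^3)" .
qed (use m_nonneg L in auto)

text \<open>\<open>ZZ\<close> has Lipschitz constant of order \<open>m * K / e\<close>, so
  mollifying at scale \<open>e\<close> changes it by order \<open>m * K\<close> only. The mollifier
  is controlled by its sup bound times the volume of the ball. The part at scale \<open>L\<close> is
  estimated by the integral of \<open>norm (ZZ x)\<close> instead.\<close>

lemma dl_test:
  "\<bar>(LBINT x. dlD (x - \<gamma> t) * (ZZ x \<bullet> \<tau> t)) - ZZ (\<gamma> t) \<bullet> \<tau> t\<bar> \<le> 10^6 * m * K"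
proof -
  define f where "f x = ZZ x \<bullet> \<tau> t" for x
  have fm[measurable]: "f \<in> borel_measurable borel"
    unfolding f_def using C1c_measurable[OF ZZ_C1c] by measurable
  have fc: "continuous_on UNIV f" unfolding f_def by (intro continuous_intros C1c_cont[OF ZZ_C1c])
  have fn: "\<bar>f x\<bar> \<le> norm (ZZ x)" for x unfolding f_def using Cauchy_Schwarz_ineq2[of "ZZ x" "\<tau> t"] by simp
  have dm[measurable]: "(\<lambda>x::real^3. dl R (x \<bullet> x)) \<in> borel_measurable borel" if "R > 0" for R
    using dl_cont[OF that] by (rule borel_measurable_continuous_onI)
  note dme = dm[OF e(1)] and dmL = dm[OF L]
  let ?c = "\<gamma> t"
  have shz: "dl R ((x - ?c) \<bullet> (x - ?c)) = 0" if "R > 0" "R + norm ?c \<le> norm x" for R x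
    using dl_zero[OF that(1), of "(x - ?c) \<bullet> (x - ?c)"] norm_ge_sq[of R "x - ?c"] norm_triangle_ineq2[of x ?c] that by simp
  have shc: "continuous_on UNIV (\<lambda>x. dl R ((x - ?c) \<bullet> (x - ?c)))" if "R > 0" for R
    by (rule continuous_on_compose2[OF dl_cont[OF that]]) (auto intro!: continuous_intros)
  have i: "integrable lborel (\<lambda>x. dl R ((x - ?c) \<bullet> (x - ?c)) * f x)" if "R > 0" for R
    by (rule cont_int_prod(1)[OF shc[OF that] shz[OF that] fc])
  have "(LBINT x. dlD (x - ?c) * f x) = (LBINT x. dl e ((x - ?c) \<bullet> (x - ?c)) * f x - dl L ((x - ?c) \<bullet> (x - ?c)) * f x)"
    by (simp add: dlD_def algebra_simps)
  also have "\<dots> = (LBINT x. dl e ((x - ?c) \<bullet> (x - ?c)) * f x) - (LBINT x. dl L ((x - ?c) \<bullet> (x - ?c)) * f x)"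
    by (rule Bochner_Integration.integral_diff[OF i[OF e(1)] i[OF L]])
  finally have split: "(LBINT x. dlD (x - ?c) * f x) = (LBINT x. dl e ((x - ?c) \<bullet> (x - ?c)) * f x) - (LBINT x. dl L ((x - ?c) \<bullet> (x - ?c)) * f x)" .
  have outer: "\<bar>LBINT x. dl L ((x - ?c) \<bullet> (x - ?c)) * f x\<bar> \<le> 1200 * m"
  proof -
    have "norm (LBINT x. dl L ((x - ?c) \<bullet> (x - ?c)) * f x) \<le> (LBINT x. 16 / L^3 * norm (ZZ x))"
    proof (rule integral_norm_bound_AE[OF i[OF L]])
      show "integrable lborel (\<lambda>x. 16 / L^3 * norm (ZZ x))" using C1c_integrable[OF ZZ_C1c] by simp
      have "norm (dl L ((x - ?c) \<bullet> (x - ?c)) * f x) \<le> 16 / L^3 * norm (ZZ x)" for x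
        unfolding real_norm_def abs_mult using dl_bound[OF L, of "(x - ?c) \<bullet> (x - ?c)"] fn[of x] L by (intro mult_mono) auto
      then show "AE x in lborel. norm (dl L ((x - ?c) \<bullet> (x - ?c)) * f x) \<le> 16 / L^3 * norm (ZZ x)" by simp
    qed
    also have "\<dots> = 16 / L^3 * (LBINT x. norm (ZZ x))" by simp
    also have "\<dots> \<le> 16 / L^3 * (18 * pi * m * L^3)" using L by (intro mult_left_mono ZZ_L1) auto
    also have "\<dots> = 288 * pi * m" using L by simp
    also have "\<dots> \<le> 288 * 4 * m" using m_nonneg pi_less_4 by (intro mult_right_mono) auto
    finally show ?thesis using m_nonneg by simp
  qed
  have inner: "\<bar>(LBINT x. dl e ((x - ?c) \<bullet> (x - ?c)) * f x) - f ?c\<bar> \<le> 300000 * (m * K)"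
  proof -
    have i0: "integrable lborel (\<lambda>x::real^3. dl e (x \<bullet> x))"
      by (rule compact_supp_integrable[where R=e]) (use e in \<open>auto intro!: dl_cont dl_zero norm_ge_sq\<close>)
    have i1: "integrable lborel (\<lambda>x. dl e ((x - ?c) \<bullet> (x - ?c)))"
      by (rule compact_supp_integrable[OF shc[OF e(1)] shz[OF e(1)]])
    have "(LBINT x. dl e ((x - ?c) \<bullet> (x - ?c))) = 1"
      using lborel_integral_shift3[OF dme, of ?c] dl_mass[OF e(1)] by simp
    then have "(LBINT x. dl e ((x - ?c) \<bullet> (x - ?c)) * f x) - f ?c
      = (LBINT x. dl e ((x - ?c) \<bullet> (x - ?c)) * f x) - (LBINT x. dl e ((x - ?c) \<bullet> (x - ?c)) * f ?c)" by simp
    also have "\<dots> = (LBINT x. dl e ((x - ?c) \<bullet> (x - ?c)) * f x - dl e ((x - ?c) \<bullet> (x - ?c)) * f ?c)"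
      using i[OF e(1)] i1 by simp
    also have "norm \<dots> \<le> (LBINT x. indicator (cball ?c e) x * (16 / e^3 * (3240 * m * K)))"
    proof (rule integral_norm_bound_AE)
      show "integrable lborel (\<lambda>x. dl e ((x - ?c) \<bullet> (x - ?c)) * f x - dl e ((x - ?c) \<bullet> (x - ?c)) * f ?c)"
        using i[OF e(1)] i1 by simp
      show "integrable lborel (\<lambda>x. indicator (cball ?c e) x * (16 / e^3 * (3240 * m * K)))"
        using borel_integrable_compact[of "cball ?c e" "\<lambda>x. 16 / e^3 * (3240 * m * K)"] by simp
      have "norm (dl e ((x - ?c) \<bullet> (x - ?c)) * f x - dl e ((x - ?c) \<bullet> (x - ?c)) * f ?c) \<le> indicator (cball ?c e) x * (16 / e^3 * (3240 * m * K))" for x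
      proof (cases "norm (x - ?c) \<le> e")
        case True
        have "\<bar>f x - f ?c\<bar> \<le> norm (ZZ x - ZZ ?c)"
          unfolding f_def inner_diff_left[symmetric] using Cauchy_Schwarz_ineq2[of "ZZ x - ZZ ?c" "\<tau> t"] by simp
        also have "\<dots> \<le> 3 * (1080 * m * K / e) * norm (x - ?c)" by (rule C1c_lipschitz[OF ZZ_C1c dZZ_bound])
        also have "\<dots> \<le> 3 * (1080 * m * K / e) * e" using True e K m_nonneg by (intro mult_left_mono) auto
        also have "\<dots> = 3240 * m * K" using e by simp
        finally have "\<bar>dl e ((x - ?c) \<bullet> (x - ?c))\<bar> * \<bar>f x - f ?c\<bar> \<le> 16 / e^3 * (3240 * m * K)"
          using dl_bound[OF e(1), of "(x - ?c) \<bullet> (x - ?c)"] e by (intro mult_mono) auto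
        moreover have "x \<in> cball ?c e" using True by (simp add: dist_norm norm_minus_commute)
        moreover have "dl e ((x - ?c) \<bullet> (x - ?c)) * f x - dl e ((x - ?c) \<bullet> (x - ?c)) * f ?c = dl e ((x - ?c) \<bullet> (x - ?c)) * (f x - f ?c)"
          by (simp add: algebra_simps)
        ultimately show ?thesis by (simp only: real_norm_def abs_mult indicator_simps(1) mult_1)
      next
        case False
        then have "dl e ((x - ?c) \<bullet> (x - ?c)) = 0" using e by (intro dl_zero norm_ge_sq) auto
        moreover have "x \<notin> cball ?c e" using False by (simp add: dist_norm norm_minus_commute)
        ultimately show ?thesis by simp
      qed
      then show "AE x in lborel. norm (dl e ((x - ?c) \<bullet> (x - ?c)) * f x - dl e ((x - ?c) \<bullet> (x - ?c)) * f ?c) \<le> indicator (cball ?c e) x * (16 / e^3 * (3240 * m * K))" by simp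
    qed
    also have "\<dots> = measure lborel (cball ?c e) * (16 / e^3 * (3240 * m * K))" by simp
    also have "measure lborel (cball ?c e) = 4/3 * pi * e^3"
      using emeasure_cball[of e ?c] e by (simp add: measure_def eval_unit_ball_vol mult.commute)
    also have "4/3 * pi * e^3 * (16 / e^3 * (3240 * m * K)) = 69120 * pi * (m * K)" using e by simp
    also have "\<dots> \<le> 69120 * 4 * (m * K)" using m_nonneg K pi_less_4 by (intro mult_right_mono) auto
    also have "\<dots> \<le> 300000 * (m * K)" using m_nonneg K by (intro mult_right_mono) auto
    finally show ?thesis by simp
  qed
  have "m \<le> m * K" using K m_nonneg by (simp add: mult_le_cancel_left1)
  moreover have "0 \<le> m * K" using K m_nonneg by simp
  moreover have "\<bar>(A - B) - C\<bar> \<le> 10^6 * mK" if "\<bar>A - C\<bar> \<le> 300000 * mK" "\<bar>B\<bar> \<le> 1200 * m" "m \<le> mK" "0 \<le> mK" for A B C mK :: real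
    using that by (simp add: abs_le_iff)
  ultimately have "\<bar>(LBINT x. dlD (x - ?c) * f x) - f ?c\<bar> \<le> 10^6 * (m * K)"
    unfolding split using inner outer by blast
  then show ?thesis unfolding f_def mult.assoc .
qed

lemma VV_vref_est: "\<bar>(LBINT x. VV x \<bullet> vref x) + pairing ZZ\<bar> \<le> 10^6 * m * K * L"
proof -
  obtain B where B: "\<And>x. norm (ZZ x) \<le> B" using C1c_bounded[OF ZZ_C1c] by metis
  have [measurable]: "ZZ \<in> borel_measurable borel" by (rule C1c_measurable[OF ZZ_C1c])
  have i: "integrable CM (\<lambda>t. ZZ (\<gamma> t) \<bullet> \<tau> t)"
  proof (rule CM_integrable[where B=B])
    show "norm (ZZ (\<gamma> t) \<bullet> \<tau> t) \<le> B" for t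
      using Cauchy_Schwarz_ineq2[of "ZZ (\<gamma> t)" "\<tau> t"] B[of "\<gamma> t"] by simp
  qed measurable
  let ?W = "\<integral>t. (LBINT x. dlD (x - \<gamma> t) * (ZZ x \<bullet> \<tau> t)) - ZZ (\<gamma> t) \<bullet> \<tau> t \<partial>CM"
  have eq: "(LBINT x. VV x \<bullet> vref x) + pairing ZZ = - ?W"
    unfolding VV_vref pairing_def Bochner_Integration.integral_diff[OF VV_vref_int i] by simp
  have le: "norm ?W \<le> (\<integral>t. 10^6 * m * K \<partial>CM)"
  proof (rule integral_norm_bound_AE)
    show "integrable CM (\<lambda>t. (LBINT x. dlD (x - \<gamma> t) * (ZZ x \<bullet> \<tau> t)) - ZZ (\<gamma> t) \<bullet> \<tau> t)"
      by (rule Bochner_Integration.integrable_diff[OF VV_vref_int i])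
    show "integrable CM (\<lambda>t. 10^6 * m * K)" by (rule PM.integrable_const)
    show "AE t in CM. norm ((LBINT x. dlD (x - \<gamma> t) * (ZZ x \<bullet> \<tau> t)) - ZZ (\<gamma> t) \<bullet> \<tau> t) \<le> 10^6 * m * K"
      by (intro AE_I2) (simp only: real_norm_def dl_test)
  qed
  have "(\<integral>t. 10^6 * m * K \<partial>CM) = 10^6 * m * K * L" using measure_CM by simp
  with le show ?thesis unfolding eq by (simp only: abs_minus_cancel real_norm_def)
qed

end

section \<open>The pairing of the test field with the curve: expansion near the diagonal\<close>

lemma K2_line:
  assumes "norm t = 1"
  shows "K2 f1 f2 i k (h *\<^sub>R t) = 2 * of_bool (i = k) * f1 (h\<^sup>2) + 4 * h\<^sup>2 * (t$i * t$k) * f2 (h\<^sup>2)"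
proof -
  have "(h *\<^sub>R t) \<bullet> (h *\<^sub>R t) = h\<^sup>2"
    using assms by (simp add: power2_eq_square norm_eq_1)
  then show ?thesis unfolding K2_def by (simp only:) (simp add: power2_eq_square mult_ac)
qed

definition zeta :: "(3 \<Rightarrow> 3 \<Rightarrow> real) \<Rightarrow> real^3^3 \<Rightarrow> real^3 \<Rightarrow> real^3" where
  "zeta D A t = (\<Sum>j\<in>UNIV. cross3 (axis j 1) (\<Sum>k\<in>UNIV. D j k *\<^sub>R (A *v cross3 (axis k 1) t)))"

text \<open>The origin of the projection in the theorem. Along a straight line the Hessian is a
  multiple of the identity plus a multiple of \<open>t\<close> times \<open>t\<close>. The second
  part drops out because \<open>cross3 t t\<close> is zero. The first leaves minus the sum over
  \<open>j\<close> of \<open>A\<close> paired with the square of \<open>cross3 (axis j 1) t\<close>,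
  and these squares add up to \<open>(t \<bullet> t) *\<^sub>R mat 1 - tensor t t\<close>.\<close>

lemma zeta_line:
  "zeta (\<lambda>j k. 2 * of_bool (j = k) * a + 4 * c * (t$j * t$k)) A t \<bullet> t
    = - (2 * a) * (A \<bullet> ((t \<bullet> t) *\<^sub>R mat 1 - tensor t t))"
  by (simp add: zeta_def sum_3 inner_vec_def cross3_def axis_def mat_def tensor_def matrix_vector_mult_def algebra_simps)

lemma zeta_diff: "zeta D A t - zeta D' A t = zeta (\<lambda>j k. D j k - D' j k) A t"
  by (simp add: zeta_def sum_subtractf[symmetric] left_diff_distrib[symmetric] scaleR_diff_left cross3_simps)

lemma norm_zeta_le:
  assumes D: "\<And>j k. \<bar>D j k\<bar> \<le> B" and A: "norm A \<le> m" and t: "norm t = 1"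
  shows "norm (zeta D A t) \<le> 9 * B * m"
proof -
  have B0: "0 \<le> B" using D[of 1 1] by linarith
  have m0: "0 \<le> m" using A norm_ge_zero order_trans by blast
  have c: "norm (D j k *\<^sub>R (A *v cross3 (axis k 1) t)) \<le> B * m" for j k
  proof -
    have "norm (A *v cross3 (axis k 1) t) \<le> norm A * norm (cross3 (axis k 1) t)" by (rule norm_matrix_vector_le)
    also have "\<dots> \<le> m * 1" using A norm_cross_le[of "axis k 1" t] t m0 by (intro mult_mono) auto
    finally show ?thesis using D[of j k] B0 unfolding norm_scaleR by (intro mult_mono) auto
  qed
  have "norm (zeta D A t) \<le> (\<Sum>j\<in>(UNIV::3 set). 3 * (B * m))"
    unfolding zeta_def
  proof (rule sum_norm_le)
    fix j :: 3
    have "norm (cross3 (axis j 1) (\<Sum>k\<in>UNIV. D j k *\<^sub>R (A *v cross3 (axis k 1) t))) \<le> norm (\<Sum>k\<in>UNIV. D j k *\<^sub>R (A *v cross3 (axis k 1) t))"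
      using norm_cross_le[of "axis j 1" "\<Sum>k\<in>UNIV. D j k *\<^sub>R (A *v cross3 (axis k 1) t)"] by simp
    also have "\<dots> \<le> (\<Sum>k\<in>(UNIV::3 set). B * m)" by (intro sum_norm_le c)
    finally show "norm (cross3 (axis j 1) (\<Sum>k\<in>UNIV. D j k *\<^sub>R (A *v cross3 (axis k 1) t))) \<le> 3 * (B * m)" by simp
  qed
  then show ?thesis by simp
qed

lemma norm_tensor_part: "norm t = 1 \<Longrightarrow> \<bar>A \<bullet> (mat 1 - tensor t t)\<bar> \<le> 2 * norm (A::real^3^3)"
proof -
  assume t: "norm t = 1"
  have tt: "(\<Sum>i\<in>UNIV. t$i * t$i) = 1" using t by (simp add: norm_eq_1 inner_vec_def)
  have "(norm (mat 1 - tensor t t))\<^sup>2 = 3 - 2 * (\<Sum>i\<in>UNIV. t$i * t$i) + (\<Sum>i\<in>UNIV. t$i * t$i) * (\<Sum>i\<in>UNIV. t$i * t$i)"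
    by (simp add: power2_norm_eq_inner inner_vec_def sum_3 mat_def tensor_def algebra_simps)
  also have "\<dots> = 2" unfolding tt by simp
  finally have "(norm (mat 1 - tensor t t))\<^sup>2 \<le> 2\<^sup>2" by simp
  then have "norm (mat 1 - tensor t t) \<le> 2" by (rule power2_le_imp_le) simp
  then have "norm A * norm (mat 1 - tensor t t) \<le> norm A * 2" by (intro mult_left_mono) auto
  then show ?thesis using Cauchy_Schwarz_ineq2[of A "mat 1 - tensor t t"] by simp
qed

context tensor_curve
begin

lemma \<tau>_inner_self[simp]: "\<tau> s \<bullet> \<tau> s = 1"
  using \<tau>_norm[of s] by (simp only: norm_eq_1)

definition qq :: "real \<Rightarrow> real \<Rightarrow> real" where
  "qq s t = - (zeta (\<lambda>j k. D2 e L j k (\<gamma> t - \<gamma> s)) (b s) (\<tau> s) \<bullet> \<tau> t)"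

lemma D2_cont: "continuous_on UNIV (D2 e L j k)"
  by (rule C1c_cont[OF C1c_D2[OF e]])

lemma D2_meas[measurable]: "D2 e L j k \<in> borel_measurable borel"
  by (rule borel_measurable_continuous_onI[OF D2_cont])

lemma qq_meas[measurable]: "(\<lambda>(s, t). qq s t) \<in> borel_measurable (borel \<Otimes>\<^sub>M borel)"
  unfolding qq_def zeta_def by measurable

lemma D2_bound': "\<bar>D2 e L j k z\<bar> \<le> 1 / e"
proof -
  have "\<bar>D2 e L j k z\<bar> \<le> max e (norm z) powr -1" using D2_bound[OF e, of j k z] by (auto split: if_splits)
  also have "\<dots> \<le> e powr -1" using e by (intro powr_mono2') auto
  finally show ?thesis using e by (simp add: powr_minus_divide)
qed

lemma qq_le: "\<bar>qq s t\<bar> \<le> 9 * B * m" if "\<And>j k. \<bar>D2 e L j k (\<gamma> t - \<gamma> s)\<bar> \<le> B"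
proof -
  have "\<bar>qq s t\<bar> \<le> norm (zeta (\<lambda>j k. D2 e L j k (\<gamma> t - \<gamma> s)) (b s) (\<tau> s)) * norm (\<tau> t)"
    unfolding qq_def abs_minus_cancel by (rule Cauchy_Schwarz_ineq2)
  also have "\<dots> \<le> 9 * B * m" using norm_zeta_le[OF that b_bound] by simp
  finally show ?thesis .
qed

lemma qq_bdd: "\<bar>qq s t\<bar> \<le> 9 * (1/e) * m"
  by (rule qq_le[OF D2_bound'])

lemma ZZ_eq: "ZZ x \<bullet> v = (\<integral>s. zeta (\<lambda>j k. D2 e L j k (x - \<gamma> s)) (b s) (\<tau> s) \<bullet> v \<partial>CM)"
proof -
  have i: "integrable CM (\<lambda>s. D2 e L j k (x - \<gamma> s) *\<^sub>R cw k s)" for j k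
    by (rule conv_int(1)[OF C1c_D2[OF e] cw_meas cw_bound])
  have bl: "bounded_linear (cross3 a)" for a
    using bilinear_cross unfolding bilinear_def by (auto simp: linear_conv_bounded_linear)
  have iS: "integrable CM (\<lambda>s. \<Sum>k\<in>UNIV. D2 e L j k (x - \<gamma> s) *\<^sub>R cw k s)" for j
    by (rule Bochner_Integration.integrable_sum) (rule i)
  have XS: "XX j x = (\<integral>s. (\<Sum>k\<in>UNIV. D2 e L j k (x - \<gamma> s) *\<^sub>R cw k s) \<partial>CM)" for j
    unfolding XX_def conv_def by (rule Bochner_Integration.integral_sum[symmetric]) (rule i)
  have CS: "cross3 (axis j 1) (XX j x) = (\<integral>s. cross3 (axis j 1) (\<Sum>k\<in>UNIV. D2 e L j k (x - \<gamma> s) *\<^sub>R cw k s) \<partial>CM)" for j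
    unfolding XS by (rule integral_bounded_linear[OF bl iS, symmetric])
  have iC: "integrable CM (\<lambda>s. cross3 (axis j 1) (\<Sum>k\<in>UNIV. D2 e L j k (x - \<gamma> s) *\<^sub>R cw k s))" for j
    by (rule integrable_bounded_linear[OF bl iS])
  have "ZZ x = (\<integral>s. (\<Sum>j\<in>UNIV. cross3 (axis j 1) (\<Sum>k\<in>UNIV. D2 e L j k (x - \<gamma> s) *\<^sub>R cw k s)) \<partial>CM)"
    unfolding ZZ_def curlv_alt CS by (rule Bochner_Integration.integral_sum[symmetric]) (rule iC)
  then have "ZZ x \<bullet> v = (\<integral>s. (\<Sum>j\<in>UNIV. cross3 (axis j 1) (\<Sum>k\<in>UNIV. D2 e L j k (x - \<gamma> s) *\<^sub>R cw k s)) \<partial>CM) \<bullet> v" by simp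
  also have "\<dots> = (\<integral>s. (\<Sum>j\<in>UNIV. cross3 (axis j 1) (\<Sum>k\<in>UNIV. D2 e L j k (x - \<gamma> s) *\<^sub>R cw k s)) \<bullet> v \<partial>CM)"
    by (rule integral_inner_left[symmetric]) (rule Bochner_Integration.integrable_sum, rule iC)
  finally show ?thesis by (simp only: zeta_def cw_def)
qed

definition QQ :: "real \<Rightarrow> real" where "QQ s = (\<integral>t. qq s t \<partial>CM)"

text \<open>The order of integration is exchanged so that the source point \<open>s\<close>, where
  the tensor is frozen and the security radius is taken, is integrated last.\<close>

lemma pairing_QQ: "- pairing ZZ = (\<integral>s. QQ s \<partial>CM)" and QQ_integrable: "integrable CM QQ"
proof -
  interpret P: pair_sigma_finite CM CM by unfold_locales
  interpret PF: finite_measure "CM \<Otimes>\<^sub>M CM"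
    by (rule finite_measure_pair_measure) (rule finite_CM)+
  have [measurable]: "(\<lambda>h. h) \<in> borel_measurable CM" by (rule borel_CM) simp
  have m1: "(\<lambda>(s, t). qq s t) \<in> borel_measurable (CM \<Otimes>\<^sub>M CM)" by measurable
  have i: "integrable (CM \<Otimes>\<^sub>M CM) (\<lambda>(s, t). qq s t)"
    by (rule PF.integrable_const_bound[where B="9 * (1/e) * m", OF _ m1]) (use qq_bdd in auto)
  have "- pairing ZZ = (\<integral>t. (\<integral>s. qq s t \<partial>CM) \<partial>CM)"
    unfolding pairing_def ZZ_eq qq_def by simp
  also have "\<dots> = (\<integral>s. (\<integral>t. qq s t \<partial>CM) \<partial>CM)"
    by (rule P.Fubini_integral[OF i])
  finally show "- pairing ZZ = (\<integral>s. QQ s \<partial>CM)" unfolding QQ_def .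
  show "integrable CM QQ" unfolding QQ_def[abs_def] using P.integrable_fst[OF i] by simp
qed

text \<open>Third derivatives of the kernel are at most \<open>4 / d\<^sup>2\<close> at distance at
  least \<open>d\<close> from the origin, and the whole segment is required to keep that distance;
  the factor \<open>3\<close> sums over the directions.\<close>

lemma D2_lipschitz_seg:
  assumes seg: "\<And>u. 0 \<le> u \<Longrightarrow> u \<le> 1 \<Longrightarrow> d \<le> norm (w + u *\<^sub>R (z - w))" and d: "0 < d"
  shows "\<bar>D2 e L j k z - D2 e L j k w\<bar> \<le> 12 / d\<^sup>2 * norm (z - w)"
proof -
  have "norm (D2 e L j k z - D2 e L j k w) \<le> 12 / d\<^sup>2 * norm (z - w)"
  proof (rule differentiable_bound[of "closed_segment w z" _ "\<lambda>x h. \<Sum>i\<in>UNIV. (h$i) *\<^sub>R D3 e L i j k x"])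
    fix x assume x: "x \<in> closed_segment w z"
    then obtain u where u: "0 \<le> u" "u \<le> 1" "x = (1 - u) *\<^sub>R w + u *\<^sub>R z" by (auto simp: closed_segment_def)
    then have "x = w + u *\<^sub>R (z - w)" by (simp add: algebra_simps)
    then have dx: "d \<le> norm x" using seg[OF u(1,2)] by simp
    show "(D2 e L j k has_derivative (\<lambda>h. \<Sum>i\<in>UNIV. (h$i) *\<^sub>R D3 e L i j k x)) (at x within closed_segment w z)"
      by (rule has_derivative_at_withinI[OF C1c_deriv[OF C1c_D2[OF e]]])
    have "max e (norm x) powr -2 \<le> d powr -2" using dx d by (intro powr_mono2') auto
    also have "\<dots> = 1 / d\<^sup>2" using d by (simp add: powr_minus_divide powr_numeral)
    finally have "\<bar>D3 e L i j k x\<bar> \<le> 4 / d\<^sup>2" for i using D3_bound[OF e, of i j k x] by simp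
    then have "norm (\<Sum>i\<in>UNIV. (h$i) *\<^sub>R D3 e L i j k x) \<le> 3 * (4 / d\<^sup>2) * norm h" for h
      by (intro norm_partials_le) simp
    then show "onorm (\<lambda>h. \<Sum>i\<in>UNIV. (h$i) *\<^sub>R D3 e L i j k x) \<le> 12 / d\<^sup>2"
      using d by (intro onorm_le) simp
  qed auto
  then show ?thesis by simp
qed

definition lead :: "real \<Rightarrow> real" where "lead s = b s \<bullet> (mat 1 - tensor (\<tau> s) (\<tau> s))"

lemma lead_bound: "\<bar>lead s\<bar> \<le> 2 * m"
  unfolding lead_def using norm_tensor_part[of "\<tau> s" "b s"] b_bound[of s] by simp

text \<open>Two replacements bring the kernel to the straight-line case: the chord becomes
  \<open>h *\<^sub>R \<tau> s\<close>, with displacement of order \<open>h\<^sup>2 / \<rho>\<close>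
  against a derivative of order \<open>1 / h\<^sup>2\<close>, and the tangent at
  \<open>s + h\<close> becomes \<open>\<tau> s\<close>, with \<open>\<bar>h\<bar> / \<rho>\<close>
  against \<open>1 / \<bar>h\<bar>\<close>. Both errors are of order \<open>m / \<rho> s\<close>
  uniformly in \<open>h\<close>, so over the near window they integrate to a multiple of
  \<open>m\<close>.\<close>

lemma qq_near:
  assumes g: "good s" and h: "\<bar>h\<bar> \<le> \<rho> s" and t: "norm (\<tau> (s + h) - \<tau> s) \<le> \<bar>h\<bar> / \<rho> s"
  shows "\<bar>qq s (s + h) - 2 * pp1 e L (h\<^sup>2) * lead s\<bar> \<le> 225 * m / \<rho> s"
proof (cases "h = 0")
  case True
  have "qq s s = 2 * pp1 e L 0 * lead s"
    using zeta_line[of "pp1 e L 0" "0 * pp2 e L 0" "\<tau> s" "b s"] K2_line[OF \<tau>_norm[of s], of "pp1 e L" "pp2 e L" _ _ 0]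
    by (simp add: qq_def lead_def)
  then show ?thesis using True m_nonneg good_pos[OF g] by simp
next
  case False
  have r: "\<rho> s > 0" using g by (rule good_pos)
  define z where "z = \<gamma> (s + h) - \<gamma> s"
  define w where "w = h *\<^sub>R \<tau> s"
  have hp: "\<bar>h\<bar> > 0" using False by simp
  have zw: "norm (z - w) \<le> h\<^sup>2 / (2 * \<rho> s)" unfolding z_def w_def by (rule good_near[OF g h])
  have half: "h\<^sup>2 / (2 * \<rho> s) \<le> \<bar>h\<bar> / 2"
  proof -
    have "h\<^sup>2 = \<bar>h\<bar> * \<bar>h\<bar>" by (simp add: power2_eq_square)
    also have "\<dots> \<le> \<bar>h\<bar> * \<rho> s" using h by (intro mult_left_mono) auto
    finally show ?thesis using r by (simp add: field_simps)
  qed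
  \<comment> \<open>The chord deviates from the tangent vector by at most half of its length, so the
    connecting segment stays away from the singularity.\<close>
  have seg: "\<bar>h\<bar> / 2 \<le> norm (w + u *\<^sub>R (z - w))" if "0 \<le> u" "u \<le> 1" for u
  proof -
    have "norm (u *\<^sub>R (z - w)) \<le> 1 * (\<bar>h\<bar> / 2)" unfolding norm_scaleR using that zw half by (intro mult_mono) auto
    moreover have "norm w = \<bar>h\<bar>" by (simp add: w_def)
    moreover have "norm w \<le> norm (w + u *\<^sub>R (z - w)) + norm (u *\<^sub>R (z - w))"
      using norm_triangle_ineq4[of "w + u *\<^sub>R (z - w)" "u *\<^sub>R (z - w)"] by simp
    ultimately show ?thesis by linarith
  qed
  have D: "\<bar>D2 e L j k z - D2 e L j k w\<bar> \<le> 24 / \<rho> s" for j k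
  proof -
    have "\<bar>D2 e L j k z - D2 e L j k w\<bar> \<le> 12 / (\<bar>h\<bar> / 2)\<^sup>2 * norm (z - w)"
      using hp by (intro D2_lipschitz_seg seg) auto
    also have "\<dots> \<le> 12 / (\<bar>h\<bar> / 2)\<^sup>2 * (h\<^sup>2 / (2 * \<rho> s))" by (intro mult_left_mono zw) auto
    also have "\<dots> = 24 / \<rho> s" using hp r by (simp add: power_divide field_simps)
    finally show ?thesis .
  qed
  have Dw: "\<bar>D2 e L j k w\<bar> \<le> 1 / \<bar>h\<bar>" for j k
  proof -
    have "\<bar>D2 e L j k w\<bar> \<le> max e (norm w) powr -1" using D2_bound[OF e, of j k w] by (auto split: if_splits)
    also have "\<dots> \<le> \<bar>h\<bar> powr -1" using hp by (intro powr_mono2') (auto simp: w_def)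
    finally show ?thesis using hp by (simp add: powr_minus_divide)
  qed
  let ?z = "zeta (\<lambda>j k. D2 e L j k z) (b s) (\<tau> s)" and ?w = "zeta (\<lambda>j k. D2 e L j k w) (b s) (\<tau> s)"
  have "norm (?z - ?w) \<le> 9 * (24 / \<rho> s) * m" unfolding zeta_diff by (rule norm_zeta_le[OF D b_bound]) simp
  then have 1: "\<bar>(?z - ?w) \<bullet> \<tau> (s + h)\<bar> \<le> 216 * m / \<rho> s"
    using Cauchy_Schwarz_ineq2[of "?z - ?w" "\<tau> (s + h)"] by simp
  have "norm ?w \<le> 9 * (1 / \<bar>h\<bar>) * m" by (rule norm_zeta_le[OF Dw b_bound]) simp
  then have "norm ?w * norm (\<tau> (s + h) - \<tau> s) \<le> 9 * (1 / \<bar>h\<bar>) * m * (\<bar>h\<bar> / \<rho> s)"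
    using t m_nonneg by (intro mult_mono) auto
  also have "\<dots> = 9 * m / \<rho> s" using hp by simp
  finally have 2: "\<bar>?w \<bullet> (\<tau> (s + h) - \<tau> s)\<bar> \<le> 9 * m / \<rho> s"
    using Cauchy_Schwarz_ineq2[of ?w "\<tau> (s + h) - \<tau> s"] by linarith
  have "(\<lambda>j k. D2 e L j k w) = (\<lambda>j k. 2 * of_bool (j = k) * pp1 e L (h\<^sup>2) + 4 * (h\<^sup>2 * pp2 e L (h\<^sup>2)) * (\<tau> s $ j * \<tau> s $ k))"
    unfolding w_def by (intro ext) (simp add: K2_line)
  then have 3: "?w \<bullet> \<tau> s = - (2 * pp1 e L (h\<^sup>2)) * lead s"
    using zeta_line[of "pp1 e L (h\<^sup>2)" "h\<^sup>2 * pp2 e L (h\<^sup>2)" "\<tau> s" "b s"]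
    by (simp add: lead_def)
  have "qq s (s + h) = - ((?z - ?w) \<bullet> \<tau> (s + h)) - ?w \<bullet> (\<tau> (s + h) - \<tau> s) - ?w \<bullet> \<tau> s"
    unfolding qq_def z_def by (simp add: inner_diff_left inner_diff_right)
  then have "qq s (s + h) - 2 * pp1 e L (h\<^sup>2) * lead s = - ((?z - ?w) \<bullet> \<tau> (s + h)) - ?w \<bullet> (\<tau> (s + h) - \<tau> s)"
    unfolding 3 by simp
  then have "\<bar>qq s (s + h) - 2 * pp1 e L (h\<^sup>2) * lead s\<bar> \<le> 216 * m / \<rho> s + 9 * m / \<rho> s"
    using 1 2 by linarith
  also have "\<dots> = 225 * m / \<rho> s" by (simp add: field_simps)
  finally show ?thesis .
qed

lemma qq_far:
  assumes g: "good s" and h: "\<rho> s < \<bar>h\<bar>" "\<bar>h\<bar> \<le> L / 2"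
  shows "ennreal \<bar>qq s (s + h)\<bar> \<le> ennreal (9 * m) * far L s h"
proof -
  define z where "z = \<gamma> (s + h) - \<gamma> s"
  have z: "\<rho> s / 2 \<le> norm z" unfolding z_def using good_far[OF g] h by simp
  then have z0: "norm z > 0" using good_pos[OF g] by linarith
  have zL: "norm z \<le> L" using lip[of "s + h" s] h L unfolding z_def by simp
  have "\<bar>D2 e L j k z\<bar> \<le> 1 / norm z" for j k
  proof -
    have "\<bar>D2 e L j k z\<bar> \<le> max e (norm z) powr -1" using D2_bound[OF e, of j k z] by (auto split: if_splits)
    also have "\<dots> \<le> norm z powr -1" using z0 by (intro powr_mono2') auto
    finally show ?thesis using z0 by (simp add: powr_minus_divide)
  qed
  then have "\<bar>qq s (s + h)\<bar> \<le> 9 * m * (1 / norm z)"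
    using qq_le[of "s + h" s "1 / norm z"] unfolding z_def by (simp add: mult_ac)
  then have "ennreal \<bar>qq s (s + h)\<bar> \<le> ennreal (9 * m) * ennreal (1 / norm z)"
    using m_nonneg by (simp add: ennreal_mult[symmetric] ennreal_leI)
  also have "ennreal (1 / norm z) = far L s h" using h zL by (simp add: far_def z_def)
  finally show ?thesis .
qed

lemma pp1_sq: "\<bar>pp1 e L (h\<^sup>2)\<bar> \<le> 1/6 * (1 / e)" "e \<le> \<bar>h\<bar> \<Longrightarrow> \<bar>2 * pp1 e L (h\<^sup>2) - 1 / (8 * pi * \<bar>h\<bar>)\<bar> \<le> 1 / (6 * L)"
proof -
  obtain t :: "real^3" where t: "norm t = \<bar>h\<bar>" using vector_choose_size[of "\<bar>h\<bar>"] by auto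
  then have tt: "t \<bullet> t = h\<^sup>2" by (simp add: power2_norm_eq_inner[symmetric])
  have "\<bar>pp1 e L (h\<^sup>2)\<bar> \<le> 1/6 * max e \<bar>h\<bar> powr -1" using pp_bounds(1)[OF e, of t] unfolding tt t .
  also have "max e \<bar>h\<bar> powr -1 \<le> e powr -1" using e by (intro powr_mono2') auto
  finally show "\<bar>pp1 e L (h\<^sup>2)\<bar> \<le> 1/6 * (1 / e)" using e by (simp add: powr_minus_divide)
  assume he: "e \<le> \<bar>h\<bar>"
  have hp: "\<bar>h\<bar> > 0" using he e by linarith
  have "e\<^sup>2 \<le> h\<^sup>2" using power_mono[OF he, of 2] e by simp
  then have "ps1 e (h\<^sup>2) = 1 / (16*pi) * (h\<^sup>2) powr -(1/2)" by (rule ps_outer(1)[OF e(1)])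
  also have "(h\<^sup>2) powr -(1/2) = 1 / \<bar>h\<bar>" using hp by (simp add: powr_minus_divide powr_half_sqrt)
  finally have "2 * pp1 e L (h\<^sup>2) - 1 / (8 * pi * \<bar>h\<bar>) = - 2 * ps1 L (h\<^sup>2)" by (simp add: pp1_def)
  moreover have "\<bar>ps1 L (h\<^sup>2)\<bar> \<le> 1 / (4*pi) * (1 / L)"
  proof -
    have "\<bar>ps1 L (h\<^sup>2)\<bar> \<le> 1 / (4*pi) * max L \<bar>h\<bar> powr -1" using ps_bounds(1)[OF L, of t] unfolding tt t .
    also have "1 / (4*pi) * max L \<bar>h\<bar> powr -1 \<le> 1 / (4*pi) * L powr -1" using L by (intro mult_left_mono powr_mono2') auto
    finally show ?thesis using L by (simp add: powr_minus_divide)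
  qed
  moreover have "1 / (4*pi) * (1 / L) \<le> 1 / 12 * (1 / L)" using L pi_gt3 by (intro mult_right_mono) (auto simp: field_simps)
  ultimately show "\<bar>2 * pp1 e L (h\<^sup>2) - 1 / (8 * pi * \<bar>h\<bar>)\<bar> \<le> 1 / (6 * L)" by (simp add: abs_mult)
qed

lemma pp1_meas[measurable]: "pp1 e L \<in> borel_measurable borel"
  by (rule borel_measurable_continuous_onI[OF DERIV_cont[OF pp_deriv(1)[OF e]]])

text \<open>The integrand is split into the part below scale \<open>e\<close> (bounded by
  \<open>2/3\<close>), the deviation from \<open>1 / (8 * pi * \<bar>h\<bar>)\<close> caused by the
  truncation at \<open>L\<close> (bounded by \<open>1/12\<close>), and the exact logarithm up to
  \<open>r\<close>. Its shortfall from the logarithm up to \<open>L\<close> is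
  \<open>ln (L / r) / (4 * pi)\<close>, which the square root dominates.\<close>

lemma lead_window:
  assumes r: "0 < r" "r \<le> L / 4"
  defines "I \<equiv> (LBINT h. indicator {-r..r} h * (2 * pp1 e L (h\<^sup>2)))"
  shows "\<bar>I - (ln L - ln e) / (4 * pi)\<bar> \<le> 2 + sqrt (L / r)"
proof -
  let ?f = "\<lambda>h. 2 * pp1 e L (h\<^sup>2)"
  define A where "A = {h. e \<le> \<bar>h\<bar> \<and> \<bar>h\<bar> \<le> r}"
  define f1 where "f1 h = indicator {-r..r} h * (if e \<le> \<bar>h\<bar> then 0 else ?f h)" for h
  define f2 where "f2 h = indicator A h * (?f h - 1 / (8 * pi * \<bar>h\<bar>))" for h
  define f3 where "f3 h = indicator A h * (1 / (8 * pi * \<bar>h\<bar>))" for h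
  have [measurable]: "A \<in> sets borel" unfolding A_def by measurable
  have f1m: "f1 \<in> borel_measurable lborel" unfolding f1_def[abs_def] by measurable
  have f2m: "f2 \<in> borel_measurable lborel" unfolding f2_def[abs_def] by measurable
  have dec: "indicator {-r..r} h * ?f h = f1 h + (f2 h + f3 h)" for h
    using e by (auto simp: f1_def f2_def f3_def A_def indicator_def abs_le_iff)
  have b1: "norm (f1 h) \<le> indicator {-e..e} h * (1 / (3 * e))" for h
    using pp1_sq(1)[of h] e by (auto simp: f1_def indicator_def abs_mult)
  have b2: "norm (f2 h) \<le> indicator {-r..r} h * (1 / (6 * L))" for h
    using pp1_sq(2)[of h] L by (auto simp: f2_def indicator_def A_def)
  have j1: "integrable lborel (\<lambda>h. indicator {-e..e} h * (1 / (3 * e)))" and j2: "integrable lborel (\<lambda>h. indicator {-r..r} h * (1 / (6 * L)))"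
    using indicator_Icc_integrable by (auto intro!: integrable_mult_left)
  have i1: "integrable lborel f1"
    by (rule Bochner_Integration.integrable_bound[OF j1 f1m]) (intro AE_I2 order_trans[OF b1], unfold real_norm_def, rule abs_ge_self)
  have i2: "integrable lborel f2"
    by (rule Bochner_Integration.integrable_bound[OF j2 f2m]) (intro AE_I2 order_trans[OF b2], unfold real_norm_def, rule abs_ge_self)
  have n1: "\<bar>LBINT h. f1 h\<bar> \<le> 2/3"
  proof -
    have "norm (LBINT h. f1 h) \<le> (LBINT h. indicator {-e..e} h * (1 / (3 * e)))"
      by (rule integral_norm_bound_AE[OF i1 j1]) (intro AE_I2 b1)
    then show ?thesis using e by simp
  qed
  have n2: "\<bar>LBINT h. f2 h\<bar> \<le> 1/12"
  proof -
    have "norm (LBINT h. f2 h) \<le> (LBINT h. indicator {-r..r} h * (1 / (6 * L)))"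
      by (rule integral_norm_bound_AE[OF i2 j2]) (intro AE_I2 b2)
    also have "\<dots> = 2 * r * (1 / (6 * L))" using r by simp
    also have "\<dots> \<le> 2 * (L/4) * (1 / (6 * L))" using r L by (intro mult_right_mono) auto
    also have "\<dots> = 1/12" using L by simp
    finally show ?thesis by simp
  qed
  have lnr: "ln (L / r) \<le> 2 * sqrt (L / r)"
  proof -
    have "ln (L / r) = 2 * ln (sqrt (L / r))" using L r by (simp add: ln_sqrt)
    also have "\<dots> \<le> 2 * sqrt (L / r)" using ln_le_minus_one[of "sqrt (L / r)"] L r by simp
    finally show ?thesis .
  qed
  have lnr': "0 \<le> ln (L / r)" using r L by (simp add: ln_ge_zero_iff)
  have q: "x / (4 * pi) \<le> sqrt (L / r)" if "x \<le> ln (L / r)" for x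
  proof -
    have "x / (4 * pi) \<le> ln (L / r) / (4 * pi)" using that by (intro divide_right_mono) auto
    also have "\<dots> \<le> 2 * sqrt (L / r) / (4 * pi)" using lnr by (intro divide_right_mono) auto
    also have "\<dots> = sqrt (L / r) * (1 / (2 * pi))" by simp
    also have "\<dots> \<le> sqrt (L / r) * 1" using pi_gt3 L r by (intro mult_left_mono) (auto simp: field_simps)
    finally show ?thesis by simp
  qed
  have i3: "integrable lborel f3" and n3: "\<bar>(LBINT h. f3 h) - (ln L - ln e) / (4 * pi)\<bar> \<le> sqrt (L / r)"
  proof -
    have "integrable lborel f3 \<and> \<bar>(LBINT h. f3 h) - (ln L - ln e) / (4 * pi)\<bar> \<le> sqrt (L / r)"
    proof (cases "e \<le> r")
      case True
      have k: "integrable lborel (\<lambda>h. indicator {e..r} h * (1 / (8 * pi * \<bar>h\<bar>)))" "(LBINT h. indicator {e..r} h * (1 / (8 * pi * \<bar>h\<bar>))) = (ln r - ln e) / (8 * pi)"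
      proof -
        have eq: "indicator {e..r} h * (1 / (8 * pi * \<bar>h\<bar>)) = 1 / (8 * pi) * (indicator {e..r} h * (1 / h))" for h
          using e by (auto simp: indicator_def)
        show "integrable lborel (\<lambda>h. indicator {e..r} h * (1 / (8 * pi * \<bar>h\<bar>)))"
          unfolding eq by (intro integrable_mult_right integral_inverse_window(2) e True)
        show "(LBINT h. indicator {e..r} h * (1 / (8 * pi * \<bar>h\<bar>))) = (ln r - ln e) / (8 * pi)"
          unfolding eq integral_mult_right_zero integral_inverse_window(1)[OF e(1) True] by simp
      qed
      have "integrable lborel f3" "(LBINT h. f3 h) = 2 * ((ln r - ln e) / (8 * pi))"
        unfolding f3_def[abs_def] A_def using integral_sym_window[OF k(1) _ e(1)] k(2) by simp_all
      moreover have "2 * ((ln r - ln e) / (8 * pi)) - (ln L - ln e) / (4 * pi) = - (ln (L / r) / (4 * pi))"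
        using L r by (simp add: ln_div field_simps)
      ultimately show ?thesis using q[of "ln (L / r)"] lnr' by simp
    next
      case False
      then have z: "f3 = (\<lambda>h. 0)" by (auto simp: f3_def A_def indicator_def)
      have "ln L - ln e \<le> ln (L / r)" using False L r e by (simp add: ln_div)
      moreover have "0 \<le> ln L - ln e" using e L by simp
      ultimately show ?thesis using q[of "ln L - ln e"] by (simp add: z)
    qed
    then show "integrable lborel f3" "\<bar>(LBINT h. f3 h) - (ln L - ln e) / (4 * pi)\<bar> \<le> sqrt (L / r)" by auto
  qed
  have "I = (LBINT h. f1 h) + ((LBINT h. f2 h) + (LBINT h. f3 h))"
    unfolding I_def dec using i1 i2 i3 by simp
  then show ?thesis using n1 n2 n3 by linarith
qed

text \<open>The constant \<open>454\<close> collects \<open>450\<close> from the near error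
  \<open>225 * m / \<rho> s\<close> over a window of length \<open>2 * \<rho> s\<close>, and
  \<open>4\<close> from the bounded part of \<open>lead_window\<close> times
  \<open>\<bar>lead s\<bar> \<le> 2 * m\<close>. The half power of \<open>\<rho>\<close> and the
  integral of \<open>far\<close> are left to be integrated in \<open>s\<close>.\<close>

lemma QQ_est:
  assumes g: "good s" and s: "0 \<le> s" "s < L"
  shows "ennreal \<bar>QQ s - (ln L - ln e) / (4 * pi) * lead s\<bar> \<le>
    ennreal (454 * m) + ennreal (2 * m * sqrt L) * (if \<rho> s \<le> L then ennreal (\<rho> s powr -(1/2)) else 0)
      + ennreal (9 * m) * (\<integral>\<^sup>+h. far L s h \<partial>HM)"
proof -
  have r: "0 < \<rho> s" "\<rho> s \<le> L / 4" using good_pos[OF g] good_le[OF g] by auto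
  let ?f = "\<lambda>h. 2 * pp1 e L (h\<^sup>2)"
  let ?T = "(ln L - ln e) / (4 * pi)"
  define w where "w h = indicator {-\<rho> s..\<rho> s} h * ?f h * lead s" for h
  have wm[measurable]: "w \<in> borel_measurable borel" unfolding w_def by measurable
  have qm: "qq s \<in> borel_measurable borel" by measurable
  have qper: "qq s (t + L) = qq s t" for t unfolding qq_def by (simp add: per)
  have Q: "QQ s = (\<integral>h. qq s (s + h) \<partial>HM)"
    unfolding QQ_def by (rule integral_shift[where B="9 * (1/e) * m"]) (rule qm qper s qq_bdd)+
  have iq: "integrable HM (\<lambda>h. qq s (s + h))"
    by (rule finite_measure.integrable_const_bound[OF finite_HM, where B="9 * (1/e) * m"]) (use qq_bdd in \<open>auto intro!: borel_HM\<close>)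
  have wb: "\<bar>w h\<bar> \<le> 2 * (1/6 * (1/e)) * (2 * m)" for h
  proof -
    have "\<bar>indicator {-\<rho> s..\<rho> s} h * ?f h\<bar> \<le> 2 * (1/6 * (1/e))" using pp1_sq(1)[of h] e by (auto simp: indicator_def abs_mult)
    then show ?thesis unfolding w_def abs_mult[of _ "lead s"] using lead_bound[of s] e by (intro mult_mono) auto
  qed
  have iw: "integrable HM w"
    by (rule finite_measure.integrable_const_bound[OF finite_HM, where B="2 * (1/6 * (1/e)) * (2 * m)"]) (use wb in \<open>auto intro!: borel_HM\<close>)
  have Iw: "(\<integral>h. w h \<partial>HM) = (LBINT h. indicator {-\<rho> s..\<rho> s} h * ?f h) * lead s"
  proof -
    have "(\<integral>h. w h \<partial>HM) = (LBINT h. w h)"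
      by (rule HM_lborel(1)) (use r L in \<open>auto simp: w_def indicator_def\<close>)
    then show ?thesis by (simp add: w_def)
  qed
  have main: "\<bar>(\<integral>h. w h \<partial>HM) - ?T * lead s\<bar> \<le> (2 + sqrt (L / \<rho> s)) * (2 * m)"
  proof -
    have "(\<integral>h. w h \<partial>HM) - ?T * lead s = ((LBINT h. indicator {-\<rho> s..\<rho> s} h * ?f h) - ?T) * lead s"
      unfolding Iw by (simp add: algebra_simps)
    also have "\<bar>\<dots>\<bar> \<le> (2 + sqrt (L / \<rho> s)) * (2 * m)"
      unfolding abs_mult using lead_window[OF r] lead_bound[of s] by (intro mult_mono) auto
    finally show ?thesis .
  qed
  have ae: "AE h in HM. \<bar>h\<bar> \<le> \<rho> s \<longrightarrow> norm (\<tau> (s + h) - \<tau> s) \<le> \<bar>h\<bar> / \<rho> s"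
    using good_AE_h[OF g] by (subst AE_restrict_space_iff) auto
  have "ennreal \<bar>QQ s - (\<integral>h. w h \<partial>HM)\<bar> = ennreal (norm (\<integral>h. qq s (s + h) - w h \<partial>HM))"
    unfolding Q using iq iw by simp
  also have "\<dots> \<le> (\<integral>\<^sup>+h. norm (qq s (s + h) - w h) \<partial>HM)"
    using iq iw by (intro integral_norm_bound_ennreal) simp
  also have "\<dots> \<le> (\<integral>\<^sup>+h. ennreal (225 * m / \<rho> s) * indicator {-\<rho> s..\<rho> s} h + ennreal (9 * m) * far L s h \<partial>HM)"
  proof (rule nn_integral_mono_AE)
    have "AE h in HM. h \<in> space HM" by (rule AE_space)
    then show "AE h in HM. ennreal (norm (qq s (s + h) - w h)) \<le> ennreal (225 * m / \<rho> s) * indicator {-\<rho> s..\<rho> s} h + ennreal (9 * m) * far L s h"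
      using ae
    proof eventually_elim
      fix h assume h: "h \<in> space HM" and *: "\<bar>h\<bar> \<le> \<rho> s \<longrightarrow> norm (\<tau> (s + h) - \<tau> s) \<le> \<bar>h\<bar> / \<rho> s"
      show "ennreal (norm (qq s (s + h) - w h)) \<le> ennreal (225 * m / \<rho> s) * indicator {-\<rho> s..\<rho> s} h + ennreal (9 * m) * far L s h"
      proof (cases "\<bar>h\<bar> \<le> \<rho> s")
        case True
        then have i: "h \<in> {-\<rho> s..\<rho> s}" by auto
        have "norm (qq s (s + h) - w h) \<le> 225 * m / \<rho> s"
          using qq_near[OF g True] * True i by (simp add: w_def)
        then have "ennreal (norm (qq s (s + h) - w h)) \<le> ennreal (225 * m / \<rho> s)" by (rule ennreal_leI)
        then show ?thesis using i by (simp add: add_increasing2)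
      next
        case False
        then have i: "h \<notin> {-\<rho> s..\<rho> s}" by auto
        have "ennreal \<bar>qq s (s + h)\<bar> \<le> ennreal (9 * m) * far L s h"
          using False h by (intro qq_far[OF g]) (auto simp: abs_le_iff)
        then show ?thesis using i by (simp add: w_def)
      qed
    qed
  qed
  also have "\<dots> = (\<integral>\<^sup>+h. ennreal (225 * m / \<rho> s) * indicator {-\<rho> s..\<rho> s} h \<partial>HM) + (\<integral>\<^sup>+h. ennreal (9 * m) * far L s h \<partial>HM)"
  proof (rule nn_integral_add)
    show "(\<lambda>h. ennreal (225 * m / \<rho> s) * indicator {-\<rho> s..\<rho> s} h) \<in> borel_measurable HM" by (rule borel_HM) measurable
    show "(\<lambda>h. ennreal (9 * m) * far L s h) \<in> borel_measurable HM" unfolding far_def by (rule borel_HM) measurable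
  qed
  also have "(\<integral>\<^sup>+h. ennreal (9 * m) * far L s h \<partial>HM) = ennreal (9 * m) * (\<integral>\<^sup>+h. far L s h \<partial>HM)"
  proof (rule nn_integral_cmult)
    show "far L s \<in> borel_measurable HM" unfolding far_def[abs_def] by (rule borel_HM) measurable
  qed
  also have "(\<integral>\<^sup>+h. ennreal (225 * m / \<rho> s) * indicator {-\<rho> s..\<rho> s} h \<partial>HM) \<le> ennreal (450 * m)"
  proof -
    have "(\<integral>\<^sup>+h. ennreal (225 * m / \<rho> s) * indicator {-\<rho> s..\<rho> s} h \<partial>HM) = (\<integral>\<^sup>+h. ennreal (225 * m / \<rho> s) * indicator {-\<rho> s..\<rho> s} h * indicator {-(L/2)..<L/2} h \<partial>lborel)"
      by (rule nn_HM) measurable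
    also have "\<dots> \<le> (\<integral>\<^sup>+h. ennreal (225 * m / \<rho> s) * indicator {-\<rho> s..\<rho> s} h \<partial>lborel)"
      by (intro nn_integral_mono) (auto simp: indicator_def)
    also have "\<dots> = ennreal (225 * m / \<rho> s) * ennreal (2 * \<rho> s)" using r by (simp add: nn_integral_cmult_indicator)
    also have "\<dots> = ennreal (450 * m)" using r m_nonneg by (subst ennreal_mult[symmetric]) auto
    finally show ?thesis .
  qed
  finally have 1: "ennreal \<bar>QQ s - (\<integral>h. w h \<partial>HM)\<bar> \<le> ennreal (450 * m) + ennreal (9 * m) * (\<integral>\<^sup>+h. far L s h \<partial>HM)"
    by (simp add: add_right_mono)
  have "sqrt (L / \<rho> s) = sqrt L * \<rho> s powr -(1/2)"
    using r by (simp add: real_sqrt_divide powr_minus_divide powr_half_sqrt)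
  then have "(2 + sqrt (L / \<rho> s)) * (2 * m) = 4 * m + 2 * m * sqrt L * \<rho> s powr -(1/2)" by (simp add: algebra_simps)
  then have "\<bar>QQ s - ?T * lead s\<bar> \<le> \<bar>QQ s - (\<integral>h. w h \<partial>HM)\<bar> + (4 * m + 2 * m * sqrt L * \<rho> s powr -(1/2))"
    using main by linarith
  then have "ennreal \<bar>QQ s - ?T * lead s\<bar> \<le> ennreal (\<bar>QQ s - (\<integral>h. w h \<partial>HM)\<bar> + (4 * m + 2 * m * sqrt L * \<rho> s powr -(1/2)))"
    by (rule ennreal_leI)
  also have "\<dots> = ennreal \<bar>QQ s - (\<integral>h. w h \<partial>HM)\<bar> + (ennreal (4 * m) + ennreal (2 * m * sqrt L) * ennreal (\<rho> s powr -(1/2)))"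
    using m_nonneg L by (simp add: ennreal_mult)
  also have "\<dots> \<le> (ennreal (450 * m) + ennreal (9 * m) * (\<integral>\<^sup>+h. far L s h \<partial>HM)) + (ennreal (4 * m) + ennreal (2 * m * sqrt L) * ennreal (\<rho> s powr -(1/2)))"
    by (intro add_right_mono 1)
  also have "\<dots> = (ennreal (450 * m) + ennreal (4 * m)) + ennreal (2 * m * sqrt L) * ennreal (\<rho> s powr -(1/2)) + ennreal (9 * m) * (\<integral>\<^sup>+h. far L s h \<partial>HM)"
    by (simp add: add_ac)
  also have "ennreal (450 * m) + ennreal (4 * m) = ennreal (454 * m)" using m_nonneg by (simp flip: ennreal_plus)
  finally show ?thesis using r L by simp
qed

lemma lead_meas[measurable]: "lead \<in> borel_measurable borel"
proof -
  have "continuous_on UNIV (\<lambda>x::real^3. tensor x x)"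
    unfolding tensor_def by (intro continuous_on_vec_lambda continuous_intros)
  then have [measurable]: "(\<lambda>x::real^3. tensor x x) \<in> borel_measurable borel" by (rule borel_measurable_continuous_onI)
  show ?thesis unfolding lead_def[abs_def] by measurable
qed

lemma pairing_est: "\<bar>- pairing ZZ - (ln L - ln e) / (4 * pi) * (\<integral>s. lead s \<partial>CM)\<bar> \<le> 2200 * m * K\<^sup>2 * L"
proof -
  let ?T = "(ln L - ln e) / (4 * pi)"
  have il: "integrable CM lead" by (rule CM_integrable[OF lead_meas, where B="2 * m"]) (use lead_bound in auto)
  have i: "integrable CM (\<lambda>s. \<bar>QQ s - ?T * lead s\<bar>)" using QQ_integrable il by simp
  have "(\<integral>s. \<bar>QQ s - ?T * lead s\<bar> \<partial>CM) \<le> 2200 * m * K\<^sup>2 * L"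
  proof (rule integral_le_nn[OF i])
    let ?r = "\<lambda>s. if \<rho> s \<le> L then ennreal (\<rho> s powr -(1/2)) else 0"
    have "AE s in CM. s \<in> space CM" by (rule AE_space)
    then show "AE s in CM. ennreal \<bar>QQ s - ?T * lead s\<bar> \<le> ennreal (454 * m) + ennreal (2 * m * sqrt L) * ?r s + ennreal (9 * m) * (\<integral>\<^sup>+h. far L s h \<partial>HM)"
      using AE_CM_good by eventually_elim (use QQ_est in auto)
    have mr: "?r \<in> borel_measurable CM" by (rule borel_CM) measurable
    note [measurable] = mr far_measurable
    have "(\<integral>\<^sup>+s. ennreal (454 * m) + ennreal (2 * m * sqrt L) * ?r s + ennreal (9 * m) * (\<integral>\<^sup>+h. far L s h \<partial>HM) \<partial>CM)
      = ennreal (454 * m) * ennreal L + ennreal (2 * m * sqrt L) * (\<integral>\<^sup>+s. ?r s \<partial>CM) + ennreal (9 * m) * (\<integral>\<^sup>+s. (\<integral>\<^sup>+h. far L s h \<partial>HM) \<partial>CM)"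
      by (simp add: nn_integral_add nn_integral_cmult emeasure_CM[unfolded space_CM])
    also have "\<dots> \<le> ennreal (454 * m) * ennreal L + ennreal (2 * m * sqrt L) * ennreal (4 * K * sqrt L) + ennreal (9 * m) * ennreal (240 * K\<^sup>2 * L)"
      using L CM_\<rho>_le[of L] far_lemma[OF L] unfolding far_def by (intro add_mono mult_left_mono) auto
    also have "\<dots> = ennreal (454 * m * L + 2 * m * sqrt L * (4 * K * sqrt L) + 9 * m * (240 * K\<^sup>2 * L))"
      using m_nonneg L K by (simp add: ennreal_mult[symmetric] flip: ennreal_plus)
    also have "2 * m * sqrt L * (4 * K * sqrt L) = 8 * (m * L * K)" using L by simp
    also have "454 * m * L + 8 * (m * L * K) + 9 * m * (240 * K\<^sup>2 * L) \<le> 2200 * m * K\<^sup>2 * L"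
    proof -
      \<comment> \<open>Here the lower bound for \<open>K\<close> absorbs the constant and the
        linear term into \<open>K\<^sup>2\<close>.\<close>
      have K2: "K * (11/3) \<le> K\<^sup>2" "(11/3) * (11/3) \<le> K\<^sup>2" unfolding power2_eq_square using K by (intro mult_mono; simp)+
      have "454 + 8 * K + 2160 * K\<^sup>2 \<le> 2200 * K\<^sup>2" using K2 by simp
      then have "(m * L) * (454 + 8 * K + 2160 * K\<^sup>2) \<le> (m * L) * (2200 * K\<^sup>2)" using m_nonneg L by (intro mult_left_mono) auto
      then show ?thesis by (simp add: algebra_simps)
    qed
    finally show "(\<integral>\<^sup>+s. ennreal (454 * m) + ennreal (2 * m * sqrt L) * ?r s + ennreal (9 * m) * (\<integral>\<^sup>+h. far L s h \<partial>HM) \<partial>CM) \<le> ennreal (2200 * m * K\<^sup>2 * L)"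
      by (simp add: ennreal_leI)
  qed (use m_nonneg L in auto)
  moreover have "- pairing ZZ - ?T * (\<integral>s. lead s \<partial>CM) = (\<integral>s. QQ s - ?T * lead s \<partial>CM)"
    unfolding pairing_QQ using QQ_integrable il by simp
  moreover have "\<bar>\<integral>s. QQ s - ?T * lead s \<partial>CM\<bar> \<le> (\<integral>s. \<bar>QQ s - ?T * lead s\<bar> \<partial>CM)"
    by (rule integral_abs_bound)
  ultimately show ?thesis by linarith
qed

end

section \<open>The product of two potentials of the curve\<close>

context curve
begin

definition kk :: "real \<Rightarrow> real \<Rightarrow> real \<Rightarrow> ennreal" where
  "kk e a u = (if u \<le> L then ennreal (max e u powr -a) else 0)"

lemma kk_meas[measurable]: "kk e a \<in> borel_measurable borel"
  unfolding kk_def[abs_def] by measurable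

definition AA :: "real \<Rightarrow> real \<Rightarrow> real^3 \<Rightarrow> ennreal" where "AA e a x = (\<integral>\<^sup>+t. kk e a (norm (x - \<gamma> t)) \<partial>CM)"

lemma AA_meas[measurable]: "AA e a \<in> borel_measurable borel"
  unfolding AA_def[abs_def] by measurable

text \<open>In the product of the two kernels the less singular factor is traded for the more singular one.\<close>

lemma AA_product:
  assumes e: "0 < e" "e \<le> L"
  shows "(\<integral>\<^sup>+x. AA e 1 x * AA e 2 x \<partial>lborel) \<le> ennreal (2000 * K * L\<^sup>2)"
proof -
  \<comment> \<open>\<open>F\<close> takes over when the point carrying exponent two is the closer
    one to \<open>x\<close>, \<open>G\<close> when it is the farther one. In either case the farther
    point is integrated along the curve first, which leaves the exponents \<open>5/2\<close> and
    \<open>2\<close> at the closer point, both below the dimension three.\<close>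
  define F where "F u v = (if u \<le> L then ennreal (sqrt L * max e u powr -2) * ennreal (max (max e u) v powr -(3/2)) else 0)" for u v
  define G where "G v u = (if v \<le> L then ennreal (max e v powr -1) * ennreal (max (max e v) u powr -2) else 0)" for v u
  have [measurable]: "(\<lambda>(u, v). F u v) \<in> borel_measurable (borel \<Otimes>\<^sub>M borel)" "(\<lambda>(u, v). G u v) \<in> borel_measurable (borel \<Otimes>\<^sub>M borel)"
    unfolding F_def G_def by measurable
  interpret P: pair_sigma_finite CM CM
    by (intro pair_sigma_finite.intro PM.sigma_finite_measure_axioms)
  let ?H1 = "\<lambda>u. if u \<le> L then ennreal (45 * K * sqrt L * max e u powr -(5/2)) else 0"
  let ?H2 = "\<lambda>u. if u \<le> L then ennreal (30 * K * max e u powr -2) else 0"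
  have split: "kk e 1 v * kk e 2 u \<le> F u v + G v u" for u v
  proof (cases "u \<le> L \<and> v \<le> L")
    case True
    define p q where "p = max e u" and "q = max e v"
    have pq: "0 < p" "0 < q" "p \<le> L" "q \<le> L" using e True by (auto simp: p_def q_def)
    have kq: "kk e 1 v * kk e 2 u = ennreal (q powr -1 * p powr -2)" unfolding kk_def p_def q_def using True by (subst ennreal_mult) simp_all
    show ?thesis
    proof (cases "p \<le> q")
      case True
      then have m: "max p v = q" using pq unfolding p_def q_def by auto
      \<comment> \<open>Exponent one is critical along a curve and would produce a logarithm. Since
        \<open>q \<le> L\<close>, half a power is exchanged for \<open>sqrt L\<close>, and
        \<open>3/2\<close> converges at infinity.\<close>
      have "q powr -1 = q powr (1/2) * q powr -(3/2)" by (simp flip: powr_add)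
      also have "\<dots> \<le> L powr (1/2) * q powr -(3/2)" using pq by (intro mult_right_mono powr_mono2) auto
      finally have "q powr -1 * p powr -2 \<le> sqrt L * p powr -2 * q powr -(3/2)"
        using pq mult_right_mono[of "q powr -1" "sqrt L * q powr -(3/2)" "p powr -2"] by (simp add: powr_half_sqrt mult_ac)
      then have "ennreal (q powr -1 * p powr -2) \<le> ennreal (sqrt L * p powr -2) * ennreal (q powr -(3/2))"
        using L by (subst ennreal_mult[symmetric]) (auto intro: ennreal_leI)
      also have "\<dots> = F u v" using \<open>u \<le> L \<and> v \<le> L\<close> m by (simp add: F_def p_def)
      finally show ?thesis unfolding kq by (simp add: add_increasing2)
    next
      case False
      then have m: "max q u = p" using pq unfolding p_def q_def by auto
      have "ennreal (q powr -1 * p powr -2) = G v u" using \<open>u \<le> L \<and> v \<le> L\<close> m by (simp add: G_def q_def ennreal_mult[symmetric])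
      then show ?thesis unfolding kq by (simp add: add_increasing)
    qed
  qed (auto simp: kk_def)
  have Fs: "(\<integral>\<^sup>+s. F u (norm (x - \<gamma> s)) \<partial>CM) \<le> ?H1 u" for u x
  proof (cases "u \<le> L")
    case True
    define p where "p = max e u"
    have p: "0 < p" using e by (simp add: p_def)
    have "(\<integral>\<^sup>+s. F u (norm (x - \<gamma> s)) \<partial>CM) = ennreal (sqrt L * p powr -2) * (\<integral>\<^sup>+s. ennreal (max p (norm (x - \<gamma> s)) powr -(3/2)) \<partial>CM)"
      unfolding F_def p_def using True by (simp add: nn_integral_cmult)
    also have "\<dots> \<le> ennreal (sqrt L * p powr -2) * ennreal (15 * K * (p powr (1 - 3/2) * (3/2) / (3/2 - 1)))"
      by (intro mult_left_mono CM_max_powr_le p) auto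
    also have "\<dots> = ennreal (45 * K * sqrt L * (p powr -2 * p powr -(1/2)))"
      using L K by (subst ennreal_mult[symmetric]) (auto simp: mult_ac)
    also have "p powr -2 * p powr -(1/2) = p powr -(5/2)" by (simp flip: powr_add)
    finally show ?thesis using True by (simp add: p_def)
  qed (simp add: F_def)
  have Gs: "(\<integral>\<^sup>+t. G v (norm (x - \<gamma> t)) \<partial>CM) \<le> ?H2 v" for v x
  proof (cases "v \<le> L")
    case True
    define q where "q = max e v"
    have q: "0 < q" using e by (simp add: q_def)
    have "(\<integral>\<^sup>+t. G v (norm (x - \<gamma> t)) \<partial>CM) = ennreal (q powr -1) * (\<integral>\<^sup>+t. ennreal (max q (norm (x - \<gamma> t)) powr -2) \<partial>CM)"
      unfolding G_def q_def using True by (simp add: nn_integral_cmult)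
    also have "\<dots> \<le> ennreal (q powr -1) * ennreal (15 * K * (q powr (1 - 2) * 2 / (2 - 1)))"
      by (intro mult_left_mono CM_max_powr_le q) auto
    also have "\<dots> = ennreal (30 * K * (q powr -1 * q powr -1))"
      using L K by (subst ennreal_mult[symmetric]) (auto simp: mult_ac)
    also have "q powr -1 * q powr -1 = q powr -2" unfolding powr_add[symmetric] by simp
    finally show ?thesis using True by (simp add: q_def)
  qed (simp add: G_def)
  have pw: "AA e 1 x * AA e 2 x \<le> (\<integral>\<^sup>+t. ?H1 (norm (x - \<gamma> t)) \<partial>CM) + (\<integral>\<^sup>+s. ?H2 (norm (x - \<gamma> s)) \<partial>CM)" for x
  proof -
    let ?d = "\<lambda>t. norm (x - \<gamma> t)"
    have "AA e 1 x * AA e 2 x = (\<integral>\<^sup>+s. kk e 1 (?d s) * AA e 2 x \<partial>CM)"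
      unfolding AA_def[of e 1] by (rule nn_integral_multc[symmetric]) measurable
    also have "\<dots> = (\<integral>\<^sup>+s. (\<integral>\<^sup>+t. kk e 1 (?d s) * kk e 2 (?d t) \<partial>CM) \<partial>CM)"
      unfolding AA_def by (intro nn_integral_cong nn_integral_cmult[symmetric]) measurable
    also have "\<dots> \<le> (\<integral>\<^sup>+s. (\<integral>\<^sup>+t. F (?d t) (?d s) + G (?d s) (?d t) \<partial>CM) \<partial>CM)" by (intro nn_integral_mono split)
    also have "\<dots> = (\<integral>\<^sup>+s. (\<integral>\<^sup>+t. F (?d t) (?d s) \<partial>CM) + (\<integral>\<^sup>+t. G (?d s) (?d t) \<partial>CM) \<partial>CM)"
      by (intro nn_integral_cong nn_integral_add) measurable
    also have "\<dots> = (\<integral>\<^sup>+s. (\<integral>\<^sup>+t. F (?d t) (?d s) \<partial>CM) \<partial>CM) + (\<integral>\<^sup>+s. (\<integral>\<^sup>+t. G (?d s) (?d t) \<partial>CM) \<partial>CM)"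
      by (rule nn_integral_add) measurable
    also have "(\<integral>\<^sup>+s. (\<integral>\<^sup>+t. F (?d t) (?d s) \<partial>CM) \<partial>CM) = (\<integral>\<^sup>+t. (\<integral>\<^sup>+s. F (?d t) (?d s) \<partial>CM) \<partial>CM)"
      by (rule P.Fubini'[symmetric]) measurable
    also have "\<dots> \<le> (\<integral>\<^sup>+t. ?H1 (?d t) \<partial>CM)" by (intro nn_integral_mono Fs)
    also have "(\<integral>\<^sup>+s. (\<integral>\<^sup>+t. G (?d s) (?d t) \<partial>CM) \<partial>CM) \<le> (\<integral>\<^sup>+s. ?H2 (?d s) \<partial>CM)" by (intro nn_integral_mono Gs)
    finally show ?thesis by (simp add: add_mono)
  qed
  have "(\<integral>\<^sup>+x. AA e 1 x * AA e 2 x \<partial>lborel) \<le> (\<integral>\<^sup>+x. (\<integral>\<^sup>+t. ?H1 (norm (x - \<gamma> t)) \<partial>CM) + (\<integral>\<^sup>+s. ?H2 (norm (x - \<gamma> s)) \<partial>CM) \<partial>lborel)"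
    by (intro nn_integral_mono pw)
  also have "\<dots> = (\<integral>\<^sup>+x. (\<integral>\<^sup>+t. ?H1 (norm (x - \<gamma> t)) \<partial>CM) \<partial>lborel) + (\<integral>\<^sup>+x. (\<integral>\<^sup>+s. ?H2 (norm (x - \<gamma> s)) \<partial>CM) \<partial>lborel)"
    by (rule nn_integral_add) measurable
  also have "\<dots> \<le> ennreal (45 * K * sqrt L * (4 * pi * L powr (3 - 5/2) / (3 - 5/2)) * L) + ennreal (30 * K * (4 * pi * L powr (3 - 2) / (3 - 2)) * L)"
    using K L e by (intro add_mono nn_tube) auto
  also have "\<dots> = ennreal (480 * pi * (K * L\<^sup>2))"
  proof -
    have eq1: "45 * K * sqrt L * (4 * pi * L powr (3 - 5/2) / (3 - 5/2)) * L = 360 * pi * (K * L\<^sup>2)"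
      using L by (simp add: powr_half_sqrt power2_eq_square)
    have eq2: "30 * K * (4 * pi * L powr (3 - 2) / (3 - 2)) * L = 120 * pi * (K * L\<^sup>2)"
      using L by (simp add: power2_eq_square)
    show ?thesis unfolding eq1 eq2 using K by (subst ennreal_plus[symmetric]) auto
  qed
  also have "\<dots> \<le> ennreal (2000 * K * L\<^sup>2)"
  proof (rule ennreal_leI)
    have "480 * pi * (K * L\<^sup>2) \<le> 2000 * (K * L\<^sup>2)" using K pi_less_4 by (intro mult_right_mono) auto
    then show "480 * pi * (K * L\<^sup>2) \<le> 2000 * K * L\<^sup>2" by simp
  qed
  finally show ?thesis .
qed

end

section \<open>Energy and stress of the velocity field\<close>

locale tensor_field = curve +
  fixes e :: real and S :: "real^3 \<Rightarrow> real^3^3" and m \<Lambda> :: real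
  assumes e: "0 < e" "e \<le> L" and S_bound: "\<And>x. norm (S x) \<le> m" and S_lip: "\<And>x y. norm (S x - S y) \<le> \<Lambda> * norm (x - y)"
    and \<Lambda>: "0 \<le> \<Lambda>"
begin

lemma S_cont: "continuous_on UNIV S"
proof (rule lipschitz_on_continuous_on[of \<Lambda>], rule lipschitz_onI)
  show "dist (S x) (S y) \<le> \<Lambda> * dist x y" for x y using S_lip[of x y] by (simp add: dist_norm)
qed (rule \<Lambda>)

lemma S_meas[measurable]: "S \<in> borel_measurable borel"
  by (rule borel_measurable_continuous_onI[OF S_cont])

sublocale T: tensor_curve L \<gamma> \<tau> K \<rho> e "\<lambda>s. S (\<gamma> s)" m
  by unfold_locales (use e S_bound in auto)

text \<open>The commutator of multiplication by \<open>S\<close> with convolution along the curve: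
  the difference between taking the tensor at \<open>x\<close> and at the source point.\<close>

definition DD :: "real^3 \<Rightarrow> real^3" where "DD x = S x *v T.vref x - T.VV x"

lemma K1_hg_bound: "\<bar>K1 (hg1 e L) k x\<bar> \<le> (if norm x \<le> L then 12 * max e (norm x) powr -2 else 0)"
proof (cases "norm x \<le> L")
  case True
  have "\<bar>K1 (hg1 e L) k x\<bar> \<le> (\<Sum>i\<in>UNIV. \<bar>D3 e L i i k x\<bar>)" unfolding D3_trace[symmetric] by (rule sum_abs)
  also have "\<dots> \<le> (\<Sum>i\<in>(UNIV::3 set). 4 * max e (norm x) powr -2)" by (intro sum_mono D3_bound e)
  finally show ?thesis using True by simp
next
  case False
  then have "L\<^sup>2 \<le> x \<bullet> x" using L unfolding power2_norm_eq_inner[symmetric] by (intro power_mono) auto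
  then show ?thesis using False by (simp add: K1_def pp_zero(4)[OF e])
qed

lemma K1_sum_bound:
  fixes w :: "3 \<Rightarrow> real \<Rightarrow> real^3" and x :: "real^3"
  assumes w: "\<And>k. w k \<in> borel_measurable borel" "\<And>k s. norm (w k s) \<le> B"
    and h: "\<And>k s. norm (x - \<gamma> s) \<le> L \<Longrightarrow> max e (norm (x - \<gamma> s)) powr -2 * norm (w k s) \<le> c * max e (norm (x - \<gamma> s)) powr -a"
    and c: "0 \<le> c"
  shows "ennreal (norm (\<Sum>k\<in>UNIV. conv CM \<gamma> (K1 (hg1 e L) k) (w k) x)) \<le> ennreal (36 * c) * AA e a x"
proof -
  have k: "ennreal (norm (conv CM \<gamma> (K1 (hg1 e L) k) (w k) x)) \<le> ennreal (12 * c) * AA e a x" for k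
  proof -
    have "ennreal (norm (conv CM \<gamma> (K1 (hg1 e L) k) (w k) x)) \<le> (\<integral>\<^sup>+s. norm (K1 (hg1 e L) k (x - \<gamma> s) *\<^sub>R w k s) \<partial>CM)"
      unfolding conv_def by (rule integral_norm_bound_ennreal[OF conv_int(1)[OF C1c_hg[OF e] w]])
    also have "\<dots> \<le> (\<integral>\<^sup>+s. ennreal (12 * c) * kk e a (norm (x - \<gamma> s)) \<partial>CM)"
    proof (rule nn_integral_mono)
      fix s
      have "norm (K1 (hg1 e L) k (x - \<gamma> s) *\<^sub>R w k s) \<le> (if norm (x - \<gamma> s) \<le> L then 12 * max e (norm (x - \<gamma> s)) powr -2 else 0) * norm (w k s)"
        unfolding norm_scaleR real_norm_def by (intro mult_right_mono K1_hg_bound) auto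
      also have "\<dots> \<le> (if norm (x - \<gamma> s) \<le> L then 12 * c * max e (norm (x - \<gamma> s)) powr -a else 0)"
        using h[of s k] by simp
      finally have "ennreal (norm (K1 (hg1 e L) k (x - \<gamma> s) *\<^sub>R w k s)) \<le> ennreal (if norm (x - \<gamma> s) \<le> L then 12 * c * max e (norm (x - \<gamma> s)) powr -a else 0)"
        by (rule ennreal_leI)
      also have "\<dots> = ennreal (12 * c) * kk e a (norm (x - \<gamma> s))" using c by (simp add: kk_def ennreal_mult)
      finally show "ennreal (norm (K1 (hg1 e L) k (x - \<gamma> s) *\<^sub>R w k s)) \<le> ennreal (12 * c) * kk e a (norm (x - \<gamma> s))" .
    qed
    also have "\<dots> = ennreal (12 * c) * AA e a x" unfolding AA_def by (rule nn_integral_cmult) measurable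
    finally show ?thesis .
  qed
  have "ennreal (norm (\<Sum>k\<in>UNIV. conv CM \<gamma> (K1 (hg1 e L) k) (w k) x)) \<le> ennreal (\<Sum>k\<in>UNIV. norm (conv CM \<gamma> (K1 (hg1 e L) k) (w k) x))"
    by (intro ennreal_leI norm_sum)
  also have "\<dots> = (\<Sum>k\<in>UNIV. ennreal (norm (conv CM \<gamma> (K1 (hg1 e L) k) (w k) x)))" by (rule sum_ennreal[symmetric]) simp
  also have "\<dots> \<le> (\<Sum>k\<in>(UNIV::3 set). ennreal (12 * c) * AA e a x)" by (intro sum_mono k)
  also have "\<dots> = ennreal (3 * (12 * c)) * AA e a x" using c by (simp add: ennreal_mult mult.assoc)
  also have "3 * (12 * c) = 36 * c" by simp
  finally show ?thesis .
qed

lemma vref_bound: "ennreal (norm (T.vref x)) \<le> ennreal 36 * AA e 2 x"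
proof -
  have "ennreal (norm (\<Sum>k\<in>UNIV. conv CM \<gamma> (K1 (hg1 e L) k) (\<lambda>s. cross3 (axis k 1) (\<tau> s)) x)) \<le> ennreal (36 * 1) * AA e 2 x"
    using cross_axis_\<tau>(2) by (intro K1_sum_bound[where B=1] cross_axis_\<tau>) (auto intro!: mult_left_le)
  then show ?thesis by (simp add: T.vref_def vfield_def)
qed

lemma DD_conv: "DD x = (\<Sum>k\<in>UNIV. conv CM \<gamma> (K1 (hg1 e L) k) (\<lambda>s. (S x - S (\<gamma> s)) *v cross3 (axis k 1) (\<tau> s)) x)"
proof -
  have bl: "bounded_linear ((*v) (S x))" by (rule matrix_vector_mul_bounded_linear)
  have i: "integrable CM (\<lambda>s. K1 (hg1 e L) k (x - \<gamma> s) *\<^sub>R cross3 (axis k 1) (\<tau> s))" for k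
    by (rule conv_int(1)[OF C1c_hg[OF e] cross_axis_\<tau>])
  have j: "integrable CM (\<lambda>s. K1 (hg1 e L) k (x - \<gamma> s) *\<^sub>R T.cw k s)" for k
    by (rule conv_int(1)[OF C1c_hg[OF e] T.cw_meas T.cw_bound])
  have "S x *v conv CM \<gamma> (K1 (hg1 e L) k) (\<lambda>s. cross3 (axis k 1) (\<tau> s)) x - conv CM \<gamma> (K1 (hg1 e L) k) (T.cw k) x
    = conv CM \<gamma> (K1 (hg1 e L) k) (\<lambda>s. (S x - S (\<gamma> s)) *v cross3 (axis k 1) (\<tau> s)) x" for k
  proof -
    have "S x *v conv CM \<gamma> (K1 (hg1 e L) k) (\<lambda>s. cross3 (axis k 1) (\<tau> s)) x = (\<integral>s. S x *v (K1 (hg1 e L) k (x - \<gamma> s) *\<^sub>R cross3 (axis k 1) (\<tau> s)) \<partial>CM)"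
      unfolding conv_def by (rule integral_bounded_linear[OF bl i, symmetric])
    moreover have "integrable CM (\<lambda>s. S x *v (K1 (hg1 e L) k (x - \<gamma> s) *\<^sub>R cross3 (axis k 1) (\<tau> s)))"
      by (rule integrable_bounded_linear[OF bl i])
    ultimately show ?thesis using j
      by (simp add: conv_def T.cw_def matrix_vector_mult_diff_rdistrib scaleR_matrix_vector_assoc[symmetric] matrix_vector_mult_scaleR scaleR_diff_right flip: Bochner_Integration.integral_diff)
  qed
  then show ?thesis
    by (simp add: DD_def T.vref_def vfield_def T.VV_conv sum_subtractf[symmetric] linear_sum[OF bounded_linear.linear[OF bl]])
qed

lemma DD_w:
  "(\<lambda>s. (S x - S (\<gamma> s)) *v cross3 (axis k 1) (\<tau> s)) \<in> borel_measurable borel"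
  "norm ((S x - S (\<gamma> s)) *v cross3 (axis k 1) (\<tau> s)) \<le> norm (S x - S (\<gamma> s))"
proof -
  show "(\<lambda>s. (S x - S (\<gamma> s)) *v cross3 (axis k 1) (\<tau> s)) \<in> borel_measurable borel" by measurable
  have "norm ((S x - S (\<gamma> s)) *v cross3 (axis k 1) (\<tau> s)) \<le> norm (S x - S (\<gamma> s)) * norm (cross3 (axis k 1) (\<tau> s))" by (rule norm_matrix_vector_le)
  also have "\<dots> \<le> norm (S x - S (\<gamma> s)) * 1" by (intro mult_left_mono cross_axis_\<tau>) auto
  finally show "norm ((S x - S (\<gamma> s)) *v cross3 (axis k 1) (\<tau> s)) \<le> norm (S x - S (\<gamma> s))" by simp
qed

lemma S_diff: "norm (S x - S y) \<le> 2 * m"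
  using norm_triangle_ineq4[of "S x" "S y"] S_bound[of x] S_bound[of y] by linarith

text \<open>The first bound uses only the size of \<open>S\<close>. The second lets \<open>norm (S x
  - S (\<gamma> s)) \<le> \<Lambda> * norm (x - \<gamma> s)\<close> cancel one power of the kernel.
  Neither alone is enough for the square of \<open>DD\<close>; using one for each factor yields
  \<open>AA e 1 x * AA e 2 x\<close>, whose integral has no logarithm.\<close>

lemma DD_bound: "ennreal (norm (DD x)) \<le> ennreal (72 * m) * AA e 2 x" "ennreal (norm (DD x)) \<le> ennreal (36 * \<Lambda>) * AA e 1 x"
proof -
  have 1: "norm ((S x - S (\<gamma> s)) *v cross3 (axis k 1) (\<tau> s)) \<le> 2 * m" for k s
    using DD_w(2)[of x s k] S_diff[of x "\<gamma> s"] by linarith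
  have "ennreal (norm (DD x)) \<le> ennreal (36 * (2 * m)) * AA e 2 x"
    unfolding DD_conv using 1 T.m_nonneg by (intro K1_sum_bound[where B="2 * m"] DD_w) (auto simp: mult.commute[of "2 * m"] intro!: mult_left_mono)
  then show "ennreal (norm (DD x)) \<le> ennreal (72 * m) * AA e 2 x" by simp
  show "ennreal (norm (DD x)) \<le> ennreal (36 * \<Lambda>) * AA e 1 x"
    unfolding DD_conv
  proof (rule K1_sum_bound[where B="2 * m", OF DD_w(1) 1 _ \<Lambda>])
    fix k s
    define q where "q = max e (norm (x - \<gamma> s))"
    have q: "0 < q" using e by (simp add: q_def)
    have "norm ((S x - S (\<gamma> s)) *v cross3 (axis k 1) (\<tau> s)) \<le> \<Lambda> * norm (x - \<gamma> s)"
      using DD_w(2)[of x s k] S_lip[of x "\<gamma> s"] by linarith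
    also have "\<dots> \<le> \<Lambda> * q" using \<Lambda> by (intro mult_left_mono) (auto simp: q_def)
    finally have "q powr -2 * norm ((S x - S (\<gamma> s)) *v cross3 (axis k 1) (\<tau> s)) \<le> q powr -2 * (\<Lambda> * q)" by (intro mult_left_mono) auto
    also have "\<dots> = \<Lambda> * (q powr -2 * q powr 1)" using q by simp
    also have "q powr -2 * q powr 1 = q powr -1" unfolding powr_add[symmetric] by simp
    finally show "max e (norm (x - \<gamma> s)) powr -2 * norm ((S x - S (\<gamma> s)) *v cross3 (axis k 1) (\<tau> s)) \<le> \<Lambda> * max e (norm (x - \<gamma> s)) powr -1"
      unfolding q_def .
  qed
qed

lemma DD_meas[measurable]: "DD \<in> borel_measurable borel"
  using C1c_measurable[OF T.vref_C1c] C1c_measurable[OF T.VV_C1c] unfolding DD_def[abs_def] by measurable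

lemma product_est:
  assumes f: "integrable lborel f" "\<And>x. f x \<le> p x * q x" and p: "\<And>x::real^3. 0 \<le> p x" "\<And>x. ennreal (p x) \<le> ennreal c * AA e 1 x"
    and q: "\<And>x. 0 \<le> q x" "\<And>x. ennreal (q x) \<le> ennreal d * AA e 2 x" and cd: "0 \<le> c" "0 \<le> d"
  shows "(LBINT x. f x) \<le> c * d * (2000 * K * L\<^sup>2)"
proof (rule integral_le_nn[OF f(1)])
  have "ennreal (f x) \<le> ennreal (c * d) * (AA e 1 x * AA e 2 x)" for x
  proof -
    have "ennreal (f x) \<le> ennreal (p x * q x)" by (intro ennreal_leI f)
    also have "\<dots> = ennreal (p x) * ennreal (q x)" using p q by (intro ennreal_mult) auto
    also have "\<dots> \<le> (ennreal c * AA e 1 x) * (ennreal d * AA e 2 x)" by (intro mult_mono p q) auto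
    also have "\<dots> = ennreal (c * d) * (AA e 1 x * AA e 2 x)" using cd by (simp add: ennreal_mult mult_ac)
    finally show ?thesis .
  qed
  then show "AE x in lborel. ennreal (f x) \<le> ennreal (c * d) * (AA e 1 x * AA e 2 x)" by simp
  have "(\<integral>\<^sup>+x. ennreal (c * d) * (AA e 1 x * AA e 2 x) \<partial>lborel) = ennreal (c * d) * (\<integral>\<^sup>+x. AA e 1 x * AA e 2 x \<partial>lborel)"
    by (rule nn_integral_cmult) measurable
  also have "\<dots> \<le> ennreal (c * d) * ennreal (2000 * K * L\<^sup>2)" by (intro mult_left_mono AA_product e) auto
  also have "\<dots> = ennreal (c * d * (2000 * K * L\<^sup>2))" using cd K by (intro ennreal_mult[symmetric]) auto
  finally show "(\<integral>\<^sup>+x. ennreal (c * d) * (AA e 1 x * AA e 2 x) \<partial>lborel) \<le> ennreal (c * d * (2000 * K * L\<^sup>2))" .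
qed (use cd K in auto)

end

context curve
begin

lemma norm_mat1: "norm (mat 1 :: real^3^3) \<le> 2"
proof -
  have "(mat 1 :: real^3^3) \<bullet> mat 1 = 3" by (simp add: inner_vec_def sum_3 mat_def)
  then have "norm (mat 1 :: real^3^3) = sqrt 3" by (simp add: norm_eq_sqrt_inner)
  also have "\<dots> \<le> sqrt 4" by (rule real_sqrt_le_mono) simp
  finally show ?thesis by simp
qed

text \<open>The energy of the difference is computed with the constant tensor \<open>mat 1\<close>,
  for which \<open>VV\<close> is the comparison field itself and \<open>lead\<close> equals
  \<open>2\<close>, the trace of the projection. The integrals of \<open>v \<bullet> u\<close> and
  of the squared norm of \<open>v\<close> are then both equal to \<open>- P\<close> up to errors of
  order \<open>K * L\<close>, and \<open>- P\<close> is the logarithmic main term.\<close>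

lemma defect_est:
  assumes e: "0 < e" "e \<le> L" and u: "u \<in> borel_measurable borel" "integrable lborel (\<lambda>x. (norm (u x))\<^sup>2)"
    and d: "weak_div_free u" and F: "flat_close e u"
  defines "v \<equiv> vfield (hg1 e L)"
  shows "(LBINT x. (norm (u x - v x))\<^sup>2) \<le> (LBINT x. (norm (u x))\<^sup>2) - 2 * L * ((ln L - ln e) / (4 * pi)) + 560000 * K\<^sup>2 * L"
proof -
  interpret I: tensor_curve L \<gamma> \<tau> K \<rho> e "\<lambda>_. mat 1" 2
    by unfold_locales (use e norm_mat1 in auto)
  have cw: "I.cw k = (\<lambda>s. cross3 (axis k 1) (\<tau> s))" for k by (simp add: I.cw_def fun_eq_iff)
  have VV: "I.VV = v" by (simp add: fun_eq_iff I.VV_conv v_def vfield_def cw)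
  have vr: "I.vref = v" by (simp add: v_def I.vref_def)
  have lead: "I.lead s = 2" for s
  proof -
    have "(\<Sum>i\<in>UNIV. \<tau> s $ i * \<tau> s $ i) = 1" using I.\<tau>_inner_self[of s] by (simp add: inner_vec_def)
    then show ?thesis unfolding I.lead_def by (simp add: inner_vec_def sum_3 mat_def tensor_def algebra_simps)
  qed
  note vC = I.vref_C1c[unfolded vr]
  note v = C1c_measurable[OF vC] C1c_sq_integrable[OF vC]
  note [measurable] = u(1) v(1)
  define P where "P = pairing I.ZZ"
  define T where "T = (ln L - ln e) / (4 * pi)"
  have iuv: "integrable lborel (\<lambda>x. v x \<bullet> u x)" by (rule L2_inner_integrable[OF u(1) v(1) u(2) v(2)])
  have sq: "(norm (u x - v x))\<^sup>2 = (norm (u x))\<^sup>2 - 2 * (v x \<bullet> u x) + (norm (v x))\<^sup>2" for x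
    by (simp add: power2_norm_eq_inner inner_diff_left inner_diff_right inner_commute)
  have 1: "(LBINT x. (norm (u x - v x))\<^sup>2) = (LBINT x. (norm (u x))\<^sup>2) - 2 * (LBINT x. v x \<bullet> u x) + (LBINT x. (norm (v x))\<^sup>2)"
    unfolding sq using u(2) v(2) iuv by simp
  have 2: "\<bar>(LBINT x. v x \<bullet> u x) + P\<bar> \<le> 6480 * (K * L)"
    using I.VV_u_est[OF u d F] by (simp add: VV P_def)
  have 3: "\<bar>(LBINT x. (norm (v x))\<^sup>2) + P\<bar> \<le> 2000000 * (K * L)"
    using I.VV_vref_est by (simp add: VV vr P_def power2_norm_eq_inner)
  have 4: "\<bar>- P - 2 * (L * T)\<bar> \<le> 4400 * (K\<^sup>2 * L)"
    using I.pairing_est L by (simp add: lead P_def T_def measure_CM[unfolded space_CM] mult_ac)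
  have 5: "K * L \<le> 3/11 * (K\<^sup>2 * L)"
  proof -
    have "K * 1 \<le> K * (3/11 * K)" using K by (intro mult_left_mono) auto
    then have "K \<le> 3/11 * K\<^sup>2" by (simp add: power2_eq_square)
    then have "K * L \<le> 3/11 * K\<^sup>2 * L" using L by (intro mult_right_mono) auto
    then show ?thesis by simp
  qed
  have 6: "0 \<le> K\<^sup>2 * L" using L by simp
  have fin: "I \<le> U - 2 * t + 560000 * p" if "I = U - 2 * b1 + b2" "\<bar>b1 + P'\<bar> \<le> 6480 * q" "\<bar>b2 + P'\<bar> \<le> 2000000 * q"
      "\<bar>- P' - 2 * t\<bar> \<le> 4400 * p" "q \<le> 3/11 * p" "0 \<le> p" for I U b1 b2 P' p q t :: real
    using that by (simp add: abs_le_iff)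
  show ?thesis using fin[OF 1 2 3 4 5 6] unfolding T_def[symmetric] by (simp add: mult.assoc)
qed

end

context tensor_field
begin

text \<open>With \<open>w = u - v\<close> and \<open>S v = VV + DD\<close>, the quadratic form in
  \<open>u\<close> is expanded so that \<open>VV\<close> is tested only with \<open>u\<close> and
  \<open>v\<close>, where the decomposition applies, never with \<open>w\<close>. The form in
  \<open>w\<close> is bounded by the defect, and \<open>DD\<close> is paired with \<open>w\<close>
  and \<open>v\<close>. The combination \<open>2 * VV \<bullet> u - VV \<bullet> v\<close>
  reproduces the pairing of \<open>ZZ\<close> with the curve exactly once.\<close>

lemma stress_est:
  assumes u: "u \<in> borel_measurable borel" "integrable lborel (\<lambda>x. (norm (u x))\<^sup>2)" and d: "weak_div_free u"
    and F: "flat_close e u" and m: "0 < m" and sym: "\<And>x. transpose (S x) = S x"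
  shows "\<bar>(LBINT x. (S x *v u x) \<bullet> u x) - (ln L - ln e) / (4 * pi) * (\<integral>s. T.lead s \<partial>CM)\<bar>
    \<le> 2 * m * ((LBINT x. (norm (u x))\<^sup>2) - 2 * L * ((ln L - ln e) / (4 * pi))) + 1400000 * m * K\<^sup>2 * L + 2200000 * \<Lambda> * K\<^sup>2 * L\<^sup>2"
proof -
  define v where "v = T.vref"
  define w where "w x = u x - v x" for x
  define P where "P = pairing T.ZZ"
  note vC = T.vref_C1c[folded v_def]
  note v = C1c_measurable[OF vC] C1c_sq_integrable[OF vC]
  note V = C1c_measurable[OF T.VV_C1c] C1c_sq_integrable[OF T.VV_C1c]
  note [measurable] = u(1) v(1) V(1)
  have w1[measurable]: "w \<in> borel_measurable borel" unfolding w_def[abs_def] by measurable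
  have w2: "integrable lborel (\<lambda>x. (norm (w x))\<^sup>2)"
  proof (rule Bochner_Integration.integrable_bound[where f="\<lambda>x. 2 * (norm (u x))\<^sup>2 + 2 * (norm (v x))\<^sup>2"])
    have "(norm (w x))\<^sup>2 \<le> 2 * (norm (u x))\<^sup>2 + 2 * (norm (v x))\<^sup>2" for x
    proof -
      have "(norm (w x))\<^sup>2 \<le> (norm (u x) + norm (v x))\<^sup>2" unfolding w_def by (intro power_mono norm_triangle_ineq4) auto
      also have "\<dots> \<le> 2 * (norm (u x))\<^sup>2 + 2 * (norm (v x))\<^sup>2" using sum_squares_bound[of "norm (u x)" "norm (v x)"] by (simp add: power2_sum)
      finally show ?thesis .
    qed
    then show "AE x in lborel. norm ((norm (w x))\<^sup>2) \<le> norm (2 * (norm (u x))\<^sup>2 + 2 * (norm (v x))\<^sup>2)" by simp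
  qed (use u(2) v(2) in simp_all)
  have Sf: "norm (S x *v f) \<le> m * norm f" for x f
    by (rule order_trans[OF norm_matrix_vector_le]) (intro mult_right_mono S_bound, simp)
  have SL: "(\<lambda>x. S x *v f x) \<in> borel_measurable borel" "integrable lborel (\<lambda>x. (norm (S x *v f x))\<^sup>2)"
    if f[measurable]: "f \<in> borel_measurable borel" and i: "integrable lborel (\<lambda>x. (norm (f x))\<^sup>2)" for f
  proof -
    show [measurable]: "(\<lambda>x. S x *v f x) \<in> borel_measurable borel" by measurable
    show "integrable lborel (\<lambda>x. (norm (S x *v f x))\<^sup>2)"
    proof (rule Bochner_Integration.integrable_bound[where f="\<lambda>x. m\<^sup>2 * (norm (f x))\<^sup>2"])
      have "(norm (S x *v f x))\<^sup>2 \<le> m\<^sup>2 * (norm (f x))\<^sup>2" for x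
        unfolding power_mult_distrib[symmetric] by (intro power_mono Sf) simp
      then show "AE x in lborel. norm ((norm (S x *v f x))\<^sup>2) \<le> norm (m\<^sup>2 * (norm (f x))\<^sup>2)" by (simp add: abs_mult)
    qed (use i in simp_all)
  qed
  have D2i: "integrable lborel (\<lambda>x. (norm (DD x))\<^sup>2)"
  proof (rule Bochner_Integration.integrable_bound[where f="\<lambda>x. 2 * (norm (S x *v v x))\<^sup>2 + 2 * (norm (T.VV x))\<^sup>2"])
    have "(norm (DD x))\<^sup>2 \<le> 2 * (norm (S x *v v x))\<^sup>2 + 2 * (norm (T.VV x))\<^sup>2" for x
    proof -
      have "(norm (DD x))\<^sup>2 \<le> (norm (S x *v v x) + norm (T.VV x))\<^sup>2" unfolding DD_def v_def by (intro power_mono norm_triangle_ineq4) auto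
      also have "\<dots> \<le> 2 * (norm (S x *v v x))\<^sup>2 + 2 * (norm (T.VV x))\<^sup>2" using sum_squares_bound[of "norm (S x *v v x)" "norm (T.VV x)"] by (simp add: power2_sum)
      finally show ?thesis .
    qed
    then show "AE x in lborel. norm ((norm (DD x))\<^sup>2) \<le> norm (2 * (norm (S x *v v x))\<^sup>2 + 2 * (norm (T.VV x))\<^sup>2)" by simp
  qed (use SL[OF v] V in simp_all)
  have iw: "integrable lborel (\<lambda>x. (S x *v w x) \<bullet> w x)" by (rule L2_inner_integrable[OF w1 SL(1)[OF w1 w2] w2 SL(2)[OF w1 w2]])
  have iVu: "integrable lborel (\<lambda>x. T.VV x \<bullet> u x)" by (rule L2_inner_integrable[OF u(1) V(1) u(2) V(2)])
  have iVv: "integrable lborel (\<lambda>x. T.VV x \<bullet> v x)" by (rule L2_inner_integrable[OF v(1) V(1) v(2) V(2)])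
  have iDw: "integrable lborel (\<lambda>x. DD x \<bullet> w x)" by (rule L2_inner_integrable[OF w1 DD_meas w2 D2i])
  have iDv: "integrable lborel (\<lambda>x. DD x \<bullet> v x)" by (rule L2_inner_integrable[OF v(1) DD_meas v(2) D2i])
  have dot: "(S x *v a) \<bullet> c = (S x *v c) \<bullet> a" for x a c
    using dot_lmul_matrix[of c "S x" a] sym[of x] by (metis inner_commute transpose_matrix_vector)
  have id: "(S x *v u x) \<bullet> u x = (S x *v w x) \<bullet> w x + 2 * (T.VV x \<bullet> u x) - T.VV x \<bullet> v x + 2 * (DD x \<bullet> w x) + DD x \<bullet> v x" for x
  proof -
    have Sv: "S x *v v x = T.VV x + DD x" by (simp add: DD_def v_def)
    have ux: "u x = w x + v x" by (simp add: w_def)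
    have "(S x *v u x) \<bullet> u x = (S x *v w x) \<bullet> w x + 2 * ((S x *v v x) \<bullet> w x) + (S x *v v x) \<bullet> v x"
      unfolding ux by (simp add: matrix_vector_right_distrib inner_add_left inner_add_right dot[of x "w x" "v x"])
    then show ?thesis unfolding Sv by (simp add: ux inner_add_left inner_add_right)
  qed
  have main: "(LBINT x. (S x *v u x) \<bullet> u x) = (LBINT x. (S x *v w x) \<bullet> w x) + 2 * (LBINT x. T.VV x \<bullet> u x) - (LBINT x. T.VV x \<bullet> v x)
    + 2 * (LBINT x. DD x \<bullet> w x) + (LBINT x. DD x \<bullet> v x)"
    unfolding id using iw iVu iVv iDw iDv by simp
  define W where "W = (LBINT x. (norm (w x))\<^sup>2)"
  have A: "\<bar>LBINT x. (S x *v w x) \<bullet> w x\<bar> \<le> m * W"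
  proof -
    have "norm (LBINT x. (S x *v w x) \<bullet> w x) \<le> (LBINT x. m * (norm (w x))\<^sup>2)"
    proof (rule integral_norm_bound_AE[OF iw])
      have "norm ((S x *v w x) \<bullet> w x) \<le> m * (norm (w x))\<^sup>2" for x
      proof -
        have "norm ((S x *v w x) \<bullet> w x) \<le> norm (S x *v w x) * norm (w x)" using Cauchy_Schwarz_ineq2 by simp
        also have "\<dots> \<le> m * norm (w x) * norm (w x)" by (intro mult_right_mono Sf) simp
        finally show ?thesis by (simp add: power2_eq_square mult.assoc)
      qed
      then show "AE x in lborel. norm ((S x *v w x) \<bullet> w x) \<le> m * (norm (w x))\<^sup>2" by simp
    qed (use w2 in simp)
    then show ?thesis by (simp add: W_def)
  qed
  have DDn: "(LBINT x. (norm (DD x))\<^sup>2) \<le> 36 * \<Lambda> * (72 * m) * (2000 * K * L\<^sup>2)"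
    by (rule product_est[OF D2i _ norm_ge_zero DD_bound(2) norm_ge_zero DD_bound(1)]) (use \<Lambda> m in \<open>auto simp: power2_eq_square\<close>)
  have half: "p \<le> r / 2" if "p \<le> q" "2 * q \<le> r" for p q r :: real using that by linarith
  \<comment> \<open>Young's inequality with weight \<open>m\<close>: it costs a second copy of
    \<open>m * W\<close>, whence the factor \<open>2 * m\<close> in the conclusion. The division by
    \<open>m\<close> cancels the factor \<open>m\<close> in the bound for the square of
    \<open>DD\<close>, so that the remaining error depends only on \<open>\<Lambda>\<close>.\<close>
  have B: "2 * \<bar>LBINT x. DD x \<bullet> w x\<bar> \<le> m * W + 5184000 * (\<Lambda> * K * L\<^sup>2)"
  proof -
    have "norm (LBINT x. DD x \<bullet> w x) \<le> (LBINT x. (m * (norm (w x))\<^sup>2 + (norm (DD x))\<^sup>2 / m) / 2)"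
    proof (rule integral_norm_bound_AE[OF iDw])
      have "norm (DD x \<bullet> w x) \<le> (m * (norm (w x))\<^sup>2 + (norm (DD x))\<^sup>2 / m) / 2" for x
      proof -
        have "norm (DD x \<bullet> w x) \<le> norm (DD x) * norm (w x)" using Cauchy_Schwarz_ineq2 by simp
        moreover have "2 * (norm (DD x) * norm (w x)) \<le> m * (norm (w x))\<^sup>2 + (norm (DD x))\<^sup>2 / m"
        proof -
          have "0 \<le> (m * norm (w x) - norm (DD x))\<^sup>2 / m" using m by simp
          also have "\<dots> = m * (norm (w x))\<^sup>2 + (norm (DD x))\<^sup>2 / m - 2 * (norm (DD x) * norm (w x))"
            using m by (simp add: power2_diff power_mult_distrib field_simps power2_eq_square)
          finally show ?thesis by simp
        qed
        ultimately show ?thesis by (rule half)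
      qed
      then show "AE x in lborel. norm (DD x \<bullet> w x) \<le> (m * (norm (w x))\<^sup>2 + (norm (DD x))\<^sup>2 / m) / 2" by simp
    qed (use w2 D2i in simp)
    also have "\<dots> = (m * W + (LBINT x. (norm (DD x))\<^sup>2) / m) / 2"
      using w2 D2i by (simp add: W_def)
    also have "(LBINT x. (norm (DD x))\<^sup>2) / m \<le> 36 * \<Lambda> * (72 * m) * (2000 * K * L\<^sup>2) / m"
      using DDn m by (intro divide_right_mono) auto
    also have "\<dots> = 5184000 * (\<Lambda> * K * L\<^sup>2)" using m by simp
    finally show ?thesis by simp
  qed
  have C: "\<bar>LBINT x. DD x \<bullet> v x\<bar> \<le> 2592000 * (\<Lambda> * K * L\<^sup>2)"
  proof -
    have "\<bar>LBINT x. DD x \<bullet> v x\<bar> \<le> (LBINT x. \<bar>DD x \<bullet> v x\<bar>)" by (rule integral_abs_bound)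
    also have "\<dots> \<le> 36 * \<Lambda> * 36 * (2000 * K * L\<^sup>2)"
      by (rule product_est[OF _ Cauchy_Schwarz_ineq2 norm_ge_zero DD_bound(2) norm_ge_zero vref_bound[folded v_def]]) (use iDv \<Lambda> in auto)
    finally show ?thesis by simp
  qed
  have W: "W \<le> (LBINT x. (norm (u x))\<^sup>2) - 2 * L * ((ln L - ln e) / (4 * pi)) + 560000 * K\<^sup>2 * L"
    using defect_est[OF e u d F] by (simp add: W_def w_def v_def T.vref_def)
  have Vu: "\<bar>(LBINT x. T.VV x \<bullet> u x) + P\<bar> \<le> 3240 * (m * K * L)"
    using T.VV_u_est[OF u d F m] by (simp add: P_def mult.assoc)
  have Vv: "\<bar>(LBINT x. T.VV x \<bullet> v x) + P\<bar> \<le> 1000000 * (m * K * L)"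
    using T.VV_vref_est by (simp add: P_def v_def mult.assoc)
  have PL: "\<bar>- P - (ln L - ln e) / (4 * pi) * (\<integral>s. T.lead s \<partial>CM)\<bar> \<le> 2200 * (m * K\<^sup>2 * L)"
    using T.pairing_est by (simp add: P_def mult.assoc)
  have K1: "K \<le> 3/11 * K\<^sup>2"
  proof -
    have "K * 1 \<le> K * (3/11 * K)" using K by (intro mult_left_mono) auto
    then show ?thesis by (simp add: power2_eq_square)
  qed
  have k1: "m * K * L \<le> 3/11 * (m * K\<^sup>2 * L)"
    using mult_left_mono[OF K1, of "m * L"] m L by (simp add: mult_ac)
  have k2: "\<Lambda> * K * L\<^sup>2 \<le> 3/11 * (\<Lambda> * K\<^sup>2 * L\<^sup>2)"
    using mult_left_mono[OF K1, of "\<Lambda> * L\<^sup>2"] \<Lambda> by (simp add: mult_ac)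
  have W': "m * W \<le> m * ((LBINT x. (norm (u x))\<^sup>2) - 2 * L * ((ln L - ln e) / (4 * pi))) + 560000 * (m * K\<^sup>2 * L)"
    using mult_left_mono[OF W, of m] m by (simp add: algebra_simps)
  have pos: "0 \<le> m * K\<^sup>2 * L" "0 \<le> \<Lambda> * K\<^sup>2 * L\<^sup>2" using m L \<Lambda> by auto
  let ?X = "(LBINT x. (norm (u x))\<^sup>2) - 2 * L * ((ln L - ln e) / (4 * pi))"
  have fin: "\<bar>I - Tl\<bar> \<le> 2 * X + 1400000 * p + 2200000 * q"
    if "I = a + 2 * b1 - b2 + 2 * c + d" "\<bar>a\<bar> \<le> Wm" "2 * \<bar>c\<bar> \<le> Wm + 5184000 * q'" "\<bar>d\<bar> \<le> 2592000 * q'" "\<bar>b1 + P'\<bar> \<le> 3240 * p'" "\<bar>b2 + P'\<bar> \<le> 1000000 * p'"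
      "\<bar>- P' - Tl\<bar> \<le> 2200 * p" "p' \<le> 3/11 * p" "q' \<le> 3/11 * q" "Wm \<le> X + 560000 * p" "0 \<le> p" "0 \<le> q"
    for I Tl X p q p' q' a b1 b2 c d Wm P' :: real
    using that by (simp add: abs_le_iff) linarith
  show ?thesis
    using fin[OF main A B C Vu Vv PL k1 k2 W' pos] by (simp add: mult.assoc)
qed

end

section \<open>Continuous representatives of Sobolev functions\<close>

lemma AE_lebesgue_bound_continuous:
  fixes f :: "real^3 \<Rightarrow> 'b::euclidean_space"
  assumes f: "continuous_on UNIV f" and ae: "AE x in lebesgue. norm (f x) \<le> B"
  shows "norm (f x) \<le> B"
proof (rule ccontr)
  assume "\<not> norm (f x) \<le> B"
  define U where "U = {y. B < norm (f y)}"
  have U: "open U" unfolding U_def by (intro open_Collect_less continuous_intros f)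
  have "x \<in> U" using \<open>\<not> norm (f x) \<le> B\<close> by (simp add: U_def)
  then have "\<not> negligible U" using open_not_negligible[OF U] by auto
  moreover have "U \<in> null_sets lebesgue"
    by (rule AE_iff_null_sets[THEN iffD2]) (use U ae in \<open>auto simp: U_def not_less elim: eventually_mono\<close>)
  ultimately show False by (simp add: negligible_iff_null_sets)
qed

lemma Linf_norm_AE:
  fixes f :: "real^3 \<Rightarrow> 'b::real_normed_vector"
  assumes fin: "Linf_norm f < \<infinity>"
  shows "AE x in lebesgue. norm (f x) \<le> enn2real (Linf_norm f)"
proof -
  have "AE x in lebesgue. ennreal (norm (f x)) \<le> Linf_norm f" unfolding Linf_norm_def by (rule esssup_AE)
  then show ?thesis
    by eventually_elim (use fin enn2real_mono[of "ennreal (norm (f _))" "Linf_norm f"] in auto)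
qed

text \<open>Squaring the positive part makes the cutoff continuously differentiable. The mass is
  left unnormalised; the proof using it divides by the integral at the end.\<close>

definition bump :: "real \<Rightarrow> real \<Rightarrow> real" where "bump \<delta> y = (max 0 (\<delta>\<^sup>2 - y))\<^sup>2"
definition dbump :: "real \<Rightarrow> real \<Rightarrow> real" where "dbump \<delta> y = - 2 * max 0 (\<delta>\<^sup>2 - y)"

lemma DERIV_max_sq: "DERIV (\<lambda>t::real. (max 0 t)\<^sup>2) t :> 2 * max 0 t"
proof -
  have "DERIV (\<lambda>t::real. if t \<le> 0 then 0 else t\<^sup>2) t :> (if t \<le> 0 then 0 else 2 * t)"
    by (rule DERIV_glue) (auto intro!: derivative_eq_intros)
  moreover have "(\<lambda>t::real. if t \<le> 0 then 0 else t\<^sup>2) = (\<lambda>t. (max 0 t)\<^sup>2)" by (auto simp: fun_eq_iff max_def)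
  moreover have "(if t \<le> 0 then 0 else 2 * t) = 2 * max 0 t" by (simp add: max_def)
  ultimately show ?thesis by simp
qed

lemma bump_C1c:
  assumes "0 \<le> \<delta>"
  shows "C1c (\<lambda>x. bump \<delta> (x \<bullet> x)) (\<lambda>i. K1 (dbump \<delta>) i)"
proof (rule C1c_radial[where R=\<delta>])
  show "DERIV (bump \<delta>) y :> dbump \<delta> y" for y
  proof -
    have "DERIV (\<lambda>y. \<delta>\<^sup>2 - y) y :> -1" by (auto intro!: derivative_eq_intros)
    from DERIV_chain2[OF DERIV_max_sq this] show ?thesis by (simp add: bump_def[abs_def] dbump_def)
  qed
  show "continuous_on UNIV (dbump \<delta>)" unfolding dbump_def[abs_def] by (intro continuous_intros)
qed (use assms in \<open>auto simp: bump_def dbump_def\<close>)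

lemma bump_pos:
  assumes "0 < \<delta>"
  shows "0 < (LBINT x. bump \<delta> ((x::real^3) \<bullet> x))"
proof -
  note C = bump_C1c[of \<delta>]
  have i: "integrable lborel (\<lambda>x::real^3. bump \<delta> (x \<bullet> x))" using C1c_integrable[OF C] assms by simp
  have "0 \<le> (LBINT x. bump \<delta> ((x::real^3) \<bullet> x))" by (rule Bochner_Integration.integral_nonneg) (simp add: bump_def)
  moreover have "(LBINT x. bump \<delta> ((x::real^3) \<bullet> x)) \<noteq> 0"
  proof
    assume "(LBINT x. bump \<delta> ((x::real^3) \<bullet> x)) = 0"
    then have "AE x in lborel. bump \<delta> ((x::real^3) \<bullet> x) = 0"
      by (subst (asm) integral_nonneg_eq_0_iff_AE[OF i]) (auto simp: bump_def)
    then have "AE x in lebesgue. norm (bump \<delta> ((x::real^3) \<bullet> x)) \<le> 0" by (intro AE_completion) simp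
    then have "norm (bump \<delta> ((0::real^3) \<bullet> 0)) \<le> 0"
      by (rule AE_lebesgue_bound_continuous[OF C1c_cont[OF C], rotated]) (use assms in simp)
    then show False using assms by (simp add: bump_def)
  qed
  ultimately show ?thesis by linarith
qed

text \<open>The partial derivatives of a mollification are, by the weak derivative tested against
  reflected bumps, averages of the weak gradient, hence bounded by its essential supremum. As the
  mollification scale shrinks, the Lipschitz bound passes to the continuous function itself. The
  factor \<open>3\<close> comes from summing three partial derivatives.\<close>

lemma W1inf_lipschitz:
  fixes \<phi> :: "real^3 \<Rightarrow> 'b::euclidean_space"
  assumes W: "W1inf \<phi>" and c: "continuous_on UNIV \<phi>"
  shows "norm (\<phi> x - \<phi> y) \<le> 3 * enn2real (Linf_norm (weak_gradient \<phi>)) * norm (x - y)"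
proof -
  define G where "G = weak_gradient \<phi>"
  define g where "g = enn2real (Linf_norm G)"
  have wg: "has_weak_gradient \<phi> G" and fin: "Linf_norm G < \<infinity>" using W by (auto simp: W1inf_def G_def)
  have Gm: "G \<in> borel_measurable lebesgue" using wg by (simp add: has_weak_gradient_def locally_integrable_def)
  have Gk: "(\<lambda>x. G x $ k) \<in> borel_measurable lebesgue" for k
    by (rule borel_measurable_continuous_on[OF _ Gm]) (intro continuous_intros)
  have Gb: "AE x in lebesgue. norm (G x) \<le> g" unfolding g_def by (rule Linf_norm_AE[OF fin])
  have [measurable]: "\<phi> \<in> borel_measurable borel" by (rule borel_measurable_continuous_onI[OF c])
  have g0: "0 \<le> g" by (simp add: g_def)
  \<comment> \<open>The ball is large enough for integrability of \<open>\<phi>\<close> to be a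
    local matter: kernels of radius at most \<open>1\<close> centred in the ball of radius
    \<open>R - 1\<close>, which contains the segment from \<open>x\<close> to \<open>y\<close>, do
    not reach its boundary from outside.\<close>
  define R where "R = norm x + norm y + 2"
  define M where "M = restrict_space lborel (cball (0::real^3) R)"
  have fM: "finite_measure M"
    by (rule finite_measureI) (use emeasure_lborel_cball_finite[of "0::real^3" R] in \<open>simp add: M_def emeasure_restrict_space less_top\<close>)
  interpret M: finite_measure M by (rule fM)
  interpret PM: param_measure M "\<lambda>z. z" R
    by unfold_locales (auto simp: M_def intro: measurable_restrict_space1)
  have iM: "integrable M \<phi>"
  proof -
    have "integrable lborel (\<lambda>x. indicator (cball 0 R) x *\<^sub>R \<phi> x)"
      by (rule borel_integrable_compact) (auto intro: continuous_on_subset[OF c])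
    then show ?thesis unfolding M_def by (simp add: integrable_restrict_space)
  qed
  have toM: "(\<integral>z. f z \<partial>M) = (LBINT z. f z)" if "\<And>z. R < norm z \<Longrightarrow> f z = 0" for f :: "real^3 \<Rightarrow> 'b"
  proof -
    have "indicator (cball 0 R) z *\<^sub>R f z = f z" for z using that[of z] by (auto simp: indicator_def)
    then show ?thesis unfolding M_def by (simp add: integral_restrict_space)
  qed
  have key: "norm (\<phi> x - \<phi> y) \<le> 3 * g * norm (x - y) + 2 * h" if h: "h > 0" for h
  proof -
    obtain \<delta>1 where \<delta>1: "\<delta>1 > 0" "\<And>z. dist z x < \<delta>1 \<Longrightarrow> dist (\<phi> z) (\<phi> x) < h"
      using c h unfolding continuous_on_iff by (metis UNIV_I)
    obtain \<delta>2 where \<delta>2: "\<delta>2 > 0" "\<And>z. dist z y < \<delta>2 \<Longrightarrow> dist (\<phi> z) (\<phi> y) < h"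
      using c h unfolding continuous_on_iff by (metis UNIV_I)
    define \<delta> where "\<delta> = min 1 (min \<delta>1 \<delta>2) / 2"
    have \<delta>: "0 < \<delta>" "\<delta> \<le> 1" "\<delta> < \<delta>1" "\<delta> < \<delta>2" using \<delta>1(1) \<delta>2(1) by (auto simp: \<delta>_def)
    define \<eta> where "\<eta> z = bump \<delta> (z \<bullet> z)" for z :: "real^3"
    have C: "C1c \<eta> (\<lambda>i. K1 (dbump \<delta>) i)" unfolding \<eta>_def[abs_def] by (rule bump_C1c) (use \<delta> in simp)
    have \<eta>0: "0 \<le> \<eta> z" for z by (simp add: \<eta>_def bump_def)
    have out: "\<eta> z = 0" "K1 (dbump \<delta>) i z = 0" if "\<delta> \<le> norm z" for z i
    proof -
      have "\<delta>\<^sup>2 \<le> z \<bullet> z" unfolding power2_norm_eq_inner[symmetric] using that \<delta> by (intro power_mono) auto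
      then show "\<eta> z = 0" "K1 (dbump \<delta>) i z = 0" by (auto simp: \<eta>_def bump_def K1_def dbump_def)
    qed
    define I where "I = (LBINT z. \<eta> z)"
    have I: "0 < I" unfolding I_def \<eta>_def by (rule bump_pos[OF \<delta>(1)])
    have [measurable]: "\<eta> \<in> borel_measurable borel" by (rule C1c_measurable[OF C])
    have I': "(LBINT z. \<eta> (p - z)) = I" for p unfolding I_def by (rule lborel_integral_reflect) measurable
    have Cr: "C1c (\<lambda>z. \<eta> (p - z)) (\<lambda>i z. - K1 (dbump \<delta>) i (p - z))" for p by (rule C1c_reflect[OF C])
    have i\<eta>: "integrable lborel (\<lambda>z. \<eta> (p - z))" for p by (rule C1c_integrable[OF Cr])
    have i\<eta>': "integrable lebesgue (\<lambda>z. \<eta> (p - z))" "(\<integral>z. \<eta> (p - z) \<partial>lebesgue) = I" for p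
      using i\<eta>[of p] I'[of p] by (simp_all add: integrable_completion integral_completion)
    define N where "N = conv M (\<lambda>z. z) \<eta> \<phi>"
    have NC: "C1c N (\<lambda>i. conv M (\<lambda>z. z) (K1 (dbump \<delta>) i) \<phi>)" unfolding N_def by (rule PM.conv_C1c[OF C iM])
    have far: "\<delta> \<le> norm (p - z)" if "norm p \<le> R - 1" "R < norm z" for p z :: "real^3"
      using that \<delta> norm_triangle_ineq2[of z p] by (simp add: norm_minus_commute)
    have dN: "norm (conv M (\<lambda>z. z) (K1 (dbump \<delta>) i) \<phi> p) \<le> I * g" if p: "norm p \<le> R - 1" for p i
    proof -
      have "conv M (\<lambda>z. z) (K1 (dbump \<delta>) i) \<phi> p = (LBINT z. K1 (dbump \<delta>) i (p - z) *\<^sub>R \<phi> z)"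
        unfolding conv_def by (rule toM) (use out(2) far[OF p] in simp)
      also have "\<dots> = (\<integral>z. K1 (dbump \<delta>) i (p - z) *\<^sub>R \<phi> z \<partial>lebesgue)"
      proof (rule integral_completion[symmetric])
        have "continuous_on UNIV (\<lambda>z. - (- K1 (dbump \<delta>) i (p - z)) *\<^sub>R \<phi> z)"
          by (intro continuous_on_scaleR continuous_on_minus C1c_cont_d[OF Cr] c)
        then show "(\<lambda>z. K1 (dbump \<delta>) i (p - z) *\<^sub>R \<phi> z) \<in> borel_measurable lborel"
          by (simp add: borel_measurable_continuous_onI)
      qed
      also have "\<dots> = - (\<integral>z. partial_deriv i (\<lambda>z. \<eta> (p - z)) z *\<^sub>R \<phi> z \<partial>lebesgue)"
        by (simp add: C1c_partial_deriv[OF Cr])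
      also have "\<dots> = (\<integral>z. \<eta> (p - z) *\<^sub>R (G z $ i) \<partial>lebesgue)"
        using wg C1c_C1_compact[OF Cr, of p] unfolding has_weak_gradient_def by simp
      finally have eq: "conv M (\<lambda>z. z) (K1 (dbump \<delta>) i) \<phi> p = (\<integral>z. \<eta> (p - z) *\<^sub>R (G z $ i) \<partial>lebesgue)" .
      have ae: "AE z in lebesgue. norm (\<eta> (p - z) *\<^sub>R (G z $ i)) \<le> \<eta> (p - z) * g"
        using Gb
      proof eventually_elim
        fix z assume "norm (G z) \<le> g"
        then have "norm (G z $ i) \<le> g" using Finite_Cartesian_Product.norm_nth_le[of "G z" i] by linarith
        then show "norm (\<eta> (p - z) *\<^sub>R (G z $ i)) \<le> \<eta> (p - z) * g" using \<eta>0[of "p - z"] by (simp add: mult_left_mono)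
      qed
      have j: "integrable lebesgue (\<lambda>z. \<eta> (p - z) * g)" using i\<eta>'(1) by simp
      have "integrable lebesgue (\<lambda>z. \<eta> (p - z) *\<^sub>R (G z $ i))"
      proof (rule Bochner_Integration.integrable_bound[OF j])
        show "(\<lambda>z. \<eta> (p - z) *\<^sub>R (G z $ i)) \<in> borel_measurable lebesgue"
          by (intro borel_measurable_scaleR Gk borel_measurable_integrable[OF i\<eta>'(1)])
        show "AE z in lebesgue. norm (\<eta> (p - z) *\<^sub>R (G z $ i)) \<le> norm (\<eta> (p - z) * g)"
          using ae by eventually_elim (use \<eta>0 g0 in \<open>simp add: abs_mult\<close>)
      qed
      from integral_norm_bound_AE[OF this j ae] show ?thesis unfolding eq using i\<eta>'(2) by simp
    qed
    have lipN: "norm (N x - N y) \<le> 3 * (I * g) * norm (x - y)"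
    proof (rule differentiable_bound[of "cball 0 (R - 1)" N "\<lambda>p h. \<Sum>i\<in>UNIV. (h$i) *\<^sub>R conv M (\<lambda>z. z) (K1 (dbump \<delta>) i) \<phi> p"])
      show "onorm (\<lambda>h. \<Sum>i\<in>UNIV. (h$i) *\<^sub>R conv M (\<lambda>z. z) (K1 (dbump \<delta>) i) \<phi> p) \<le> 3 * (I * g)" if "p \<in> cball 0 (R - 1)" for p
        using dN[of p] that by (intro onorm_le norm_partials_le) auto
      show "(N has_derivative (\<lambda>h. \<Sum>i\<in>UNIV. (h$i) *\<^sub>R conv M (\<lambda>z. z) (K1 (dbump \<delta>) i) \<phi> p)) (at p within cball 0 (R - 1))" for p
        by (rule has_derivative_at_withinI[OF C1c_deriv[OF NC]])
    qed (auto simp: R_def)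
    have near: "norm (N p - I *\<^sub>R \<phi> p) \<le> I * h" if p: "norm p \<le> R - 1" and cp: "\<And>z. dist z p < \<delta> \<Longrightarrow> dist (\<phi> z) (\<phi> p) \<le> h" for p
    proof -
      have N: "N p = (LBINT z. \<eta> (p - z) *\<^sub>R \<phi> z)"
        unfolding N_def conv_def by (rule toM) (use out(1) far[OF p] in simp)
      have i1: "integrable lborel (\<lambda>z. \<eta> (p - z) *\<^sub>R \<phi> z)"
      proof (rule compact_supp_integrable[where R="R+1"])
        show "continuous_on UNIV (\<lambda>z. \<eta> (p - z) *\<^sub>R \<phi> z)" by (intro continuous_intros C1c_cont[OF Cr] c)
        show "\<eta> (p - z) *\<^sub>R \<phi> z = 0" if "R + 1 \<le> norm z" for z using out(1) far[OF p, of z] that by simp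
      qed
      have "N p - I *\<^sub>R \<phi> p = (LBINT z. \<eta> (p - z) *\<^sub>R \<phi> z - \<eta> (p - z) *\<^sub>R \<phi> p)"
        unfolding N using i1 i\<eta>[of p] I'[of p] by simp
      also have "norm \<dots> \<le> (LBINT z. \<eta> (p - z) * h)"
      proof (rule integral_norm_bound_AE)
        show "integrable lborel (\<lambda>z. \<eta> (p - z) *\<^sub>R \<phi> z - \<eta> (p - z) *\<^sub>R \<phi> p)" using i1 i\<eta>[of p] by simp
        show "integrable lborel (\<lambda>z. \<eta> (p - z) * h)" using i\<eta>[of p] by simp
        have "norm (\<eta> (p - z) *\<^sub>R \<phi> z - \<eta> (p - z) *\<^sub>R \<phi> p) \<le> \<eta> (p - z) * h" for z
        proof (cases "norm (p - z) < \<delta>")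
          case True
          then have "norm (\<phi> z - \<phi> p) \<le> h" using cp[of z] by (simp add: dist_norm norm_minus_commute)
          then show ?thesis using \<eta>0[of "p - z"] by (simp add: scaleR_diff_right[symmetric] mult_left_mono)
        qed (use out(1) in simp)
        then show "AE z in lborel. norm (\<eta> (p - z) *\<^sub>R \<phi> z - \<eta> (p - z) *\<^sub>R \<phi> p) \<le> \<eta> (p - z) * h" by simp
      qed
      also have "\<dots> = I * h" using I'[of p] by simp
      finally show ?thesis .
    qed
    have nx: "norm (N x - I *\<^sub>R \<phi> x) \<le> I * h" by (rule near) (use \<delta> in \<open>auto simp: R_def intro!: less_imp_le[OF \<delta>1(2)]\<close>)
    have ny: "norm (N y - I *\<^sub>R \<phi> y) \<le> I * h" by (rule near) (use \<delta> in \<open>auto simp: R_def intro!: less_imp_le[OF \<delta>2(2)]\<close>)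
    have "I * norm (\<phi> x - \<phi> y) = norm (I *\<^sub>R \<phi> x - I *\<^sub>R \<phi> y)" using I by (simp add: scaleR_diff_right[symmetric])
    also have "I *\<^sub>R \<phi> x - I *\<^sub>R \<phi> y = (N x - N y) + ((N y - I *\<^sub>R \<phi> y) - (N x - I *\<^sub>R \<phi> x))" by simp
    also have "norm \<dots> \<le> norm (N x - N y) + (norm (N y - I *\<^sub>R \<phi> y) + norm (N x - I *\<^sub>R \<phi> x))"
      by (rule order_trans[OF norm_triangle_ineq]) (intro add_left_mono norm_triangle_ineq4)
    also have "\<dots> \<le> 3 * (I * g) * norm (x - y) + (I * h + I * h)" by (intro add_mono lipN nx ny)
    also have "\<dots> = I * (3 * g * norm (x - y) + 2 * h)" by (simp add: algebra_simps)
    finally show ?thesis using I by simp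
  qed
  have "norm (\<phi> x - \<phi> y) \<le> 3 * g * norm (x - y)"
  proof (rule field_le_epsilon)
    show "norm (\<phi> x - \<phi> y) \<le> 3 * g * norm (x - y) + h" if "0 < h" for h using key[of "h/2"] that by simp
  qed
  then show ?thesis by (simp add: g_def G_def)
qed

section \<open>Measurability of the security radius\<close>

lemma AE_lborel_shift:
  fixes c :: real
  assumes "AE x in lborel. P x"
  shows "AE x in lborel. P (c + x)"
proof -
  have "AE x in distr lborel borel ((+) c). P x" unfolding lborel_distr_plus by (rule assms)
  then show ?thesis by (rule AE_distrD[rotated]) simp
qed

lemma AE_lborel_periodic:
  fixes L :: real
  assumes L: "0 < L" and P: "\<And>s. P (s + L) = P s" and ae: "AE s in lborel. s \<in> {0..<L} \<longrightarrow> P s"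
  shows "AE s in lborel. P s"
proof -
  have n: "P (s + of_nat n * L) = P s" for s n
  proof (induction n)
    case (Suc n)
    have "P (s + of_nat n * L + L) = P s" using P Suc by simp
    then show ?case by (simp add: algebra_simps)
  qed simp
  have z: "P (of_int k * L + s) = P s" for s k
  proof (cases "0 \<le> k")
    case True
    then show ?thesis using n[of s "nat k"] by (simp add: add.commute)
  next
    case False
    then show ?thesis using n[of "of_int k * L + s" "nat (- k)"] by (simp add: algebra_simps)
  qed
  have "AE s in lborel. \<forall>k::int. of_int k * L + s \<in> {0..<L} \<longrightarrow> P (of_int k * L + s)"
    unfolding AE_all_countable by (intro allI AE_lborel_shift ae)
  then show ?thesis
  proof eventually_elim
    fix s assume *: "\<forall>k::int. of_int k * L + s \<in> {0..<L} \<longrightarrow> P (of_int k * L + s)"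
    define k where "k = - \<lfloor>s / L\<rfloor>"
    have "of_int \<lfloor>s / L\<rfloor> * L \<le> s" "s < (of_int \<lfloor>s / L\<rfloor> + 1) * L"
      using of_int_floor_le[of "s / L"] floor_correct[of "s / L"] L
      by (simp_all only: pos_le_divide_eq pos_divide_less_eq of_int_add of_int_1)
    then have "of_int k * L + s \<in> {0..<L}" by (auto simp: k_def algebra_simps)
    then show "P s" using * z by blast
  qed
qed

lemma circle_abs_eq:
  assumes L: "0 < L" and h: "\<bar>h - of_int k * L\<bar> \<le> L / 2"
  shows "circle_abs L h = \<bar>h - of_int k * L\<bar>"
proof -
  have le: "\<bar>h - of_int k * L\<bar> \<le> \<bar>h - of_int j * L\<bar>" for j
  proof (cases "j = k")
    case False
    then have "1 \<le> \<bar>real_of_int (j - k)\<bar>" by linarith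
    then have "L \<le> \<bar>real_of_int (j - k) * L\<bar>" using L by (simp add: abs_mult)
    also have "real_of_int (j - k) * L = (h - of_int k * L) - (h - of_int j * L)" by (simp add: algebra_simps)
    finally show ?thesis using h by linarith
  qed simp
  have "infdist h (range (\<lambda>k::int. of_int k * L)) = (INF a\<in>range (\<lambda>k::int. of_int k * L). dist h a)"
    by (rule infdist_notempty) simp
  also have "\<dots> = \<bar>h - of_int k * L\<bar>"
  proof (rule antisym)
    show "(INF a\<in>range (\<lambda>k::int. of_int k * L). dist h a) \<le> \<bar>h - of_int k * L\<bar>"
      by (rule cINF_lower2[where x="of_int k * L"]) (auto simp: dist_real_def intro!: bdd_belowI[of _ 0])
    show "\<bar>h - of_int k * L\<bar> \<le> (INF a\<in>range (\<lambda>k::int. of_int k * L). dist h a)"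
      by (rule cINF_greatest) (use le in \<open>auto simp: dist_real_def\<close>)
  qed
  finally show ?thesis by (simp add: circle_abs_def)
qed

lemma circle_abs_small: "0 < L \<Longrightarrow> \<bar>h\<bar> \<le> L / 2 \<Longrightarrow> circle_abs L h = \<bar>h\<bar>"
  using circle_abs_eq[of L h 0] by simp

lemma circle_abs_reduce:
  assumes L: "0 < L"
  obtains k :: int where "\<bar>h - of_int k * L\<bar> \<le> L / 2" "circle_abs L h = \<bar>h - of_int k * L\<bar>"
proof -
  have "\<bar>of_int (round (h / L)) - h / L\<bar> \<le> 1 / 2" by (rule of_int_round_abs_le)
  then have "\<bar>h / L - of_int (round (h / L))\<bar> * L \<le> 1 / 2 * L" using L by (intro mult_right_mono) (auto simp: abs_minus_commute)
  also have "\<bar>h / L - of_int (round (h / L))\<bar> * L = \<bar>h - of_int (round (h / L)) * L\<bar>"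
  proof -
    have "(h / L - of_int (round (h / L))) * L = h - of_int (round (h / L)) * L" using L by (simp add: field_simps)
    then show ?thesis using L by (metis abs_mult abs_of_pos)
  qed
  finally have "\<bar>h - of_int (round (h / L)) * L\<bar> \<le> L / 2" by simp
  then show ?thesis using that circle_abs_eq[OF L] by blast
qed

lemma circle_abs_meas[measurable]: "circle_abs L \<in> borel_measurable borel"
  unfolding circle_abs_def[abs_def] by (intro borel_measurable_continuous_onI continuous_intros)

section \<open>Admissible radii and their Borel supremum\<close>

context arc
begin

text \<open>\<open>admissible_radius\<close> with the everywhere defined Borel tangent
  \<open>\<tau>\<close> in place of the derivative; at almost every \<open>s\<close> the two notions
  agree for all radii.\<close>

definition adm :: "real \<Rightarrow> real \<Rightarrow> bool" where
  "adm q s \<longleftrightarrow> 0 < q \<and> (\<forall>h. q \<le> circle_abs L h \<longrightarrow> q / 2 \<le> norm (\<gamma> (s + h) - \<gamma> s)) \<and>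
     (AE h in lborel. circle_abs L h \<le> q \<longrightarrow> norm (\<tau> (s + h) - \<tau> s) \<le> circle_abs L h / q)"

lemma inner_lower:
  assumes ab: "a \<le> b" and f: "integrable lborel (\<lambda>t. indicator {a..b} t * f t)"
    and ae: "AE t in lborel. t \<in> {a..b} \<longrightarrow> f t \<le> \<tau> t \<bullet> v"
  shows "(LBINT t. indicator {a..b} t * f t) \<le> (\<gamma> b - \<gamma> a) \<bullet> v"
proof -
  have "integrable lborel (\<lambda>t. (indicator {a..b} t *\<^sub>R \<tau> t) \<bullet> v)"
    by (rule integrable_inner_left) (rule indicator_\<tau>_integrable)
  then have "(LBINT t. indicator {a..b} t * f t) \<le> (LBINT t. (indicator {a..b} t *\<^sub>R \<tau> t) \<bullet> v)"
    by (rule Bochner_Integration.integral_mono_AE[OF f]) (rule eventually_mono[OF ae], auto simp: indicator_def)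
  also have "\<dots> = (LBINT t. indicator {a..b} t *\<^sub>R \<tau> t) \<bullet> v" by (rule integral_inner_left) (use indicator_\<tau>_integrable in simp)
  finally show ?thesis unfolding ftc[OF ab] .
qed

lemma unit_inner: "norm (x - y) \<le> c \<Longrightarrow> norm x = 1 \<Longrightarrow> norm y = 1 \<Longrightarrow> 1 - c\<^sup>2 / 2 \<le> x \<bullet> (y::real^3)"
proof -
  assume a: "norm (x - y) \<le> c" and n: "norm x = 1" "norm y = 1"
  have "(norm (x - y))\<^sup>2 \<le> c\<^sup>2" using a by (intro power_mono) auto
  moreover have "(norm (x - y))\<^sup>2 = 2 - 2 * (x \<bullet> y)"
    using n by (simp add: power2_norm_eq_inner inner_diff_left inner_diff_right inner_commute norm_eq_1)
  ultimately show ?thesis by linarith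
qed

lemma adm_AE:
  assumes "adm q s"
  shows "AE t in lborel. \<bar>t - s\<bar> \<le> L / 2 \<longrightarrow> \<bar>t - s\<bar> \<le> q \<longrightarrow> norm (\<tau> t - \<tau> s) \<le> \<bar>t - s\<bar> / q"
proof -
  have "AE h in lborel. circle_abs L h \<le> q \<longrightarrow> norm (\<tau> (s + h) - \<tau> s) \<le> circle_abs L h / q" using assms by (simp add: adm_def)
  then have "AE t in lborel. circle_abs L (- s + t) \<le> q \<longrightarrow> norm (\<tau> (s + (- s + t)) - \<tau> s) \<le> circle_abs L (- s + t) / q"
    by (rule AE_lborel_shift)
  then show ?thesis by eventually_elim (auto simp: circle_abs_small[OF L])
qed

text \<open>Within distance \<open>p\<close> of \<open>s\<close> the curve advances in direction
  \<open>\<tau> s\<close> by at least \<open>5 * p / 3\<close>, because the tangent turns slowly.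
  Being closed, it must come back along the complementary arc, of length \<open>L - 2 * p\<close>.
  Hence \<open>11 * p / 3 \<le> L\<close>. The cap at \<open>L / 2\<close> keeps \<open>p\<close>
  where the circle distance is the ordinary one, and \<open>3 * L / 11 < L / 2\<close> excludes the
  capped case.\<close>

lemma adm_le:
  assumes A: "adm q s"
  shows "q \<le> 3 * L / 11"
proof (rule ccontr)
  assume nq: "\<not> q \<le> 3 * L / 11"
  define p where "p = min q (L / 2)"
  have q: "0 < q" using A by (simp add: adm_def)
  have p: "0 < p" "p \<le> q" "p \<le> L / 2" "3 * L / 11 < p" using q L nq by (auto simp: p_def)
  define f where "f t = 1 - (t - s)\<^sup>2 / (2 * q\<^sup>2)" for t
  have hb: "has_bochner_integral lborel (\<lambda>t. f t * indicator {s - p..s + p} t) ((s + p - (s + p - s)^3 / (6 * q\<^sup>2)) - (s - p - (s - p - s)^3 / (6 * q\<^sup>2)))"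
  proof (rule has_bochner_integral_FTC_Icc_real)
    show "((\<lambda>t. t - (t - s)^3 / (6 * q\<^sup>2)) has_real_derivative f t) (at t)" for t
      unfolding f_def using q by (auto intro!: derivative_eq_intros simp: field_simps power2_eq_square)
    show "isCont f t" for t unfolding f_def using q by (intro continuous_intros) auto
  qed (use p in simp)
  have fi: "integrable lborel (\<lambda>t. indicator {s - p..s + p} t * f t)" "(LBINT t. indicator {s - p..s + p} t * f t) = 2 * p - p^3 / (3 * q\<^sup>2)"
    using hb by (auto simp: has_bochner_integral_iff mult.commute field_simps)
  have ae: "AE t in lborel. t \<in> {s - p..s + p} \<longrightarrow> f t \<le> \<tau> t \<bullet> \<tau> s"
    using adm_AE[OF A]
  proof eventually_elim
    fix t assume *: "\<bar>t - s\<bar> \<le> L / 2 \<longrightarrow> \<bar>t - s\<bar> \<le> q \<longrightarrow> norm (\<tau> t - \<tau> s) \<le> \<bar>t - s\<bar> / q"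
    show "t \<in> {s - p..s + p} \<longrightarrow> f t \<le> \<tau> t \<bullet> \<tau> s"
    proof
      assume "t \<in> {s - p..s + p}"
      then have "\<bar>t - s\<bar> \<le> p" by auto
      then have "norm (\<tau> t - \<tau> s) \<le> \<bar>t - s\<bar> / q" using * p by auto
      from unit_inner[OF this] show "f t \<le> \<tau> t \<bullet> \<tau> s" by (simp add: f_def power_divide)
    qed
  qed
  have "2 * p - p^3 / (3 * q\<^sup>2) \<le> (\<gamma> (s + p) - \<gamma> (s - p)) \<bullet> \<tau> s"
    using inner_lower[OF _ fi(1) ae] fi(2) p by simp
  moreover have "p^3 / (3 * q\<^sup>2) \<le> p / 3"
  proof -
    have "p^3 = p * p\<^sup>2" by (simp add: power3_eq_cube power2_eq_square)
    also have "\<dots> \<le> p * q\<^sup>2" using p by (intro mult_left_mono power_mono) auto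
    finally show ?thesis using q by (simp add: field_simps)
  qed
  moreover have "(\<gamma> (s + p) - \<gamma> (s - p)) \<bullet> \<tau> s = - ((\<gamma> (s - p + L) - \<gamma> (s + p)) \<bullet> \<tau> s)"
    using per(1)[of "s - p"] by (simp flip: inner_minus_left)
  moreover have "\<bar>(\<gamma> (s - p + L) - \<gamma> (s + p)) \<bullet> \<tau> s\<bar> \<le> L - 2 * p"
    using Cauchy_Schwarz_ineq2[of "\<gamma> (s - p + L) - \<gamma> (s + p)" "\<tau> s"] lip0[of "s + p" "s - p + L"] p by simp
  ultimately have "2 * p - p / 3 \<le> L - 2 * p" by (simp add: abs_le_iff)
  then show False using p by simp
qed

text \<open>The tangent condition only weakens, but the chord condition for \<open>h\<close> between
  \<open>p\<close> and \<open>q\<close> is new. There the tangent condition at radius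
  \<open>q\<close> applies: along the arc the inner product with \<open>\<tau> s\<close> is at least
  \<open>1/2\<close>, so the chord is at least half the arc.\<close>

lemma adm_down:
  assumes A: "adm q s" and p: "0 < p" "p \<le> q"
  shows "adm p s"
  unfolding adm_def
proof (intro conjI allI impI)
  have q: "0 < q" using A by (simp add: adm_def)
  show "AE h in lborel. circle_abs L h \<le> p \<longrightarrow> norm (\<tau> (s + h) - \<tau> s) \<le> circle_abs L h / p"
  proof -
    have "AE h in lborel. circle_abs L h \<le> q \<longrightarrow> norm (\<tau> (s + h) - \<tau> s) \<le> circle_abs L h / q" using A by (simp add: adm_def)
    then show ?thesis
    proof eventually_elim
      fix h assume *: "circle_abs L h \<le> q \<longrightarrow> norm (\<tau> (s + h) - \<tau> s) \<le> circle_abs L h / q"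
      have "circle_abs L h / q \<le> circle_abs L h / p" using p by (intro divide_left_mono) (auto simp: circle_abs_def infdist_nonneg)
      then show "circle_abs L h \<le> p \<longrightarrow> norm (\<tau> (s + h) - \<tau> s) \<le> circle_abs L h / p" using * p by auto
    qed
  qed
  fix h assume h: "p \<le> circle_abs L h"
  show "p / 2 \<le> norm (\<gamma> (s + h) - \<gamma> s)"
  proof (cases "q \<le> circle_abs L h")
    case True
    then have "q / 2 \<le> norm (\<gamma> (s + h) - \<gamma> s)" using A by (simp add: adm_def)
    then show ?thesis using p by simp
  next
    case False
    obtain k where k: "\<bar>h - of_int k * L\<bar> \<le> L / 2" "circle_abs L h = \<bar>h - of_int k * L\<bar>" using circle_abs_reduce[OF L] by blast
    define g where "g = h - of_int k * L"
    have g: "\<bar>g\<bar> \<le> L / 2" "\<bar>g\<bar> \<le> q" "p \<le> \<bar>g\<bar>" "\<gamma> (s + h) = \<gamma> (s + g)"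
      using k False h \<gamma>_per_int[of "s + g" k] by (auto simp: g_def)
    \<comment> \<open>Ordering the endpoints treats both signs of the reduced difference
      \<open>g\<close> at once.\<close>
    define a b where "a = min s (s + g)" and "b = max s (s + g)"
    have ab: "a \<le> b" "b - a = \<bar>g\<bar>" by (auto simp: a_def b_def)
    have ae: "AE t in lborel. t \<in> {a..b} \<longrightarrow> 1/2 \<le> \<tau> t \<bullet> \<tau> s"
      using adm_AE[OF A]
    proof eventually_elim
      fix t assume *: "\<bar>t - s\<bar> \<le> L / 2 \<longrightarrow> \<bar>t - s\<bar> \<le> q \<longrightarrow> norm (\<tau> t - \<tau> s) \<le> \<bar>t - s\<bar> / q"
      show "t \<in> {a..b} \<longrightarrow> 1/2 \<le> \<tau> t \<bullet> \<tau> s"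
      proof
        assume "t \<in> {a..b}"
        then have "\<bar>t - s\<bar> \<le> \<bar>g\<bar>" by (auto simp: a_def b_def min_def max_def split: if_splits)
        then have 1: "norm (\<tau> t - \<tau> s) \<le> \<bar>t - s\<bar> / q" "\<bar>t - s\<bar> \<le> q" using * g by auto
        then have "norm (\<tau> t - \<tau> s) \<le> 1" using q by (smt (verit) divide_le_eq_1_pos)
        from unit_inner[OF this] show "1/2 \<le> \<tau> t \<bullet> \<tau> s" by simp
      qed
    qed
    have "(LBINT t. indicator {a..b} t * (1/2)) \<le> (\<gamma> b - \<gamma> a) \<bullet> \<tau> s"
      by (rule inner_lower[OF ab(1) _ ae]) (use indicator_Icc_integrable in simp)
    then have "\<bar>g\<bar> / 2 \<le> (\<gamma> b - \<gamma> a) \<bullet> \<tau> s" using ab by simp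
    also have "\<dots> \<le> norm (\<gamma> b - \<gamma> a)" using norm_cauchy_schwarz[of "\<gamma> b - \<gamma> a" "\<tau> s"] by simp
    also have "norm (\<gamma> b - \<gamma> a) = norm (\<gamma> (s + h) - \<gamma> s)" unfolding g(4) by (auto simp: a_def b_def min_def max_def norm_minus_commute)
    finally show ?thesis using g by linarith
  qed
qed (rule p)

text \<open>The chord condition is an intersection of closed sets. The condition holding for almost
  every \<open>h\<close> is the vanishing of a nonnegative integral depending on \<open>s\<close>,
  which is Borel in \<open>s\<close> by Tonelli.\<close>

lemma adm_meas[measurable]: "Measurable.pred borel (adm q)"
proof (cases "0 < q")
  case True
  let ?A = "{s. \<forall>h. q \<le> circle_abs L h \<longrightarrow> q / 2 \<le> norm (\<gamma> (s + h) - \<gamma> s)}"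
  have "?A = (\<Inter>h\<in>{h. q \<le> circle_abs L h}. {s. q / 2 \<le> norm (\<gamma> (s + h) - \<gamma> s)})" by auto
  moreover have "closed \<dots>"
    by (intro closed_INT ballI closed_Collect_le continuous_intros continuous_on_compose2[OF \<gamma>_cont]) auto
  ultimately have [measurable]: "?A \<in> sets borel" by simp
  define F where "F s h = (if circle_abs L h \<le> q \<and> \<not> norm (\<tau> (s + h) - \<tau> s) \<le> circle_abs L h / q then 1 else 0 :: ennreal)" for s h
  have F[measurable]: "(\<lambda>(s, h). F s h) \<in> borel_measurable (borel \<Otimes>\<^sub>M borel)" unfolding F_def by measurable
  have Fs: "F s \<in> borel_measurable lborel" for s unfolding F_def[abs_def] by measurable
  have eq: "adm q s \<longleftrightarrow> s \<in> ?A \<and> (\<integral>\<^sup>+h. F s h \<partial>lborel) = 0" for s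
    unfolding nn_integral_0_iff_AE[OF Fs] adm_def using True by (simp add: F_def)
  have [measurable]: "(\<lambda>s. \<integral>\<^sup>+h. F s h \<partial>lborel) \<in> borel_measurable borel" by measurable
  show ?thesis unfolding eq by measurable
next
  case False
  then have "adm q = (\<lambda>_. False)" by (auto simp: adm_def fun_eq_iff)
  then show ?thesis by simp
qed

text \<open>Rational radii suffice because admissibility passes to smaller radii, and a countable
  supremum is Borel. The default value \<open>0\<close> for inadmissible radii gives the supremum of
  the empty set its prescribed value.\<close>

definition rr :: "real \<Rightarrow> real" where "rr s = (SUP q\<in>\<rat>. if adm q s then q else 0)"

lemma rr_bdd: "bdd_above ((\<lambda>q. if adm q s then q else 0) ` \<rat>)"
  by (rule bdd_aboveI[of _ "3 * L / 11"]) (use adm_le L in auto)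

lemma rr_meas[measurable]: "rr \<in> borel_measurable borel"
  unfolding rr_def[abs_def] by (rule borel_measurable_cSUP) (use rr_bdd countable_rat in auto)

lemma rr_ge: "0 \<le> rr s"
  unfolding rr_def by (rule cSUP_upper2[OF rr_bdd, of 0]) auto

lemma rr_le: "rr s \<le> 3 * L / 11"
  unfolding rr_def by (rule cSUP_least) (use adm_le L in auto)

lemma rr_less: "x < rr s \<Longrightarrow> 0 \<le> x \<Longrightarrow> \<exists>q>x. adm q s"
  unfolding rr_def by (subst (asm) less_cSUP_iff[OF _ rr_bdd]) (auto split: if_splits)

lemma rr_upper:
  assumes "adm q s" "0 \<le> x" "x < q"
  shows "x < rr s"
proof -
  obtain p where p: "p \<in> \<rat>" "x < p" "p < q" using Rats_dense_in_real[OF assms(3)] by auto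
  then have "adm p s" using adm_down[OF assms(1)] assms(2) by auto
  then have "p \<le> rr s" unfolding rr_def by (intro cSUP_upper2[OF rr_bdd p(1)]) auto
  then show ?thesis using p by simp
qed

lemma rr_per: "rr (s + L) = rr s"
proof -
  have "adm q (s + L) = adm q s" for q
  proof -
    have "\<gamma> (s + L + h) = \<gamma> (s + h)" "\<tau> (s + L + h) = \<tau> (s + h)" for h
      using per[of "s + h"] by (simp_all add: add_ac)
    then show ?thesis unfolding adm_def per by simp
  qed
  then show ?thesis by (simp add: rr_def)
qed

text \<open>Superlevel sets of \<open>\<kappa>\<^sup>*\<close> become sublevel sets of the Borel
  function \<open>rr\<close>. The quantifier over \<open>x\<close> stands inside, so one null set
  serves all levels. Only parameters where the curve is differentiable with tangent
  \<open>\<tau> s\<close> are considered; elsewhere the security radius has a different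
  definition.\<close>

lemma security_le:
  "AE s in lborel. \<forall>x>0. (ennreal (1 / x) \<le> kappa_star L \<gamma> s) = (rr s \<le> x)"
  using deriv
proof eventually_elim
  fix s assume d: "(\<gamma> has_vector_derivative \<tau> s) (at s)"
  have ts: "tangent \<gamma> s = \<tau> s" using d by (rule vector_derivative_at)
  have ae: "AE h in lborel. tangent \<gamma> (s + h) = \<tau> (s + h)"
    by (rule AE_lborel_shift, rule eventually_mono[OF deriv]) (rule vector_derivative_at)
  have iff: "admissible_radius L \<gamma> s r \<longleftrightarrow> adm r s" for r
  proof -
    have "(AE h in lborel. circle_abs L h \<le> r \<longrightarrow> norm (tangent \<gamma> (s + h) - tangent \<gamma> s) \<le> circle_abs L h / r)
      \<longleftrightarrow> (AE h in lborel. circle_abs L h \<le> r \<longrightarrow> norm (\<tau> (s + h) - \<tau> s) \<le> circle_abs L h / r)"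
      unfolding ts by (rule eventually_cong[OF ae]) simp
    then show ?thesis by (simp add: admissible_radius_def adm_def AE_completion_iff)
  qed
  have sec: "security_radius L \<gamma> s = (SUP r\<in>{r. adm r s}. ennreal r)"
  proof -
    have "admissible_radius L \<gamma> s = (\<lambda>r. adm r s)" by (simp add: fun_eq_iff iff)
    then show ?thesis using d by (simp add: security_radius_def differentiableI_vector)
  qed
  show "\<forall>x>0. (ennreal (1 / x) \<le> kappa_star L \<gamma> s) = (rr s \<le> x)"
  proof (intro allI impI)
    fix x :: real assume x: "0 < x"
    have "(rr s \<le> x) = (security_radius L \<gamma> s \<le> ennreal x)"
    proof
      assume r: "rr s \<le> x"
      show "security_radius L \<gamma> s \<le> ennreal x" unfolding sec
      proof (rule SUP_least)
        fix q assume "q \<in> {q. adm q s}"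
        then have "q \<le> x" using rr_upper[of q s x] r x by force
        then show "ennreal q \<le> ennreal x" by (rule ennreal_leI)
      qed
    next
      assume *: "security_radius L \<gamma> s \<le> ennreal x"
      show "rr s \<le> x"
      proof (rule ccontr)
        assume "\<not> rr s \<le> x"
        then obtain q where q: "q > x" "adm q s" using rr_less[of x s] x by auto
        then have "ennreal q \<le> security_radius L \<gamma> s" unfolding sec by (intro SUP_upper) simp
        then have "ennreal q \<le> ennreal x" using * by (rule order_trans)
        then show False using q x by (simp add: ennreal_le_iff2)
      qed
    qed
    moreover have "(ennreal (1 / x) \<le> 1 / R) = (R \<le> ennreal x)" for R
    proof (cases R rule: ennreal_cases)
      case (real y)
      show ?thesis
      proof (cases "y = 0")
        case False
        then have "1 / R = ennreal (1 / y)" using real by (simp add: divide_ennreal[symmetric])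
        then show ?thesis using real False x by (simp add: ennreal_le_iff2 field_simps)
      qed (use real x in simp)
    qed (use x in \<open>simp add: top_unique ennreal_le_iff2\<close>)
    ultimately show "(ennreal (1 / x) \<le> kappa_star L \<gamma> s) = (rr s \<le> x)" by (simp add: kappa_star_def)
  qed
qed

lemma rr_weak:
  assumes fin: "weak_L1_norm L (kappa_star L \<gamma>) < \<infinity>" and x: "0 < x"
  shows "emeasure lborel {s\<in>{0..<L}. rr s \<le> x} \<le> ennreal (enn2real (weak_L1_norm L (kappa_star L \<gamma>)) * x)"
proof -
  define W where "W = weak_L1_norm L (kappa_star L \<gamma>)"
  define A where "A = {s\<in>{0..<L}. rr s \<le> x}"
  define S where "S = {s\<in>{0..<L}. kappa_star L \<gamma> s \<ge> ennreal (1 / x)}"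
  have A: "A \<in> sets borel" unfolding A_def by measurable
  obtain N where N: "N \<in> null_sets lborel" "{s. \<not> (\<forall>x>0. (ennreal (1 / x) \<le> kappa_star L \<gamma> s) = (rr s \<le> x))} \<subseteq> N"
    using security_le unfolding eventually_ae_filter by auto
  have SN: "S - N = A - N" using N(2) x by (auto simp: A_def S_def)
  have N': "N \<in> null_sets lebesgue" using N(1) by (rule null_sets_completionI)
  have "S \<inter> N \<in> null_sets lebesgue" by (rule null_sets_completion_subset[OF _ N']) auto
  \<comment> \<open>\<open>emeasure\<close> is \<open>0\<close> on nonmeasurable sets, so the weak
    norm says something about the level set \<open>S\<close> only after its Lebesgue measurability
    is known. It differs from the Borel set \<open>A\<close> only inside the null set
    \<open>N\<close>.\<close>
  then have "S - N \<union> S \<inter> N \<in> sets lebesgue" unfolding SN using A N by (intro sets.Un sets.Diff) auto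
  moreover have "S - N \<union> S \<inter> N = S" by auto
  ultimately have Sm: "S \<in> sets lebesgue" by simp
  have "AE s in lborel. s \<notin> N" by (rule AE_not_in[OF N(1)])
  then have ae: "AE s in lebesgue. s \<in> S \<longleftrightarrow> s \<in> A"
    by (intro AE_completion, eventually_elim) (use SN in blast)
  have "emeasure lborel A = emeasure lebesgue A" using A by simp
  also have "\<dots> = emeasure lebesgue S" by (rule emeasure_eq_AE) (use ae A Sm in \<open>auto elim: eventually_mono\<close>)
  finally have e: "emeasure lborel A = emeasure lebesgue S" .
  have "ennreal (1 / x) * emeasure lebesgue S \<le> W"
    unfolding W_def weak_L1_norm_def S_def by (rule SUP_upper) (use x in simp)
  then have "ennreal x * (ennreal (1 / x) * emeasure lborel A) \<le> ennreal x * W" unfolding e by (intro mult_left_mono) auto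
  moreover have "ennreal x * (ennreal (1 / x) * emeasure lborel A) = emeasure lborel A"
    using x by (simp add: mult.assoc[symmetric] ennreal_mult[symmetric])
  moreover have "W = ennreal (enn2real W)" using fin by (simp add: W_def less_top)
  ultimately have "emeasure lborel A \<le> ennreal x * ennreal (enn2real W)" by simp
  also have "\<dots> = ennreal (enn2real W * x)" using x by (subst ennreal_mult[symmetric]) (auto simp: mult.commute)
  finally show ?thesis unfolding A_def W_def .
qed

text \<open>The supremum \<open>rr s\<close> need not be attained, but half of a positive supremum
  is admissible, by \<open>adm_down\<close>. The price is the factor \<open>2\<close> in the
  weak-type bound.\<close>

lemma curve_instance:
  assumes fin: "weak_L1_norm L (kappa_star L \<gamma>) < \<infinity>"
  shows "curve L \<gamma> \<tau> (enn2real (weak_L1_norm L (kappa_star L \<gamma>))) (\<lambda>s. rr s / 2)"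
proof -
  define K where "K = enn2real (weak_L1_norm L (kappa_star L \<gamma>))"
  have w: "emeasure lborel {s\<in>{0..<L}. rr s / 2 \<le> x} \<le> ennreal (2 * K * x)" if "x > 0" for x
    using rr_weak[OF fin, of "2 * x"] that by (simp add: K_def field_simps)
  \<comment> \<open>At this level the sublevel set is the whole period, since no admissible radius
    exceeds \<open>3 * L / 11\<close>. The weak-type bound then forces
    \<open>K \<ge> 11/3\<close>.\<close>
  have "{s\<in>{0..<L}. rr s / 2 \<le> 3 * L / 22} = {0..<L}" using rr_le by (auto simp: field_simps)
  then have "ennreal L \<le> ennreal (2 * K * (3 * L / 22))" using w[of "3 * L / 22"] L by simp
  then have "L \<le> 2 * K * (3 * L / 22)" using L by (subst (asm) ennreal_le_iff2) auto
  then have K: "11/3 \<le> K" using L by (simp add: field_simps)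
  have pos: "AE s in lborel. 0 < rr s"
  proof (rule AE_lborel_periodic[OF L])
    define Z where "Z = {s\<in>{0..<L}. rr s \<le> 0}"
    have Zm: "Z \<in> sets lborel" unfolding Z_def by measurable
    \<comment> \<open>The weak-type bound at arbitrarily small levels shows that the security radius
      is positive almost everywhere.\<close>
    have Zx: "emeasure lborel Z \<le> ennreal x" if x: "0 < x" for x
    proof -
      have "emeasure lborel Z \<le> emeasure lborel {s\<in>{0..<L}. rr s / 2 \<le> x / (2 * K)}"
        using x K by (intro emeasure_mono) (auto simp: Z_def intro: order_trans)
      also have "\<dots> \<le> ennreal (2 * K * (x / (2 * K)))" by (rule w) (use x K in simp)
      finally show ?thesis using K by simp
    qed
    have "emeasure lborel Z \<le> 0"
    proof (rule ennreal_le_epsilon)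
      show "emeasure lborel Z \<le> 0 + ennreal x" if "0 < x" for x :: real unfolding add_0 by (rule Zx[OF that])
    qed
    then have "Z \<in> null_sets lborel" using Zm by auto
    then have "AE s in lborel. s \<notin> Z" by (rule AE_not_in)
    then show "AE s in lborel. s \<in> {0..<L} \<longrightarrow> 0 < rr s" by eventually_elim (auto simp: Z_def)
  qed (simp add: rr_per)
  have "curve L \<gamma> \<tau> K (\<lambda>s. rr s / 2)"
  proof unfold_locales
    show "AE s in lborel. 0 < rr s / 2 \<and> rr s / 2 \<le> L / 4 \<and>
       (\<forall>h. rr s / 2 \<le> \<bar>h\<bar> \<and> \<bar>h\<bar> \<le> L / 2 \<longrightarrow> rr s / 2 / 2 \<le> norm (\<gamma> (s + h) - \<gamma> s)) \<and>
       (AE t in lborel. \<bar>t - s\<bar> \<le> rr s / 2 \<longrightarrow> norm (\<tau> t - \<tau> s) \<le> \<bar>t - s\<bar> / (rr s / 2))" (is "AE s in lborel. ?P s")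
      using pos
    proof eventually_elim
      fix s assume r: "0 < rr s"
      have "rr s / 2 < rr s" "0 \<le> rr s / 2" using r by auto
      then obtain q where q: "q > rr s / 2" "adm q s" using rr_less by blast
      have A: "adm (rr s / 2) s" using adm_down[OF q(2)] q(1) r by auto
      have le: "rr s / 2 \<le> L / 4" using rr_le[of s] L by simp
      have "rr s / 2 / 2 \<le> norm (\<gamma> (s + h) - \<gamma> s)" if "rr s / 2 \<le> \<bar>h\<bar>" "\<bar>h\<bar> \<le> L / 2" for h
        using A that circle_abs_small[OF L that(2)] unfolding adm_def by auto
      moreover have "AE t in lborel. \<bar>t - s\<bar> \<le> rr s / 2 \<longrightarrow> norm (\<tau> t - \<tau> s) \<le> \<bar>t - s\<bar> / (rr s / 2)"
        using adm_AE[OF A] by eventually_elim (use le L in auto)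
      ultimately show "?P s"
        using r le by auto
    qed
    show "emeasure lborel {s\<in>{0..<L}. rr s / 2 \<le> x} \<le> ennreal (2 * K * x)" if "x > 0" for x by (rule w[OF that])
  qed (use K rr_ge in auto)
  then show ?thesis by (simp add: K_def)
qed

end

text \<open>A Lipschitz function is recovered from its derivative by dominated convergence of
  difference quotients; their integrals over an interval are differences of averages of the curve
  near the two endpoints. This gives the fundamental theorem in the form required by
  \<open>arc\<close>, with a Borel tangent.\<close>

lemma arc_exists:
  assumes C: "closed_arclength_curve L \<gamma>"
  shows "\<exists>\<tau>. arc L \<gamma> \<tau>"
proof -
  from C have L: "L > 0" and per: "\<gamma> (s + L) = \<gamma> s" for s by (auto simp: closed_arclength_curve_def)
  from C obtain M where M: "M-lipschitz_on UNIV \<gamma>" by (auto simp: closed_arclength_curve_def)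
  have M0: "0 \<le> M" by (rule lipschitz_on_nonneg[OF M])
  have lipM: "norm (\<gamma> a - \<gamma> b) \<le> M * \<bar>a - b\<bar>" for a b using lipschitz_onD[OF M, of a b] by (simp add: dist_norm)
  have ae0: "AE s in lborel. \<exists>v. (\<gamma> has_vector_derivative v) (at s) \<and> norm v = 1"
    using C by (simp add: closed_arclength_curve_def AE_completion_iff)
  have cont: "continuous_on UNIV \<gamma>" by (rule lipschitz_on_continuous_on[OF M])
  have [measurable]: "\<gamma> \<in> borel_measurable borel" by (rule borel_measurable_continuous_onI[OF cont])
  define \<eta> where "\<eta> n = inverse (real (Suc n))" for n
  have \<eta>: "0 < \<eta> n" for n by (simp add: \<eta>_def)
  have \<eta>0: "\<eta> \<longlonglongrightarrow> 0" unfolding \<eta>_def[abs_def] by (rule LIMSEQ_inverse_real_of_nat)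
  define D where "D n s = (1 / \<eta> n) *\<^sub>R (\<gamma> (s + \<eta> n) - \<gamma> s)" for n s
  have Dm[measurable]: "D n \<in> borel_measurable borel" for n unfolding D_def[abs_def] by measurable
  define t0 where "t0 s = lim (\<lambda>n. D n s)" for s
  \<comment> \<open>The default \<open>axis 1 1\<close> keeps the norm equal to \<open>1\<close> at
    the exceptional parameters, so that later bounds hold everywhere and not just almost
    everywhere.\<close>
  define \<tau> where "\<tau> s = (if norm (t0 s) = 1 then t0 s else axis 1 1)" for s
  have [measurable]: "t0 \<in> borel_measurable borel" unfolding t0_def[abs_def] by measurable
  have \<tau>m[measurable]: "\<tau> \<in> borel_measurable borel" unfolding \<tau>_def[abs_def] by measurable
  have \<tau>n: "norm (\<tau> s) = 1" for s by (simp add: \<tau>_def)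
  have conv: "AE s in lborel. (\<gamma> has_vector_derivative \<tau> s) (at s) \<and> (\<lambda>n. D n s) \<longlonglongrightarrow> \<tau> s"
    using ae0
  proof eventually_elim
    fix s assume "\<exists>v. (\<gamma> has_vector_derivative v) (at s) \<and> norm v = 1"
    then obtain v where v: "(\<gamma> has_vector_derivative v) (at s)" "norm v = 1" by blast
    have "(\<lambda>h. norm (\<gamma> (s + h) - \<gamma> s - h *\<^sub>R v) / norm h) \<midarrow>0\<rightarrow> 0"
      using v(1) by (simp add: has_vector_derivative_def has_derivative_at)
    then have "((\<lambda>h. norm (\<gamma> (s + h) - \<gamma> s - h *\<^sub>R v) / norm h) \<circ> \<eta>) \<longlonglongrightarrow> 0"
      using \<eta>0 \<eta> unfolding tendsto_at_iff_sequentially by (auto simp: less_imp_neq[THEN not_sym])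
    moreover have "norm (\<gamma> (s + \<eta> n) - \<gamma> s - \<eta> n *\<^sub>R v) / norm (\<eta> n) = norm (D n s - v)" for n
    proof -
      have "D n s - v = (1 / \<eta> n) *\<^sub>R (\<gamma> (s + \<eta> n) - \<gamma> s - \<eta> n *\<^sub>R v)" using \<eta>[of n] by (simp add: D_def scaleR_diff_right)
      then show ?thesis using \<eta>[of n] by simp
    qed
    ultimately have "(\<lambda>n. norm (D n s - v)) \<longlonglongrightarrow> 0" by (simp add: comp_def)
    then have lim: "(\<lambda>n. D n s) \<longlonglongrightarrow> v" using LIM_zero_cancel tendsto_norm_zero_iff by blast
    then have "\<tau> s = v" using v(2) by (simp add: \<tau>_def t0_def limI)
    then show "(\<gamma> has_vector_derivative \<tau> s) (at s) \<and> (\<lambda>n. D n s) \<longlonglongrightarrow> \<tau> s" using v lim by simp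
  qed
  have ftc: "\<gamma> b - \<gamma> a = (LBINT t. indicator {a..b} t *\<^sub>R \<tau> t)" if ab: "a \<le> b" for a b
  proof (cases "a = b")
    case True
    have "AE t in lborel. t \<noteq> a" by (rule AE_lborel_singleton)
    then have "AE t in lborel. indicator {a..b} t *\<^sub>R \<tau> t = 0" by eventually_elim (auto simp: True indicator_def)
    then have "(LBINT t. indicator {a..b} t *\<^sub>R \<tau> t) = 0" by (rule integral_eq_zero_AE)
    then show ?thesis using True by simp
  next
    case False
    then have ab: "a < b" using that by simp
    have ii: "integrable lborel (\<lambda>t. indicator {p..q} t *\<^sub>R \<gamma> t)" for p q
      by (rule borel_integrable_compact) (auto intro: continuous_on_subset[OF cont])
    have lim1: "(\<lambda>n. LBINT t. indicator {a..b} t *\<^sub>R D n t) \<longlonglongrightarrow> (LBINT t. indicator {a..b} t *\<^sub>R \<tau> t)"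
    proof (rule integral_dominated_convergence[where w="\<lambda>t. indicator {a..b} t * M"])
      show "integrable lborel (\<lambda>t. indicator {a..b} t * M)"
        using borel_integrable_compact[of "{a..b}" "\<lambda>_. M"] by (simp add: mult.commute)
      show "AE t in lborel. (\<lambda>n. indicator {a..b} t *\<^sub>R D n t) \<longlonglongrightarrow> indicator {a..b} t *\<^sub>R \<tau> t"
        using conv by eventually_elim (auto intro!: tendsto_intros)
      have "norm (D n t) \<le> M" for n t
        using lipM[of "t + \<eta> n" t] \<eta>[of n] unfolding D_def norm_scaleR by (simp add: field_simps)
      then show "AE t in lborel. norm (indicator {a..b} t *\<^sub>R D n t) \<le> indicator {a..b} t * M" for n
        by (auto split: split_indicator)
    qed auto
    \<comment> \<open>After the shift by \<open>h\<close> the overlapping parts of the two integrals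
      cancel. What remains are the means of the curve over \<open>{b..b+h}\<close> and
      \<open>{a..a+h}\<close>, each within \<open>M * h\<close> of the value at its left
      endpoint.\<close>
    have key: "norm ((LBINT t. indicator {a..b} t *\<^sub>R D n t) - (\<gamma> b - \<gamma> a)) \<le> 2 * M * \<eta> n" if n: "\<eta> n \<le> b - a" for n
    proof -
      define h where "h = \<eta> n"
      have h: "0 < h" "h \<le> b - a" using n \<eta> by (auto simp: h_def)
      have sh: "(LBINT t. indicator {a..b} t *\<^sub>R \<gamma> (t + h)) = (LBINT t. indicator {a+h..b+h} t *\<^sub>R \<gamma> t)"
        "integrable lborel (\<lambda>t. indicator {a..b} t *\<^sub>R \<gamma> (t + h))"
      proof -
        have eq: "indicator {a..b} t *\<^sub>R \<gamma> (t + h) = indicator {a+h..b+h} (h + t) *\<^sub>R \<gamma> (h + t)" for t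
          by (auto simp: indicator_def add.commute)
        have "(LBINT t. indicator {a+h..b+h} t *\<^sub>R \<gamma> t) = (\<integral>t. indicator {a+h..b+h} t *\<^sub>R \<gamma> t \<partial>distr lborel borel ((+) h))"
          by (simp add: lborel_distr_plus)
        also have "\<dots> = (LBINT t. indicator {a+h..b+h} (h + t) *\<^sub>R \<gamma> (h + t))" by (rule integral_distr) auto
        finally show "(LBINT t. indicator {a..b} t *\<^sub>R \<gamma> (t + h)) = (LBINT t. indicator {a+h..b+h} t *\<^sub>R \<gamma> t)" unfolding eq ..
        show "integrable lborel (\<lambda>t. indicator {a..b} t *\<^sub>R \<gamma> (t + h))"
          by (rule borel_integrable_compact) (auto intro!: continuous_on_compose2[OF cont] continuous_intros)
      qed
      let ?e = "\<lambda>c t. indicator {c..c+h} t *\<^sub>R (\<gamma> t - \<gamma> c)"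
      have ei: "integrable lborel (?e c)" for c
        by (rule borel_integrable_compact) (auto intro!: continuous_on_compose2[OF cont] continuous_intros)
      have eb: "norm (LBINT t. ?e c t) \<le> h * (M * h)" for c
      proof -
        have "norm (LBINT t. ?e c t) \<le> (LBINT t. indicator {c..c+h} t * (M * h))"
        proof (rule integral_norm_bound_AE[OF ei])
          have "norm (?e c t) \<le> indicator {c..c+h} t * (M * h)" for t
            using lipM[of t c] mult_left_mono[of "\<bar>t - c\<bar>" h M] M0 by (auto simp: indicator_def)
          then show "AE t in lborel. norm (?e c t) \<le> indicator {c..c+h} t * (M * h)" by simp
          show "integrable lborel (\<lambda>t. indicator {c..c+h} t * (M * h))"
            using borel_integrable_compact[of "{c..c+h}" "\<lambda>_. M * h"] by (simp add: mult.commute)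
        qed
        then show ?thesis using h by simp
      qed
      have ci: "integrable lborel (\<lambda>t. indicator {c..c+h} t *\<^sub>R w)" "(LBINT t. indicator {c..c+h} t *\<^sub>R w) = h *\<^sub>R w" for c and w :: "real^3"
        using borel_integrable_compact[of "{c..c+h}" "\<lambda>_. w"] h by simp_all
      have "(LBINT t. indicator {a..b} t *\<^sub>R D n t) = (LBINT t. (1/h) *\<^sub>R (indicator {a..b} t *\<^sub>R \<gamma> (t + h) - indicator {a..b} t *\<^sub>R \<gamma> t))"
        by (simp add: D_def h_def scaleR_diff_right scaleR_left_commute mult.commute)
      also have "\<dots> = (1/h) *\<^sub>R (LBINT t. indicator {a+h..b+h} t *\<^sub>R \<gamma> t - indicator {a..b} t *\<^sub>R \<gamma> t)"
        using sh ii by simp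
      also have "(LBINT t. indicator {a+h..b+h} t *\<^sub>R \<gamma> t - indicator {a..b} t *\<^sub>R \<gamma> t)
        = (LBINT t. (?e b t + indicator {b..b+h} t *\<^sub>R \<gamma> b) - (?e a t + indicator {a..a+h} t *\<^sub>R \<gamma> a))"
      proof (rule integral_cong_AE)
        have "AE t in lborel. t \<noteq> a + h" "AE t in lborel. t \<noteq> b" by (rule AE_lborel_singleton)+
        then show "AE t in lborel. indicator {a+h..b+h} t *\<^sub>R \<gamma> t - indicator {a..b} t *\<^sub>R \<gamma> t
          = (?e b t + indicator {b..b+h} t *\<^sub>R \<gamma> b) - (?e a t + indicator {a..a+h} t *\<^sub>R \<gamma> a)"
          by eventually_elim (use h in \<open>auto simp: indicator_def\<close>)
      qed auto
      also have "\<dots> = ((LBINT t. ?e b t) + h *\<^sub>R \<gamma> b) - ((LBINT t. ?e a t) + h *\<^sub>R \<gamma> a)"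
        using ei ci by simp
      finally have "(LBINT t. indicator {a..b} t *\<^sub>R D n t) - (\<gamma> b - \<gamma> a) = (1/h) *\<^sub>R ((LBINT t. ?e b t) - (LBINT t. ?e a t))"
        using h by (simp add: algebra_simps)
      also have "norm \<dots> \<le> (1/h) * (h * (M * h) + h * (M * h))"
      proof -
        have "norm ((LBINT t. ?e b t) - (LBINT t. ?e a t)) \<le> h * (M * h) + h * (M * h)"
          by (rule order_trans[OF norm_triangle_ineq4]) (intro add_mono eb)
        then show ?thesis unfolding norm_scaleR using h by (intro mult_mono) auto
      qed
      also have "\<dots> = 2 * M * h" using h by simp
      finally show ?thesis by (simp add: h_def)
    qed
    have "(\<lambda>n. (LBINT t. indicator {a..b} t *\<^sub>R D n t) - (\<gamma> b - \<gamma> a)) \<longlonglongrightarrow> 0"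
    proof (rule Lim_null_comparison)
      have "\<forall>\<^sub>F n in sequentially. \<eta> n < b - a" using order_tendstoD(2)[OF \<eta>0, of "b - a"] ab by simp
      then show "\<forall>\<^sub>F n in sequentially. norm ((LBINT t. indicator {a..b} t *\<^sub>R D n t) - (\<gamma> b - \<gamma> a)) \<le> 2 * M * \<eta> n"
        by eventually_elim (rule key, simp)
      show "(\<lambda>n. 2 * M * \<eta> n) \<longlonglongrightarrow> 0" using tendsto_mult_right_zero[OF \<eta>0] by simp
    qed
    then have "(\<lambda>n. LBINT t. indicator {a..b} t *\<^sub>R D n t) \<longlonglongrightarrow> \<gamma> b - \<gamma> a" by (rule LIM_zero_cancel)
    then show ?thesis using lim1 by (rule LIMSEQ_unique)
  qed
  have "arc L \<gamma> \<tau>"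
  proof
    have "D n (s + L) = D n s" for n s using per[of "s + \<eta> n"] per[of s] by (simp add: D_def add.assoc add.commute[of L])
    then show "\<tau> (s + L) = \<tau> s" for s by (simp add: \<tau>_def t0_def)
    show "AE s in lborel. (\<gamma> has_vector_derivative \<tau> s) (at s)" using conv by eventually_elim simp
  qed (use L per \<tau>m \<tau>n ftc in auto)
  then show ?thesis by blast
qed

section \<open>The main estimates\<close>

lemma integral_lebesgue_AE:
  fixes f f0 :: "'a::euclidean_space \<Rightarrow> 'b::euclidean_space"
  assumes m: "f0 \<in> borel_measurable borel" and ae: "AE x in lborel. f x = f0 x"
  shows "(LINT x|lebesgue. f x) = (LBINT x. f0 x)"
proof -
  have m0: "f0 \<in> borel_measurable lborel" using m by simp
  then have ml: "f0 \<in> borel_measurable lebesgue" by (rule measurable_completion)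
  have ae': "AE x in lebesgue. f0 x = f x" by (rule AE_completion, rule eventually_mono[OF ae]) simp
  have "f \<in> borel_measurable lebesgue" by (rule borel_measurable_AE[OF ml ae'])
  then have "(LINT x|lebesgue. f x) = (LINT x|lebesgue. f0 x)"
    using ml ae' by (intro integral_cong_AE) (auto elim: eventually_mono)
  then show ?thesis by (simp add: integral_completion[OF m0])
qed

lemma borel_representative:
  fixes u :: "real^3 \<Rightarrow> real^3"
  assumes u: "u \<in> borel_measurable lebesgue"
  obtains u0 where "u0 \<in> borel_measurable borel" "AE x in lborel. u x = u0 x"
proof -
  have "\<exists>g. g \<in> borel_measurable lborel \<and> (AE x in lborel. u x $ k = g x)" for k
  proof -
    have "(\<lambda>x. u x $ k) \<in> borel_measurable lebesgue"
      by (rule borel_measurable_continuous_on[OF _ u]) (intro continuous_intros)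
    from completion_ex_borel_measurable_real[OF this] show ?thesis by blast
  qed
  then obtain g where g: "\<And>k. g k \<in> borel_measurable lborel" "\<And>k. AE x in lborel. u x $ k = g k x" by metis
  have [measurable]: "g k \<in> borel_measurable borel" for k using g(1)[of k] by simp
  show ?thesis
  proof
    show "(\<lambda>x. \<Sum>k\<in>UNIV. g k x *\<^sub>R (axis k 1 :: real^3)) \<in> borel_measurable borel" by measurable
    have "AE x in lborel. \<forall>k. u x $ k = g k x" unfolding AE_all_countable using g(2) by blast
    then show "AE x in lborel. u x = (\<Sum>k\<in>UNIV. g k x *\<^sub>R (axis k 1 :: real^3))"
      by eventually_elim (simp add: vec_eq_iff sum_3 forall_3 axis_def)
  qed
qed

section \<open>Symmetrisation, choice of scales and transfer to the original hypotheses\<close>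

lemma norm_transpose: "norm (transpose A) = norm (A :: real^3^3)"
  by (simp add: norm_eq_sqrt_inner inner_vec_def transpose_def sum_3 add_ac)

text \<open>Both sides of the stress estimate see only the symmetric part of \<open>\<phi>\<close>,
  and symmetrisation increases neither the norm nor the Lipschitz constant. This reconciles general
  test tensors with the symmetry assumed in \<open>stress_est\<close>.\<close>

definition symm :: "real^3^3 \<Rightarrow> real^3^3" where "symm A = (1/2) *\<^sub>R (A + transpose A)"

lemma norm_symm: "norm (symm A) \<le> norm A"
  using norm_triangle_ineq[of A "transpose A"] by (simp add: symm_def norm_transpose)

lemma symm_diff: "symm A - symm B = symm (A - B)"
  by (simp add: symm_def vec_eq_iff transpose_def algebra_simps)

lemma transpose_symm: "transpose (symm A) = symm A"
  by (simp add: symm_def vec_eq_iff transpose_def)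

lemma symm_tensor: "(symm A *v x) \<bullet> x = A \<bullet> tensor x x"
  by (simp add: symm_def inner_vec_def tensor_def transpose_def matrix_vector_mult_def sum_3 field_simps)

lemma symm_projection: "symm A \<bullet> (mat 1 - tensor x x) = A \<bullet> (mat 1 - tensor x x)"
  by (simp add: symm_def inner_vec_def tensor_def transpose_def mat_def sum_3 field_simps)

context curve
begin

lemma K2: "121 / 9 \<le> K\<^sup>2"
proof -
  have "(11/3)\<^sup>2 \<le> K\<^sup>2" using K by (intro power_mono) auto
  then show ?thesis by (simp add: power2_eq_square)
qed

text \<open>The scales are moved away from \<open>\<epsilon>\<close> and \<open>L\<close> by the
  factor \<open>4096\<close> so that the errors proportional to \<open>K\<^sup>2 * l\<close> and to
  \<open>\<epsilon> / a\<close> become small. The logarithm thereby lost is a fixed number, absorbed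
  through \<open>K\<^sup>2 \<ge> 121 / 9\<close>. The aim is a total below
  \<open>K\<^sup>2 * L / 2\<close>. The factor is a power of two so that a bound on
  \<open>ln 2\<close> suffices.\<close>

lemma energy_lower:
  assumes e: "0 < \<epsilon>" and u: "u \<in> borel_measurable borel" "integrable lborel (\<lambda>x. (norm (u x))\<^sup>2)"
    and F: "flat_close \<epsilon> u"
  shows "L * ((ln L - ln \<epsilon>) / (4 * pi)) - K\<^sup>2 * L / 2 \<le> (LBINT x. (norm (u x))\<^sup>2) / 2"
proof -
  define a l where "a = 4096 * \<epsilon>" and "l = L / 4096"
  have lnN: "ln (4096::real) \<le> 12 * (7/10)"
  proof -
    have "ln (4096::real) = ln (2 ^ 12)" by simp
    also have "\<dots> = 12 * ln 2" by (subst ln_realpow) auto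
    finally show ?thesis using ln2_le_25_over_36 by simp
  qed
  have al: "ln l - ln a = (ln L - ln \<epsilon>) - 2 * ln 4096" using L e by (simp add: a_def l_def ln_div ln_mult)
  have c: "2 * ln 4096 / (4 * pi) \<le> 14/10"
  proof -
    have "2 * ln (4096::real) \<le> 14/10 * 12" using lnN by simp
    also have "\<dots> \<le> 14/10 * (4 * pi)" using pi_gt3 by simp
    finally show ?thesis by (simp add: pos_divide_le_eq)
  qed
  define T where "T = (ln L - ln \<epsilon>) / (4 * pi)"
  have T: "(ln l - ln a) / (4 * pi) = T - 2 * ln 4096 / (4 * pi)" unfolding al T_def by (rule diff_divide_distrib)
  have KL: "121 / 9 * L \<le> K\<^sup>2 * L" using K2 L by (intro mult_right_mono) auto
  have KL': "K * L \<le> 3/11 * (K\<^sup>2 * L)"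
  proof -
    have "K * 1 \<le> K * (3/11 * K)" using K by (intro mult_left_mono) auto
    then have "K * L \<le> (3/11 * K\<^sup>2) * L" using L by (intro mult_right_mono) (auto simp: power2_eq_square)
    then show ?thesis by simp
  qed
  have "L * T - K\<^sup>2 * L / 2 \<le> (LBINT x. (norm (u x))\<^sup>2) / 2"
  proof (cases "a \<le> l")
    case True
    have fin: "t - p / 2 \<le> y" if "x - (a1 + a2) - a3 \<le> y" "a1 \<le> 1 / 4096 * q" "a2 = 480 / 4096 * p" "a3 = 23 / 4096 * q"
      "t - 3 * L \<le> x" "121 / 9 * L \<le> p" "q \<le> 3/11 * p" for x y t p q a1 a2 a3 :: real
      using that L by linarith
    have 1: "L * ((ln l - ln a) / (4 * pi) - 8/5) - (2 * K * l / pi + 480 * K\<^sup>2 * l) - \<epsilon> * L * (23 * K / a) \<le> (LBINT x. (norm (u x))\<^sup>2) / 2"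
      by (rule lower_bound[OF _ True u F]) (use e in \<open>auto simp: a_def\<close>)
    have 2: "2 * K * l / pi \<le> 1 / 4096 * (K * L)"
    proof -
      have "2 * K * l / pi \<le> 2 * K * l / 2" using K L pi_gt3 by (intro divide_left_mono) (auto simp: l_def)
      then show ?thesis by (simp add: l_def)
    qed
    have 3: "480 * K\<^sup>2 * l = 480 / 4096 * (K\<^sup>2 * L)" by (simp add: l_def)
    have 4: "\<epsilon> * L * (23 * K / a) = 23 / 4096 * (K * L)" using e by (simp add: a_def)
    have 5: "L * T - 3 * L \<le> L * ((ln l - ln a) / (4 * pi) - 8/5)"
    proof -
      have "L * (T - 3) \<le> L * ((ln l - ln a) / (4 * pi) - 8/5)" using c L unfolding T by (intro mult_left_mono) auto
      then show ?thesis by (simp add: algebra_simps)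
    qed
    show ?thesis by (rule fin[OF 1 2 3 4 5 KL KL'])
  next
    case False
    \<comment> \<open>Here \<open>\<epsilon>\<close> is so large that no scales are left between
      \<open>a\<close> and \<open>l\<close>. The logarithmic term is then itself below
      \<open>K\<^sup>2 * L / 2\<close>, and nonnegativity of the energy is enough.\<close>
    have "ln l - ln a \<le> 0" using False L e by (simp add: a_def l_def)
    then have "(ln l - ln a) / (4 * pi) \<le> 0" by (simp add: divide_le_0_iff)
    then have "T \<le> 14/10" using c T by linarith
    then have "L * T \<le> L * (14/10)" using L by (intro mult_left_mono) auto
    then have "L * T - K\<^sup>2 * L / 2 \<le> 0" using KL L by linarith
    also have "0 \<le> (LBINT x. (norm (u x))\<^sup>2) / 2" by simp
    finally show ?thesis .
  qed
  then show ?thesis by (simp add: T_def)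
qed

lemma stress_symm_est:
  fixes \<phi> :: "real^3 \<Rightarrow> real^3^3"
  assumes e: "0 < \<epsilon>" "\<epsilon> \<le> L" and u: "u \<in> borel_measurable borel" "integrable lborel (\<lambda>x. (norm (u x))\<^sup>2)"
    and d: "weak_div_free u" and F: "flat_close \<epsilon> u"
    and b: "\<And>x. norm (\<phi> x) \<le> m" and lip: "\<And>x y. norm (\<phi> x - \<phi> y) \<le> \<Lambda> * norm (x - y)" and m: "0 < m" and \<Lambda>: "0 \<le> \<Lambda>"
  defines "F \<equiv> \<lambda>s. \<phi> (\<gamma> s) \<bullet> (mat 1 - tensor (\<tau> s) (\<tau> s))"
  shows "\<bar>(LBINT x. \<phi> x \<bullet> tensor (u x) (u x)) - (ln L - ln \<epsilon>) / (4 * pi) * (\<integral>s. F s \<partial>CM)\<bar>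
    \<le> 2 * m * ((LBINT x. (norm (u x))\<^sup>2) - 2 * L * ((ln L - ln \<epsilon>) / (4 * pi))) + 1400000 * m * K\<^sup>2 * L + 2200000 * \<Lambda> * K\<^sup>2 * L\<^sup>2" (is ?R1)
    and "F \<in> borel_measurable borel" "(\<lambda>x. \<phi> x \<bullet> tensor (u x) (u x)) \<in> borel_measurable borel"
proof -
  interpret S: tensor_field L \<gamma> \<tau> K \<rho> \<epsilon> "\<lambda>x. symm (\<phi> x)" m \<Lambda>
  proof unfold_locales
    show "norm (symm (\<phi> x)) \<le> m" for x using norm_symm[of "\<phi> x"] b[of x] by linarith
    show "norm (symm (\<phi> x) - symm (\<phi> y)) \<le> \<Lambda> * norm (x - y)" for x y
      unfolding symm_diff using norm_symm[of "\<phi> x - \<phi> y"] lip[of x y] by linarith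
  qed (use e \<Lambda> in auto)
  note [measurable] = u(1) S.S_meas
  have l: "S.T.lead = F" by (simp add: fun_eq_iff S.T.lead_def F_def symm_projection)
  show ?R1
    using S.stress_est[OF u d F m transpose_symm] unfolding l symm_tensor .
  show "F \<in> borel_measurable borel" using S.T.lead_meas unfolding l .
  have "(\<lambda>x. (symm (\<phi> x) *v u x) \<bullet> u x) \<in> borel_measurable borel" by measurable
  then show "(\<lambda>x. \<phi> x \<bullet> tensor (u x) (u x)) \<in> borel_measurable borel" unfolding symm_tensor .
qed

lemma line_integral_CM:
  fixes f0 :: "real \<Rightarrow> real"
  assumes m: "f0 \<in> borel_measurable borel" and ae: "AE s in lborel. f s = f0 s"
  shows "(LINT s:{0..<L}|lebesgue. f s) = (\<integral>s. f0 s \<partial>CM)"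
proof -
  have "(LINT s:{0..<L}|lebesgue. f s) = (LBINT s. indicator {0..<L} s *\<^sub>R f0 s)"
    unfolding set_lebesgue_integral_def
  proof (rule integral_lebesgue_AE)
    show "(\<lambda>s. indicator {0..<L} s *\<^sub>R f0 s) \<in> borel_measurable borel" using m by measurable
    show "AE s in lborel. indicator {0..<L} s *\<^sub>R f s = indicator {0..<L} s *\<^sub>R f0 s" using ae by eventually_elim simp
  qed
  also have "\<dots> = (\<integral>s. f0 s \<partial>CM)" by (simp add: integral_restrict_space)
  finally show ?thesis .
qed

lemma tangent_AE: "AE s in lborel. tangent \<gamma> s = \<tau> s"
  using deriv by eventually_elim (rule vector_derivative_at)

lemma flat_close_flat_norm:
  assumes u0[measurable]: "u0 \<in> borel_measurable borel" and ae: "AE x in lborel. u x = u0 x"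
    and F: "flat_norm (\<lambda>\<xi>. distr_curl u \<xi> - curve_measure L \<gamma> \<xi>) \<le> ereal (\<epsilon> * L)"
  shows "flat_close \<epsilon> u0"
  unfolding flat_close_def
proof (intro allI impI)
  have rep: "distr_curl u Z - curve_measure L \<gamma> Z = curl_pair u0 dZ - pairing Z" if Z: "C1c Z dZ" for Z dZ
  proof -
    have [measurable]: "curlv dZ \<in> borel_measurable borel"
      by (rule borel_measurable_continuous_onI, rule curlv_cont) (rule C1c_cont_d[OF Z])
    note [measurable] = C1c_measurable[OF Z]
    have "distr_curl u Z = (LBINT x. curlv dZ x \<bullet> u0 x)"
      unfolding distr_curl_def curl_C1c[OF Z]
    proof (rule integral_lebesgue_AE)
      show "(\<lambda>x. curlv dZ x \<bullet> u0 x) \<in> borel_measurable borel" by measurable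
      show "AE x in lborel. curlv dZ x \<bullet> u x = curlv dZ x \<bullet> u0 x" using ae by eventually_elim simp
    qed
    moreover have "curve_measure L \<gamma> Z = (\<integral>t. Z (\<gamma> t) \<bullet> \<tau> t \<partial>CM)"
      unfolding curve_measure_def
    proof (rule line_integral_CM)
      show "(\<lambda>t. Z (\<gamma> t) \<bullet> \<tau> t) \<in> borel_measurable borel" by measurable
      show "AE s in lborel. Z (\<gamma> s) \<bullet> tangent \<gamma> s = Z (\<gamma> s) \<bullet> \<tau> s" using tangent_AE by eventually_elim simp
    qed
    ultimately show ?thesis by (simp add: curl_pair_def pairing_def)
  qed
  fix Z dZ A assume Z: "C1c Z dZ" and A: "A > 0" "\<forall>x. norm (curlv dZ x) \<le> A"
  have "\<bar>distr_curl u Z - curve_measure L \<gamma> Z\<bar> \<le> \<epsilon> * L * A"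
  proof (rule flat_norm_test[OF _ F Z])
    fix c and \<xi> :: "real^3 \<Rightarrow> real^3" and d assume \<xi>: "C1c \<xi> d"
    have C: "C1c (\<lambda>x. c *\<^sub>R \<xi> x) (\<lambda>i x. c *\<^sub>R d i x)"
      by (rule C1c_linear[OF bounded_linear_scaleR_right \<xi>])
    have "curlv (\<lambda>i x. c *\<^sub>R d i x) x = c *\<^sub>R curlv d x" for x by (simp add: vec_eq_iff forall_3 algebra_simps)
    then show "distr_curl u (\<lambda>x. c *\<^sub>R \<xi> x) - curve_measure L \<gamma> (\<lambda>x. c *\<^sub>R \<xi> x) = c * (distr_curl u \<xi> - curve_measure L \<gamma> \<xi>)"
      unfolding rep[OF C] rep[OF \<xi>] by (simp add: curl_pair_def pairing_def right_diff_distrib')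
  qed (use A in auto)
  then show "\<bar>curl_pair u0 dZ - pairing Z\<bar> \<le> \<epsilon> * L * A" unfolding rep[OF Z] .
qed

end

lemma weak_div_free_representative:
  assumes u0[measurable]: "u0 \<in> borel_measurable borel" and ae: "AE x in lborel. u x = u0 x" and d: "divergence_free u"
  shows "weak_div_free u0"
  unfolding weak_div_free_def
proof (intro allI impI)
  fix E :: "real^3 \<Rightarrow> real" and dE assume C: "C1c E dE"
  have g: "gradient E = (\<lambda>x. \<chi> i. dE i x)" by (simp add: gradient_def C1c_partial_deriv[OF C] fun_eq_iff)
  have "continuous_on UNIV (\<lambda>x. \<chi> i. dE i x)" by (intro continuous_on_vec_lambda C1c_cont_d[OF C])
  then have [measurable]: "(\<lambda>x. \<chi> i. dE i x) \<in> borel_measurable borel" by (rule borel_measurable_continuous_onI)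
  have "(LINT x|lebesgue. u x \<bullet> gradient E x) = (LBINT x. u0 x \<bullet> (\<chi> i. dE i x))"
    unfolding g
  proof (rule integral_lebesgue_AE)
    show "AE x in lborel. u x \<bullet> (\<chi> i. dE i x) = u0 x \<bullet> (\<chi> i. dE i x)" using ae by eventually_elim simp
  qed measurable
  then show "(LBINT x. u0 x \<bullet> (\<chi> i. dE i x)) = 0" using d C1c_C1_compact[OF C] by (simp add: divergence_free_def)
qed

text \<open>The excess enters the second estimate with a large constant although it may be negative; this is harmless
  because the constant \<open>1/2 < 1\<close> in the lower bound for the excess leaves room.\<close>

lemma stress_constants:
  fixes L k T K m G U E P Q :: real
  assumes pos: "0 < L" "0 < k" "0 \<le> m" "0 \<le> G" and kT: "k * T = 1" and E: "E = k / L * (U / 2) - 1"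
    and lo: "- (K\<^sup>2 * k / 2) \<le> E"
    and le: "\<bar>P - T * Q\<bar> \<le> 2 * m * (U - 2 * L * T) + 1400000 * m * K\<^sup>2 * L + 2200000 * (3 * G) * K\<^sup>2 * L\<^sup>2"
  shows "1 / L * \<bar>k * P - Q\<bar> \<le> 10^7 * m * E + 10^7 * k * K\<^sup>2 * (m + L * G)"
proof -
  have "\<bar>k * P - Q\<bar> = k * \<bar>P - T * Q\<bar>"
  proof -
    have "k * P - Q = k * P - (k * T) * Q" unfolding kT by simp
    also have "\<dots> = k * (P - T * Q)" by (simp add: algebra_simps)
    finally show ?thesis using pos by (simp add: abs_mult)
  qed
  then have "1 / L * \<bar>k * P - Q\<bar> = k / L * \<bar>P - T * Q\<bar>" by simp
  also have "\<dots> \<le> k / L * (2 * m * (U - 2 * L * T) + 1400000 * m * K\<^sup>2 * L + 2200000 * (3 * G) * K\<^sup>2 * L\<^sup>2)"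
    using pos by (intro mult_left_mono le) auto
  also have "\<dots> = 2 * m * (k / L * U - 2 * (k * T)) + 1400000 * (m * (k * K\<^sup>2)) + 6600000 * (G * L * (k * K\<^sup>2))"
    using pos by (simp add: field_simps power2_eq_square)
  also have "k / L * U - 2 * (k * T) = 2 * E" unfolding kT E by simp
  also have "2 * m * (2 * E) + 1400000 * (m * (k * K\<^sup>2)) + 6600000 * (G * L * (k * K\<^sup>2))
    \<le> 10^7 * m * E + 10^7 * k * K\<^sup>2 * (m + L * G)"
  proof -
    have "m * (- (K\<^sup>2 * k / 2)) \<le> m * E" using pos by (intro mult_left_mono lo) auto
    moreover have "0 \<le> G * L * (k * K\<^sup>2)" "0 \<le> m * (k * K\<^sup>2)" using pos by auto
    ultimately show ?thesis by (simp add: algebra_simps)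
  qed
  finally show ?thesis .
qed

lemma security_radius_estimates:
  fixes L :: real and \<gamma> :: "real \<Rightarrow> real^3" and \<epsilon> :: real and u :: "real^3 \<Rightarrow> real^3" and K :: real
  assumes c: "closed_arclength_curve L \<gamma>" and fin: "weak_L1_norm L (kappa_star L \<gamma>) < \<infinity>"
    and K: "K = enn2real (weak_L1_norm L (kappa_star L \<gamma>))"
    and e: "0 < \<epsilon>" "\<epsilon> < L / 2" and u: "L2_field u" "divergence_free u"
    and F: "flat_norm (\<lambda>\<xi>. distr_curl u \<xi> - curve_measure L \<gamma> \<xi>) \<le> ereal (\<epsilon> * L)"
  shows "0 \<le> excess L \<epsilon> u + 10^7 * K\<^sup>2 * k_eps L \<epsilon>" (is ?R1)
    and "W1inf \<phi> \<Longrightarrow> continuous_on UNIV \<phi> \<Longrightarrow>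
        1 / L * \<bar>k_eps L \<epsilon> * (LINT x|lebesgue. \<phi> x \<bullet> tensor (u x) (u x))
             - (LINT s:{0..<L}|lebesgue. \<phi> (\<gamma> s) \<bullet> (mat 1 - tensor (tangent \<gamma> s) (tangent \<gamma> s)))\<bar>
        \<le> 10^7 * enn2real (Linf_norm \<phi>) * excess L \<epsilon> u + 10^7 * k_eps L \<epsilon> * K\<^sup>2 * W1inf_norm L \<phi>"
proof -
  obtain \<tau> where "arc L \<gamma> \<tau>" using arc_exists[OF c] by blast
  then interpret arc L \<gamma> \<tau> .
  interpret curve L \<gamma> \<tau> K "\<lambda>s. rr s / 2" unfolding K by (rule curve_instance[OF fin])
  obtain u0 where u0[measurable]: "u0 \<in> borel_measurable borel" and ae: "AE x in lborel. u x = u0 x"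
    using borel_representative[of u] u(1) unfolding L2_field_def by metis
  have sq: "(LINT x|lebesgue. (norm (u x))\<^sup>2) = (LBINT x. (norm (u0 x))\<^sup>2)"
  proof (rule integral_lebesgue_AE)
    show "AE x in lborel. (norm (u x))\<^sup>2 = (norm (u0 x))\<^sup>2" using ae by eventually_elim simp
  qed measurable
  have u2: "integrable lborel (\<lambda>x. (norm (u0 x))\<^sup>2)"
  proof -
    have m: "(\<lambda>x. (norm (u0 x))\<^sup>2) \<in> borel_measurable lborel" by measurable
    have i: "integrable lebesgue (\<lambda>x. (norm (u x))\<^sup>2)" using u(1) by (simp add: L2_field_def)
    have "AE x in lebesgue. (norm (u x))\<^sup>2 = (norm (u0 x))\<^sup>2" by (rule AE_completion, rule eventually_mono[OF ae]) simp
    then have "integrable lebesgue (\<lambda>x. (norm (u0 x))\<^sup>2)"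
      using integrable_cong_AE_imp[OF i measurable_completion[OF m]] by (auto elim: eventually_mono)
    then show ?thesis using m by (simp add: integrable_completion)
  qed
  have fc: "flat_close \<epsilon> u0" by (rule flat_close_flat_norm[OF u0 ae F])
  have df: "weak_div_free u0" by (rule weak_div_free_representative[OF u0 ae u(2)])
  define U where "U = (LBINT x. (norm (u0 x))\<^sup>2)"
  define T where "T = (ln L - ln \<epsilon>) / (4 * pi)"
  define k where "k = k_eps L \<epsilon>"
  have ln: "ln \<epsilon> < ln L" using e L by (subst ln_less_cancel_iff) auto
  have k: "k = 4 * pi / (ln L - ln \<epsilon>)" using ln e L by (simp add: k_def k_eps_def ln_div)
  have k0: "0 < k" and kT: "k * T = 1" using ln by (simp_all add: k T_def)
  have E: "excess L \<epsilon> u = k / L * (U / 2) - 1"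
    by (simp add: excess_def sq k_def U_def)
  have "L * T - K\<^sup>2 * L / 2 \<le> U / 2"
    using energy_lower[OF e(1) u0 u2 fc] by (simp add: T_def U_def)
  then have "k / L * (L * T - K\<^sup>2 * L / 2) \<le> k / L * (U / 2)" using k0 L by (intro mult_left_mono) auto
  moreover have "k / L * (L * T - K\<^sup>2 * L / 2) = k * T - K\<^sup>2 * k / 2" using L by (simp add: field_simps)
  ultimately have lo: "- (K\<^sup>2 * k / 2) \<le> excess L \<epsilon> u" unfolding E kT by linarith
  have "0 \<le> K\<^sup>2 * k" using k0 by simp
  then show ?R1 using lo unfolding k_def[symmetric] by (simp add: mult.assoc)
  assume W: "W1inf \<phi>" and ct: "continuous_on UNIV \<phi>"
  define m where "m = enn2real (Linf_norm \<phi>)"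
  define G where "G = enn2real (Linf_norm (weak_gradient \<phi>))"
  have b: "norm (\<phi> x) \<le> m" for x
    unfolding m_def by (rule AE_lebesgue_bound_continuous[OF ct Linf_norm_AE]) (use W in \<open>simp add: W1inf_def\<close>)
  have m0: "0 \<le> m" and G0: "0 \<le> G" by (simp_all add: m_def G_def)
  have Wn: "W1inf_norm L \<phi> = m + L * G" by (simp add: W1inf_norm_def m_def G_def)
  define P where "P = (LINT x|lebesgue. \<phi> x \<bullet> tensor (u x) (u x))"
  define Q where "Q = (LINT s:{0..<L}|lebesgue. \<phi> (\<gamma> s) \<bullet> (mat 1 - tensor (tangent \<gamma> s) (tangent \<gamma> s)))"
  show "1 / L * \<bar>k_eps L \<epsilon> * P - Q\<bar> \<le> 10^7 * m * excess L \<epsilon> u + 10^7 * k_eps L \<epsilon> * K\<^sup>2 * W1inf_norm L \<phi>"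
  \<comment> \<open>The stress estimate divides by \<open>m\<close> in Young's inequality; for
    \<open>m = 0\<close> the continuous \<open>\<phi>\<close> vanishes identically and so does the
    left side.\<close>
  proof (cases "m = 0")
    case True
    then have "\<phi> x = 0" for x using b[of x] by simp
    then have "P = 0" "Q = 0" by (simp_all add: P_def Q_def set_lebesgue_integral_def)
    then show ?thesis using True k0 L G0 by (simp add: Wn k_def[symmetric])
  next
    case False
    then have m1: "0 < m" using m0 by simp
    have lip: "norm (\<phi> x - \<phi> y) \<le> 3 * G * norm (x - y)" for x y unfolding G_def by (rule W1inf_lipschitz[OF W ct])
    have e': "\<epsilon> \<le> L" using e L by simp
    have G3: "0 \<le> 3 * G" using G0 by simp
    note st = stress_symm_est[OF e(1) e' u0 u2 df fc b lip m1 G3]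
    have P: "P = (LBINT x. \<phi> x \<bullet> tensor (u0 x) (u0 x))"
      unfolding P_def by (rule integral_lebesgue_AE[OF st(3)]) (rule eventually_mono[OF ae], simp)
    have Q: "Q = (\<integral>s. \<phi> (\<gamma> s) \<bullet> (mat 1 - tensor (\<tau> s) (\<tau> s)) \<partial>CM)"
      unfolding Q_def by (rule line_integral_CM[OF st(2)]) (rule eventually_mono[OF tangent_AE], simp)
    have "1 / L * \<bar>k * P - Q\<bar> \<le> 10^7 * m * excess L \<epsilon> u + 10^7 * k * K\<^sup>2 * (m + L * G)"
      by (rule stress_constants[OF L k0 m0 G0 kT E lo]) (use st(1) in \<open>simp add: P Q T_def U_def\<close>)
    then show ?thesis by (simp add: Wn k_def)
  qed
qed

theorem theorem1:
  shows "\<exists>C::real. \<forall>(L::real) (\<gamma>::real \<Rightarrow> real^3) (\<epsilon>::real) (u::real^3 \<Rightarrow> real^3) (K::real).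
    closed_arclength_curve L \<gamma> \<longrightarrow>
    weak_L1_norm L (kappa_star L \<gamma>) < \<infinity> \<longrightarrow>
    K = enn2real (weak_L1_norm L (kappa_star L \<gamma>)) \<longrightarrow>
    0 < \<epsilon> \<longrightarrow> \<epsilon> < L / 2 \<longrightarrow>
    L2_field u \<longrightarrow> divergence_free u \<longrightarrow>
    flat_norm (\<lambda>\<xi>. distr_curl u \<xi> - curve_measure L \<gamma> \<xi>) \<le> ereal (\<epsilon> * L) \<longrightarrow>
      0 \<le> excess L \<epsilon> u + C * K\<^sup>2 * k_eps L \<epsilon> \<and>
      \<comment> \<open>The line integral refers to the continuous representative of \<open>\<phi>\<close>.\<close>
      (\<forall>\<phi>::real^3 \<Rightarrow> real^3^3. W1inf \<phi> \<longrightarrow> continuous_on UNIV \<phi> \<longrightarrow>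
        1 / L * \<bar>k_eps L \<epsilon> * (LINT x|lebesgue. \<phi> x \<bullet> tensor (u x) (u x))
             - (LINT s:{0..<L}|lebesgue. \<phi> (\<gamma> s) \<bullet> (mat 1 - tensor (tangent \<gamma> s) (tangent \<gamma> s)))\<bar>
        \<le> C * enn2real (Linf_norm \<phi>) * excess L \<epsilon> u
            + C * k_eps L \<epsilon> * K\<^sup>2 * W1inf_norm L \<phi>)"
proof (intro exI[of _ "10^7"] allI impI conjI, goal_cases)
  case (1 L \<gamma> \<epsilon> u K)
  then show ?case by (rule security_radius_estimates(1))
next
  case (2 L \<gamma> \<epsilon> u K \<phi>)
  then show ?case by (rule security_radius_estimates(2))
qed

end
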